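(* Let $d\ge2$, let $f$ be a monic centered polynomial of degree $d$ with distinct critical points $c_1,\dots,c_p$ of multiplicities $\bar p=\{m_1,\dots,m_p\}$ and critical values $v_k=f(c_k)$, and suppose that $c_1,\dots,c_r$ are pairwise different weakly expanding critical points of $f$. For $1\le j\le r$, $1\le k\le p$ let $L(c_j,v_k)=\lim_{m\to\infty}\frac{\partial(f^m(c_j))/\partial v_k}{(f^{m-1})'(v_j)}$ (these limits exist). Let $1\le k_1<\dots<k_r\le p$ be indexes for which the determinant of the square matrix $(L(c_j,v_{k_i}))_{1\le j\le r,1\le i\le r}$ is non-zero, and define the local $r$-dimensional submanifold $\Lambda$ of $\Pi_{d,\bar p}$ as the set of all $g\in\Pi_{d,\bar p}$ with $v_i(g)=v_i(f)$ for every $i\ne k_1,\dots,k_r$. Consider a one-dimensional family $f_t\in\Lambda$ through $f$ ($f_0=f$) with $f_t(z)=f(z)+t\,u(z)+O(|t|^2)$ as $t\to0$. If $u\ne0$, then for at least one $j\in\{1,\dots,r\}$, $$\lim_{m\to\infty}\frac{\frac{d}{dt}\big|_{t=0}f_t^m(c_j(t))}{(f^{m-1})'(v_j)}\ne0,$$ where $c_j(t)$ is the holomorphic function with $c_j(0)=c_j$ such that $c_j(t)$ is a critical point of $f_t$, and $v_j=f(c_j)$. In particular, if all critical points of $f$ are simple and weakly expanding, then $\lim_{m\to\infty}\frac{\frac{d}{dt}|_{t=0}f_t^m(c_j(t))}{(f^{m-1})'(v_j)}\ne0$ holds, for at least one critical point $c_j$ of $f$, for every curve $f_t$ in $\Pi_d$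 through $f$ with a non-degenerate tangent vector at $f$. Furthermore, if $f(0)$ and all the critical points of $f$ are real, the spaces $\Pi_d$, $\Pi_{d,\bar p}$, $\Lambda$ and the maps $g$, $f_t$ in them can be taken real.
   Context: A monic centered polynomial of degree $d$ is one of the form $z^d+a_1z^{d-2}+\dots+a_{d-1}$; the space $\Pi_d$ of these is identified with $\mathbf C^{d-1}$ by coefficients. $\Pi_{d,\bar p}$ is the set of all $g\in\Pi_d$ in a small neighborhood of $f$ having the same number $p$ of distinct critical points $c_1(g),\dots,c_p(g)$, with $c_i(g)$ close to $c_i$ and of multiplicity $m_i$. It is known that $\Pi_{d,\bar p}$ is a $p$-dimensional complex manifold and that $V(g)=(v_1(g),\dots,v_p(g))$, $v_i(g)=g(c_i(g))$, is a local holomorphic coordinate on it; the $c_i(g)$ are holomorphic in $g$. $\frac{\partial (f^m(c_j))}{\partial v_k}$ denotes the partial derivative of $g\mapsto g^m(c_j(g))$ with respect to the coordinate $v_k(g)$, evaluated at $g=f$; $f^m$ is the $m$-th iterate. A critical point $c$ of $f$ is weakly expanding (summable) if, with $v=f(c)$, $\sum_{n=0}^\infty \frac{1+|f^n(v)|^2}{1+|v|^2}\frac{1}{|(f^n)'(v)|}<\infty$ (in particular $(f^n)'(v)\ne0$ for all $n$). *)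

theory Defs
  imports
    "HOL-Analysis.Derivative"
    "HOL-Library.Landau_Symbols"
    "HOL-Computational_Algebra.Polynomial"
    "Jordan_Normal_Form.Determinant"
begin

text \<open>
  All notions are defined over an arbitrary \<open>real_normed_field\<close>, and are used for both
  \<open>complex\<close> and \<open>real\<close>; the second instance gives the real versions of the spaces and maps.
  Indices run over \<open>{..<p}\<close> instead of \<open>1, \<dots>, p\<close>.
\<close>

definition monic_centered :: "nat \<Rightarrow> 'a::real_normed_field poly set" where
  "monic_centered d =
     {g. Polynomial.degree g = d \<and> Polynomial.coeff g d = 1 \<and> Polynomial.coeff g (d - 1) = 0}"

definition critical_points :: "'a::real_normed_field poly \<Rightarrow> 'a set" where
  "critical_points g = {z. poly (pderiv g) z = 0}"

definition multiplicity_crit :: "'a::real_normed_field poly \<Rightarrow> 'a \<Rightarrow> nat" where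
  "multiplicity_crit g z = Polynomial.order z (pderiv g)"

definition weakly_expanding :: "'a::real_normed_field poly \<Rightarrow> 'a \<Rightarrow> bool" where
  "weakly_expanding f c \<longleftrightarrow>
     (let v = poly f c in
        (\<forall>n. deriv (poly f ^^ n) v \<noteq> 0) \<and>
        summable (\<lambda>n. (1 + (norm ((poly f ^^ n) v))\<^sup>2) / (1 + (norm v)\<^sup>2)
                        * (1 / norm (deriv (poly f ^^ n) v))))"

text \<open>
  The local space of polynomials with the critical multiplicities of \<open>f\<close>. Here \<open>c\<close> enumerates
  the \<open>p\<close> distinct critical points of \<open>f\<close>, and \<open>\<epsilon>\<close> is the size of the small neighbourhood,
  both for the coefficients and for the critical points.
\<close>

definition stratum ::
    "real \<Rightarrow> 'a::real_normed_field poly \<Rightarrow> nat \<Rightarrow> (nat \<Rightarrow> 'a) \<Rightarrow> 'a poly set" where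
  "stratum \<epsilon> f p c =
     {g \<in> monic_centered (Polynomial.degree f).
        (\<forall>i. norm (Polynomial.coeff g i - Polynomial.coeff f i) < \<epsilon>) \<and>
        (\<exists>c'. bij_betw c' {..<p} (critical_points g) \<and>
           (\<forall>i<p. dist (c' i) (c i) < \<epsilon> \<and>
                  multiplicity_crit g (c' i) = multiplicity_crit f (c i)))}"

text \<open>
  The critical point \<open>c\<^sub>i(g)\<close> of \<open>g\<close> close to \<open>c\<^sub>i\<close>. On the stratum it is unique as soon as
  \<open>\<epsilon>\<close> is at most half the minimal distance between distinct critical points of \<open>f\<close>.
\<close>

definition crit_near ::
    "real \<Rightarrow> (nat \<Rightarrow> 'a::real_normed_field) \<Rightarrow> 'a poly \<Rightarrow> nat \<Rightarrow> 'a" where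
  "crit_near \<epsilon> c g i = (THE z. z \<in> critical_points g \<and> dist z (c i) < \<epsilon>)"

definition crit_values ::
    "real \<Rightarrow> nat \<Rightarrow> (nat \<Rightarrow> 'a::real_normed_field) \<Rightarrow> 'a poly \<Rightarrow> nat \<Rightarrow> 'a" where
  "crit_values \<epsilon> p c g = restrict (\<lambda>i. poly g (crit_near \<epsilon> c g i)) {..<p}"

text \<open>
  Partial derivative at \<open>f\<close> of a function \<open>\<Phi>\<close> on the stratum with respect to the \<open>k\<close>-th
  coordinate of the chart \<open>crit_values\<close>. For small \<open>\<epsilon>\<close> the chart is injective on the stratum
  and its image contains a neighbourhood of the critical values of \<open>f\<close>, so that \<open>inv_into\<close>
  is the inverse chart there.
\<close>

definition partial_crit_value ::
    "real \<Rightarrow> 'a::real_normed_field poly \<Rightarrow> nat \<Rightarrow> (nat \<Rightarrow> 'a) \<Rightarrow> ('a poly \<Rightarrow> 'a) \<Rightarrow> nat \<Rightarrow> 'a" where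
  "partial_crit_value \<epsilon> f p c \<Phi> k =
     deriv (\<lambda>s. \<Phi> (inv_into (stratum \<epsilon> f p c) (crit_values \<epsilon> p c)
                     ((crit_values \<epsilon> p c f)(k := s))))
           (crit_values \<epsilon> p c f k)"

definition L_seq ::
    "real \<Rightarrow> 'a::real_normed_field poly \<Rightarrow> nat \<Rightarrow> (nat \<Rightarrow> 'a) \<Rightarrow> nat \<Rightarrow> nat \<Rightarrow> nat \<Rightarrow> 'a" where
  "L_seq \<epsilon> f p c j k m =
     partial_crit_value \<epsilon> f p c (\<lambda>g. (poly g ^^ m) (crit_near \<epsilon> c g j)) k
       / deriv (poly f ^^ (m - 1)) (poly f (c j))"

definition L ::
    "real \<Rightarrow> 'a::real_normed_field poly \<Rightarrow> nat \<Rightarrow> (nat \<Rightarrow> 'a) \<Rightarrow> nat \<Rightarrow> nat \<Rightarrow> 'a" where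
  "L \<epsilon> f p c j k = lim (L_seq \<epsilon> f p c j k)"

text \<open>The submanifold on which only the critical values with index in \<open>K\<close> may vary.\<close>

definition Lambda ::
    "real \<Rightarrow> 'a::real_normed_field poly \<Rightarrow> nat \<Rightarrow> (nat \<Rightarrow> 'a) \<Rightarrow> nat set \<Rightarrow> 'a poly set" where
  "Lambda \<epsilon> f p c K =
     {g \<in> stratum \<epsilon> f p c.
        \<forall>i<p. i \<notin> K \<longrightarrow> crit_values \<epsilon> p c g i = crit_values \<epsilon> p c f i}"

text \<open>One-dimensional family \<open>F\<close> in \<open>S\<close> through \<open>f\<close> with tangent vector \<open>u\<close> at \<open>f\<close>.\<close>

definition family_through ::
    "'a::real_normed_field poly set \<Rightarrow> 'a poly \<Rightarrow> 'a poly \<Rightarrow> ('a \<Rightarrow> 'a poly) \<Rightarrow> bool" where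
  "family_through S f u F \<longleftrightarrow>
     F 0 = f \<and> (\<forall>\<^sub>F t in nhds 0. F t \<in> S) \<and>
     (\<forall>z. (\<lambda>t. poly (F t) z - (poly f z + t * poly u z)) \<in> O[at 0](\<lambda>t. t\<^sup>2))"

text \<open>Over \<open>complex\<close> this says that \<open>h\<close> is holomorphic near \<open>0\<close>.\<close>

definition differentiable_near_0 :: "('a::real_normed_field \<Rightarrow> 'a) \<Rightarrow> bool" where
  "differentiable_near_0 h \<longleftrightarrow> (\<forall>\<^sub>F t in nhds 0. h field_differentiable at t)"

text \<open>The normalised speed at \<open>t = 0\<close> of \<open>F\<^sub>t\<^sup>m(c\<^sub>j(t))\<close>, where \<open>c\<^sub>j(t) = c\<^sub>j(F\<^sub>t)\<close>.\<close>

definition speed_seq ::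
    "real \<Rightarrow> 'a::real_normed_field poly \<Rightarrow> (nat \<Rightarrow> 'a) \<Rightarrow> ('a \<Rightarrow> 'a poly) \<Rightarrow> nat \<Rightarrow> nat \<Rightarrow> 'a" where
  "speed_seq \<epsilon> f c F j m =
     deriv (\<lambda>t. (poly (F t) ^^ m) (crit_near \<epsilon> c (F t) j)) 0
       / deriv (poly f ^^ (m - 1)) (poly f (c j))"

end

theory Submission
  imports Defs "HOL-Complex_Analysis.Complex_Analysis"
    "HOL-Computational_Algebra.Fundamental_Theorem_Algebra"
begin

text \<open>
  Near \<open>f\<close> the stratum is parametrised by the critical points and the constant term, and the
  inverse function theorem shows that the critical values are coordinates on it. The tangent
  vectors \<open>u\<close> have degree at most \<open>d - 2\<close> and a derivative vanishing to order \<open>m\<^sub>i - 1\<close> at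
  \<open>c\<^sub>i\<close>; they are determined by the values \<open>u(c\<^sub>i)\<close>. Differentiating \<open>f\<^sub>t\<^sup>m(c\<^sub>j(t))\<close> gives the
  limit speed \<open>u(c\<^sub>j) + \<Sum>\<^sub>n u(f\<^sup>n(v\<^sub>j)) / (f\<^sup>n\<^sup>+\<^sup>1)'(v\<^sub>j)\<close>, a linear functional of \<open>u\<close>
  whose matrix in the coordinates \<open>v\<^sub>k\<close> is \<open>L(c\<^sub>j, v\<^sub>k)\<close>. On \<open>\<Lambda>\<close> the non-vanishing is
  therefore linear algebra.

  If all critical points are simple and weakly expanding and all limit speeds of some \<open>u \<noteq> 0\<close>
  vanish, a dual linear relation yields weights \<open>\<beta>\<^sub>j\<close>, not all zero, such that the Cauchy transform
  \<open>H\<close> of \<open>\<nu> = \<Sum>\<^sub>j \<beta>\<^sub>j \<Sum>\<^sub>n \<delta>(f\<^sup>n(v\<^sub>j)) / (f\<^sup>n)'(v\<^sub>j)\<close> is fixed by the transfer operator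
  \<open>H \<mapsto> \<Sum>\<^sub>w H(w) / f'(w)\<^sup>2\<close>. Its iterates tend to zero near infinity, by an area estimate for
  the inverse branches of \<open>f\<^sup>n\<close>; hence \<open>H = 0\<close> there and \<open>\<nu>\<close> annihilates the polynomials. The
  atoms of \<open>\<nu>\<close> lie on the boundary of the filled Julia set, where every point is a peak point for
  uniform limits of polynomials, so \<open>\<nu> = 0\<close>, which forces \<open>\<beta> = 0\<close>.

  For real \<open>f\<close> and \<open>c\<^sub>i\<close> the critical point of a real \<open>g\<close> near \<open>c\<^sub>i\<close> equals its conjugate, so the
  whole picture is the complexification of its real counterpart.
\<close>

section \<open>Peak points for uniform limits of polynomials\<close>

text \<open>The dual relation says that the integral of 1 / (c_k - w) against \<nu> equals \<beta>_k
  f''(c_k). Vanishing moments do not make this zero directly: c_k lies in the filled Julia set and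
  may be accumulated by the orbits, so in general the kernel is neither bounded on the atoms nor a
  limit of polynomials. Hence the detour through single points: once every point has total mass
  zero, all absolutely summable functions integrate to zero, the unbounded kernel included. Using
  total masses of points also covers critical orbits that merge. The weights 1 / (f^n)' come from a
  residue identity: the transfer operator sends the kernel with pole a to the kernel with pole f(a),
  with factor 1 / f'(a), plus terms at the critical points, and the dual relation turns these terms
  into the contribution of the first atoms. The local geometry is developed over any complete normed
  field, so that one proof serves real and complex polynomials. Only the non-vanishing for simple
  critical points uses complex analysis; it reaches the reals by complexification.\<close>

definition poly_approx :: "complex set \<Rightarrow> (complex \<Rightarrow> complex) \<Rightarrow> bool" where
  "poly_approx K \<phi> \<longleftrightarrow> (\<forall>e>0. \<exists>P. \<forall>w\<in>K. norm (\<phi> w - poly P w) < e)"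

lemma poly_approx_poly: "poly_approx K (poly P)"
  unfolding poly_approx_def by (intro allI impI exI[of _ P]) simp

lemma poly_approx_const: "poly_approx K (\<lambda>_. c)"
  unfolding poly_approx_def by (intro allI impI exI[of _ "[:c:]"]) simp

lemma poly_approx_cong:
  assumes "poly_approx K \<phi>" "\<And>w. w \<in> K \<Longrightarrow> \<psi> w = \<phi> w"
  shows "poly_approx K \<psi>"
  using assms unfolding poly_approx_def by simp

lemma poly_approx_limit:
  assumes "\<And>e. e > 0 \<Longrightarrow> \<exists>\<psi>. poly_approx K \<psi> \<and> (\<forall>w\<in>K. norm (\<phi> w - \<psi> w) < e)"
  shows "poly_approx K \<phi>"
  unfolding poly_approx_def
proof (intro allI impI)
  fix e :: real assume e: "e > 0"
  then obtain \<psi> where \<psi>: "poly_approx K \<psi>" "\<forall>w\<in>K. norm (\<phi> w - \<psi> w) < e/2"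
    using assms[of "e/2"] by auto
  then obtain P where P: "\<forall>w\<in>K. norm (\<psi> w - poly P w) < e/2"
    using e unfolding poly_approx_def by (meson half_gt_zero)
  have "norm (\<phi> w - poly P w) < e" if "w \<in> K" for w
    using norm_diff_triangle_less[of "\<phi> w" "\<psi> w" "e/2" "poly P w" "e/2"] \<psi> P that by auto
  then show "\<exists>P. \<forall>w\<in>K. norm (\<phi> w - poly P w) < e" by blast
qed

lemma poly_approx_bounded:
  assumes "compact K" "poly_approx K \<phi>"
  obtains B where "B > 0" "\<And>w. w \<in> K \<Longrightarrow> norm (\<phi> w) \<le> B"
proof -
  obtain P where P: "\<forall>w\<in>K. norm (\<phi> w - poly P w) < 1"
    using assms(2)[unfolded poly_approx_def, rule_format, of 1] by auto
  have "compact (poly P ` K)"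
    by (intro compact_continuous_image assms continuous_intros)
  then obtain B where B: "B > 0" "\<forall>x\<in>poly P ` K. norm x \<le> B"
    using compact_imp_bounded[of "poly P ` K"] unfolding bounded_pos by blast
  show ?thesis
  proof (rule that[of "B+1"])
    fix w assume w: "w \<in> K"
    have "norm (\<phi> w) \<le> norm (\<phi> w - poly P w) + norm (poly P w)"
      by (metis diff_add_cancel norm_triangle_ineq)
    also have "\<dots> \<le> 1 + B" using w P B by (intro add_mono) (auto intro: less_imp_le)
    finally show "norm (\<phi> w) \<le> B + 1" by simp
  qed (use B in auto)
qed

lemma poly_approx_add:
  assumes "poly_approx K \<phi>" "poly_approx K \<psi>"
  shows "poly_approx K (\<lambda>w. \<phi> w + \<psi> w)"
  unfolding poly_approx_def
proof (intro allI impI)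
  fix e :: real assume e: "e > 0"
  obtain P Q where PQ: "\<forall>w\<in>K. norm (\<phi> w - poly P w) < e/2" "\<forall>w\<in>K. norm (\<psi> w - poly Q w) < e/2"
    using assms e unfolding poly_approx_def by (meson half_gt_zero)
  have "norm (\<phi> w + \<psi> w - poly (P + Q) w) < e" if "w \<in> K" for w
  proof -
    have "norm (\<phi> w + \<psi> w - poly (P + Q) w) = norm ((\<phi> w - poly P w) + (\<psi> w - poly Q w))"
      by (simp add: algebra_simps)
    also have "\<dots> \<le> norm (\<phi> w - poly P w) + norm (\<psi> w - poly Q w)" by (rule norm_triangle_ineq)
    also have "\<dots> < e/2 + e/2" using PQ that by (intro add_strict_mono) auto
    finally show ?thesis by simp
  qed
  then show "\<exists>P. \<forall>w\<in>K. norm (\<phi> w + \<psi> w - poly P w) < e" by blast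
qed

lemma poly_approx_mult_poly:
  assumes "compact K" "poly_approx K \<phi>"
  shows "poly_approx K (\<lambda>w. \<phi> w * poly Q w)"
  unfolding poly_approx_def
proof (intro allI impI)
  fix e :: real assume e: "e > 0"
  obtain B where B: "B > 0" "\<And>w. w \<in> K \<Longrightarrow> norm (poly Q w) \<le> B"
    using poly_approx_bounded[OF assms(1) poly_approx_poly[of K Q]] by blast
  obtain P where P: "\<forall>w\<in>K. norm (\<phi> w - poly P w) < e/B"
    using assms(2) e B(1) unfolding poly_approx_def by (meson divide_pos_pos)
  have "norm (\<phi> w * poly Q w - poly (P * Q) w) < e" if "w \<in> K" for w
  proof -
    have "norm (\<phi> w * poly Q w - poly (P * Q) w) = norm (\<phi> w - poly P w) * norm (poly Q w)"
      by (simp add: norm_mult[symmetric] algebra_simps)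
    also have "\<dots> \<le> norm (\<phi> w - poly P w) * B" using B that by (intro mult_left_mono) auto
    also have "\<dots> < e/B * B" using P that B by (intro mult_strict_right_mono) auto
    finally show ?thesis using B by simp
  qed
  then show "\<exists>P. \<forall>w\<in>K. norm (\<phi> w * poly Q w - poly P w) < e" by blast
qed

lemma poly_approx_mult:
  assumes "compact K" "poly_approx K \<phi>" "poly_approx K \<psi>"
  shows "poly_approx K (\<lambda>w. \<phi> w * \<psi> w)"
proof (rule poly_approx_limit)
  fix e :: real assume e: "e > 0"
  obtain B where B: "B > 0" "\<And>w. w \<in> K \<Longrightarrow> norm (\<phi> w) \<le> B"
    using poly_approx_bounded[OF assms(1,2)] by blast
  obtain Q where Q: "\<forall>w\<in>K. norm (\<psi> w - poly Q w) < e/B"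
    using assms(3) e B(1) unfolding poly_approx_def by (meson divide_pos_pos)
  have "norm (\<phi> w * \<psi> w - \<phi> w * poly Q w) < e" if "w \<in> K" for w
  proof -
    have "norm (\<phi> w * \<psi> w - \<phi> w * poly Q w) = norm (\<phi> w) * norm (\<psi> w - poly Q w)"
      by (simp add: norm_mult[symmetric] algebra_simps)
    also have "\<dots> \<le> B * norm (\<psi> w - poly Q w)" using B that by (intro mult_right_mono) auto
    also have "\<dots> < B * (e/B)" using Q that B by (intro mult_strict_left_mono) auto
    finally show ?thesis using B by simp
  qed
  then show "\<exists>\<psi>'. poly_approx K \<psi>' \<and> (\<forall>w\<in>K. norm (\<phi> w * \<psi> w - \<psi>' w) < e)"
    using poly_approx_mult_poly[OF assms(1,2), of Q] by blast
qed

lemma poly_approx_power: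
  assumes "compact K" "poly_approx K \<phi>"
  shows "poly_approx K (\<lambda>w. \<phi> w ^ n)"
proof (induction n)
  case 0 then show ?case using poly_approx_const[of K 1] by simp
next
  case (Suc n) then show ?case using poly_approx_mult[OF assms(1,2) Suc.IH] by simp
qed

lemma poly_approx_sum:
  assumes "\<And>i. i \<in> I \<Longrightarrow> poly_approx K (\<phi> i)"
  shows "poly_approx K (\<lambda>w. \<Sum>i\<in>I. \<phi> i w)"
  using assms
proof (induction I rule: infinite_finite_induct)
  case (insert i I)
  then show ?case using poly_approx_add[of K "\<phi> i" "\<lambda>w. \<Sum>i\<in>I. \<phi> i w"] by simp
qed (use poly_approx_const[of K 0] in simp_all)

text \<open>Substituting \<open>\<phi>\<close> into the Taylor polynomials of \<open>g\<close> at
  \<open>a\<close> stays within the closure, and these converge uniformly on the closed disc of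
  radius \<open>r'\<close>, which lies strictly inside the disc of holomorphy.\<close>

lemma poly_approx_holomorphic_compose:
  assumes K: "compact K" and \<phi>: "poly_approx K \<phi>"
    and g: "g holomorphic_on ball a r" and r': "r' < r"
    and le: "\<And>w. w \<in> K \<Longrightarrow> norm (\<phi> w - a) \<le> r'"
  shows "poly_approx K (\<lambda>w. g (\<phi> w))"
proof (cases "K = {}")
  case True then show ?thesis by (simp add: poly_approx_def)
next
  case False
  then obtain w0 where "w0 \<in> K" by blast
  then have r0: "0 \<le> r'" using le[of w0] norm_ge_zero order_trans by blast
  define c where "c n = (deriv ^^ n) g a / fact n" for n
  define \<rho> where "\<rho> = (r' + r)/2"
  have \<rho>: "r' < \<rho>" "\<rho> < r" "0 < \<rho>" using r' r0 by (auto simp: \<rho>_def)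
  have sums: "(\<lambda>n. c n * (z - a) ^ n) sums g z" if "z \<in> ball a r" for z
    using holomorphic_power_series[OF g that] by (simp add: c_def)
  have "summable (\<lambda>n. c n * (of_real \<rho>) ^ n)"
    using sums_summable[OF sums[of "a + of_real \<rho>"]] \<rho> by (simp add: dist_norm)
  \<comment> \<open>Convergence at the intermediate radius \<open>\<rho>\<close> gives absolute
    convergence at \<open>r'\<close>; the tail there bounds the error at every point of
    \<open>K\<close> at once.\<close>
  then have sn: "summable (\<lambda>n. norm (c n * (of_real r') ^ n))"
    using powser_insidea[of c "of_real \<rho>" "of_real r'"] \<rho> r0 by simp
  show ?thesis
  proof (rule poly_approx_limit)
    fix e :: real assume e: "e > 0"
    have "(\<lambda>n. \<Sum>k. norm (c (k+n) * (of_real r')^(k+n))) \<longlonglongrightarrow> 0"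
      using suminf_exist_split2[OF sn] .
    from LIMSEQ_D[OF this e] obtain N where N: "norm (\<Sum>k. norm (c (k+N) * (of_real r')^(k+N))) < e"
      by auto
    define \<psi> where "\<psi> w = (\<Sum>n<N. c n * (\<phi> w - a)^n)" for w
    have "poly_approx K \<psi>"
      unfolding \<psi>_def
      by (intro poly_approx_sum poly_approx_mult[OF K] poly_approx_power[OF K] poly_approx_const)
        (use poly_approx_add[OF \<phi> poly_approx_const[of K "-a"]] in simp)
    moreover have "norm (g (\<phi> w) - \<psi> w) < e" if w: "w \<in> K" for w
    proof -
      have wb: "\<phi> w \<in> ball a r" using le[OF w] r' by (simp add: dist_norm norm_minus_commute)
      have s: "summable (\<lambda>n. c n * (\<phi> w - a)^n)" using sums[OF wb] by (rule sums_summable)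
      have "g (\<phi> w) = (\<Sum>n. c n * (\<phi> w - a)^n)" using sums[OF wb] by (rule sums_unique)
      also have "\<dots> = (\<Sum>n. c (n+N) * (\<phi> w - a)^(n+N)) + \<psi> w"
        unfolding \<psi>_def by (rule suminf_split_initial_segment[OF s])
      finally have eq: "g (\<phi> w) - \<psi> w = (\<Sum>n. c (n+N) * (\<phi> w - a)^(n+N))" by simp
      have le': "norm (c (n+N) * (\<phi> w - a)^(n+N)) \<le> norm (c (n+N) * (of_real r')^(n+N))" for n
        using le[OF w] r0 by (simp add: norm_mult norm_power mult_left_mono power_mono)
      have sN: "summable (\<lambda>n. norm (c (n+N) * (of_real r')^(n+N)))"
        using sn by (subst summable_iff_shift)
      have "norm (g (\<phi> w) - \<psi> w) \<le> (\<Sum>n. norm (c (n+N) * (of_real r')^(n+N)))"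
        unfolding eq by (rule norm_suminf_le[OF le' sN])
      also have "\<dots> < e" using N by simp
      finally show ?thesis .
    qed
    ultimately show "\<exists>\<psi>. poly_approx K \<psi> \<and> (\<forall>w\<in>K. norm (g (\<phi> w) - \<psi> w) < e)" by blast
  qed
qed

section \<open>Moving the pole of a Cauchy kernel through the complement\<close>

lemma fine_subdivision:
  fixes \<gamma> :: "real \<Rightarrow> complex"
  assumes "path \<gamma>" "e > 0"
  obtains N :: nat where "N > 0"
    "\<And>i. i < N \<Longrightarrow> dist (\<gamma> (real i / N)) (\<gamma> (real (Suc i) / N)) < e"
proof -
  have "uniformly_continuous_on {0..1} \<gamma>"
    using assms(1) by (simp add: path_def compact_uniformly_continuous)
  then obtain d where d: "d > 0" "\<And>x y. x \<in> {0..1} \<Longrightarrow> y \<in> {0..1} \<Longrightarrow> dist y x < d \<Longrightarrow> dist (\<gamma> y) (\<gamma> x) < e"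
    using assms(2) unfolding uniformly_continuous_on_def by metis
  obtain N :: nat where N: "N > 0" "inverse (real N) < d"
    using d(1) ex_inverse_of_nat_less by blast
  show ?thesis
  proof (rule that[OF N(1)])
    fix i assume i: "i < N"
    have "dist (real i / N) (real (Suc i) / N) = inverse (real N)"
      using N(1) by (simp add: dist_real_def field_simps)
    then show "dist (\<gamma> (real i / N)) (\<gamma> (real (Suc i) / N)) < e"
      using i N by (intro d(2)) auto
  qed
qed

text \<open>1/(z' - w) is 1/(z - w) divided by 1 + (z' - z)/(z - w). The pole moves by at most half
  of a lower bound for its distance to \<open>K\<close>, so the divisor stays within 1/2 of 1 on
  \<open>K\<close> and its reciprocal remains in the closure.\<close>

lemma poly_approx_inverse_near:
  assumes K: "compact K" and z: "poly_approx K (\<lambda>w. 1 / (z - w))"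
    and zK: "\<And>w. w \<in> K \<Longrightarrow> \<delta> \<le> norm (z - w)" and zz: "norm (z' - z) \<le> \<delta>/2" and \<delta>: "\<delta> > 0"
  shows "poly_approx K (\<lambda>w. 1 / (z' - w))"
proof -
  have *: "poly_approx K (\<lambda>w. 1 + (z' - z) * (1 / (z - w)))"
    by (intro poly_approx_add poly_approx_const poly_approx_mult K z)
  have "poly_approx K (\<lambda>w. 1 / (1 + (z' - z) * (1 / (z - w))))"
  proof (rule poly_approx_holomorphic_compose[OF K *, where g="\<lambda>x. 1/x" and a=1 and r=1 and r'="1/2"])
    show "(\<lambda>x. 1 / x) holomorphic_on ball 1 1"
      by (intro holomorphic_intros) (auto simp: dist_norm)
    fix w assume w: "w \<in> K"
    have "norm (z' - z) / norm (z - w) \<le> (\<delta>/2) / \<delta>"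
      using zK[OF w] zz \<delta> by (intro frac_le) auto
    then show "norm (1 + (z' - z) * (1 / (z - w)) - 1) \<le> 1/2"
      using \<delta> by (simp add: norm_divide norm_mult)
  qed simp
  from poly_approx_mult[OF K this z] show ?thesis
  proof (rule poly_approx_cong)
    fix w assume w: "w \<in> K"
    have nz: "z - w \<noteq> 0" using zK[OF w] \<delta> by auto
    have "1 + (z' - z) * (1 / (z - w)) = (z' - w) / (z - w)"
      using nz by (simp add: field_simps)
    then show "1 / (z' - w) = 1 / (1 + (z' - z) * (1 / (z - w))) * (1 / (z - w))"
      using nz by simp
  qed
qed

text \<open>Far from \<open>K\<close> the kernel is holomorphic in a disc around 0 that contains
  \<open>K\<close>, so it is a uniform limit of its Taylor polynomials on \<open>K\<close>.\<close>

lemma poly_approx_inverse_far: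
  assumes K: "compact K" and R: "\<And>w. w \<in> K \<Longrightarrow> norm w \<le> R" "0 < R" and z: "norm z > R"
  shows "poly_approx K (\<lambda>w. 1 / (z - w))"
proof -
  have "poly_approx K (\<lambda>w. 1 / (z - poly [:0,1:] w))"
  proof (rule poly_approx_holomorphic_compose[OF K poly_approx_poly, where g="\<lambda>x. 1/(z - x)" and a=0 and r="norm z" and r'=R])
    show "(\<lambda>x. 1 / (z - x)) holomorphic_on ball 0 (cmod z)"
      by (intro holomorphic_intros) (auto simp: dist_norm)
  qed (use R z in auto)
  then show ?thesis by simp
qed

text \<open>The pole starts far away and follows a path in the complement of \<open>K\<close>, in
  steps shorter than half of a lower bound for the distance between path and \<open>K\<close>.
  Connectedness of the complement provides the path.\<close>

lemma poly_approx_inverse: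
  assumes K: "compact K" and conn: "connected (- K)" and z: "z \<notin> K"
  shows "poly_approx K (\<lambda>w. 1 / (z - w))"
proof -
  obtain R where R: "R > 0" "\<And>w. w \<in> K \<Longrightarrow> norm w \<le> R"
    using K by (metis bounded_pos compact_imp_bounded)
  define y where "y = complex_of_real (R + 1)"
  have y: "norm y > R" using R by (simp add: y_def del: of_real_add)
  then have yK: "y \<notin> K" using R by force
  have "path_connected (- K)"
    using conn K by (intro connected_open_path_connected) (auto intro: compact_imp_closed)
  then obtain \<gamma> where \<gamma>: "path \<gamma>" "path_image \<gamma> \<subseteq> - K" "pathstart \<gamma> = y" "pathfinish \<gamma> = z"
    using yK z unfolding path_connected_def by (metis ComplI)
  obtain \<delta> where \<delta>: "\<delta> > 0" "\<And>x w. x \<in> path_image \<gamma> \<Longrightarrow> w \<in> K \<Longrightarrow> \<delta> \<le> dist x w"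
    using separate_compact_closed[OF compact_path_image[OF \<gamma>(1)] compact_imp_closed[OF K]] \<gamma>(2) by blast
  obtain N :: nat where N: "N > 0"
      "\<And>i. i < N \<Longrightarrow> dist (\<gamma> (real i / N)) (\<gamma> (real (Suc i) / N)) < \<delta>/2"
    using fine_subdivision[OF \<gamma>(1), of "\<delta>/2"] \<delta>(1) by auto
  have im: "\<gamma> (real i / N) \<in> path_image \<gamma>" if "i \<le> N" for i
    unfolding path_image_def using that N(1) by (intro imageI) auto
  have "poly_approx K (\<lambda>w. 1 / (\<gamma> (real i / N) - w))" if "i \<le> N" for i
    using that
  proof (induction i)
    case 0
    show ?case using poly_approx_inverse_far[OF K R(2) R(1) y] \<gamma>(3) by (simp add: pathstart_def)
  next
    case (Suc i)
    show ?case
    proof (rule poly_approx_inverse_near[OF K Suc.IH])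
      show "norm (\<gamma> (real (Suc i) / N) - \<gamma> (real i / N)) \<le> \<delta>/2"
        using N(2)[of i] Suc.prems by (simp add: dist_norm norm_minus_commute)
    qed (use Suc.prems \<delta>(1) \<delta>(2)[OF im[of i]] in \<open>auto simp: dist_norm\<close>)
  qed
  from this[of N] show ?thesis using N(1) \<gamma>(4) by (simp add: pathfinish_def)
qed

section \<open>Square roots and peak functions\<close>

lemma csqrt_near_one:
  assumes "norm (z - 1) \<le> 1/2"
  shows "norm (csqrt z - 1) \<le> norm (z - 1)"
proof -
  have "norm (csqrt z + 1) \<ge> Re (csqrt z + 1)" by (rule complex_Re_le_cmod)
  moreover have "Re (csqrt z + 1) \<ge> 1" using Re_csqrt[of z] by (simp del: csqrt.simps)
  ultimately have "norm (csqrt z + 1) \<ge> 1" by linarith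
  have "(csqrt z - 1) * (csqrt z + 1) = (csqrt z)\<^sup>2 - 1"
    by (simp add: algebra_simps power2_eq_square)
  then have "(csqrt z - 1) * (csqrt z + 1) = z - 1" by simp
  then have "norm (z - 1) = norm (csqrt z - 1) * norm (csqrt z + 1)" by (metis norm_mult)
  then show ?thesis
    using \<open>norm (csqrt z + 1) \<ge> 1\<close> mult_left_mono[of 1 "norm (csqrt z + 1)" "norm (csqrt z - 1)"] by simp
qed

lemma norm_square_root_near_one:
  assumes "norm (s\<^sup>2 - 1) \<le> e" "Re s > 0"
  shows "norm (s - 1) \<le> e"
proof -
  have "norm (s + 1) \<ge> 1" using complex_Re_le_cmod[of "s+1"] assms(2) by simp
  moreover have "norm (s - 1) * norm (s + 1) = norm (s\<^sup>2 - 1)"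
    by (simp add: norm_mult[symmetric] algebra_simps power2_eq_square)
  ultimately show ?thesis
    using assms(1) mult_left_mono[of 1 "norm (s + 1)" "norm (s - 1)"] by simp
qed

text \<open>The ratio telescopes along the path into factors (w - g i)/(w - g (i+1)) that stay
  within 1/2 of 1 on \<open>K\<close>, so each has a principal square root in the closure. The
  product of these roots is a single-valued root on \<open>K\<close>; at distance at least
  \<open>4 * \<delta>\<close> its branch is pinned by a positive real part.\<close>

lemma poly_approx_sqrt_ratio:
  assumes K: "compact K" and conn: "connected (- K)"
    and \<gamma>: "path \<gamma>" "path_image \<gamma> \<subseteq> - K" "path_image \<gamma> \<subseteq> cball (pathstart \<gamma>) \<delta>" and \<delta>: "\<delta> > 0"
  obtains s where "poly_approx K s"
    "\<And>w. w \<in> K \<Longrightarrow> (s w)\<^sup>2 = (w - pathstart \<gamma>) / (w - pathfinish \<gamma>)"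
    "\<And>w. w \<in> K \<Longrightarrow> norm (w - pathstart \<gamma>) \<ge> 4 * \<delta> \<Longrightarrow> Re (s w) > 0"
proof -
  let ?z0 = "pathstart \<gamma>"
  obtain \<eta> where \<eta>: "\<eta> > 0" "\<And>x w. x \<in> path_image \<gamma> \<Longrightarrow> w \<in> K \<Longrightarrow> \<eta> \<le> dist x w"
    using separate_compact_closed[OF compact_path_image[OF \<gamma>(1)] compact_imp_closed[OF K]] \<gamma>(2) by blast
  \<comment> \<open>Steps of at most \<open>\<eta>/2\<close> keep every factor within 1/2 of 1 on
    all of \<open>K\<close>; steps of at most \<open>\<delta>\<close> keep it within 1/3 of 1 at
    points that are at least \<open>3 * \<delta>\<close> away from the nodes on the path.\<close>
  define e where "e = min (\<eta>/2) \<delta>"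
  have e: "e > 0" "e \<le> \<eta>/2" "e \<le> \<delta>" using \<eta> \<delta> by (auto simp: e_def)
  obtain N :: nat where N: "N > 0"
      "\<And>i. i < N \<Longrightarrow> dist (\<gamma> (real i / N)) (\<gamma> (real (Suc i) / N)) < e"
    using fine_subdivision[OF \<gamma>(1) e(1)] by auto
  define g where "g i = \<gamma> (real i / N)" for i :: nat
  have im: "g i \<in> path_image \<gamma>" if "i \<le> N" for i
    unfolding path_image_def g_def using that N(1) by (intro imageI) auto
  have gK: "g i \<notin> K" if "i \<le> N" for i using im[OF that] \<gamma>(2) by auto
  have g\<delta>: "norm (g i - ?z0) \<le> \<delta>" if "i \<le> N" for i
    using im[OF that] \<gamma>(3) by (auto simp: dist_norm norm_minus_commute)
  have step: "norm (g i - g (Suc i)) \<le> e" if "i < N" for i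
    using N(2)[OF that] by (simp add: g_def dist_norm)
  have ratio: "(w - g i) / (w - g (Suc i)) - 1 = (g (Suc i) - g i) / (w - g (Suc i))"
    if "w \<in> K" "i < N" for w i
  proof -
    have "w - g (Suc i) \<noteq> 0" using gK[of "Suc i"] that by auto
    then show ?thesis by (simp add: field_simps)
  qed
  have "\<exists>s. poly_approx K s \<and> (\<forall>w\<in>K. (s w)\<^sup>2 = (w - ?z0) / (w - g i)
            \<and> (norm (w - ?z0) \<ge> 4 * \<delta> \<longrightarrow> Re (s w) > 0))" if "i \<le> N" for i
    using that
  proof (induction i)
    case 0
    have "g 0 = ?z0" by (simp add: g_def pathstart_def)
    then show ?case using gK[of 0]
      by (intro exI[of _ "\<lambda>_. 1"]) (auto intro: poly_approx_const)
  next
    case (Suc i)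
    then have i: "i < N" by simp
    obtain s where s: "poly_approx K s" "\<And>w. w \<in> K \<Longrightarrow> (s w)\<^sup>2 = (w - ?z0) / (w - g i)"
      "\<And>w. w \<in> K \<Longrightarrow> norm (w - ?z0) \<ge> 4 * \<delta> \<Longrightarrow> Re (s w) > 0"
      using Suc by auto
    define h where "h w = (w - g i) / (w - g (Suc i))" for w
    have hle: "norm (h w - 1) \<le> 1/2" if "w \<in> K" for w
    proof -
      have "norm (g (Suc i) - g i) / norm (w - g (Suc i)) \<le> (\<eta>/2) / \<eta>"
        using step[OF i] e \<eta>(2)[OF im that, of "Suc i"] i \<eta>(1)
        by (intro frac_le) (auto simp: dist_norm norm_minus_commute)
      then show ?thesis
        unfolding h_def ratio[OF that i] norm_divide using \<eta>(1) by simp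
    qed
    have "poly_approx K (\<lambda>w. poly [:- g i, 1:] w * ((-1) * (1 / (g (Suc i) - w))))"
      by (intro poly_approx_mult K poly_approx_poly poly_approx_const poly_approx_inverse conn gK)
         (use i in auto)
    then have hA: "poly_approx K h"
    proof (rule poly_approx_cong)
      fix w assume "w \<in> K"
      then have "w - g (Suc i) \<noteq> 0" "g (Suc i) - w \<noteq> 0" using gK[of "Suc i"] i by auto
      then show "h w = poly [:- g i, 1:] w * (- 1 * (1 / (g (Suc i) - w)))"
        by (simp add: h_def field_simps)
    qed
    have "poly_approx K (\<lambda>w. csqrt (h w))"
    proof (rule poly_approx_holomorphic_compose[OF K hA, where a=1 and r=1 and r'="1/2"])
      show "csqrt holomorphic_on ball 1 1"
      proof -
          { fix z :: complex assume "z \<in> ball 1 1" "z \<in> \<real>\<^sub>\<le>\<^sub>0"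
            then have "Re z \<le> 0" by (auto simp: complex_nonpos_Reals_iff)
            then have "1 \<le> Re (1 - z)" by simp
            then have "1 \<le> norm (1 - z)" using complex_Re_le_cmod order_trans by blast
            then have False using \<open>z \<in> ball 1 1\<close> by (simp add: dist_norm) }
          then have "z \<notin> \<real>\<^sub>\<le>\<^sub>0" if "z \<in> ball 1 1" for z :: complex using that by blast
          then have "csqrt field_differentiable at z within ball 1 1" if "z \<in> ball 1 1" for z
            using field_differentiable_at_within field_differentiable_at_csqrt that by blast
          then show ?thesis by (rule holomorphic_onI)
      qed
      show "norm (h w - 1) \<le> 1/2" if "w \<in> K" for w using hle[OF that] .
    qed simp
    then have A: "poly_approx K (\<lambda>w. s w * csqrt (h w))"
      by (rule poly_approx_mult[OF K s(1)])
    have "(s w * csqrt (h w))\<^sup>2 = (w - ?z0) / (w - g (Suc i))" if "w \<in> K" for w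
    proof -
      have "w - g i \<noteq> 0" using gK[of i] i that by auto
      then show ?thesis using s(2)[OF that] by (simp add: power_mult_distrib h_def)
    qed
    \<comment> \<open>Both the old root and the new factor are within 1/3 of 1, so the product is
      within 7/9 of 1 and the branch cannot change sign.\<close>
    moreover have "Re (s w * csqrt (h w)) > 0" if w: "w \<in> K" "norm (w - ?z0) \<ge> 4 * \<delta>" for w
    proof -
      have far: "norm (w - g j) \<ge> 3 * \<delta>" if "j \<le> N" for j
        using g\<delta>[OF that] w(2) norm_triangle_ineq[of "w - g j" "g j - ?z0"] by simp
      have "(s w)\<^sup>2 - 1 = (g i - ?z0) / (w - g i)"
      proof -
        have "w - g i \<noteq> 0" using gK[of i] i w(1) by auto
        then show ?thesis using s(2)[OF w(1)] by (simp add: field_simps)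
      qed
      also have "norm \<dots> \<le> \<delta> / (3 * \<delta>)"
        unfolding norm_divide using g\<delta>[of i] far[of i] i \<delta> by (intro frac_le) auto
      also have "\<dots> = 1/3" using \<delta> by simp
      finally have s1: "norm (s w - 1) \<le> 1/3"
        using s(3)[OF w] norm_square_root_near_one by blast
      have "norm (h w - 1) \<le> \<delta> / (3*\<delta>)"
        unfolding h_def ratio[OF w(1) i] norm_divide
        using far[of "Suc i"] i \<delta> step[OF i] e by (intro frac_le) (auto simp: norm_minus_commute)
      then have h1: "norm (csqrt (h w) - 1) \<le> 1/3"
        using csqrt_near_one[OF hle[OF w(1)]] \<delta> by simp
      have "s w * csqrt (h w) - 1 = (s w - 1) * (csqrt (h w) - 1) + (s w - 1) + (csqrt (h w) - 1)"
        by (simp add: algebra_simps)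
      also have "norm \<dots> \<le> norm (s w - 1) * norm (csqrt (h w) - 1) + norm (s w - 1) + norm (csqrt (h w) - 1)"
        by (intro order_trans[OF norm_triangle_ineq] add_mono) (auto simp: norm_mult)
      also have "\<dots> \<le> (1/3) * (1/3) + 1/3 + 1/3"
        using s1 h1 by (intro add_mono mult_mono) auto
      also have "\<dots> < 1" by simp
      finally have "norm (s w * csqrt (h w) - 1) < 1" .
      then have "\<bar>Re (s w * csqrt (h w) - 1)\<bar> < 1" using abs_Re_le_cmod le_less_trans by blast
      then show ?thesis by simp
    qed
    ultimately show ?case using A by blast
  qed
  from this[of N] obtain s where s: "poly_approx K s" "\<forall>w\<in>K. (s w)\<^sup>2 = (w - ?z0) / (w - g N)
            \<and> (norm (w - ?z0) \<ge> 4 * \<delta> \<longrightarrow> Re (s w) > 0)" by auto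
  moreover have "g N = pathfinish \<gamma>" using N(1) by (simp add: g_def pathfinish_def)
  ultimately show ?thesis using that by metis
qed

text \<open>Every boundary point of a compact set with connected complement is a peak point for the
  uniform closure of the polynomials. Writing \<open>s\<close> for the square root of
  \<open>(w - z\<^sub>0) / (w - z\<^sub>1)\<close>, with the path from \<open>z\<^sub>0\<close> to \<open>z\<^sub>1\<close> short but much longer than
  the distance from \<open>z\<^sub>0\<close> to the boundary point, the function \<open>(1 - s) / (1 + s)\<close> nearly peaks;
  it is a polynomial in \<open>s\<close> and \<open>w\<close> because \<open>1 - s\<^sup>2 = (z\<^sub>0 - z\<^sub>1) / (w - z\<^sub>1)\<close>.\<close>

lemma poly_approx_almost_peak:
  assumes K: "compact K" and conn: "connected (- K)" and b: "b \<in> K" "b \<in> closure (- K)"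
    and \<delta>: "0 < \<delta>" and \<rho>: "0 < \<rho>" "\<rho> \<le> \<delta>/2" "\<delta> \<le> 1"
  obtains q where "poly_approx K q" "\<And>w. w \<in> K \<Longrightarrow> norm (q w) \<le> 20"
    "\<And>w. w \<in> K \<Longrightarrow> norm (w - b) \<ge> 6 * \<delta> \<Longrightarrow> norm (q w) \<le> 2 * \<delta> / norm (w - b)"
    "norm (q b - 1) \<le> 9 * sqrt (2 * \<rho> / \<delta>)"
proof -
  obtain z0 where z0: "z0 \<notin> K" "dist z0 b < \<rho>"
    using b(2) \<rho>(1) unfolding closure_approachable by auto
  obtain R where R: "R > 0" "\<And>w. w \<in> K \<Longrightarrow> norm w \<le> R"
    using K by (metis bounded_pos compact_imp_bounded)
  define y where "y = complex_of_real (R + norm z0 + \<delta> + 1)"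
  have ny: "norm y = R + norm z0 + \<delta> + 1"
    unfolding y_def norm_of_real using R(1) \<delta> norm_ge_zero[of z0] by linarith
  have yK: "y \<notin> K" using R(2)[of y] ny \<delta> norm_ge_zero[of z0] by auto
  have "norm y \<le> norm z0 + norm (y - z0)" by (metis add.commute diff_add_cancel norm_triangle_ineq)
  then have yz: "y \<notin> cball z0 \<delta>" using ny R(1) by (auto simp: dist_norm norm_minus_commute)
  have "path_connected (- K)"
    using conn K by (intro connected_open_path_connected) (auto intro: compact_imp_closed)
  then obtain \<gamma>' where \<gamma>': "path \<gamma>'" "path_image \<gamma>' \<subseteq> - K" "pathstart \<gamma>' = z0" "pathfinish \<gamma>' = y"
    using yK z0 unfolding path_connected_def by (metis ComplI)
  \<comment> \<open>Cutting the path where it reaches the circle of radius \<open>\<delta>\<close>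
    around \<open>z0\<close> makes its endpoints exactly \<open>\<delta>\<close> apart, while the
    path itself never leaves the disc.\<close>
  obtain \<gamma> where \<gamma>: "path \<gamma>" "pathstart \<gamma> = z0" "path_image \<gamma> \<subseteq> path_image \<gamma>' \<inter> cball z0 \<delta>"
      "pathfinish \<gamma> \<in> frontier (cball z0 \<delta>)"
  proof (rule exists_path_subpath_to_frontier_closed[of "cball z0 \<delta>" \<gamma>'])
    show "pathstart \<gamma>' \<in> cball z0 \<delta>" using \<gamma>'(3) \<delta> by simp
    show "pathfinish \<gamma>' \<notin> cball z0 \<delta>" using \<gamma>'(4) yz by simp
  qed (use \<gamma>' that in simp_all)
  define z1 where "z1 = pathfinish \<gamma>"
  have z1: "norm (z1 - z0) = \<delta>" using \<gamma>(4) \<delta> by (simp add: z1_def dist_norm norm_minus_commute)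
  have z1K: "z1 \<notin> K" using \<gamma>(1,3) \<gamma>'(2) pathfinish_in_path_image[of \<gamma>] by (auto simp: z1_def)
  obtain s where s: "poly_approx K s" "\<And>w. w \<in> K \<Longrightarrow> (s w)\<^sup>2 = (w - z0) / (w - z1)"
    "\<And>w. w \<in> K \<Longrightarrow> norm (w - z0) \<ge> 4 * \<delta> \<Longrightarrow> Re (s w) > 0"
  proof (rule poly_approx_sqrt_ratio[OF K conn \<gamma>(1) _ _ \<delta>])
    show "path_image \<gamma> \<subseteq> - K" "path_image \<gamma> \<subseteq> cball (pathstart \<gamma>) \<delta>" using \<gamma> \<gamma>' by auto
  qed (use that in \<open>simp add: \<gamma>(2) z1_def\<close>)
  \<comment> \<open>This is (1 - s)/(1 + s) = (1 - s)^2/(1 - s^2), rewritten so that no division by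
    a function of \<open>w\<close> is left.\<close>
  define q where "q w = (1 - s w)\<^sup>2 * poly [:- z1 / (z0 - z1), 1 / (z0 - z1):] w" for w
  have nz: "z0 - z1 \<noteq> 0" using z1 \<delta> by auto
  have q: "q w = (1 - s w)\<^sup>2 * (w - z1) / (z0 - z1)" for w
    by (simp add: q_def diff_divide_distrib right_diff_distrib left_diff_distrib mult.commute)
  have nq: "norm (q w) = (norm (1 - s w))\<^sup>2 * norm (w - z1) / \<delta>" for w
    unfolding q norm_divide norm_mult norm_power using z1 by (simp add: norm_minus_commute)
  have wz1: "norm (w - z1) > 0" if "w \<in> K" for w using z1K that by auto
  have ns: "(norm (s w))\<^sup>2 = norm (w - z0) / norm (w - z1)" if "w \<in> K" for w
    using s(2)[OF that] by (metis norm_divide norm_power)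
  have tri1: "norm (w - z1) \<le> norm (w - z0) + \<delta>" for w
    using norm_triangle_ineq[of "w - z0" "z0 - z1"] z1 by (simp add: norm_minus_commute)
  have tri0: "norm (w - z0) \<le> norm (w - z1) + \<delta>" for w
    using norm_triangle_ineq[of "w - z1" "z1 - z0"] z1 by simp
  have far: "norm (q w) \<le> \<delta> / norm (w - z1)" if w: "w \<in> K" "norm (w - z0) \<ge> 4 * \<delta>" for w
  proof -
    have "(s w)\<^sup>2 - 1 = (z1 - z0) / (w - z1)"
      using s(2)[OF w(1)] wz1[OF w(1)] by (simp add: field_simps)
    then have "norm ((s w)\<^sup>2 - 1) \<le> \<delta> / norm (w - z1)" using z1 by (simp add: norm_divide)
    from norm_square_root_near_one[OF this s(3)[OF w]]
    have "norm (1 - s w) \<le> \<delta> / norm (w - z1)" by (simp add: norm_minus_commute)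
    then have "(norm (1 - s w))\<^sup>2 * norm (w - z1) / \<delta> \<le> (\<delta> / norm (w - z1))\<^sup>2 * norm (w - z1) / \<delta>"
      using \<delta> by (intro divide_right_mono mult_right_mono power_mono) auto
    also have "\<dots> = \<delta> / norm (w - z1)" using \<delta> wz1[OF w(1)] by (simp add: power2_eq_square field_simps)
    finally show ?thesis unfolding nq .
  qed
  have zb: "norm (b - z0) < \<rho>" using z0(2) by (simp add: dist_norm norm_minus_commute)
  show ?thesis
  proof (rule that)
    have "poly_approx K (\<lambda>w. 1 + (-1) * s w)"
      by (rule poly_approx_add[OF poly_approx_const poly_approx_mult[OF K poly_approx_const s(1)]])
    then have "poly_approx K (\<lambda>w. 1 - s w)" by simp
    then show "poly_approx K q"
      unfolding q_def by (rule poly_approx_mult[OF K poly_approx_power[OF K] poly_approx_poly])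
  next
    fix w assume w: "w \<in> K"
    show "norm (q w) \<le> 20"
    proof (cases "norm (w - z0) \<ge> 4 * \<delta>")
      case True
      then have "norm (w - z1) \<ge> \<delta>" using tri0[of w] \<delta> by linarith
      then have "\<delta> / norm (w - z1) \<le> 1" using \<delta> by (simp add: divide_le_eq_1)
      then show ?thesis using far[OF w True] by simp
    next
      case False
      \<comment> \<open>Near \<open>z0\<close>, |1 - s|^2 is at most 2 (1 + |s|^2); multiplied by |w
        - z1| this is 2 (|w - z1| + |w - z0|), which is below 18 \<open>\<delta>\<close>. Hence the
        bound 20.\<close>
      have "(norm (1 - s w))\<^sup>2 \<le> (1 + norm (s w))\<^sup>2"
        using norm_triangle_ineq4[of 1 "s w"] by (intro power_mono) auto
      also have "\<dots> \<le> 2 * (1 + (norm (s w))\<^sup>2)"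
        using sum_squares_bound[of 1 "norm (s w)"] by (simp add: power2_eq_square algebra_simps)
      finally have "(norm (1 - s w))\<^sup>2 * norm (w - z1) \<le> 2 * (1 + (norm (s w))\<^sup>2) * norm (w - z1)"
        by (intro mult_right_mono) auto
      moreover have "2 * (1 + (norm (s w))\<^sup>2) * norm (w - z1) = 2 * norm (w - z1) + 2 * norm (w - z0)"
        unfolding ns[OF w] using wz1[OF w] by (simp add: field_simps)
      ultimately have "(norm (1 - s w))\<^sup>2 * norm (w - z1) \<le> 20 * \<delta>"
        using False tri1[of w] \<delta> by linarith
      then show ?thesis unfolding nq using \<delta> by (simp add: divide_le_eq)
    qed
  next
    fix w assume w: "w \<in> K" "norm (w - b) \<ge> 6 * \<delta>"
    have "norm (w - b) \<le> norm (w - z0) + norm (z0 - b)"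
      using norm_triangle_ineq[of "w - z0" "z0 - b"] by simp
    then have "norm (w - b) \<le> norm (w - z0) + \<delta>"
      using zb \<rho>(1,2) \<delta> unfolding norm_minus_commute[of b z0] by linarith
    then have 1: "norm (w - z0) \<ge> 4 * \<delta>" using w(2) \<delta> by linarith
    have "norm (w - z1) \<ge> norm (w - b) / 2"
      using tri0[of w] \<open>norm (w - b) \<le> norm (w - z0) + \<delta>\<close> w(2) \<delta> by linarith
    moreover have "norm (w - b) > 0" using w(2) \<delta> by linarith
    ultimately have "\<delta> / norm (w - z1) \<le> \<delta> / (norm (w - b) / 2)"
      using \<delta> wz1[OF w(1)] by (intro divide_left_mono mult_pos_pos) auto
    then show "norm (q w) \<le> 2 * \<delta> / norm (w - b)" using far[OF w(1) 1] by (simp add: mult.commute)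
  next
    \<comment> \<open>\<open>\<sigma>\<close> bounds |s b|, and |t| as well. Then q b - 1 = (1 -
      s)^2 t + s^2 - 2 s is at most 4 + 1 + 2 times \<open>\<sigma>\<close>, with room to spare
      below 9.\<close>
    define \<sigma> where "\<sigma> = sqrt (2 * \<rho> / \<delta>)"
    have \<sigma>: "0 \<le> \<sigma>" "\<sigma> \<le> 1" "\<sigma>\<^sup>2 = 2 * \<rho> / \<delta>"
      using \<rho> \<delta> by (auto simp: \<sigma>_def field_simps)
    have "norm (b - z1) \<ge> \<delta>/2"
      using norm_triangle_ineq[of "z1 - b" "b - z0"] z1 zb \<rho>(2)
      unfolding norm_minus_commute[of b z1] by simp
    then have "(norm (s b))\<^sup>2 \<le> \<rho> / (\<delta>/2)"
      unfolding ns[OF b(1)] using zb \<delta> \<rho> by (intro frac_le) auto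
    also have "\<dots> = \<sigma>\<^sup>2" using \<sigma>(3) by simp
    finally have sb: "norm (s b) \<le> \<sigma>" using \<sigma>(1) by (rule power2_le_imp_le)
    define t where "t = (b - z0) / (z0 - z1)"
    have "norm t \<le> \<rho> / \<delta>"
      unfolding t_def norm_divide using zb \<rho> \<delta> z1 by (intro frac_le) (auto simp: norm_minus_commute)
    also have "\<rho> / \<delta> \<le> \<sigma>\<^sup>2" using \<sigma>(3) \<rho> \<delta> by (simp add: field_simps)
    also have "\<sigma>\<^sup>2 \<le> \<sigma>" using \<sigma>(1,2) by (simp add: power2_eq_square mult_left_le)
    finally have t: "norm t \<le> \<sigma>" .
    have "q b = (1 - s b)\<^sup>2 * (1 + t)"
      unfolding q t_def using nz by (simp add: field_simps)
    then have "q b - 1 = (1 - s b)\<^sup>2 * t + (s b)\<^sup>2 - 2 * s b"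
      by (simp add: power2_eq_square algebra_simps)
    then have "norm (q b - 1) \<le> (norm (1 - s b))\<^sup>2 * norm t + (norm (s b))\<^sup>2 + 2 * norm (s b)"
      using norm_triangle_ineq4[of "(1 - s b)\<^sup>2 * t + (s b)\<^sup>2" "2 * s b"]
        norm_triangle_ineq[of "(1 - s b)\<^sup>2 * t" "(s b)\<^sup>2"]
      by (simp add: norm_mult norm_power)
    moreover have "(norm (s b))\<^sup>2 \<le> \<sigma>"
    proof -
      have "(norm (s b))\<^sup>2 \<le> \<sigma>\<^sup>2" using sb by (intro power_mono) auto
      also have "\<sigma>\<^sup>2 \<le> \<sigma>" using \<sigma>(1,2) by (simp add: power2_eq_square mult_left_le)
      finally show ?thesis .
    qed
    moreover have "(norm (1 - s b))\<^sup>2 * norm t \<le> 4 * \<sigma>"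
    proof -
      have "norm (1 - s b) \<le> 1 + norm (s b)" using norm_triangle_ineq4[of 1 "s b"] by simp
      then have "norm (1 - s b) \<le> 2" using sb \<sigma>(2) by linarith
      then have "(norm (1 - s b))\<^sup>2 \<le> 2\<^sup>2" by (intro power_mono) auto
      then show ?thesis using t by (intro mult_mono) auto
    qed
    ultimately have "norm (q b - 1) \<le> 9 * \<sigma>" using sb \<sigma>(1) by linarith
    then show "norm (q b - 1) \<le> 9 * sqrt (2 * \<rho> / \<delta>)" by (simp add: \<sigma>_def)
  qed
qed

lemma poly_approx_peak:
  assumes K: "compact K" and conn: "connected (- K)" and b: "b \<in> K" "b \<in> closure (- K)"
  obtains q :: "nat \<Rightarrow> complex \<Rightarrow> complex" where "\<And>n. poly_approx K (q n)"
    "\<And>n w. w \<in> K \<Longrightarrow> norm (q n w) \<le> 20"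
    "\<And>w. w \<in> K \<Longrightarrow> (\<lambda>n. q n w) \<longlonglongrightarrow> (if w = b then 1 else 0)"
proof -
  define \<delta> where "\<delta> n = 1 / real (Suc (Suc n))" for n
  define \<rho> where "\<rho> n = \<delta> n * \<delta> n" for n
  have \<delta>: "0 < \<delta> n" "\<delta> n \<le> 1/2" for n by (auto simp: \<delta>_def field_simps)
  have \<rho>: "0 < \<rho> n" "\<rho> n \<le> \<delta> n / 2" for n
    using \<delta>[of n] mult_left_mono[of "\<delta> n" "1/2" "\<delta> n"] by (auto simp: \<rho>_def)
  have "\<exists>q. poly_approx K q \<and> (\<forall>w\<in>K. norm (q w) \<le> 20) \<and>
      (\<forall>w\<in>K. norm (w - b) \<ge> 6 * \<delta> n \<longrightarrow> norm (q w) \<le> 2 * \<delta> n / norm (w - b)) \<and>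
      norm (q b - 1) \<le> 9 * sqrt (2 * \<rho> n / \<delta> n)" for n
    by (rule poly_approx_almost_peak[OF K conn b \<delta>(1)[of n] \<rho>(1)[of n] \<rho>(2)[of n]])
      (use \<delta>(2)[of n] in \<open>auto\<close>)
  then obtain q where q: "\<And>n. poly_approx K (q n)" "\<And>n w. w \<in> K \<Longrightarrow> norm (q n w) \<le> 20"
    "\<And>n w. w \<in> K \<Longrightarrow> norm (w - b) \<ge> 6 * \<delta> n \<Longrightarrow> norm (q n w) \<le> 2 * \<delta> n / norm (w - b)"
    "\<And>n. norm (q n b - 1) \<le> 9 * sqrt (2 * \<rho> n / \<delta> n)"
    by metis
  have lim\<delta>: "\<delta> \<longlonglongrightarrow> 0"
    unfolding \<delta>_def using LIMSEQ_Suc[OF LIMSEQ_Suc[OF lim_1_over_n]] by simp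
  have "(\<lambda>n. q n w) \<longlonglongrightarrow> (if w = b then 1 else 0)" if w: "w \<in> K" for w
  proof (cases "w = b")
    case True
    have e: "9 * sqrt (2 * \<rho> n / \<delta> n) = 9 * sqrt (2 * \<delta> n)" for n
      using \<delta>[of n] by (simp add: \<rho>_def)
    have "(\<lambda>n. 9 * sqrt (2 * \<delta> n)) \<longlonglongrightarrow> 9 * sqrt (2 * 0)"
      by (intro tendsto_intros lim\<delta>)
    then have "(\<lambda>n. 9 * sqrt (2 * \<delta> n)) \<longlonglongrightarrow> 0" by simp
    then have "(\<lambda>n. q n b - 1) \<longlonglongrightarrow> 0"
      by (rule Lim_null_comparison[rotated]) (use q(4) e in auto)
    then show ?thesis using True by (simp add: LIM_zero_iff)
  next
    case False
    then have pos: "norm (w - b) > 0" by simp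
    have "eventually (\<lambda>n. \<delta> n < norm (w - b) / 6) sequentially"
      using order_tendstoD(2)[OF lim\<delta>, of "norm (w - b) / 6"] pos by simp
    then have ev: "eventually (\<lambda>n. norm (q n w) \<le> 2 * \<delta> n / norm (w - b)) sequentially"
      by eventually_elim (use q(3)[OF w] in auto)
    have "(\<lambda>n. 2 * \<delta> n / norm (w - b)) \<longlonglongrightarrow> 2 * 0 / norm (w - b)"
      by (intro tendsto_intros lim\<delta>) (use False in auto)
    then have "(\<lambda>n. q n w) \<longlonglongrightarrow> 0"
      by (intro Lim_null_comparison[OF ev]) simp
    then show ?thesis using False by simp
  qed
  then show ?thesis using that q(1,2) by blast
qed

section \<open>Iterates and summability\<close>

definition iter_deriv :: "'a::real_normed_field poly \<Rightarrow> nat \<Rightarrow> 'a \<Rightarrow> 'a" where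
  "iter_deriv f n z = (\<Prod>i<n. poly (pderiv f) ((poly f ^^ i) z))"

lemma iter_deriv_0 [simp]: "iter_deriv f 0 z = 1"
  by (simp add: iter_deriv_def)

lemma iter_deriv_Suc: "iter_deriv f (Suc n) z = poly (pderiv f) ((poly f ^^ n) z) * iter_deriv f n z"
  by (simp add: iter_deriv_def mult.commute)

lemma iter_deriv_add:
  "iter_deriv f (m + n) z = iter_deriv f m ((poly f ^^ n) z) * iter_deriv f n z"
  by (induction m) (simp_all add: iter_deriv_Suc funpow_add mult.assoc)

lemma DERIV_iterate:
  fixes f :: "'a::real_normed_field poly"
  shows "((poly f ^^ n) has_field_derivative iter_deriv f n z) (at z)"
proof (induction n)
  case 0
  then show ?case by simp
next
  case (Suc n)
  have "((\<lambda>x. poly f ((poly f ^^ n) x)) has_field_derivative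
      poly (pderiv f) ((poly f ^^ n) z) * iter_deriv f n z) (at z)"
    by (rule DERIV_chain2[OF poly_DERIV Suc])
  then show ?case by (simp add: iter_deriv_Suc o_def)
qed

lemma deriv_iterate:
  fixes f :: "'a::real_normed_field poly"
  shows "deriv (poly f ^^ n) z = iter_deriv f n z"
  by (rule DERIV_imp_deriv[OF DERIV_iterate])

lemma norm_poly_le:
  fixes P :: "'a::real_normed_field poly"
  assumes "1 \<le> norm z" "degree P \<le> k"
  shows "norm (poly P z) \<le> (\<Sum>i\<le>degree P. norm (coeff P i)) * norm z ^ k"
proof -
  have "norm (poly P z) \<le> (\<Sum>i\<le>degree P. norm (coeff P i * z ^ i))"
    unfolding poly_altdef by (rule norm_sum)
  also have "\<dots> \<le> (\<Sum>i\<le>degree P. norm (coeff P i) * norm z ^ k)"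
    using assms by (intro sum_mono) (auto simp: norm_mult norm_power intro!: mult_left_mono power_increasing)
  finally show ?thesis by (simp add: sum_distrib_right)
qed

text \<open>Beyond twice the coefficient sum the lower-order terms are at most half of the leading
  one. The order of quantifiers matters: \<open>C\<close> is fixed before \<open>A\<close>, so that
  \<open>A\<close> may later be taken equal to \<open>C\<close> and an escaping orbit outgrows the
  factor C^n which the derivative estimate costs.\<close>

lemma monic_poly_growth:
  fixes f :: "'a::real_normed_field poly"
  assumes d: "2 \<le> degree f" and monic: "lead_coeff f = 1"
  obtains C where "C \<ge> 1"
    "\<And>A. \<exists>R\<ge>1. \<forall>z. norm z \<ge> R \<longrightarrow> A * norm z \<le> norm (poly f z) \<and>
        norm (poly (pderiv f) z) * norm z \<le> C * norm (poly f z)"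
proof -
  define d where "d = degree f"
  define g where "g = f - monom 1 d"
  have dg: "degree g \<le> d - 1"
  proof (rule degree_le, intro allI impI)
    fix i assume "d - 1 < i"
    then consider "i = d" | "i > d" by linarith
    then show "coeff g i = 0"
      by cases (auto simp: g_def d_def monic[unfolded d_def] coeff_eq_0)
  qed
  define M where "M = (\<Sum>i\<le>degree g. norm (coeff g i))"
  define M' where "M' = (\<Sum>i\<le>degree (pderiv f). norm (coeff (pderiv f) i))"
  have M: "M \<ge> 0" "M' \<ge> 0" by (auto simp: M_def M'_def intro: sum_nonneg)
  have *: "norm z ^ d / 2 \<le> norm (poly f z)" if z: "norm z \<ge> max 1 (2 * M)" for z
  proof -
    have "norm (poly g z) \<le> M * norm z ^ (d - 1)"
      unfolding M_def using z by (intro norm_poly_le dg) auto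
    also have "\<dots> \<le> (norm z / 2) * norm z ^ (d - 1)"
      using z by (intro mult_right_mono) auto
    also have "\<dots> = norm z ^ d / 2" using d by (simp add: d_def power_eq_if)
    finally have "norm (poly g z) \<le> norm z ^ d / 2" .
    moreover have "poly f z = z ^ d + poly g z" by (simp add: g_def poly_monom)
    ultimately show ?thesis
      using norm_diff_ineq[of "z ^ d" "poly g z"] by (simp add: norm_power)
  qed
  show ?thesis
  proof (rule that[of "max 1 (2 * M')"])
    fix A :: real
    define R where "R = max (max 1 (2 * M)) (2 * A)"
    show "\<exists>R\<ge>1. \<forall>z. norm z \<ge> R \<longrightarrow> A * norm z \<le> norm (poly f z) \<and>
        norm (poly (pderiv f) z) * norm z \<le> max 1 (2 * M') * norm (poly f z)"
    proof (intro exI[of _ R] conjI allI impI)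
      show "R \<ge> 1" by (simp add: R_def)
      fix z :: 'a assume z: "norm z \<ge> R"
      then have z1: "norm z \<ge> max 1 (2 * M)" "norm z \<ge> 2 * A" "norm z \<ge> 1" by (auto simp: R_def)
      have "A * norm z \<le> (norm z / 2) * norm z" using z1 by (intro mult_right_mono) auto
      also have "\<dots> = norm z ^ 2 / 2" by (simp add: power2_eq_square)
      also have "\<dots> \<le> norm z ^ d / 2"
        using z1 d by (intro divide_right_mono power_increasing) (auto simp: d_def)
      finally show "A * norm z \<le> norm (poly f z)" using *[OF z1(1)] by linarith
      have "norm (poly (pderiv f) z) * norm z \<le> (M' * norm z ^ (d - 1)) * norm z"
        unfolding M'_def using z1 by (intro mult_right_mono norm_poly_le) (auto simp: d_def degree_pderiv)
      also have "\<dots> = 2 * M' * (norm z ^ d / 2)" using d by (simp add: d_def power_eq_if)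
      also have "\<dots> \<le> 2 * M' * norm (poly f z)" using *[OF z1(1)] M by (intro mult_left_mono) auto
      also have "\<dots> \<le> max 1 (2 * M') * norm (poly f z)" by (intro mult_right_mono) auto
      finally show "norm (poly (pderiv f) z) * norm z \<le> max 1 (2 * M') * norm (poly f z)" .
    qed
  qed simp
qed

text \<open>An escaping orbit satisfies \<open>|(f\<^sup>n)'(v)| \<le> C\<^sup>n |f\<^sup>n(v)|\<close> up to a constant, while
  \<open>|f\<^sup>n(v)|\<close> grows faster than any exponential; the numerator \<open>1 + |f\<^sup>n(v)|\<^sup>2\<close> therefore
  keeps the terms of the summability condition away from \<open>0\<close>.\<close>

lemma weakly_expanding_bounded_orbit:
  fixes f :: "'a::real_normed_field poly"
  assumes d: "2 \<le> degree f" and monic: "lead_coeff f = 1" and we: "weakly_expanding f c"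
  obtains B where "\<And>n. norm ((poly f ^^ n) (poly f c)) \<le> B"
proof (rule ccontr)
  assume neg: "\<not> thesis"
  define v where "v = poly f c"
  define w where "w n = (poly f ^^ n) v" for n
  define D where "D n = iter_deriv f n v" for n
  have D0: "D n \<noteq> 0" for n
    using we by (simp add: weakly_expanding_def Let_def deriv_iterate D_def v_def)
  have sum: "summable (\<lambda>n. (1 + (norm (w n))\<^sup>2) / (1 + (norm v)\<^sup>2) * (1 / norm (D n)))"
    using we by (simp add: weakly_expanding_def Let_def deriv_iterate D_def v_def w_def)
  obtain C where C: "C \<ge> 1"
    and gr: "\<And>A. \<exists>R\<ge>1. \<forall>z. norm z \<ge> R \<longrightarrow> A * norm z \<le> norm (poly f z) \<and>
        norm (poly (pderiv f) z) * norm z \<le> C * norm (poly f z)"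
    using monic_poly_growth[OF d monic] by blast
  obtain R where R: "R \<ge> 1"
    and gr: "\<And>z. norm z \<ge> R \<Longrightarrow> C * norm z \<le> norm (poly f z)"
            "\<And>z. norm z \<ge> R \<Longrightarrow> norm (poly (pderiv f) z) * norm z \<le> C * norm (poly f z)"
    using gr[of C] by blast
  have "\<not> (\<forall>n. norm (w n) \<le> R)"
    using neg that[of R] by (auto simp: w_def v_def)
  then obtain N where N: "norm (w N) > R"
    by (auto simp: not_le)
  have wS: "w (Suc n) = poly f (w n)" for n by (simp add: w_def)
  have big: "norm (w (N + n)) \<ge> R \<and> norm (w (N + n)) \<ge> C ^ n * norm (w N)" for n
  proof (induction n)
    case (Suc n)
    have 1: "C * norm (w (N + n)) \<le> norm (w (N + Suc n))" using gr(1) Suc by (simp add: wS)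
    have "1 * norm (w (N + n)) \<le> C * norm (w (N + n))" using C by (intro mult_right_mono) auto
    moreover have "C * (C ^ n * norm (w N)) \<le> C * norm (w (N + n))"
      using Suc C by (intro mult_left_mono) auto
    ultimately show ?case using 1 Suc by (simp add: mult.assoc)
  qed (use N in auto)
  have Dle: "norm (D (N + n)) * norm (w N) \<le> C ^ n * norm (D N) * norm (w (N + n))" for n
  proof (induction n)
    case (Suc n)
    have pos: "norm (w (N + n)) > 0" using big[of n] R by linarith
    have "norm (D (N + Suc n)) * norm (w N) * norm (w (N + n))
        = (norm (poly (pderiv f) (w (N + n))) * norm (w (N + n))) * (norm (D (N + n)) * norm (w N))"
      by (simp add: D_def w_def iter_deriv_Suc norm_mult)
    also have "\<dots> \<le> (C * norm (w (N + Suc n))) * (C ^ n * norm (D N) * norm (w (N + n)))"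
    proof (rule mult_mono)
      show "norm (poly (pderiv f) (w (N + n))) * norm (w (N + n)) \<le> C * norm (w (N + Suc n))"
        using gr(2)[of "w (N + n)"] big[of n] by (simp add: wS)
    qed (use Suc C in auto)
    finally have "(norm (D (N + Suc n)) * norm (w N)) * norm (w (N + n))
        \<le> (C ^ Suc n * norm (D N) * norm (w (N + Suc n))) * norm (w (N + n))"
      by (simp add: algebra_simps)
    then show ?case using pos by (rule mult_right_le_imp_le)
  qed simp
  \<comment> \<open>The factor C^n in the bound for the derivative is absorbed by one factor |w (N +
    n)|, the bound itself contains a second one, and the numerator of the summability condition
    supplies both. So no term from index \<open>N\<close> on falls below
    \<open>\<kappa>\<close>.\<close>
  define \<kappa> where "\<kappa> = (norm (w N))\<^sup>2 / norm (D N) / (1 + (norm v)\<^sup>2)"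
  have wN: "norm (w N) > 0" using N R by linarith
  have v0: "1 + (norm v)\<^sup>2 > 0" by (simp add: add_pos_nonneg)
  have "\<kappa> > 0" using wN D0[of N] v0 by (simp add: \<kappa>_def)
  have "\<kappa> \<le> (1 + (norm (w (N + n)))\<^sup>2) / (1 + (norm v)\<^sup>2) * (1 / norm (D (N + n)))" for n
  proof -
    let ?W = "norm (w (N + n))"
    have Dp: "norm (D (N + n)) > 0" "norm (D N) > 0" using D0 by auto
    have "(norm (w N))\<^sup>2 * norm (D (N + n)) \<le> norm (w N) * (C ^ n * norm (D N) * ?W)"
      using mult_left_mono[OF Dle[of n], of "norm (w N)"] by (simp add: power2_eq_square algebra_simps)
    also have "\<dots> = (C ^ n * norm (w N)) * (norm (D N) * ?W)" by (simp add: algebra_simps)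
    also have "\<dots> \<le> ?W * (norm (D N) * ?W)" using big[of n] by (intro mult_right_mono) auto
    also have "\<dots> \<le> (1 + ?W\<^sup>2) * norm (D N)" by (simp add: power2_eq_square algebra_simps)
    finally have "(norm (w N))\<^sup>2 / norm (D N) \<le> (1 + ?W\<^sup>2) / norm (D (N + n))"
      using Dp by (simp add: divide_le_eq le_divide_eq field_simps)
    then have "\<kappa> \<le> (1 + ?W\<^sup>2) / norm (D (N + n)) / (1 + (norm v)\<^sup>2)"
      unfolding \<kappa>_def using v0 by (intro divide_right_mono) auto
    then show ?thesis by (simp add: field_simps)
  qed
  moreover have "(\<lambda>n. (1 + (norm (w (N + n)))\<^sup>2) / (1 + (norm v)\<^sup>2) * (1 / norm (D (N + n)))) \<longlonglongrightarrow> 0"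
    using LIMSEQ_ignore_initial_segment[OF summable_LIMSEQ_zero[OF sum], of N]
    by (simp add: add.commute)
  ultimately have "\<kappa> \<le> 0" by (intro LIMSEQ_le_const) auto
  then show False using \<open>\<kappa> > 0\<close> by simp
qed

lemma weakly_expanding_iter_deriv_nonzero:
  "weakly_expanding f c \<Longrightarrow> iter_deriv f n (poly f c) \<noteq> 0"
  by (simp add: weakly_expanding_def Let_def deriv_iterate)

lemma weakly_expanding_summable:
  assumes "weakly_expanding f c"
  shows "summable (\<lambda>n. 1 / norm (iter_deriv f n (poly f c)))"
proof -
  let ?v = "poly f c"
  have pos: "1 + (norm ?v)\<^sup>2 > 0" by (simp add: add_pos_nonneg)
  have "summable (\<lambda>n. (1 + (norm ((poly f ^^ n) ?v))\<^sup>2) / (1 + (norm ?v)\<^sup>2) * (1 / norm (iter_deriv f n ?v)))"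
    using assms by (simp add: weakly_expanding_def Let_def deriv_iterate)
  from summable_mult[OF this, of "1 + (norm ?v)\<^sup>2"] pos
  have s: "summable (\<lambda>n. (1 + (norm ((poly f ^^ n) ?v))\<^sup>2) * (1 / norm (iter_deriv f n ?v)))"
    by simp
  show ?thesis
  proof (rule summable_comparison_test'[OF s])
    fix n :: nat
    have "1 * (1 / norm (iter_deriv f n ?v))
        \<le> (1 + (norm ((poly f ^^ n) ?v))\<^sup>2) * (1 / norm (iter_deriv f n ?v))"
      by (intro mult_right_mono) auto
    then show "norm (1 / norm (iter_deriv f n ?v))
        \<le> (1 + (norm ((poly f ^^ n) ?v))\<^sup>2) * (1 / norm (iter_deriv f n ?v))"
      by simp
  qed
qed

text \<open>A weakly expanding critical orbit is bounded, so \<open>u\<close> is bounded along it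
  and the reciprocals of the derivatives decide convergence.\<close>

lemma summable_along_orbit:
  fixes f :: "'a::{real_normed_field,banach} poly" and u :: "'a poly"
  assumes "2 \<le> degree f" "lead_coeff f = 1" "weakly_expanding f c"
  shows "summable (\<lambda>n. norm (poly u ((poly f ^^ n) (poly f c)) / iter_deriv f (Suc n) (poly f c)))"
proof -
  obtain B where B: "\<And>n. norm ((poly f ^^ n) (poly f c)) \<le> B"
    using weakly_expanding_bounded_orbit[OF assms] by blast
  define M where "M = (\<Sum>i\<le>degree u. norm (coeff u i) * B ^ i)"
  have M: "norm (poly u ((poly f ^^ n) (poly f c))) \<le> M" for n
  proof -
    have "norm (poly u ((poly f ^^ n) (poly f c))) \<le>
        (\<Sum>i\<le>degree u. norm (coeff u i * ((poly f ^^ n) (poly f c)) ^ i))"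
      unfolding poly_altdef by (rule norm_sum)
    also have "\<dots> \<le> M"
      unfolding M_def using B by (intro sum_mono) (auto simp: norm_mult norm_power intro!: mult_left_mono power_mono)
    finally show ?thesis .
  qed
  have "summable (\<lambda>n. 1 / norm (iter_deriv f (Suc n) (poly f c)))"
    using weakly_expanding_summable[OF assms(3)] by (subst summable_Suc_iff)
  from summable_mult[OF this, of M] show ?thesis
  proof (rule summable_comparison_test')
    fix n :: nat
    show "norm (norm (poly u ((poly f ^^ n) (poly f c)) / iter_deriv f (Suc n) (poly f c)))
       \<le> M * (1 / norm (iter_deriv f (Suc n) (poly f c)))"
      using divide_right_mono[OF M[of n] norm_ge_zero[of "iter_deriv f (Suc n) (poly f c)"]]
      by (simp add: norm_divide)
  qed
qed

section \<open>Inverse branches\<close>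

lemma holomorphic_poly: "poly P holomorphic_on S"
  using poly_DERIV[of P] unfolding holomorphic_on_def field_differentiable_def
  by (blast intro: has_field_derivative_at_within)

lemma degree_add_const:
  fixes P :: "'a::comm_ring_1 poly"
  shows "0 < degree P \<Longrightarrow> degree (P + [:y:]) = degree P"
  by (intro degree_add_eq_left) simp

lemma card_roots_eq_degree:
  fixes P :: "complex poly"
  assumes "\<And>w. poly P w = y \<Longrightarrow> poly (pderiv P) w \<noteq> 0" "degree P > 0"
  shows "card {w. poly P w = y} = degree P"
proof -
  define Q where "Q = P + [:-y:]"
  have dQ: "degree Q = degree P" using assms(2) by (simp add: Q_def degree_add_const)
  then have Q0: "Q \<noteq> 0" using assms(2) by auto
  have pdQ: "pderiv Q = pderiv P" by (simp add: Q_def pderiv_add pderiv_pCons)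
  have roots: "{w. poly P w = y} = {w. poly Q w = 0}" by (auto simp: Q_def)
  have "rsquarefree Q" unfolding rsquarefree_roots pdQ using assms(1) by (auto simp: Q_def)
  then have "smult (lead_coeff Q) (\<Prod>z|poly Q z = 0. [:-z, 1:]) = Q"
    by (rule complex_poly_decompose_rsquarefree)
  then have "degree Q = degree (\<Prod>z|poly Q z = 0. [:-z, 1:])"
    using Q0 by (metis degree_smult_eq leading_coeff_0_iff)
  also have "\<dots> = (\<Sum>z|poly Q z = 0. degree [:-z, 1:])"
    by (rule degree_prod_sum_eq) auto
  finally show ?thesis using dQ roots by simp
qed

lemma finite_roots:
  fixes P :: "complex poly"
  assumes "degree P > 0"
  shows "finite {w. poly P w = y}"
proof -
  have "P + [:-y:] \<noteq> 0" using degree_add_const[OF assms, of "-y"] assms by (metis degree_0 less_irrefl)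
  from poly_roots_finite[OF this] show ?thesis by simp
qed

lemma poly_surj:
  fixes P :: "complex poly"
  assumes "degree P > 0"
  shows "\<exists>w. poly P w = y"
proof -
  have "degree (P + [:-y:]) \<noteq> 0" using assms by (simp add: degree_add_const)
  then have "\<not> constant (poly (P + [:-y:]))" by (simp add: constant_degree)
  from fundamental_theorem_of_algebra[OF this] show ?thesis by simp
qed

text \<open>Counting replaces properness. Each fibre over \<open>D\<close> has exactly degree-many
  points, and small discs around the fibre of \<open>x\<close> already contain that many preimages
  of every nearby value, so no preimage lies elsewhere. The parts of these discs over
  \<open>T\<close> are the sheets.\<close>

lemma polynomial_covering:
  fixes P :: "complex poly"
  assumes dP: "degree P > 0" and D: "open D"
    and nc: "\<And>w. poly P w \<in> D \<Longrightarrow> poly (pderiv P) w \<noteq> 0"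
  shows "covering_space (poly P -` D) (poly P) D"
  unfolding covering_space_def
proof (intro conjI ballI)
  show "continuous_on (poly P -` D) (poly P)" by (intro continuous_intros)
  show "poly P ` (poly P -` D) = D" using poly_surj[OF dP] by (auto simp: image_iff) metis
next
  fix x assume x: "x \<in> D"
  define A where "A = {w. poly P w = x}"
  have fA: "finite A" unfolding A_def by (rule finite_roots[OF dP])
  have cA: "card A = degree P" unfolding A_def by (rule card_roots_eq_degree) (use nc x dP in auto)
  have A0: "A \<noteq> {}" using poly_surj[OF dP, of x] by (auto simp: A_def)
  have "\<exists>r>0. inj_on (poly P) (ball a r)" if "a \<in> A" for a
  proof -
    have "deriv (poly P) a \<noteq> 0"
      using nc[of a] that x by (simp add: A_def DERIV_imp_deriv[OF poly_DERIV])
    then show ?thesis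
      using has_complex_derivative_locally_invertible[of "poly P" UNIV a]
      by (metis UNIV_I holomorphic_poly open_UNIV)
  qed
  then obtain r1 where r1: "\<And>a. a \<in> A \<Longrightarrow> r1 a > 0" "\<And>a. a \<in> A \<Longrightarrow> inj_on (poly P) (ball a (r1 a))"
    by metis
  obtain r2 where r2: "r2 > 0" "\<And>a b. a \<in> A \<Longrightarrow> b \<in> A \<Longrightarrow> a \<noteq> b \<Longrightarrow> r2 \<le> dist a b"
  proof -
    have "\<exists>d>0. \<forall>b\<in>A. b \<noteq> a \<longrightarrow> d \<le> dist a b" for a
      by (rule finite_set_avoid[OF fA])
    then obtain d where d: "\<And>a. d a > 0" "\<And>a b. b \<in> A \<Longrightarrow> b \<noteq> a \<Longrightarrow> d a \<le> dist a b" by metis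
    show ?thesis
    proof (rule that[of "Min (d ` A)"])
      show "Min (d ` A) > 0" using fA A0 d(1) by simp
      fix a b assume ab: "a \<in> A" "b \<in> A" "a \<noteq> b"
      then have "Min (d ` A) \<le> d a" using fA by simp
      also have "d a \<le> dist a b" using d(2)[of b a] ab by auto
      finally show "Min (d ` A) \<le> dist a b" .
    qed
  qed
  define r where "r = min (r2/2) (Min (r1 ` A))"
  have r: "r > 0" "\<And>a. a \<in> A \<Longrightarrow> r \<le> r1 a" "r \<le> r2/2"
    using r1(1) r2(1) fA A0 by (auto simp: r_def min_le_iff_disj)
  have inj: "inj_on (poly P) (ball a r)" if "a \<in> A" for a
    using r1(2)[OF that] by (rule inj_on_subset) (use r(2)[OF that] in auto)
  have disj: "ball a r \<inter> ball b r = {}" if "a \<in> A" "b \<in> A" "a \<noteq> b" for a b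
  proof -
    have "r + r \<le> dist a b" using r2(2)[OF that] r(3) by linarith
    then show ?thesis by (intro disjoint_ballI) simp
  qed
  have op: "open (poly P ` S)" if "open S" "S \<subseteq> ball a r" "a \<in> A" for S a
    using open_mapping_thm3[OF holomorphic_poly that(1) inj_on_subset[OF inj[OF that(3)] that(2)]] .
  define T where "T = D \<inter> (\<Inter>a\<in>A. poly P ` ball a r)"
  have openT: "open T"
    unfolding T_def using D fA op by (intro open_Int open_INT) auto
  have xT: "x \<in> T"
    unfolding T_def using x r(1) by (force simp: A_def)
  define V where "V a = ball a r \<inter> poly P -` T" for a
  have openV: "open (V a)" for a
    unfolding V_def by (intro open_Int open_ball continuous_open_vimage openT) (auto intro: continuous_intros)
  have PV: "poly P ` V a = T" if "a \<in> A" for a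
  proof (intro equalityI subsetI)
    fix y assume y: "y \<in> T"
    then have "y \<in> poly P ` ball a r" using that unfolding T_def by blast
    then obtain z where "z \<in> ball a r" "y = poly P z" by (rule imageE) simp
    then show "y \<in> poly P ` V a" using y by (auto simp: V_def)
  qed (auto simp: V_def)
  have cover: "w \<in> (\<Union>a\<in>A. V a)" if w: "poly P w \<in> T" for w
  proof -
    let ?y = "poly P w"
    have "\<forall>a\<in>A. \<exists>z\<in>ball a r. poly P z = ?y"
    proof
      fix a assume "a \<in> A"
      then have "?y \<in> poly P ` ball a r" using w unfolding T_def by blast
      then show "\<exists>z\<in>ball a r. poly P z = ?y" by (metis imageE)
    qed
    then obtain z where z: "\<And>a. a \<in> A \<Longrightarrow> z a \<in> ball a r" "\<And>a. a \<in> A \<Longrightarrow> poly P (z a) = ?y" by metis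
    have "inj_on z A" using z(1) disj by (intro inj_onI) (metis disjoint_iff)
    then have "card (z ` A) = degree P" using cA by (simp add: card_image)
    moreover have "z ` A \<subseteq> {u. poly P u = ?y}" using z(2) by auto
    moreover have "card {u. poly P u = ?y} = degree P"
      by (rule card_roots_eq_degree) (use nc w dP T_def in auto)
    ultimately have "z ` A = {u. poly P u = ?y}"
      using finite_roots[OF dP] by (intro card_subset_eq) auto
    then obtain a where "a \<in> A" "w = z a" by blast
    then show ?thesis using z(1) w by (auto simp: V_def)
  qed
  show "\<exists>T. x \<in> T \<and> openin (top_of_set D) T \<and>
     (\<exists>v. \<Union> v = poly P -` D \<inter> poly P -` T \<and> (\<forall>u\<in>v. openin (top_of_set (poly P -` D)) u) \<and>
          disjoint v \<and> (\<forall>u\<in>v. \<exists>q. homeomorphism u T (poly P) q))"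
  proof (intro exI[of _ T] conjI exI[of _ "V ` A"] ballI)
    show "x \<in> T" by (rule xT)
    show "openin (top_of_set D) T" using openT D by (simp add: openin_open_eq T_def)
    show "\<Union> (V ` A) = poly P -` D \<inter> poly P -` T" using cover by (auto simp: V_def T_def)
    show "disjoint (V ` A)"
    proof (rule pairwiseI)
      fix s t assume "s \<in> V ` A" "t \<in> V ` A" "s \<noteq> t"
      then obtain a b where "a \<in> A" "b \<in> A" "a \<noteq> b" "s = V a" "t = V b" by auto
      then show "disjnt s t" using disj[of a b] by (auto simp: V_def disjnt_def)
    qed
    fix u assume "u \<in> V ` A"
    then obtain a where a: "a \<in> A" "u = V a" by blast
    have oD: "open (poly P -` D)"
      by (intro continuous_open_vimage D) (auto intro: continuous_intros)
    show "openin (top_of_set (poly P -` D)) u"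
      using openV[of a] oD by (subst openin_open_eq) (auto simp: a V_def T_def)
    have "inj_on (poly P) (V a)" using inj[OF a(1)] by (rule inj_on_subset) (auto simp: V_def)
    then show "\<exists>q. homeomorphism u T (poly P) q"
    proof -
      have "openin (top_of_set T) (poly P ` U)" if "openin (top_of_set (V a)) U" for U
      proof -
        have "open U" "U \<subseteq> V a" using that openV[of a] by (auto simp: openin_open_eq)
        then have "open (poly P ` U)" using op[of U a] a(1) by (auto simp: V_def)
        moreover have "poly P ` U \<subseteq> T" using \<open>U \<subseteq> V a\<close> by (auto simp: V_def)
        ultimately show ?thesis using openT by (simp add: openin_open_eq)
      qed
      then show ?thesis
        unfolding a(2)
        using homeomorphism_injective_open_map[OF _ PV[OF a(1)] \<open>inj_on (poly P) (V a)\<close>]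
          continuous_on_poly[OF continuous_on_id] by blast
    qed
  qed
qed

text \<open>The branch is the lift of the identity map of the disc, which is simply connected;
  holomorphy and the derivative come from inverting \<open>P\<close> locally.\<close>

lemma inverse_branch:
  fixes P :: "complex poly"
  assumes dP: "degree P > 0" and r: "r > 0"
    and nc: "\<And>w. poly P w \<in> ball z r \<Longrightarrow> poly (pderiv P) w \<noteq> 0"
    and a: "poly P a = z"
  obtains g where "g holomorphic_on ball z r" "g z = a" "\<And>y. y \<in> ball z r \<Longrightarrow> poly P (g y) = y"
    "deriv g z = 1 / poly (pderiv P) a"
proof -
  have cov: "covering_space (poly P -` ball z r) (poly P) (ball z r)"
    by (rule polynomial_covering[OF dP open_ball nc])
  obtain g where g: "continuous_on (ball z r) g" "g \<in> ball z r \<rightarrow> poly P -` ball z r" "g z = a"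
      "\<And>y. y \<in> ball z r \<Longrightarrow> poly P (g y) = y"
  proof (rule covering_space_lift_strong[OF cov, of a z "ball z r" "\<lambda>x. x"])
    show "simply_connected (ball z r)" by (rule convex_imp_simply_connected[OF convex_ball])
    show "locally path_connected (ball z r)" by (rule convex_imp_locally_path_connected[OF convex_ball])
    show "continuous_on (ball z r) (\<lambda>x. x)" by (rule continuous_on_id)
  qed (use a r that in simp_all)
  have der: "(g has_field_derivative inverse (poly (pderiv P) (g y))) (at y)" if "y \<in> ball z r" for y
  proof (rule has_field_derivative_inverse_basic[OF poly_DERIV _ _ open_ball that])
    show "poly (pderiv P) (g y) \<noteq> 0" using nc g(4)[OF that] that by simp
    show "isCont g y" using g(1) that by (simp add: continuous_on_eq_continuous_at)
  qed (use g(4) in auto)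
  show ?thesis
  proof (rule that[of g])
    show "g holomorphic_on ball z r"
      using der by (intro holomorphic_onI) (auto simp: field_differentiable_def intro: has_field_derivative_at_within)
    show "deriv g z = 1 / poly (pderiv P) a"
      using DERIV_imp_deriv[OF der[of z]] r g(3) by (simp add: inverse_eq_divide)
  qed (use g in auto)
qed

text \<open>\<open>P\<close> recovers the argument from the value, so a common value is taken at a
  common argument; two lifts that agree at one point of a connected set agree on all of it.\<close>

lemma inverse_branches_disjoint:
  fixes P :: "complex poly"
  assumes dP: "degree P > 0"
    and nc: "\<And>w. poly P w \<in> ball z r \<Longrightarrow> poly (pderiv P) w \<noteq> 0"
    and g: "continuous_on (ball z r) g" "\<And>y. y \<in> ball z r \<Longrightarrow> poly P (g y) = y"
    and h: "continuous_on (ball z r) h" "\<And>y. y \<in> ball z r \<Longrightarrow> poly P (h y) = y"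
    and x: "x \<in> ball z r" and y: "y \<in> ball z r" and eq: "g x = h y"
  shows "g z = h z"
proof -
  have xy: "x = y" using g(2)[OF x] h(2)[OF y] eq by simp
  have cov: "covering_space (poly P -` ball z r) (poly P) (ball z r)"
    by (rule polynomial_covering[OF dP open_ball nc])
  have z: "z \<in> ball z r" using x by (auto intro: le_less_trans[OF zero_le_dist])
  show ?thesis
  proof (rule covering_space_lift_unique[OF cov, where f="\<lambda>x. x" and T="ball z r" and a=x
        and ?g1.0=g and ?g2.0=h and x=z])
    show "g x = h x" using eq xy by simp
    show "continuous_on (ball z r) (\<lambda>x. x)" by (rule continuous_on_id)
    show "g \<in> ball z r \<rightarrow> poly P -` ball z r" "h \<in> ball z r \<rightarrow> poly P -` ball z r"
      using g(2) h(2) by auto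
    show "\<And>x. x \<in> ball z r \<Longrightarrow> x = poly P (g x)" "\<And>x. x \<in> ball z r \<Longrightarrow> x = poly P (h x)"
      using g(2) h(2) by auto
  qed (use g(1) h(1) x z in \<open>simp_all add: connected_ball\<close>)
qed

section \<open>Annihilating measures\<close>

text \<open>Throughout this part \<open>a n j\<close> are the weights of a finite complex measure;
  \<open>\<phi> n j\<close> stands for the value of the integrand at the corresponding atom. The
  index \<open>j\<close> of the critical orbit runs through a finite set, so only the sum over
  \<open>n\<close> is infinite.\<close>

lemma summable_sum_mult_bounded:
  fixes a \<phi> :: "nat \<Rightarrow> nat \<Rightarrow> complex"
  assumes sum: "summable (\<lambda>n. \<Sum>j<p. norm (a n j))"
    and bnd: "\<And>n j. j < p \<Longrightarrow> norm (\<phi> n j) \<le> B"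
  shows "summable (\<lambda>n. \<Sum>j<p. a n j * \<phi> n j)"
    and "norm (\<Sum>n. \<Sum>j<p. a n j * \<phi> n j) \<le> B * (\<Sum>n. \<Sum>j<p. norm (a n j))"
proof -
  have le: "norm (\<Sum>j<p. a n j * \<phi> n j) \<le> B * (\<Sum>j<p. norm (a n j))" for n
  proof -
    have "norm (\<Sum>j<p. a n j * \<phi> n j) \<le> (\<Sum>j<p. norm (a n j) * norm (\<phi> n j))"
      by (rule order_trans[OF norm_sum]) (simp add: norm_mult)
    also have "\<dots> \<le> (\<Sum>j<p. norm (a n j) * B)"
      using bnd by (intro sum_mono mult_left_mono) auto
    finally show ?thesis by (simp add: sum_distrib_left mult.commute)
  qed
  show "summable (\<lambda>n. \<Sum>j<p. a n j * \<phi> n j)"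
    using le by (intro summable_comparison_test'[OF summable_mult[OF sum, of B]]) auto
  show "norm (\<Sum>n. \<Sum>j<p. a n j * \<phi> n j) \<le> B * (\<Sum>n. \<Sum>j<p. norm (a n j))"
    using norm_suminf_le[OF le summable_mult[OF sum, of B]] suminf_mult[OF sum, of B] by simp
qed

text \<open>Dominated convergence for such a measure, as an instance of Tannery's theorem.\<close>

lemma tendsto_suminf_dominated:
  fixes a :: "nat \<Rightarrow> nat \<Rightarrow> complex" and \<phi> :: "nat \<Rightarrow> nat \<Rightarrow> nat \<Rightarrow> complex"
  assumes sum: "summable (\<lambda>n. \<Sum>j<p. norm (a n j))"
    and bnd: "\<And>l n j. j < p \<Longrightarrow> norm (\<phi> l n j) \<le> B"
    and lim: "\<And>n j. j < p \<Longrightarrow> (\<lambda>l. \<phi> l n j) \<longlonglongrightarrow> \<psi> n j"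
  shows "(\<lambda>l. \<Sum>n. \<Sum>j<p. a n j * \<phi> l n j) \<longlonglongrightarrow> (\<Sum>n. \<Sum>j<p. a n j * \<psi> n j)"
proof -
  have "(\<lambda>l. \<Sum>j<p. a n j * \<phi> l n j) \<longlonglongrightarrow> (\<Sum>j<p. a n j * \<psi> n j)" for n
    using lim by (intro tendsto_intros) auto
  moreover have "norm (\<Sum>j<p. a n j * \<phi> l n j) \<le> B * (\<Sum>j<p. norm (a n j))" for l n
  proof -
    have "norm (\<Sum>j<p. a n j * \<phi> l n j) \<le> (\<Sum>j<p. norm (a n j) * norm (\<phi> l n j))"
      by (rule order_trans[OF norm_sum]) (simp add: norm_mult)
    also have "\<dots> \<le> (\<Sum>j<p. norm (a n j) * B)"
      using bnd by (intro sum_mono mult_left_mono) auto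
    finally show ?thesis by (simp add: sum_distrib_left mult.commute)
  qed
  ultimately show ?thesis
    using tannerys_theorem[of "\<lambda>n l. \<Sum>j<p. a n j * \<phi> l n j" "\<lambda>n. \<Sum>j<p. a n j * \<psi> n j" sequentially
        "\<lambda>n. B * (\<Sum>j<p. norm (a n j))"] summable_mult[OF sum, of B]
    by (simp add: case_prod_unfold)
qed

text \<open>Zero moments annihilate the polynomials, and the sum \<open>A\<close> of the absolute
  weights controls the passage to uniform limits.\<close>

lemma annihilates_poly_approx:
  fixes a x :: "nat \<Rightarrow> nat \<Rightarrow> complex"
  assumes K: "compact K" and xK: "\<And>n j. j < p \<Longrightarrow> x n j \<in> K"
    and sum: "summable (\<lambda>n. \<Sum>j<p. norm (a n j))"
    and mom: "\<And>m. (\<Sum>n. \<Sum>j<p. a n j * x n j ^ m) = 0"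
    and \<phi>: "poly_approx K \<phi>"
  shows "(\<Sum>n. \<Sum>j<p. a n j * \<phi> (x n j)) = 0"
proof -
  obtain B where B: "\<And>w. w \<in> K \<Longrightarrow> norm w \<le> B"
    using compact_imp_bounded[OF K] unfolding bounded_iff by blast
  have sm: "summable (\<lambda>n. \<Sum>j<p. a n j * x n j ^ m)" for m
    by (rule summable_sum_mult_bounded[OF sum, where B="B ^ m"])
      (auto simp: norm_power intro!: power_mono B xK)
  have poly: "(\<Sum>n. \<Sum>j<p. a n j * poly P (x n j)) = 0" for P
  proof -
    have "(\<Sum>j<p. a n j * poly P (x n j)) = (\<Sum>i\<le>degree P. coeff P i * (\<Sum>j<p. a n j * x n j ^ i))" for n
      unfolding poly_altdef sum_distrib_left
      by (subst sum.swap) (simp add: algebra_simps)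
    then have "(\<Sum>n. \<Sum>j<p. a n j * poly P (x n j))
        = (\<Sum>n. \<Sum>i\<le>degree P. coeff P i * (\<Sum>j<p. a n j * x n j ^ i))" by simp
    also have "\<dots> = (\<Sum>i\<le>degree P. \<Sum>n. coeff P i * (\<Sum>j<p. a n j * x n j ^ i))"
      by (intro suminf_sum summable_mult sm)
    also have "\<dots> = 0" using suminf_mult[OF sm] mom by simp
    finally show ?thesis .
  qed
  obtain B' where B': "B' > 0" "\<And>w. w \<in> K \<Longrightarrow> norm (\<phi> w) \<le> B'"
    using poly_approx_bounded[OF K \<phi>] by blast
  have s\<phi>: "summable (\<lambda>n. \<Sum>j<p. a n j * \<phi> (x n j))"
    by (rule summable_sum_mult_bounded[OF sum, where B=B']) (use B' xK in auto)
  define A where "A = (\<Sum>n. \<Sum>j<p. norm (a n j))"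
  have A: "A \<ge> 0" unfolding A_def by (intro suminf_nonneg sum sum_nonneg) auto
  have "norm (\<Sum>n. \<Sum>j<p. a n j * \<phi> (x n j)) \<le> e * A" if e: "e > 0" for e
  proof -
    obtain P where P: "\<And>w. w \<in> K \<Longrightarrow> norm (\<phi> w - poly P w) < e"
      using \<phi> e unfolding poly_approx_def by blast
    obtain C where C: "C > 0" "\<And>w. w \<in> K \<Longrightarrow> norm (poly P w) \<le> C"
      using poly_approx_bounded[OF K poly_approx_poly] by blast
    have sP: "summable (\<lambda>n. \<Sum>j<p. a n j * poly P (x n j))"
      by (rule summable_sum_mult_bounded[OF sum, where B=C]) (use C xK in auto)
    have "(\<Sum>n. \<Sum>j<p. a n j * \<phi> (x n j))
        = (\<Sum>n. (\<Sum>j<p. a n j * \<phi> (x n j)) - (\<Sum>j<p. a n j * poly P (x n j)))"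
      using suminf_diff[OF s\<phi> sP] poly by simp
    also have "\<dots> = (\<Sum>n. \<Sum>j<p. a n j * (\<phi> (x n j) - poly P (x n j)))"
      by (simp add: sum_subtractf right_diff_distrib)
    also have "norm \<dots> \<le> e * A"
      unfolding A_def by (rule summable_sum_mult_bounded[OF sum]) (use P xK in \<open>auto intro: less_imp_le\<close>)
    finally show ?thesis .
  qed
  note le = this
  have "norm (\<Sum>n. \<Sum>j<p. a n j * \<phi> (x n j)) \<le> e" if e: "e > 0" for e
  proof -
    have "norm (\<Sum>n. \<Sum>j<p. a n j * \<phi> (x n j)) \<le> e / (A + 1) * A" using A e by (intro le) auto
    also have "\<dots> \<le> e" using A e by (simp add: field_simps)
    finally show ?thesis .
  qed
  then have "norm (\<Sum>n. \<Sum>j<p. a n j * \<phi> (x n j)) \<le> 0" by (rule field_le_epsilon) simp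
  then show ?thesis by simp
qed

text \<open>Every peak function at \<open>b\<close> has integral zero; in the limit only the atoms
  located at \<open>b\<close> remain. All indices with this point are collected, since different
  orbits may meet.\<close>

lemma annihilates_atoms:
  fixes a x :: "nat \<Rightarrow> nat \<Rightarrow> complex"
  assumes K: "compact K" and conn: "connected (- K)" and xK: "\<And>n j. j < p \<Longrightarrow> x n j \<in> K"
    and sum: "summable (\<lambda>n. \<Sum>j<p. norm (a n j))"
    and mom: "\<And>m. (\<Sum>n. \<Sum>j<p. a n j * x n j ^ m) = 0"
    and b: "b \<in> K" "b \<in> closure (- K)"
  shows "(\<Sum>n. \<Sum>j<p. a n j * (if x n j = b then 1 else 0)) = 0"
proof -
  obtain q :: "nat \<Rightarrow> complex \<Rightarrow> complex" where q: "\<And>n. poly_approx K (q n)"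
    "\<And>n w. w \<in> K \<Longrightarrow> norm (q n w) \<le> 20"
    "\<And>w. w \<in> K \<Longrightarrow> (\<lambda>n. q n w) \<longlonglongrightarrow> (if w = b then 1 else 0)"
    using poly_approx_peak[OF K conn b] by blast
  have "(\<lambda>l. \<Sum>n. \<Sum>j<p. a n j * q l (x n j)) \<longlonglongrightarrow> (\<Sum>n. \<Sum>j<p. a n j * (if x n j = b then 1 else 0))"
    by (rule tendsto_suminf_dominated[OF sum, where B=20]) (use q xK in auto)
  moreover have "(\<Sum>n. \<Sum>j<p. a n j * q l (x n j)) = 0" for l
    by (rule annihilates_poly_approx[OF K xK sum mom q(1)])
  ultimately show ?thesis by (simp add: LIMSEQ_const_iff)
qed

text \<open>In the application \<open>\<phi>\<close> is an unbounded kernel, out of reach of uniform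
  approximation. The points of the first \<open>N\<close> rows are removed together with all their
  recurrences in later rows, which costs nothing because each has total mass zero; the rest is
  bounded by the tail of an absolutely convergent series.\<close>

lemma annihilates_all:
  fixes a x :: "nat \<Rightarrow> nat \<Rightarrow> complex"
  assumes sum: "summable (\<lambda>n. \<Sum>j<p. norm (a n j))"
    and atoms: "\<And>n' j'. j' < p \<Longrightarrow> (\<Sum>n. \<Sum>j<p. a n j * (if x n j = x n' j' then 1 else 0)) = 0"
    and s\<phi>: "summable (\<lambda>n. \<Sum>j<p. norm (a n j * \<phi> (x n j)))"
  shows "(\<Sum>n. \<Sum>j<p. a n j * \<phi> (x n j)) = 0"
proof -
  have "norm (\<Sum>n. \<Sum>j<p. a n j * \<phi> (x n j)) \<le> (\<Sum>n. \<Sum>j<p. norm (a (n + N) j * \<phi> (x (n + N) j)))" for N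
  proof -
    define Bs where "Bs = (\<lambda>(n,j). x n j) ` ({..<N} \<times> {..<p})"
    have fin: "finite Bs" by (simp add: Bs_def)
    define \<alpha> where "\<alpha> n j = a n j * \<phi> (x n j) * (if x n j \<in> Bs then 1 else 0)" for n j
    define \<beta> where "\<beta> n j = a n j * \<phi> (x n j) * (if x n j \<in> Bs then 0 else 1)" for n j
    have sb: "summable (\<lambda>n. \<Sum>j<p. a n j * (if x n j = b then 1 else 0))" for b
      by (rule summable_sum_mult_bounded[OF sum, where B=1]) auto
    have "(\<Sum>j<p. \<alpha> n j) = (\<Sum>b\<in>Bs. \<phi> b * (\<Sum>j<p. a n j * (if x n j = b then 1 else 0)))" for n
    proof -
      have "\<alpha> n j = (\<Sum>b\<in>Bs. \<phi> b * (a n j * (if x n j = b then 1 else 0)))" for j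
        using fin by (simp add: \<alpha>_def if_distrib[of "\<lambda>y. _ * y"] cong: if_cong)
      then have "(\<Sum>j<p. \<alpha> n j) = (\<Sum>j<p. \<Sum>b\<in>Bs. \<phi> b * (a n j * (if x n j = b then 1 else 0)))"
        by (intro sum.cong) auto
      also have "\<dots> = (\<Sum>b\<in>Bs. \<Sum>j<p. \<phi> b * (a n j * (if x n j = b then 1 else 0)))"
        by (rule sum.swap)
      finally show ?thesis unfolding sum_distrib_left .
    qed
    then have "(\<Sum>n. \<Sum>j<p. \<alpha> n j)
        = (\<Sum>n. \<Sum>b\<in>Bs. \<phi> b * (\<Sum>j<p. a n j * (if x n j = b then 1 else 0)))" by simp
    also have "\<dots> = (\<Sum>b\<in>Bs. \<Sum>n. \<phi> b * (\<Sum>j<p. a n j * (if x n j = b then 1 else 0)))"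
      by (intro suminf_sum summable_mult sb)
    also have "\<dots> = 0"
    proof (rule sum.neutral, rule ballI)
      fix b assume "b \<in> Bs"
      then obtain n' j' where "j' < p" "b = x n' j'" by (auto simp: Bs_def)
      then show "(\<Sum>n. \<phi> b * (\<Sum>j<p. a n j * (if x n j = b then 1 else 0))) = 0"
        using suminf_mult[OF sb, of "\<phi> b" b] atoms[of j' n'] by simp
    qed
    finally have \<alpha>0: "(\<Sum>n. \<Sum>j<p. \<alpha> n j) = 0" .
    have le: "norm (\<Sum>j<p. \<gamma> n j) \<le> (\<Sum>j<p. norm (a n j * \<phi> (x n j)))"
      if "\<And>n j. norm (\<gamma> n j) \<le> norm (a n j * \<phi> (x n j))" for n and \<gamma> :: "nat \<Rightarrow> nat \<Rightarrow> complex"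
      using that by (intro order_trans[OF norm_sum] sum_mono) auto
    have le\<alpha>: "norm (\<alpha> n j) \<le> norm (a n j * \<phi> (x n j))" for n j by (simp add: \<alpha>_def)
    have le\<beta>: "norm (\<beta> n j) \<le> norm (a n j * \<phi> (x n j))" for n j by (simp add: \<beta>_def)
    have s\<alpha>: "summable (\<lambda>n. \<Sum>j<p. \<alpha> n j)"
      using le[OF le\<alpha>] by (intro summable_comparison_test'[OF s\<phi>]) auto
    have s\<beta>: "summable (\<lambda>n. \<Sum>j<p. \<beta> n j)"
      using le[OF le\<beta>] by (intro summable_comparison_test'[OF s\<phi>]) auto
    have "(\<Sum>j<p. a n j * \<phi> (x n j)) = (\<Sum>j<p. \<alpha> n j) + (\<Sum>j<p. \<beta> n j)" for n
      unfolding sum.distrib[symmetric] by (intro sum.cong) (auto simp: \<alpha>_def \<beta>_def)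
    then have "(\<Sum>n. \<Sum>j<p. a n j * \<phi> (x n j)) = (\<Sum>n. \<Sum>j<p. \<beta> n j)"
      using suminf_add[OF s\<alpha> s\<beta>] \<alpha>0 by simp
    also have "\<dots> = (\<Sum>n. \<Sum>j<p. \<beta> (n + N) j) + (\<Sum>n<N. \<Sum>j<p. \<beta> n j)"
      by (rule suminf_split_initial_segment[OF s\<beta>])
    also have "(\<Sum>n<N. \<Sum>j<p. \<beta> n j) = 0"
      by (intro sum.neutral ballI) (auto simp: \<beta>_def Bs_def image_iff)
    finally have "(\<Sum>n. \<Sum>j<p. a n j * \<phi> (x n j)) = (\<Sum>n. \<Sum>j<p. \<beta> (n + N) j)" by simp
    also have "norm \<dots> \<le> (\<Sum>n. \<Sum>j<p. norm (a (n + N) j * \<phi> (x (n + N) j)))"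
      using s\<phi> by (intro norm_suminf_le le[OF le\<beta>]) (subst summable_iff_shift)
    finally show ?thesis .
  qed
  moreover have "(\<lambda>N. \<Sum>n. \<Sum>j<p. norm (a (n + N) j * \<phi> (x (n + N) j))) \<longlonglongrightarrow> 0"
    by (rule suminf_exist_split2) (use s\<phi> in auto)
  ultimately have "norm (\<Sum>n. \<Sum>j<p. a n j * \<phi> (x n j)) \<le> 0"
    by (intro LIMSEQ_le_const) auto
  then show ?thesis by simp
qed

section \<open>The transfer operator outside the filled Julia set\<close>

fun iter_poly :: "complex poly \<Rightarrow> nat \<Rightarrow> complex poly" where
  "iter_poly f 0 = [:0, 1:]"
| "iter_poly f (Suc n) = f \<circ>\<^sub>p iter_poly f n"

lemma poly_iter_poly: "poly (iter_poly f n) = poly f ^^ n"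
  by (induction n) (auto simp: poly_pcompose fun_eq_iff)

lemma poly_pderiv_iter_poly: "poly (pderiv (iter_poly f n)) z = iter_deriv f n z"
  using DERIV_unique[OF poly_DERIV[of "iter_poly f n" z]] DERIV_iterate[of n f z]
  by (simp add: poly_iter_poly)

lemma degree_iter_poly: "degree (iter_poly f n) = degree f ^ n"
  by (induction n) (auto simp: degree_pcompose)

locale escaping_poly =
  fixes f :: "complex poly" and R :: real
  assumes deg: "2 \<le> degree f" and R1: "1 \<le> R"
    and esc: "\<And>z. R \<le> norm z \<Longrightarrow> 2 * norm z \<le> norm (poly f z)"
begin

definition filled :: "complex set" where
  "filled = {z. \<forall>n. norm ((poly f ^^ n) z) \<le> R}"

lemma filled_norm_le: "z \<in> filled \<Longrightarrow> norm z \<le> R"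
  unfolding filled_def by (metis (mono_tags, lifting) funpow_0 mem_Collect_eq)

lemma filled_iterate: "z \<in> filled \<Longrightarrow> (poly f ^^ n) z \<in> filled"
  by (auto simp: filled_def funpow_add[symmetric, THEN fun_cong, simplified])

lemma iterate_growth:
  assumes "R \<le> norm z"
  shows "2 ^ n * norm z \<le> norm ((poly f ^^ n) z)"
proof (induction n)
  case (Suc n)
  have "1 * norm z \<le> 2 ^ n * norm z" by (intro mult_right_mono) auto
  then have "R \<le> norm ((poly f ^^ n) z)" using Suc assms by linarith
  from esc[OF this] Suc show ?case by simp
qed simp

text \<open>An orbit that leaves the disc of radius \<open>R\<close> at least doubles its modulus in
  every later step. Hence the fixed bound \<open>R\<close> in \<open>filled\<close> captures all
  bounded orbits.\<close>

lemma bounded_orbit_in_filled: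
  assumes "\<And>n. norm ((poly f ^^ n) z) \<le> B"
  shows "z \<in> filled"
proof (rule ccontr)
  assume "z \<notin> filled"
  then obtain m where m: "norm ((poly f ^^ m) z) > R" by (auto simp: filled_def not_le)
  have "2 ^ n \<le> B" for n
  proof -
    have "2 ^ n * 1 \<le> 2 ^ n * norm ((poly f ^^ m) z)" using m R1 by (intro mult_left_mono) auto
    also have "\<dots> \<le> norm ((poly f ^^ n) ((poly f ^^ m) z))" using m by (intro iterate_growth) auto
    also have "\<dots> = norm ((poly f ^^ (n + m)) z)" by (simp add: funpow_add)
    also have "\<dots> \<le> B" by (rule assms)
    finally show ?thesis by simp
  qed
  moreover obtain n where "B < 2 ^ n" using real_arch_pow[of 2 B] by auto
  ultimately show False by (metis not_le)
qed

lemma filled_step_iff: "poly f z \<in> filled \<longleftrightarrow> z \<in> filled"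
proof
  assume fz: "poly f z \<in> filled"
  show "z \<in> filled"
  proof (rule bounded_orbit_in_filled)
    fix n
    show "norm ((poly f ^^ n) z) \<le> max (norm z) R"
    proof (cases n)
      case (Suc m)
      have "(poly f ^^ n) z = (poly f ^^ m) (poly f z)" by (simp only: Suc funpow_Suc_right o_apply)
      then have "norm ((poly f ^^ n) z) \<le> R" using fz by (simp add: filled_def)
      then show ?thesis by simp
    qed simp
  qed
next
  assume "z \<in> filled" then show "poly f z \<in> filled" using filled_iterate[of z 1] by simp
qed

lemma filled_iterate_iff: "(poly f ^^ n) z \<in> filled \<longleftrightarrow> z \<in> filled"
  by (induction n) (auto simp: filled_step_iff)

lemma continuous_on_iterate: "continuous_on S (poly f ^^ n)"
  unfolding poly_iter_poly[symmetric] by (intro continuous_intros)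

lemma compact_filled: "compact filled"
proof -
  have "filled = (\<Inter>n. (poly f ^^ n) -` cball 0 R)" by (auto simp: filled_def)
  moreover have "closed ((poly f ^^ n) -` cball 0 R)" for n
    using continuous_on_iterate[of UNIV n] by (intro continuous_closed_vimage) (auto simp: continuous_on_eq_continuous_at)
  ultimately have "closed filled" by auto
  moreover have "bounded filled" using filled_norm_le by (auto simp: bounded_iff)
  ultimately show ?thesis by (simp add: compact_eq_bounded_closed)
qed

text \<open>A bounded component of the complement would have its frontier in \<open>filled\<close>,
  and the maximum principle applied to all iterates would put the component itself into
  \<open>filled\<close>. Outside a bounded set there is only one unbounded component.\<close>

lemma connected_compl_filled: "connected (- filled)"
proof -
  have cl: "closed filled" using compact_filled by (rule compact_imp_closed)
  have unb: "\<not> bounded U" if U: "U \<in> components (- filled)" for U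
  proof
    assume bd: "bounded U"
    have fr: "frontier U \<subseteq> filled" by (rule frontier_of_components_closed_complement[OF cl U])
    have "z \<in> filled" if z: "z \<in> U" for z
      unfolding filled_def mem_Collect_eq
    proof
      fix n
      show "norm ((poly f ^^ n) z) \<le> R"
      proof (rule maximum_modulus_frontier[OF _ _ bd _ z])
        show "(poly f ^^ n) holomorphic_on interior U"
          unfolding poly_iter_poly[symmetric] by (rule holomorphic_poly)
        show "norm ((poly f ^^ n) w) \<le> R" if "w \<in> frontier U" for w
          using fr that by (auto simp: filled_def)
      qed (rule continuous_on_iterate)
    qed
    moreover obtain z where "z \<in> U" using in_components_nonempty[OF U] by blast
    ultimately show False using in_components_subset[OF U] by blast
  qed
  have "U = V" if "U \<in> components (- filled)" "V \<in> components (- filled)" for U V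
    using cobounded_unique_unbounded_components[of "- filled" V U] that unb
      compact_imp_bounded[OF compact_filled] by simp
  then have eq: "connected_component_set (- filled) x = connected_component_set (- filled) y"
    if "x \<in> - filled" "y \<in> - filled" for x y
    using that by (auto simp: components_def)
  show ?thesis
    unfolding connected_iff_connected_component
  proof (intro ballI)
    fix x y assume xy: "x \<in> - filled" "y \<in> - filled"
    then have "y \<in> connected_component_set (- filled) y" by simp
    then have "y \<in> connected_component_set (- filled) x" unfolding eq[OF xy] .
    then show "connected_component (- filled) x y" by simp
  qed
qed

text \<open>At an interior point the iterates are bounded by \<open>R\<close> on a fixed disc, and
  Cauchy's estimate bounds all their derivatives there; so growing derivatives place the point on
  the boundary.\<close>

lemma escaping_closure_compl:
  assumes b: "b \<in> filled" and lim: "filterlim (\<lambda>n. norm (iter_deriv f n b)) at_top sequentially"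
  shows "b \<in> closure (- filled)"
proof (rule ccontr)
  assume "b \<notin> closure (- filled)"
  then have "b \<in> interior filled" by (simp add: closure_complement)
  then obtain e where e: "e > 0" "cball b e \<subseteq> filled"
    using mem_interior_cball by blast
  have "norm (iter_deriv f n b) \<le> R / e" for n
  proof -
    have "norm ((deriv ^^ 1) (poly f ^^ n) b) \<le> fact 1 * R / e ^ 1"
    proof (rule Cauchy_inequality[OF _ _ e(1)])
      show "(poly f ^^ n) holomorphic_on ball b e"
        unfolding poly_iter_poly[symmetric] by (rule holomorphic_poly)
      show "norm ((poly f ^^ n) x) \<le> R" if "norm (b - x) = e" for x
      proof -
        have "x \<in> filled" using e(2) that by (auto simp: dist_norm)
        then show ?thesis by (simp add: filled_def)
      qed
    qed (rule continuous_on_iterate)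
    then show ?thesis by (simp add: deriv_iterate)
  qed
  moreover obtain n where "norm (iter_deriv f n b) > R / e"
    using lim unfolding filterlim_at_top_dense by (meson eventually_happens trivial_limit_sequentially)
  ultimately show False by (metis not_le)
qed

end

section \<open>Area estimate for the inverse branches of all iterates\<close>

lemma content_complex_ball: "0 \<le> r \<Longrightarrow> measure lborel (ball (c::complex) r) = pi * r\<^sup>2"
  by (simp add: content_ball unit_ball_vol_2)

context escaping_poly
begin

lemma iter_deriv_nonzero_outside:
  assumes crit: "\<And>c. poly (pderiv f) c = 0 \<Longrightarrow> c \<in> filled" and w: "w \<notin> filled"
  shows "iter_deriv f n w \<noteq> 0"
proof
  assume "iter_deriv f n w = 0"
  then obtain i where "poly (pderiv f) ((poly f ^^ i) w) = 0" by (auto simp: iter_deriv_def)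
  then have "(poly f ^^ i) w \<in> filled" by (rule crit)
  then show False using w by (simp add: filled_iterate_iff)
qed

lemma finite_iterate_fibre: "finite {w. (poly f ^^ n) w = z}"
  unfolding poly_iter_poly[symmetric] using deg by (intro finite_roots) (simp add: degree_iter_poly)

text \<open>The discs that Bloch's theorem gives inside the images of \<open>\<surd>(g - b)\<close>, with \<open>g\<close> ranging over
  the inverse branches of all iterates on one disc, are disjoint and lie in a bounded region.
  The squares of their radii are the terms of the sum, up to a constant.\<close>

lemma transfer_sum_bounded:
  assumes crit: "\<And>c. poly (pderiv f) c = 0 \<Longrightarrow> c \<in> filled"
    and z: "2 * R \<le> norm z" and b: "b \<in> filled"
  shows "(\<Sum>n<N. \<Sum>w | (poly f ^^ n) w = z. 1 / ((norm (iter_deriv f n w))\<^sup>2 * norm (w - b))) \<le> 13824 / norm z"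
proof -
  \<comment> \<open>With r = |z|/3 the disc \<open>D\<close> lies in the annulus 2r < |y| < 4r,
    outside radius \<open>R\<close>. The outer radius is only twice the inner one, so a point whose
    modulus at least doubles leaves the annulus; this will separate branches of different
    iterates.\<close>
  define r where "r = norm z / 3"
  define D where "D = ball z r"
  have r: "r > 0" using z R1 by (auto simp: r_def)
  have Dn: "R < norm y" "2 * r < norm y" "norm y < 4 * r" if "y \<in> D" for y
  proof -
    have "norm (z - y) < r" using that by (simp add: D_def dist_norm)
    then have "norm z - r < norm y" "norm y < norm z + r"
      using norm_triangle_ineq2[of z y] norm_triangle_ineq2[of y z] by (auto simp: norm_minus_commute)
    then show "R < norm y" "2 * r < norm y" "norm y < 4 * r" using z R1 by (auto simp: r_def)
  qed
  have notin: "y \<notin> filled" if "y \<in> D" for y using Dn(1)[OF that] filled_norm_le[of y] by linarith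
  have zD: "z \<in> D" using r by (simp add: D_def)
  have deep: "norm w < 4 * r \<and> w \<notin> filled" if "(poly f ^^ n) w \<in> D" for n w
  proof
    show "w \<notin> filled" using notin[OF that] by (simp add: filled_iterate_iff)
    show "norm w < 4 * r"
    proof (rule ccontr)
      assume "\<not> norm w < 4 * r"
      then have w4: "4 * r \<le> norm w" by simp
      have "R \<le> norm w" using w4 Dn(1,3)[OF zD] by linarith
      then have "2 ^ n * norm w \<le> norm ((poly f ^^ n) w)" by (rule iterate_growth)
      moreover have "1 * norm w \<le> 2 ^ n * norm w" by (intro mult_right_mono) auto
      ultimately show False using Dn(3)[OF that] w4 by linarith
    qed
  qed
  define I where "I = Sigma {..<N} (\<lambda>n. {w. (poly f ^^ n) w = z})"
  have finI: "finite I" unfolding I_def using finite_iterate_fibre by auto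
  define X where "X i = 1 / ((norm (iter_deriv f (fst i) (snd i)))\<^sup>2 * norm (snd i - b))" for i
  \<comment> \<open>The branch g avoids \<open>filled\<close>, so g - b has a square root s on the
    disc. Since s' = g'/(2s), the square of |s'(z)| is 1/(4 |(f^n)'(w)|^2 |w - b|): the root turns
    the weight of the kernel into a density of area.\<close>
  have "\<exists>s. s holomorphic_on D \<and> (\<forall>y\<in>D. (poly f ^^ fst i) ((s y)\<^sup>2 + b) = y) \<and>
      (norm (deriv s z))\<^sup>2 = X i / 4 \<and> (s z)\<^sup>2 + b = snd i" if "i \<in> I" for i
  proof -
    obtain n w where i: "i = (n, w)" by (cases i)
    have w: "(poly f ^^ n) w = z" using that by (simp add: I_def i)
    have nc: "poly (pderiv (iter_poly f n)) u \<noteq> 0" if "poly (iter_poly f n) u \<in> ball z r" for u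
      using iter_deriv_nonzero_outside[OF crit] deep[of n u] that
      by (simp add: poly_pderiv_iter_poly poly_iter_poly D_def)
    have dg: "degree (iter_poly f n) > 0" using deg by (simp add: degree_iter_poly)
    obtain g where g: "g holomorphic_on D" "g z = w" "\<And>y. y \<in> D \<Longrightarrow> (poly f ^^ n) (g y) = y"
      "deriv g z = 1 / iter_deriv f n w"
    proof (rule inverse_branch[OF dg r nc])
      show "poly (iter_poly f n) w = z" using w by (simp add: poly_iter_poly)
    qed (use that in \<open>simp_all add: D_def poly_iter_poly poly_pderiv_iter_poly\<close>)
    have gb: "g y - b \<noteq> 0" if "y \<in> D" for y
      using deep[of n "g y"] g(3)[OF that] that b by auto
    obtain s where s: "s holomorphic_on D" "\<And>y. y \<in> D \<Longrightarrow> g y - b = (s y)\<^sup>2"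
    proof (rule contractible_imp_holomorphic_sqrt[of "\<lambda>y. g y - b" D])
      show "(\<lambda>y. g y - b) holomorphic_on D" by (intro holomorphic_intros g)
      show "contractible D" unfolding D_def by (rule convex_imp_contractible[OF convex_ball])
    qed (use gb that in auto)
    have "(s has_field_derivative deriv s z) (at z)"
      using s(1) zD unfolding D_def by (intro holomorphic_derivI) auto
    then have "((\<lambda>y. (s y)\<^sup>2 + b) has_field_derivative 2 * s z * deriv s z) (at z)"
      by (auto intro!: derivative_eq_intros)
    then have "(g has_field_derivative 2 * s z * deriv s z) (at z)"
    proof (rule has_field_derivative_transform_within_open[where S=D])
      show "open D" by (simp add: D_def)
      show "\<And>y. y \<in> D \<Longrightarrow> (s y)\<^sup>2 + b = g y" using s(2) by (metis diff_add_cancel)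
    qed (rule zD)
    then have d: "2 * s z * deriv s z = 1 / iter_deriv f n w" using g(4) DERIV_imp_deriv by metis
    have sz: "(s z)\<^sup>2 = w - b" using s(2)[OF zD] g(2) by simp
    have "(2 * s z * deriv s z)\<^sup>2 = 4 * (s z)\<^sup>2 * (deriv s z)\<^sup>2" by (simp add: power_mult_distrib)
    then have "4 * (w - b) * (deriv s z)\<^sup>2 = (1 / iter_deriv f n w)\<^sup>2" using d sz by simp
    then have "norm (4 * (w - b) * (deriv s z)\<^sup>2) = norm ((1 / iter_deriv f n w)\<^sup>2)" by simp
    then have nn: "4 * norm (w - b) * (norm (deriv s z))\<^sup>2 = 1 / (norm (iter_deriv f n w))\<^sup>2"
      unfolding norm_mult norm_power norm_divide power_divide by simp
    have "norm (w - b) > 0" using gb[OF zD] g(2) by simp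
    then have "(norm (deriv s z))\<^sup>2 = (1 / (norm (iter_deriv f n w))\<^sup>2) / (4 * norm (w - b))"
      unfolding nn[symmetric] by simp
    then have "(norm (deriv s z))\<^sup>2 = X i / 4" by (simp add: X_def i)
    moreover have "(poly f ^^ fst i) ((s y)\<^sup>2 + b) = y" if "y \<in> D" for y
      using g(3)[OF that] s(2)[OF that] by (simp add: i algebra_simps)
    ultimately show ?thesis using s(1) sz by (intro exI[of _ s]) (auto simp: i)
  qed
  then obtain s where s: "\<And>i. i \<in> I \<Longrightarrow> s i holomorphic_on D"
    "\<And>i y. i \<in> I \<Longrightarrow> y \<in> D \<Longrightarrow> (poly f ^^ fst i) ((s i y)\<^sup>2 + b) = y"
    "\<And>i. i \<in> I \<Longrightarrow> (norm (deriv (s i) z))\<^sup>2 = X i / 4" "\<And>i. i \<in> I \<Longrightarrow> (s i z)\<^sup>2 + b = snd i"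
    by metis
  \<comment> \<open>The 12 is the constant of Bloch's theorem; squared and multiplied by the 4 that
    the square root brings in, it gives the 576 below.\<close>
  define \<rho> where "\<rho> i = r * norm (deriv (s i) z) / 12" for i
  have "\<exists>\<beta>. ball \<beta> (\<rho> i) \<subseteq> s i ` D" if "i \<in> I" for i
    using Bloch[of "s i" z r "\<rho> i"] s(1)[OF that] r unfolding D_def \<rho>_def by blast
  then obtain \<beta> where \<beta>: "\<And>i. i \<in> I \<Longrightarrow> ball (\<beta> i) (\<rho> i) \<subseteq> s i ` D" by metis
  have disj: "s i ` D \<inter> s k ` D = {}" if i: "i \<in> I" and k: "k \<in> I" and ik: "i \<noteq> k" for i k
  proof (rule ccontr)
    assume "s i ` D \<inter> s k ` D \<noteq> {}"
    then obtain x y where xy: "x \<in> D" "y \<in> D" "s i x = s k y" by blast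
    define u where "u = (s i x)\<^sup>2 + b"
    have ui: "(poly f ^^ fst i) u = x" using s(2)[OF i xy(1)] by (simp add: u_def)
    have uk: "(poly f ^^ fst k) u = y" using s(2)[OF k xy(2)] xy(3) by (simp add: u_def)
    \<comment> \<open>A point reached by branches of two different iterates would visit
      \<open>D\<close> twice, and between the visits its modulus at least doubles, which the annulus
      forbids.\<close>
    have not_later: False if "n < m" "(poly f ^^ n) u \<in> D" "(poly f ^^ m) u \<in> D" for n m
    proof -
      let ?v = "(poly f ^^ n) u"
      have "(poly f ^^ m) u = (poly f ^^ (m - n)) ?v"
        using that(1) by (metis (no_types, lifting) add.commute comp_apply funpow_add le_add_diff_inverse less_imp_le)
      moreover have "2 ^ (m - n) * norm ?v \<le> norm ((poly f ^^ (m - n)) ?v)"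
        using Dn(1)[OF that(2)] by (intro iterate_growth) auto
      moreover have "2 ^ 1 \<le> (2::real) ^ (m - n)" using that(1) by (intro power_increasing) auto
      then have "2 * norm ?v \<le> 2 ^ (m - n) * norm ?v" by (intro mult_right_mono) auto
      ultimately have "2 * norm ?v \<le> norm ((poly f ^^ m) u)" by simp
      then show False using Dn(2)[OF that(2)] Dn(3)[OF that(3)] by linarith
    qed
    have eqn: "fst i = fst k"
      using not_later[of "fst i" "fst k"] not_later[of "fst k" "fst i"] ui uk xy by (metis linorder_neqE_nat)
    \<comment> \<open>For one and the same iterate the two branches meet and therefore agree at the
      centre, so they start from the same preimage of \<open>z\<close>.\<close>
    have "(s i z)\<^sup>2 + b = (s k z)\<^sup>2 + b"
    proof (rule inverse_branches_disjoint[of "iter_poly f (fst i)" z r "\<lambda>y. (s i y)\<^sup>2 + b" "\<lambda>y. (s k y)\<^sup>2 + b" x y])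
      show "poly (pderiv (iter_poly f (fst i))) u \<noteq> 0" if "poly (iter_poly f (fst i)) u \<in> ball z r" for u
        using iter_deriv_nonzero_outside[OF crit] deep[of "fst i" u] that
        by (simp add: poly_pderiv_iter_poly poly_iter_poly D_def)
      show "continuous_on (ball z r) (\<lambda>y. (s i y)\<^sup>2 + b)" "continuous_on (ball z r) (\<lambda>y. (s k y)\<^sup>2 + b)"
        using s(1)[OF i] s(1)[OF k] unfolding D_def
        by (auto intro!: holomorphic_on_imp_continuous_on holomorphic_intros)
      show "poly (iter_poly f (fst i)) ((s i y)\<^sup>2 + b) = y" if "y \<in> ball z r" for y
        using s(2)[OF i] that by (simp add: poly_iter_poly D_def)
      show "poly (iter_poly f (fst i)) ((s k y)\<^sup>2 + b) = y" if "y \<in> ball z r" for y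
        using s(2)[OF k] that eqn by (simp add: poly_iter_poly D_def)
    qed (use xy deg in \<open>auto simp: degree_iter_poly D_def\<close>)
    then have "snd i = snd k" using s(4)[OF i] s(4)[OF k] by simp
    then show False using eqn ik by (simp add: prod_eq_iff)
  qed
  \<comment> \<open>The preimages of \<open>D\<close> under the iterates stay in the disc of radius
    4r, and \<open>b\<close> lies there too; hence |s|^2 is at most 8r.\<close>
  have inside: "ball (\<beta> i) (\<rho> i) \<subseteq> cball 0 (sqrt (8 * r))" if i: "i \<in> I" for i
  proof
    fix x assume "x \<in> ball (\<beta> i) (\<rho> i)"
    then obtain y where y: "y \<in> D" "x = s i y" using \<beta>[OF i] by blast
    have "(poly f ^^ fst i) (x\<^sup>2 + b) \<in> D" using s(2)[OF i y(1)] y by simp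
    then have "norm (x\<^sup>2 + b) < 4 * r" using deep by blast
    moreover have "norm b < 4 * r" using filled_norm_le[OF b] Dn(1,3)[OF zD] by linarith
    ultimately have "norm (x\<^sup>2) \<le> 8 * r" using norm_triangle_ineq4[of "x\<^sup>2 + b" b] by simp
    then have "(norm x)\<^sup>2 \<le> 8 * r" by (simp add: norm_power)
    then show "x \<in> cball 0 (sqrt (8 * r))" by (simp add: real_le_rsqrt)
  qed
  have \<rho>0: "\<rho> i \<ge> 0" for i using r by (simp add: \<rho>_def)
  have "(\<Sum>i\<in>I. pi * (\<rho> i)\<^sup>2) = (\<Sum>i\<in>I. measure lborel (ball (\<beta> i) (\<rho> i)))"
    using content_complex_ball[OF \<rho>0] by (intro sum.cong) simp_all
  also have "\<dots> = measure lborel (\<Union>i\<in>I. ball (\<beta> i) (\<rho> i))"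
  proof (rule measure_UNION'[symmetric, OF finI])
    show "pairwise (\<lambda>i j. disjnt (ball (\<beta> i) (\<rho> i)) (ball (\<beta> j) (\<rho> j))) I"
    proof (rule pairwiseI)
      fix i k assume "i \<in> I" "k \<in> I" "i \<noteq> k"
      then show "disjnt (ball (\<beta> i) (\<rho> i)) (ball (\<beta> k) (\<rho> k))"
        using disj[of i k] \<beta>[of i] \<beta>[of k] unfolding disjnt_def by blast
    qed
  qed (intro fmeasurableI emeasure_lborel_ball_finite, simp)
  also have "\<dots> \<le> measure lborel (cball (0::complex) (sqrt (8 * r)))"
  proof (rule measure_mono_fmeasurable)
    show "cball (0::complex) (sqrt (8 * r)) \<in> fmeasurable lborel"
      by (intro fmeasurableI emeasure_lborel_cball_finite) simp
  qed (use inside finI in \<open>auto intro!: borel_open\<close>)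
  also have "\<dots> = pi * (sqrt (8 * r))\<^sup>2"
    using content_complex_ball[of "sqrt (8 * r)" 0] r by (simp add: content_cball_conv_ball)
  also have "\<dots> = pi * (8 * r)" using r by simp
  \<comment> \<open>Dividing by r^2/576 and inserting r = |z|/3 produces the constant 13824 = 3 * 8
    * 576.\<close>
  finally have "(\<Sum>i\<in>I. (\<rho> i)\<^sup>2) \<le> 8 * r" by (simp add: sum_distrib_left[symmetric])
  moreover have "(\<rho> i)\<^sup>2 = r\<^sup>2 / 576 * X i" if "i \<in> I" for i
    using s(3)[OF that] by (simp add: \<rho>_def power_mult_distrib power_divide)
  ultimately have "r\<^sup>2 / 576 * (\<Sum>i\<in>I. X i) \<le> 8 * r" by (simp add: sum_distrib_left)
  then have "(\<Sum>i\<in>I. X i) \<le> 8 * r * 576 / r\<^sup>2" using r by (simp add: field_simps)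
  also have "\<dots> = 4608 / r" using r by (simp add: power2_eq_square)
  also have "\<dots> = 13824 / norm z" by (simp add: r_def)
  finally have "(\<Sum>i\<in>I. X i) \<le> 13824 / norm z" .
  moreover have "(\<Sum>n<N. \<Sum>w | (poly f ^^ n) w = z. 1 / ((norm (iter_deriv f n w))\<^sup>2 * norm (w - b))) = (\<Sum>i\<in>I. X i)"
    unfolding I_def X_def using finite_iterate_fibre by (subst sum.Sigma) (auto intro!: sum.cong)
  ultimately show ?thesis by simp
qed

text \<open>The area bound covers all iterates at once, so the terms form a convergent series. The
  bound on a single term does not depend on \<open>b\<close>, as dominated convergence over the
  atoms requires.\<close>

lemma transfer_sum_tendsto:
  assumes crit: "\<And>c. poly (pderiv f) c = 0 \<Longrightarrow> c \<in> filled"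
    and z: "2 * R \<le> norm z" and b: "b \<in> filled"
  defines "S \<equiv> \<lambda>n. \<Sum>w | (poly f ^^ n) w = z. 1 / ((norm (iter_deriv f n w))\<^sup>2 * norm (w - b))"
  shows "S n \<le> 13824 / norm z" and "S \<longlonglongrightarrow> 0"
proof -
  have S0: "S n \<ge> 0" for n unfolding S_def by (intro sum_nonneg) auto
  have bd: "(\<Sum>n<N. S n) \<le> 13824 / norm z" for N
    unfolding S_def by (rule transfer_sum_bounded[OF crit z b])
  have "S n \<le> (\<Sum>n<Suc n. S n)" using S0 by (simp add: sum_nonneg)
  then show "S n \<le> 13824 / norm z" using bd[of "Suc n"] by linarith
  have "summable S"
    by (rule bounded_imp_summable[where B="13824 / norm z"]) (use S0 bd[of "Suc _"] in \<open>auto simp: lessThan_Suc_atMost\<close>)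
  then show "S \<longlonglongrightarrow> 0" by (rule summable_LIMSEQ_zero)
qed

end

section \<open>Residue sums for the Cauchy kernel\<close>

lemma sum_inverse_root_products:
  fixes A :: "'a::field set"
  assumes fin: "finite A" and card: "2 \<le> card A"
  shows "(\<Sum>a\<in>A. 1 / (\<Prod>b\<in>A - {a}. a - b)) = 0"
proof -
  define e where "e a = (\<Prod>b\<in>A - {a}. a - b)" for a
  have e0: "e a \<noteq> 0" for a using fin by (simp add: e_def)
  \<comment> \<open>\<open>Q\<close> is the Lagrange interpolation polynomial of the constant 1 on
    \<open>A\<close>, hence equal to 1. Its coefficient in degree \<open>card A - 1\<close> is the
    sum in question, and it vanishes because \<open>card A\<close> is at least 2.\<close>
  define Q where "Q = (\<Sum>a\<in>A. smult (1 / e a) (\<Prod>b\<in>A - {a}. [:-b, 1:]))"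
  have degp: "degree (\<Prod>b\<in>A - {a}. [:-b, 1:]) = card A - 1" if "a \<in> A" for a
    using degree_prod_sum_eq[of "A - {a}" "\<lambda>b. [:-b, 1:]"] fin that by simp
  have pv: "poly (\<Prod>b\<in>A - {a}. [:-b, 1:]) x = (if x = a then e a else 0)" if "a \<in> A" "x \<in> A" for a x
    using that fin by (auto simp: poly_prod e_def intro!: prod.cong)
  have "poly Q x = 1" if "x \<in> A" for x
  proof -
    have "poly Q x = (\<Sum>a\<in>A. (1 / e a) * (if x = a then e a else 0))"
      unfolding Q_def poly_sum poly_smult using that by (intro sum.cong) (auto simp: pv)
    also have "\<dots> = (\<Sum>a\<in>A. if x = a then 1 else 0)" using e0 by (intro sum.cong) auto
    finally show ?thesis using that fin by simp
  qed
  then have "A \<subseteq> {x. poly (Q - 1) x = 0}" by auto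
  moreover have dQ: "degree Q \<le> card A - 1"
    unfolding Q_def using degp by (intro degree_sum_le fin) (auto intro: order_trans[OF degree_smult_le])
  then have "degree (Q - 1) \<le> card A - 1" by (intro degree_diff_le) auto
  ultimately have "Q - 1 = 0"
    using card_poly_roots_bound[of "Q - 1"] poly_roots_finite[of "Q - 1"] card_mono[of "{x. poly (Q - 1) x = 0}" A] card
    by (cases "Q - 1 = 0") auto
  then have "Q = 1" by simp
  then have "coeff Q (card A - 1) = 0" using card by (simp add: coeff_eq_0)
  moreover have "coeff Q (card A - 1) = (\<Sum>a\<in>A. 1 / e a)"
  proof -
    have "coeff (\<Prod>b\<in>A - {a}. [:-b, 1:]) (card A - 1) = 1" if "a \<in> A" for a
      using lead_coeff_prod[of "\<lambda>b. [:-b, 1:]" "A - {a}"] degp[OF that] by simp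
    then show ?thesis unfolding Q_def coeff_sum coeff_smult by (intro sum.cong) auto
  qed
  ultimately show ?thesis by (simp add: e_def)
qed

text \<open>The left-hand side is the sum of the residues of \<open>1 / P\<close>.\<close>

lemma sum_inverse_pderiv_roots:
  fixes P :: "complex poly"
  assumes "2 \<le> degree P" and sf: "\<And>w. poly P w = 0 \<Longrightarrow> poly (pderiv P) w \<noteq> 0"
  shows "(\<Sum>w | poly P w = 0. 1 / poly (pderiv P) w) = 0"
proof -
  let ?A = "{w. poly P w = 0}"
  have P0: "P \<noteq> 0" using assms(1) by auto
  have fin: "finite ?A" by (rule poly_roots_finite[OF P0])
  have card: "card ?A = degree P" using card_roots_eq_degree[of P 0] assms by auto
  have "rsquarefree P" unfolding rsquarefree_roots using sf by auto
  then have dec: "P = smult (lead_coeff P) (\<Prod>z\<in>?A. [:-z, 1:])"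
    by (rule complex_poly_decompose_rsquarefree[symmetric])
  have pd: "poly (pderiv P) w = lead_coeff P * (\<Prod>b\<in>?A - {w}. w - b)" if w: "w \<in> ?A" for w
  proof -
    define Q where "Q = (\<Prod>z\<in>?A - {w}. [:-z, 1:])"
    have "(\<Prod>z\<in>?A. [:-z, 1:]) = [:-w, 1:] * Q"
      unfolding Q_def by (rule prod.remove[OF fin w])
    then have "P = smult (lead_coeff P) ([:-w, 1:] * Q)" using dec by simp
    then have "pderiv P = smult (lead_coeff P) (pderiv ([:-w, 1:] * Q))" by (metis pderiv_smult)
    then have "poly (pderiv P) w = lead_coeff P * poly Q w"
      by (simp add: pderiv_mult pderiv_pCons del: mult_pCons_left)
    then show ?thesis by (simp add: Q_def poly_prod)
  qed
  have "(\<Sum>w\<in>?A. 1 / poly (pderiv P) w) = (\<Sum>w\<in>?A. 1 / lead_coeff P * (1 / (\<Prod>b\<in>?A - {w}. w - b)))"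
    using pd by (intro sum.cong) auto
  also have "\<dots> = 0"
    unfolding sum_distrib_left[symmetric] using sum_inverse_root_products[OF fin] card assms(1) by simp
  finally show ?thesis .
qed

text \<open>The residues of 1/((f - z) f' (w - a)) add up to zero. The poles are the preimages of
  \<open>z\<close>, the critical points and \<open>a\<close>, all simple under the hypotheses. As
  functions of \<open>z\<close>, the terms on the right are a kernel with pole f(a) and kernels with
  poles at the critical values.\<close>

lemma transfer_cauchy_kernel:
  fixes f :: "complex poly"
  assumes deg: "2 \<le> degree f"
    and simple: "\<And>c. poly (pderiv f) c = 0 \<Longrightarrow> poly (pderiv (pderiv f)) c \<noteq> 0"
    and z: "\<And>c. poly (pderiv f) c = 0 \<Longrightarrow> poly f c \<noteq> z"
    and a: "poly (pderiv f) a \<noteq> 0" "poly f a \<noteq> z"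
  shows "(\<Sum>w | poly f w = z. 1 / ((poly (pderiv f) w)\<^sup>2 * (w - a)))
    = 1 / (poly (pderiv f) a * (z - poly f a))
      + (\<Sum>c | poly (pderiv f) c = 0. 1 / (poly (pderiv (pderiv f)) c * (c - a) * (z - poly f c)))"
proof -
  define P where "P = (f - [:z:]) * (pderiv f * [:-a, 1:])"
  let ?W = "{w. poly f w = z}" and ?C = "{c. poly (pderiv f) c = 0}"
  have f0: "f - [:z:] \<noteq> 0" using deg by auto
  have df: "degree (f - [:z:]) = degree f"
  proof -
    have "f - [:z:] = f + [:-z:]" by simp
    then show ?thesis using degree_add_const[of f "-z"] deg by (metis less_le_trans zero_less_numeral)
  qed
  have pf0: "pderiv f \<noteq> 0" using deg by (simp add: pderiv_eq_0_iff)
  have P0: "P \<noteq> 0" using f0 pf0 by (simp add: P_def del: mult_pCons_right)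
  have "degree P = degree f + (degree (pderiv f) + 1)"
    unfolding P_def using f0 pf0 df by (subst degree_mult_eq, simp, simp del: mult_pCons_right)+ simp
  then have dP: "2 \<le> degree P" using deg by linarith
  have pP: "poly P w = (poly f w - z) * (poly (pderiv f) w * (w - a))" for w
    by (simp add: P_def algebra_simps)
  have pdP: "poly (pderiv P) w = (poly f w - z) * (poly (pderiv (pderiv f)) w * (w - a) + poly (pderiv f) w)
      + poly (pderiv f) w * (poly (pderiv f) w * (w - a))" for w
    by (simp add: P_def pderiv_mult pderiv_diff pderiv_pCons algebra_simps del: mult_pCons_right)
  have dW: "poly (pderiv P) w = (poly (pderiv f) w)\<^sup>2 * (w - a)" if "poly f w = z" for w
    using that by (simp add: pdP power2_eq_square)
  have dC: "poly (pderiv P) c = - (poly (pderiv (pderiv f)) c * (c - a) * (z - poly f c))"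
    if "poly (pderiv f) c = 0" for c using that by (simp add: pdP algebra_simps)
  have da: "poly (pderiv P) a = - (poly (pderiv f) a * (z - poly f a))" by (simp add: pdP algebra_simps)
  have roots: "{w. poly P w = 0} = insert a (?W \<union> ?C)" by (auto simp: pP)
  have finW: "finite ?W" using finite_roots[of f z] deg by simp
  have finC: "finite ?C" by (rule poly_roots_finite[OF pf0])
  have dis: "a \<notin> ?W \<union> ?C" "?W \<inter> ?C = {}" using a z by auto
  have "poly (pderiv P) w \<noteq> 0" if "poly P w = 0" for w
  proof -
    have "poly f w = z \<or> poly (pderiv f) w = 0 \<or> w = a" using that by (simp add: pP)
    then consider "w = a" | "poly f w = z" "w \<noteq> a" | "poly (pderiv f) w = 0" "w \<noteq> a"
      by blast
    then show ?thesis
    proof cases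
      case 2 then show ?thesis using dW z by auto
    next
      case 3 then show ?thesis using dC z[of w] simple[of w] by auto
    qed (use da a in auto)
  qed
  from sum_inverse_pderiv_roots[OF dP this]
  have "0 = (\<Sum>w\<in>insert a (?W \<union> ?C). 1 / poly (pderiv P) w)" by (simp add: roots)
  also have "\<dots> = 1 / poly (pderiv P) a + ((\<Sum>w\<in>?W. 1 / poly (pderiv P) w) + (\<Sum>w\<in>?C. 1 / poly (pderiv P) w))"
    using dis finW finC by (subst sum.insert) (auto simp: sum.union_disjoint)
  also have "(\<Sum>w\<in>?W. 1 / poly (pderiv P) w) = (\<Sum>w\<in>?W. 1 / ((poly (pderiv f) w)\<^sup>2 * (w - a)))"
    by (intro sum.cong) (auto simp: dW)
  also have "(\<Sum>w\<in>?C. 1 / poly (pderiv P) w)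
      = - (\<Sum>c\<in>?C. 1 / (poly (pderiv (pderiv f)) c * (c - a) * (z - poly f c)))"
    unfolding sum_negf[symmetric] by (intro sum.cong) (auto simp: dC)
  also have "1 / poly (pderiv P) a = - (1 / (poly (pderiv f) a * (z - poly f a)))"
    unfolding da by (rule minus_divide_right[symmetric])
  finally have "0 = - (1 / (poly (pderiv f) a * (z - poly f a))) +
      ((\<Sum>w\<in>?W. 1 / ((poly (pderiv f) w)\<^sup>2 * (w - a)))
        + - (\<Sum>c\<in>?C. 1 / (poly (pderiv (pderiv f)) c * (c - a) * (z - poly f c))))" .
  moreover have "S = A + T" if "0 = - A + (S + - T)" for A S T :: complex
    using that by (simp add: algebra_simps)
  ultimately show ?thesis by blast
qed

section \<open>The measure on the critical orbits and its Cauchy transform\<close>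

text \<open>The measure \<open>\<Sum>\<^sub>j \<beta>\<^sub>j \<Sum>\<^sub>n \<delta>(f\<^sup>n(v\<^sub>j)) / (f\<^sup>n)'(v\<^sub>j)\<close>, whose Cauchy transform is fixed by
  the transfer operator \<open>H \<mapsto> \<Sum>\<^sub>w H(w) / f'(w)\<^sup>2\<close>, the sum being over the preimages, thanks to the
  relation \<open>rel\<close>.\<close>

locale invariant_measure = escaping_poly +
  fixes p :: nat and c \<beta> :: "nat \<Rightarrow> complex"
  assumes bij: "bij_betw c {..<p} {z. poly (pderiv f) z = 0}"
    and simple: "\<And>j. j < p \<Longrightarrow> poly (pderiv (pderiv f)) (c j) \<noteq> 0"
    and bounded: "\<And>j. j < p \<Longrightarrow> poly f (c j) \<in> filled"
    and nonzero: "\<And>n j. j < p \<Longrightarrow> iter_deriv f n (poly f (c j)) \<noteq> 0"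
    and summ: "\<And>j. j < p \<Longrightarrow> summable (\<lambda>n. 1 / norm (iter_deriv f n (poly f (c j))))"
    and rel: "\<And>k. k < p \<Longrightarrow> \<beta> k * poly (pderiv (pderiv f)) (c k) =
      (\<Sum>n. \<Sum>j<p. \<beta> j / iter_deriv f n (poly f (c j)) * (1 / (c k - (poly f ^^ n) (poly f (c j)))))"
begin

definition x :: "nat \<Rightarrow> nat \<Rightarrow> complex" where "x n j = (poly f ^^ n) (poly f (c j))"
definition a :: "nat \<Rightarrow> nat \<Rightarrow> complex" where "a n j = \<beta> j / iter_deriv f n (poly f (c j))"
definition H :: "complex \<Rightarrow> complex" where "H z = (\<Sum>n. \<Sum>j<p. a n j * (1 / (z - x n j)))"

lemma x_filled: "j < p \<Longrightarrow> x n j \<in> filled"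
  unfolding x_def by (intro filled_iterate bounded)

lemma a_summable: "summable (\<lambda>n. \<Sum>j<p. norm (a n j))"
proof (rule summable_sum)
  fix j assume "j \<in> {..<p}"
  then have "summable (\<lambda>n. norm (\<beta> j) * (1 / norm (iter_deriv f n (poly f (c j)))))"
    by (intro summable_mult summ) simp
  then show "summable (\<lambda>n. norm (a n j))" by (simp add: a_def norm_divide)
qed

lemma x_Suc: "x (Suc n) j = poly f (x n j)"
  by (simp add: x_def)

lemma f'_x_nonzero: "j < p \<Longrightarrow> poly (pderiv f) (x n j) \<noteq> 0"
  using nonzero[of j "Suc n"] by (simp add: iter_deriv_Suc x_def)

lemma a_Suc: "a (Suc n) j = a n j / poly (pderiv f) (x n j)"
  by (simp add: a_def iter_deriv_Suc x_def)

lemma crit_index: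
  assumes "poly (pderiv f) z = 0"
  obtains j where "j < p" "z = c j"
proof -
  have "z \<in> c ` {..<p}" using bij assms by (auto simp: bij_betw_def)
  then show ?thesis using that by blast
qed

lemma crit_filled: "poly (pderiv f) z = 0 \<Longrightarrow> z \<in> filled"
  using bounded filled_step_iff by (metis crit_index)

lemma H_kernel_bounded:
  assumes "z \<notin> filled"
  obtains B where "\<And>n j. j < p \<Longrightarrow> norm (1 / (z - x n j)) \<le> B"
proof -
  obtain e where e: "e > 0" "\<forall>w\<in>filled. e \<le> dist z w"
    using separate_point_closed[OF compact_imp_closed[OF compact_filled] assms] by blast
  show ?thesis
  proof (rule that[of "1 / e"])
    fix n j assume "j < p"
    then have "e \<le> norm (z - x n j)" using e(2) x_filled by (auto simp: dist_norm)
    then show "norm (1 / (z - x n j)) \<le> 1 / e"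
      using e(1) by (simp add: norm_divide frac_le)
  qed
qed

lemma H_summable: "z \<notin> filled \<Longrightarrow> summable (\<lambda>n. \<Sum>j<p. a n j * (1 / (z - x n j)))"
proof -
  assume "z \<notin> filled"
  then obtain B where "\<And>n j. j < p \<Longrightarrow> norm (1 / (z - x n j)) \<le> B" using H_kernel_bounded by blast
  from summable_sum_mult_bounded(1)[OF a_summable this] show ?thesis .
qed

lemma sum_crit: "(\<Sum>z | poly (pderiv f) z = 0. g z) = (\<Sum>k<p. g (c k))"
  by (rule sum.reindex_bij_betw[OF bij, symmetric])

text \<open>The kernel \<open>1 / (c\<^sub>k - \<cdot>)\<close> is unbounded on the orbits, but \<open>f'(x) / (x - c\<^sub>k)\<close> is bounded and
  \<open>a n j / f'(x n j) = a (n + 1) j\<close>.\<close>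

lemma crit_kernel_summable:
  assumes k: "k < p"
  shows "summable (\<lambda>n. \<Sum>j<p. norm (a n j * (1 / (c k - x n j))))"
proof -
  have "poly (pderiv f) (c k) = 0" using bij k by (auto simp: bij_betw_def)
  then obtain g where g: "pderiv f = [:- c k, 1:] * g" by (auto simp: poly_eq_0_iff_dvd dvd_def)
  obtain B where B: "B > 0" "\<And>w. w \<in> filled \<Longrightarrow> norm (poly g w) \<le> B"
    using poly_approx_bounded[OF compact_filled poly_approx_poly] by blast
  have eq: "a n j * (1 / (c k - x n j)) = - (a (Suc n) j * poly g (x n j))" if j: "j < p" for n j
  proof -
    have nz: "poly (pderiv f) (x n j) \<noteq> 0" by (rule f'_x_nonzero[OF j])
    have e: "poly (pderiv f) (x n j) = (x n j - c k) * poly g (x n j)" by (simp add: g algebra_simps)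
    then have nz': "x n j - c k \<noteq> 0" "poly g (x n j) \<noteq> 0" using nz by auto
    have "a (Suc n) j * poly g (x n j) = a n j / (x n j - c k)"
      unfolding a_Suc e using nz' by simp
    then show ?thesis using minus_divide_right[of "a n j" "x n j - c k"] by simp
  qed
  have s: "summable (\<lambda>n. B * (\<Sum>j<p. norm (a (Suc n) j)))"
    using a_summable by (intro summable_mult) (subst summable_Suc_iff)
  show ?thesis
  proof (rule summable_comparison_test'[OF s])
    fix n :: nat
    have "(\<Sum>j<p. norm (a n j * (1 / (c k - x n j)))) \<le> (\<Sum>j<p. norm (a (Suc n) j) * B)"
    proof (rule sum_mono)
      fix j assume "j \<in> {..<p}"
      then have j: "j < p" by simp
      show "norm (a n j * (1 / (c k - x n j))) \<le> norm (a (Suc n) j) * B"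
        unfolding eq[OF j] norm_minus_cancel norm_mult
        using B(2)[OF x_filled[OF j]] by (intro mult_left_mono) auto
    qed
    then show "norm (\<Sum>j<p. norm (a n j * (1 / (c k - x n j)))) \<le> B * (\<Sum>j<p. norm (a (Suc n) j))"
      by (simp add: sum_nonneg sum_distrib_left mult.commute)
  qed
qed

lemma summable_sum_norm_cancel:
  fixes g :: "nat \<Rightarrow> nat \<Rightarrow> complex"
  assumes "summable (\<lambda>n. \<Sum>j<p. norm (g n j))"
  shows "summable (\<lambda>n. \<Sum>j<p. g n j)"
  by (rule summable_comparison_test'[OF assms norm_sum])

text \<open>Summed over the atoms, the kernel identity moves each atom one step along its orbit and
  gives it the weight of the next row, so it yields \<open>H\<close> without row 0. By
  \<open>rel\<close>, the terms at the critical points add up to row 0, whose atoms are the critical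
  values.\<close>

lemma H_fixed:
  assumes z: "z \<notin> filled"
  shows "H z = (\<Sum>w | poly f w = z. H w / (poly (pderiv f) w)\<^sup>2)"
proof -
  let ?W = "{w. poly f w = z}"
  have finW: "finite ?W" using finite_roots[of f z] deg by simp
  have W: "w \<notin> filled" if "w \<in> ?W" for w using z that filled_step_iff[of w] by auto
  let ?f'' = "\<lambda>k. poly (pderiv (pderiv f)) (c k)"
  have simple': "poly (pderiv (pderiv f)) u \<noteq> 0" if "poly (pderiv f) u = 0" for u
    using simple crit_index[OF that] by metis
  have crit_z: "poly f u \<noteq> z" if "poly (pderiv f) u = 0" for u
    using crit_filled[OF that] z filled_step_iff[of u] by auto
  have kernel: "(\<Sum>w\<in>?W. 1 / ((poly (pderiv f) w)\<^sup>2 * (w - x n j)))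
      = 1 / (poly (pderiv f) (x n j) * (z - x (Suc n) j))
        + (\<Sum>k<p. 1 / (?f'' k * (c k - x n j) * (z - poly f (c k))))" if j: "j < p" for n j
  proof -
    have "poly f (x n j) \<noteq> z" using x_filled[OF j, of "Suc n"] z by (auto simp: x_Suc)
    from transfer_cauchy_kernel[OF deg simple' crit_z f'_x_nonzero[OF j] this]
    show ?thesis unfolding sum_crit x_Suc .
  qed
  define h where "h k = 1 / (?f'' k * (z - poly f (c k)))" for k
  have tsum: "(\<Sum>w\<in>?W. (\<Sum>j<p. a n j * (1 / (w - x n j))) * (1 / (poly (pderiv f) w)\<^sup>2))
      = (\<Sum>j<p. a (Suc n) j * (1 / (z - x (Suc n) j)))
        + (\<Sum>k<p. h k * (\<Sum>j<p. a n j * (1 / (c k - x n j))))" for n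
  proof -
    have "(\<Sum>w\<in>?W. (\<Sum>j<p. a n j * (1 / (w - x n j))) * (1 / (poly (pderiv f) w)\<^sup>2))
        = (\<Sum>j<p. \<Sum>w\<in>?W. a n j * (1 / ((poly (pderiv f) w)\<^sup>2 * (w - x n j))))"
      unfolding sum_distrib_right by (subst sum.swap) (simp add: mult.commute)
    also have "\<dots> = (\<Sum>j<p. a n j * (1 / (poly (pderiv f) (x n j) * (z - x (Suc n) j))
        + (\<Sum>k<p. 1 / (?f'' k * (c k - x n j) * (z - poly f (c k))))))"
      unfolding sum_distrib_left[symmetric] using kernel by (intro sum.cong) auto
    also have "\<dots> = (\<Sum>j<p. a (Suc n) j * (1 / (z - x (Suc n) j)))
        + (\<Sum>j<p. \<Sum>k<p. h k * (a n j * (1 / (c k - x n j))))"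
      unfolding distrib_left sum.distrib sum_distrib_left
      by (intro arg_cong2[of _ _ _ _ "(+)"] sum.cong) (auto simp: a_Suc h_def)
    also have "(\<Sum>j<p. \<Sum>k<p. h k * (a n j * (1 / (c k - x n j))))
        = (\<Sum>k<p. h k * (\<Sum>j<p. a n j * (1 / (c k - x n j))))"
      unfolding sum_distrib_left by (rule sum.swap)
    finally show ?thesis .
  qed
  have s1: "summable (\<lambda>n. \<Sum>j<p. a (Suc n) j * (1 / (z - x (Suc n) j)))"
    using H_summable[OF z] by (subst summable_Suc_iff)
  have s2: "summable (\<lambda>n. \<Sum>j<p. a n j * (1 / (c k - x n j)))" if "k < p" for k
    by (rule summable_sum_norm_cancel[OF crit_kernel_summable[OF that]])
  have s3: "summable (\<lambda>n. h k * (\<Sum>j<p. a n j * (1 / (c k - x n j))))" if "k \<in> {..<p}" for k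
    using that by (intro summable_mult s2) simp
  have "(\<Sum>w\<in>?W. H w / (poly (pderiv f) w)\<^sup>2)
      = (\<Sum>w\<in>?W. \<Sum>n. (\<Sum>j<p. a n j * (1 / (w - x n j))) * (1 / (poly (pderiv f) w)\<^sup>2))"
  proof (rule sum.cong[OF refl])
    fix w assume "w \<in> ?W"
    from suminf_mult2[OF H_summable[OF W[OF this]], of "1 / (poly (pderiv f) w)\<^sup>2"]
    show "H w / (poly (pderiv f) w)\<^sup>2 = (\<Sum>n. (\<Sum>j<p. a n j * (1 / (w - x n j))) * (1 / (poly (pderiv f) w)\<^sup>2))"
      unfolding H_def by simp
  qed
  also have "\<dots> = (\<Sum>n. \<Sum>w\<in>?W. (\<Sum>j<p. a n j * (1 / (w - x n j))) * (1 / (poly (pderiv f) w)\<^sup>2))"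
    using W by (intro suminf_sum[symmetric] summable_mult2 H_summable) auto
  also have "\<dots> = (\<Sum>n. \<Sum>j<p. a (Suc n) j * (1 / (z - x (Suc n) j)))
      + (\<Sum>n. \<Sum>k<p. h k * (\<Sum>j<p. a n j * (1 / (c k - x n j))))"
    unfolding tsum by (rule suminf_add[OF s1 summable_sum[OF s3], symmetric])
  also have "(\<Sum>n. \<Sum>k<p. h k * (\<Sum>j<p. a n j * (1 / (c k - x n j))))
      = (\<Sum>k<p. \<Sum>n. h k * (\<Sum>j<p. a n j * (1 / (c k - x n j))))"
    by (rule suminf_sum[OF s3])
  also have "\<dots> = (\<Sum>k<p. h k * (\<beta> k * ?f'' k))"
  proof (rule sum.cong[OF refl])
    fix k assume "k \<in> {..<p}"
    then have k: "k < p" by simp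
    have "(\<Sum>n. \<Sum>j<p. a n j * (1 / (c k - x n j))) = \<beta> k * ?f'' k"
      using rel[OF k] by (simp add: a_def x_def)
    then show "(\<Sum>n. h k * (\<Sum>j<p. a n j * (1 / (c k - x n j)))) = h k * (\<beta> k * ?f'' k)"
      using suminf_mult[OF s2[OF k], of "h k"] by simp
  qed
  also have "\<dots> = (\<Sum>j<p. a 0 j * (1 / (z - x 0 j)))"
  proof (rule sum.cong[OF refl])
    fix k assume "k \<in> {..<p}"
    then have "?f'' k \<noteq> 0" using simple by simp
    then show "h k * (\<beta> k * ?f'' k) = a 0 k * (1 / (z - x 0 k))"
      by (simp add: h_def a_def x_def)
  qed
  also have "(\<Sum>n. \<Sum>j<p. a (Suc n) j * (1 / (z - x (Suc n) j)))
      = H z - (\<Sum>j<p. a 0 j * (1 / (z - x 0 j)))"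
    unfolding H_def by (rule suminf_split_head[OF H_summable[OF z]])
  finally show ?thesis by simp
qed

lemma H_fixed_iterate:
  assumes "z \<notin> filled"
  shows "H z = (\<Sum>w | (poly f ^^ n) w = z. H w / (iter_deriv f n w)\<^sup>2)"
  using assms
proof (induction n arbitrary: z)
  case (Suc n)
  let ?W = "{w. poly f w = z}"
  have finW: "finite ?W" using finite_roots[of f z] deg by simp
  have W: "w \<notin> filled" if "w \<in> ?W" for w using Suc.prems that filled_step_iff[of w] by auto
  have "H z = (\<Sum>y\<in>?W. H y / (poly (pderiv f) y)\<^sup>2)" by (rule H_fixed[OF Suc.prems])
  also have "\<dots> = (\<Sum>y\<in>?W. \<Sum>w | (poly f ^^ n) w = y. H w / (iter_deriv f (Suc n) w)\<^sup>2)"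
  proof (rule sum.cong[OF refl])
    fix y assume y: "y \<in> ?W"
    show "H y / (poly (pderiv f) y)\<^sup>2 = (\<Sum>w | (poly f ^^ n) w = y. H w / (iter_deriv f (Suc n) w)\<^sup>2)"
      unfolding Suc.IH[OF W[OF y]] sum_divide_distrib
      by (intro sum.cong) (auto simp: iter_deriv_Suc power_mult_distrib mult.commute)
  qed
  also have "\<dots> = (\<Sum>w\<in>(\<Union>y\<in>?W. {w. (poly f ^^ n) w = y}). H w / (iter_deriv f (Suc n) w)\<^sup>2)"
    using finW finite_iterate_fibre by (intro sum.UNION_disjoint[symmetric]) auto
  also have "(\<Union>y\<in>?W. {w. (poly f ^^ n) w = y}) = {w. (poly f ^^ Suc n) w = z}" by auto
  finally show ?case .
qed simp

text \<open>For every \<open>l\<close>, \<open>H z\<close> is the integral of \<open>t l\<close>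
  against the measure, where \<open>t l\<close> is the image of the Cauchy kernel under the
  \<open>l\<close>-th power of the transfer operator. On \<open>filled\<close> these functions are
  uniformly bounded and tend to zero.\<close>

lemma H_vanishes_far:
  assumes z: "2 * R \<le> norm z"
  shows "H z = 0"
proof -
  have zf: "z \<notin> filled" using filled_norm_le[of z] z R1 by auto
  define t where "t l b = (\<Sum>w | (poly f ^^ l) w = z. 1 / ((iter_deriv f l w)\<^sup>2 * (w - b)))" for l b
  have W: "w \<notin> filled" if "(poly f ^^ l) w = z" for w l
    using zf that filled_iterate_iff[of l w] by auto
  have eq: "H z = (\<Sum>n. \<Sum>j<p. a n j * t l (x n j))" for l
  proof -
    let ?W = "{w. (poly f ^^ l) w = z}"
    have "H z = (\<Sum>w\<in>?W. H w / (iter_deriv f l w)\<^sup>2)" by (rule H_fixed_iterate[OF zf])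
    also have "\<dots> = (\<Sum>w\<in>?W. \<Sum>n. (\<Sum>j<p. a n j * (1 / (w - x n j))) * (1 / (iter_deriv f l w)\<^sup>2))"
    proof (rule sum.cong[OF refl])
      fix w assume "w \<in> ?W"
      then have "w \<notin> filled" using W by auto
      from suminf_mult2[OF H_summable[OF this], of "1 / (iter_deriv f l w)\<^sup>2"]
      show "H w / (iter_deriv f l w)\<^sup>2 = (\<Sum>n. (\<Sum>j<p. a n j * (1 / (w - x n j))) * (1 / (iter_deriv f l w)\<^sup>2))"
        unfolding H_def by simp
    qed
    also have "\<dots> = (\<Sum>n. \<Sum>w\<in>?W. (\<Sum>j<p. a n j * (1 / (w - x n j))) * (1 / (iter_deriv f l w)\<^sup>2))"
      using W by (intro suminf_sum[symmetric] summable_mult2 H_summable) auto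
    also have "\<dots> = (\<Sum>n. \<Sum>j<p. a n j * t l (x n j))"
      unfolding t_def sum_distrib_left sum_distrib_right
      by (subst sum.swap) (simp add: mult.commute)
    finally show ?thesis .
  qed
  define S where "S l b = (\<Sum>w | (poly f ^^ l) w = z. 1 / ((norm (iter_deriv f l w))\<^sup>2 * norm (w - b)))" for l b
  have tS: "norm (t l b) \<le> S l b" for l b
    unfolding t_def S_def by (rule order_trans[OF norm_sum]) (simp add: norm_divide norm_mult norm_power)
  have "(\<lambda>l. \<Sum>n. \<Sum>j<p. a n j * t l (x n j)) \<longlonglongrightarrow> (\<Sum>n. \<Sum>j<p. a n j * 0)"
  proof (rule tendsto_suminf_dominated[OF a_summable])
    fix l n j assume j: "j < p"
    show "norm (t l (x n j)) \<le> 13824 / norm z"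
      using tS[of l "x n j"] transfer_sum_tendsto(1)[OF crit_filled z x_filled[OF j], of l n] unfolding S_def by linarith
  next
    fix n j assume j: "j < p"
    have "(\<lambda>l. S l (x n j)) \<longlonglongrightarrow> 0"
      using transfer_sum_tendsto(2)[OF crit_filled z x_filled[OF j], of n] unfolding S_def .
    then show "(\<lambda>l. t l (x n j)) \<longlonglongrightarrow> 0"
      by (rule Lim_null_comparison[rotated]) (use tS in auto)
  qed
  then show ?thesis using eq by (simp add: LIMSEQ_const_iff)
qed

text \<open>The moments are the Laurent coefficients of \<open>H\<close> at infinity. Instead of an
  expansion the recursion z G_m(z) = M_m + G_{m+1}(z) is used: if G_m vanishes far out, then G_{m+1}
  is the constant - M_m there, and it also tends to zero at infinity.\<close>

lemma moments_vanish: "(\<Sum>n. \<Sum>j<p. a n j * x n j ^ m) = 0"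
proof -
  define M where "M m = (\<Sum>n. \<Sum>j<p. a n j * x n j ^ m)" for m
  define G where "G m z = (\<Sum>n. \<Sum>j<p. a n j * (x n j ^ m / (z - x n j)))" for m z
  have xR: "norm (x n j) \<le> R" if "j < p" for n j using x_filled[OF that] by (rule filled_norm_le)
  have near: "norm (z - x n j) \<ge> norm z / 2" if "2 * R \<le> norm z" "j < p" for z n j
    using norm_triangle_ineq2[of z "x n j"] xR[OF that(2), of n] that(1) by linarith
  have kb: "norm (x n j ^ m / (z - x n j)) \<le> R ^ m * 2 / norm z" if "2 * R \<le> norm z" "j < p" for z n j m
  proof -
    have "norm (x n j ^ m / (z - x n j)) \<le> R ^ m / (norm z / 2)"
      unfolding norm_divide norm_power using that xR near R1 by (intro frac_le power_mono) auto
    then show ?thesis by simp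
  qed
  have sG: "summable (\<lambda>n. \<Sum>j<p. a n j * (x n j ^ m / (z - x n j)))" if "2 * R \<le> norm z" for m z
    by (rule summable_sum_mult_bounded[OF a_summable]) (rule kb[OF that])
  have sM: "summable (\<lambda>n. \<Sum>j<p. a n j * x n j ^ m)" for m
    by (rule summable_sum_mult_bounded[OF a_summable, where B="R ^ m"]) (auto simp: norm_power intro!: power_mono xR)
  have Glim: "(\<lambda>l. G m (of_real (2 * R * real (Suc l)))) \<longlonglongrightarrow> 0" for m
  proof -
    define C where "C = R ^ m * 2 * (\<Sum>n. \<Sum>j<p. norm (a n j))"
    have le: "norm (G m (of_real (2 * R * real (Suc l)))) \<le> C / (2 * R) * (1 / real (Suc l))" for l
    proof -
      let ?z = "complex_of_real (2 * R * real (Suc l))"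
      have nz: "norm ?z = 2 * R * real (Suc l)" unfolding norm_of_real using R1 by simp
      have "2 * R * 1 \<le> 2 * R * real (Suc l)" using R1 by (intro mult_left_mono) auto
      then have far: "2 * R \<le> norm ?z" unfolding nz by simp
      have "norm (G m ?z) \<le> R ^ m * 2 / norm ?z * (\<Sum>n. \<Sum>j<p. norm (a n j))"
        unfolding G_def by (rule summable_sum_mult_bounded[OF a_summable]) (rule kb[OF far])
      then show ?thesis unfolding nz C_def by simp
    qed
    have "(\<lambda>l. C / (2 * R) * (1 / real (Suc l))) \<longlonglongrightarrow> C / (2 * R) * 0"
      by (rule tendsto_mult_left[OF LIMSEQ_Suc[OF lim_1_over_n]])
    then have "(\<lambda>l. C / (2 * R) * (1 / real (Suc l))) \<longlonglongrightarrow> 0" by simp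
    from Lim_null_comparison[OF always_eventually[OF allI[OF le]] this] show ?thesis .
  qed
  have rec: "z * G m z = M m + G (Suc m) z" if "2 * R \<le> norm z" for m z
  proof -
    have "z * G m z = (\<Sum>n. z * (\<Sum>j<p. a n j * (x n j ^ m / (z - x n j))))"
      unfolding G_def by (rule suminf_mult[OF sG[OF that], symmetric])
    also have "\<dots> = (\<Sum>n. (\<Sum>j<p. a n j * x n j ^ m) + (\<Sum>j<p. a n j * (x n j ^ Suc m / (z - x n j))))"
    proof (rule suminf_cong)
      fix n
      have "z * (a n j * (x n j ^ m / (z - x n j))) = a n j * x n j ^ m + a n j * (x n j ^ Suc m / (z - x n j))"
        if j: "j < p" for j
      proof -
        have "z - x n j \<noteq> 0" using near[OF \<open>2 * R \<le> norm z\<close> j, of n] \<open>2 * R \<le> norm z\<close> R1 by auto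
        then show ?thesis by (simp add: field_simps)
      qed
      then show "z * (\<Sum>j<p. a n j * (x n j ^ m / (z - x n j)))
          = (\<Sum>j<p. a n j * x n j ^ m) + (\<Sum>j<p. a n j * (x n j ^ Suc m / (z - x n j)))"
        unfolding sum_distrib_left sum.distrib[symmetric] by (intro sum.cong) auto
    qed
    also have "\<dots> = M m + G (Suc m) z"
      unfolding M_def G_def by (rule suminf_add[OF sM sG[OF that], symmetric])
    finally show ?thesis .
  qed
  have G0: "\<forall>z. 2 * R \<le> norm z \<longrightarrow> G m z = 0" for m
  proof (induction m)
    case 0
    show ?case using H_vanishes_far by (simp add: G_def H_def)
  next
    case (Suc m)
    have e: "G (Suc m) z = - M m" if "2 * R \<le> norm z" for z
      using rec[OF that, of m] Suc that by (simp add: eq_neg_iff_add_eq_0 add.commute)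
    have "G (Suc m) (of_real (2 * R * real (Suc l))) = - M m" for l
    proof (rule e)
      have "2 * R * 1 \<le> 2 * R * real (Suc l)" using R1 by (intro mult_left_mono) auto
      then show "2 * R \<le> norm (complex_of_real (2 * R * real (Suc l)))" unfolding norm_of_real by simp
    qed
    then have "- M m = 0" using Glim[of "Suc m"] by (simp add: LIMSEQ_const_iff)
    then show ?case using e by simp
  qed
  have far: "2 * R \<le> norm (complex_of_real (2 * R))" unfolding norm_of_real using R1 by simp
  have "M m = 0" using rec[OF far, of m] G0[of m] G0[of "Suc m"] far by simp
  then show ?thesis by (simp add: M_def)
qed

text \<open>Summability makes the derivatives along the critical orbit tend to infinity, and by the
  chain rule also those along its tail starting at \<open>x n j\<close>.\<close>

lemma orbit_in_closure:
  assumes j: "j < p"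
  shows "x n j \<in> closure (- filled)"
proof (rule escaping_closure_compl[OF x_filled[OF j]])
  let ?v = "poly f (c j)"
  have "(\<lambda>m. 1 / norm (iter_deriv f (m + n) ?v)) \<longlonglongrightarrow> 0"
    using summable_LIMSEQ_zero[OF summ[OF j]] by (rule LIMSEQ_ignore_initial_segment)
  then have "(\<lambda>m. norm (iter_deriv f n ?v) * (1 / norm (iter_deriv f (m + n) ?v))) \<longlonglongrightarrow> norm (iter_deriv f n ?v) * 0"
    by (intro tendsto_intros)
  moreover have "norm (iter_deriv f n ?v) * (1 / norm (iter_deriv f (m + n) ?v)) = inverse (norm (iter_deriv f m (x n j)))" for m
    using nonzero[OF j, of n] by (simp add: iter_deriv_add x_def norm_mult inverse_eq_divide)
  ultimately have "(\<lambda>m. inverse (norm (iter_deriv f m (x n j)))) \<longlonglongrightarrow> 0" by simp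
  moreover have "norm (iter_deriv f m (x n j)) > 0" for m
    using nonzero[OF j, of "m + n"] by (auto simp: iter_deriv_add x_def)
  ultimately show "filterlim (\<lambda>m. norm (iter_deriv f m (x n j))) at_top sequentially"
    using filterlim_inverse_at_top[of "\<lambda>m. inverse (norm (iter_deriv f m (x n j)))" sequentially] by simp
qed

text \<open>The kernel 1/(c_k - w) has integral \<beta>_k f''(c_k) by \<open>rel\<close>, and
  integral zero because no point carries mass; the second derivative is non-zero at a simple
  critical point.\<close>

theorem weights_vanish:
  assumes k: "k < p"
  shows "\<beta> k = 0"
proof -
  have "(\<Sum>n. \<Sum>j<p. a n j * (1 / (c k - x n j))) = 0"
  proof (rule annihilates_all[OF a_summable, where x=x and \<phi>="\<lambda>w. 1 / (c k - w)"])
    show "summable (\<lambda>n. \<Sum>j<p. norm (a n j * (1 / (c k - x n j))))" by (rule crit_kernel_summable[OF k])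
    fix n' j' assume "j' < p"
    then show "(\<Sum>n. \<Sum>j<p. a n j * (if x n j = x n' j' then 1 else 0)) = 0"
      by (intro annihilates_atoms[OF compact_filled connected_compl_filled x_filled a_summable moments_vanish]
          x_filled orbit_in_closure)
  qed
  then have "\<beta> k * poly (pderiv (pderiv f)) (c k) = 0" using rel[OF k] by (simp add: a_def x_def)
  then show ?thesis using simple[OF k] by simp
qed

end

section \<open>Transversality for simple critical points\<close>

lemma det_mat_eq_0_iff:
  fixes M :: "nat \<Rightarrow> nat \<Rightarrow> 'a::field"
  shows "Determinant.det (Matrix.mat n n (\<lambda>(j, i). M j i)) = 0 \<longleftrightarrow>
    (\<exists>x. (\<exists>i<n. x i \<noteq> 0) \<and> (\<forall>j<n. (\<Sum>i<n. M j i * x i) = 0))"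
proof -
  let ?A = "Matrix.mat n n (\<lambda>(j, i). M j i)"
  have A: "?A \<in> carrier_mat n n" by simp
  have row: "vec_index (?A *\<^sub>v v) j = (\<Sum>i<n. M j i * vec_index v i)" if "v \<in> carrier_vec n" "j < n" for v j
    using that by (simp add: scalar_prod_def lessThan_atLeast0)
  show ?thesis
    unfolding det_0_iff_vec_prod_zero[OF A]
  proof
    assume "\<exists>v. v \<in> carrier_vec n \<and> v \<noteq> 0\<^sub>v n \<and> ?A *\<^sub>v v = 0\<^sub>v n"
    then obtain v where v: "v \<in> carrier_vec n" "v \<noteq> 0\<^sub>v n" "?A *\<^sub>v v = 0\<^sub>v n" by blast
    have "\<exists>i<n. vec_index v i \<noteq> 0"
    proof (rule ccontr)
      assume "\<not> (\<exists>i<n. vec_index v i \<noteq> 0)"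
      then have "v = 0\<^sub>v n" using v(1) by (intro eq_vecI) auto
      then show False using v(2) by simp
    qed
    moreover have "(\<Sum>i<n. M j i * vec_index v i) = 0" if "j < n" for j
      using row[OF v(1) that] v(3) that by simp
    ultimately show "\<exists>x. (\<exists>i<n. x i \<noteq> 0) \<and> (\<forall>j<n. (\<Sum>i<n. M j i * x i) = 0)" by blast
  next
    assume "\<exists>x. (\<exists>i<n. x i \<noteq> 0) \<and> (\<forall>j<n. (\<Sum>i<n. M j i * x i) = 0)"
    then obtain x i where x: "i < n" "x i \<noteq> 0" "\<And>j. j < n \<Longrightarrow> (\<Sum>i<n. M j i * x i) = 0" by blast
    let ?v = "Matrix.vec n x"
    have "?v \<noteq> 0\<^sub>v n"
    proof
      assume "?v = 0\<^sub>v n"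
      then have "vec_index ?v i = vec_index (0\<^sub>v n) i" by simp
      then show False using x(1,2) by simp
    qed
    moreover have "?A *\<^sub>v ?v = 0\<^sub>v n"
    proof (rule eq_vecI)
      fix j assume "j < dim_vec (0\<^sub>v n :: 'a Matrix.vec)"
      then have j: "j < n" by simp
      have "vec_index (?A *\<^sub>v ?v) j = (\<Sum>i<n. M j i * vec_index ?v i)" by (rule row) (use j in auto)
      also have "\<dots> = 0" using x(3)[OF j] by simp
      finally show "vec_index (?A *\<^sub>v ?v) j = vec_index (0\<^sub>v n) j" using j by simp
    qed simp
    ultimately show "\<exists>v. v \<in> carrier_vec n \<and> v \<noteq> 0\<^sub>v n \<and> ?A *\<^sub>v v = 0\<^sub>v n"
      by (intro exI[of _ ?v]) auto
  qed
qed

text \<open>A square matrix is singular together with its transpose. This trades one deformation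
  with vanishing speeds for a linear relation between the critical orbits.\<close>

lemma right_kernel_imp_left_kernel:
  fixes M :: "nat \<Rightarrow> nat \<Rightarrow> 'a::field"
  assumes "\<exists>i<n. x i \<noteq> 0" "\<And>j. j < n \<Longrightarrow> (\<Sum>i<n. M j i * x i) = 0"
  obtains y where "\<exists>j<n. y j \<noteq> 0" "\<And>i. i < n \<Longrightarrow> (\<Sum>j<n. M j i * y j) = 0"
proof -
  have "Determinant.det (Matrix.mat n n (\<lambda>(j, i). M j i)) = 0"
    unfolding det_mat_eq_0_iff using assms by blast
  then have "Determinant.det (transpose_mat (Matrix.mat n n (\<lambda>(j, i). M j i))) = 0"
    by (subst Determinant.det_transpose) auto
  moreover have "transpose_mat (Matrix.mat n n (\<lambda>(j, i). M j i)) = Matrix.mat n n (\<lambda>(j, i). M i j)"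
    by (rule eq_matI) auto
  ultimately have "Determinant.det (Matrix.mat n n (\<lambda>(j, i). M i j)) = 0" by simp
  from this[unfolded det_mat_eq_0_iff[where M="\<lambda>j i. M i j"]] show ?thesis using that by blast
qed

lemma poly_eq_by_degree:
  fixes P Q :: "'a::idom poly"
  assumes "finite A" "\<And>x. x \<in> A \<Longrightarrow> poly P x = poly Q x" "degree P < card A" "degree Q < card A"
  shows "P = Q"
proof (rule ccontr)
  assume "P \<noteq> Q"
  then have nz: "P - Q \<noteq> 0" by simp
  have "card A \<le> card {x. poly (P - Q) x = 0}"
    using assms(2) poly_roots_finite[OF nz] by (intro card_mono) auto
  also have "\<dots> \<le> degree (P - Q)" by (rule card_poly_roots_bound[OF nz])
  also have "\<dots> < card A" using degree_diff_le_max[of P Q] assms(3,4) by linarith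
  finally show False by simp
qed

text \<open>The normalised speed of the critical orbit \<open>j\<close> along a deformation with velocity \<open>u\<close>,
  after the substitution \<open>f\<^sup>m(c\<^sub>j) = f\<^sup>m\<^sup>-\<^sup>1(v\<^sub>j)\<close>.\<close>

definition limit_speed :: "'a::{real_normed_field,banach} poly \<Rightarrow> 'a poly \<Rightarrow> 'a \<Rightarrow> 'a" where
  "limit_speed f u c = poly u c + (\<Sum>n. poly u ((poly f ^^ n) (poly f c)) / iter_deriv f (Suc n) (poly f c))"

text \<open>The matrix \<open>M\<close> maps the values of \<open>u\<close> at the critical points
  to the limit speeds. If all of these vanish for some non-zero \<open>u\<close>, then
  \<open>M\<close> has a left kernel vector \<open>\<beta>\<close>, and the equations for
  \<open>\<beta>\<close> are the relation \<open>rel\<close> of the invariant measure, multiplied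
  out.\<close>

theorem limit_speed_nonzero:
  fixes f u :: "complex poly" and c :: "nat \<Rightarrow> complex"
  assumes d: "2 \<le> degree f" and monic: "lead_coeff f = 1"
    and bij: "bij_betw c {..<p} {z. poly (pderiv f) z = 0}"
    and simple: "\<And>j. j < p \<Longrightarrow> poly (pderiv (pderiv f)) (c j) \<noteq> 0"
    and we: "\<And>j. j < p \<Longrightarrow> weakly_expanding f (c j)"
    and u: "u \<noteq> 0" "degree u \<le> degree f - 2"
  shows "\<exists>j<p. limit_speed f u (c j) \<noteq> 0"
proof (rule ccontr)
  assume "\<not> ?thesis"
  then have zero: "limit_speed f u (c j) = 0" if "j < p" for j using that by blast
  have inj: "inj_on c {..<p}" and im: "c ` {..<p} = {z. poly (pderiv f) z = 0}"
    using bij by (auto simp: bij_betw_def)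
  have crit: "poly (pderiv f) (c k) = 0" if "k < p" for k using im that by auto
  \<comment> \<open>Simple critical points exhaust the roots of f', so there are d - 1 of them, and
    polynomials of degree at most d - 2 are given by their values there.\<close>
  have p: "p = degree f - 1"
  proof -
    have "card {w. poly (pderiv f) w = 0} = degree (pderiv f)" if "degree (pderiv f) > 0"
    proof (rule card_roots_eq_degree[OF _ that])
      fix w assume "poly (pderiv f) w = 0"
      then have "w \<in> c ` {..<p}" using im by simp
      then show "poly (pderiv (pderiv f)) w \<noteq> 0" using simple by auto
    qed
    then show ?thesis using bij_betw_same_card[OF bij] d by (simp add: degree_pderiv)
  qed
  have "\<forall>k\<in>{..<p}. \<exists>g. pderiv f = [:- c k, 1:] * g"
    using crit by (auto simp: poly_eq_0_iff_dvd dvd_def)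
  then obtain g where g: "\<And>k. k < p \<Longrightarrow> pderiv f = [:- c k, 1:] * g k" by (metis lessThan_iff)
  let ?f2 = "\<lambda>k. poly (pderiv (pderiv f)) (c k)"
  have pf0: "pderiv f \<noteq> 0" using d by (simp add: pderiv_eq_0_iff)
  have gk: "poly (g k) (c k) = ?f2 k" if "k < p" for k
    using arg_cong[OF g[OF that], of "\<lambda>q. poly (pderiv q) (c k)"]
    by (simp add: pderiv_mult pderiv_pCons del: mult_pCons_left)
  have gj: "poly (g k) (c j) = 0" if "k < p" "j < p" "j \<noteq> k" for j k
  proof -
    have "(c j - c k) * poly (g k) (c j) = 0"
      using arg_cong[OF g[OF that(1)], of "\<lambda>q. poly q (c j)"] crit[OF that(2)] by (auto simp: algebra_simps)
    moreover have "c j \<noteq> c k" using inj that by (auto simp: inj_on_def)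
    ultimately show ?thesis by simp
  qed
  have dg: "degree (g k) = degree f - 2" if "k < p" for k
  proof -
    have "g k \<noteq> 0" using g[OF that] pf0 by auto
    then have "degree (pderiv f) = 1 + degree (g k)"
      unfolding g[OF that] by (subst degree_mult_eq) auto
    then show ?thesis by (simp add: degree_pderiv)
  qed
  \<comment> \<open>The Lagrange basis at the critical points. Since \<open>g k\<close> is f'(w)/(w
    - c_k), division by f' along an orbit turns \<open>l k\<close> into a Cauchy kernel with pole
    c_k.\<close>
  define l where "l k = smult (1 / ?f2 k) (g k)" for k
  have lkj: "poly (l k) (c j) = (if j = k then 1 else 0)" if "k < p" "j < p" for k j
    using gk[OF that(1)] gj[OF that] simple[OF that(1)] by (auto simp: l_def)
  have ulin: "u = (\<Sum>k<p. smult (poly u (c k)) (l k))"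
  proof (rule poly_eq_by_degree[of "c ` {..<p}"])
    show "poly u z = poly (\<Sum>k<p. smult (poly u (c k)) (l k)) z" if z: "z \<in> c ` {..<p}" for z
    proof -
      obtain j where j: "j < p" "z = c j" using z by blast
      have "poly (\<Sum>k<p. smult (poly u (c k)) (l k)) (c j) = (\<Sum>k<p. poly u (c k) * (if j = k then 1 else 0))"
        unfolding poly_sum using lkj j(1) by (intro sum.cong) auto
      also have "\<dots> = poly u (c j)" using j(1) by (simp add: if_distrib[of "\<lambda>y. _ * y"] cong: if_cong)
      finally show ?thesis using j(2) by simp
    qed
    have "card (c ` {..<p}) = degree f - 1" using inj p by (simp add: card_image)
    moreover have "degree (\<Sum>k<p. smult (poly u (c k)) (l k)) \<le> degree f - 2"
      using dg by (intro degree_sum_le) (auto simp: l_def intro!: order_trans[OF degree_smult_le])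
    ultimately show "degree u < card (c ` {..<p})"
      "degree (\<Sum>k<p. smult (poly u (c k)) (l k)) < card (c ` {..<p})" using u(2) d by linarith+
  qed simp
  define v where "v j = poly f (c j)" for j
  define D where "D n j = iter_deriv f n (v j)" for n j
  define x where "x n j = (poly f ^^ n) (v j)" for n j
  have summ: "summable (\<lambda>n. poly q (x n j) / D (Suc n) j)" if "j < p" for q j
    using summable_norm_cancel[OF summable_along_orbit[OF d monic we[OF that]]] unfolding x_def D_def v_def .
  define M where "M j k = limit_speed f (l k) (c j)" for j k
  have "(\<Sum>k<p. M j k * poly u (c k)) = 0" if j: "j < p" for j
  proof -
    have "limit_speed f u (c j) = (\<Sum>k<p. M j k * poly u (c k))"
    proof -
      have pu: "poly u z = (\<Sum>k<p. poly u (c k) * poly (l k) z)" for z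
      proof -
        have "poly u z = poly (\<Sum>k<p. smult (poly u (c k)) (l k)) z" by (rule arg_cong[OF ulin])
        then show ?thesis by (simp only: poly_sum poly_smult)
      qed
      have "(\<Sum>n. poly u (x n j) / D (Suc n) j) = (\<Sum>n. \<Sum>k<p. poly u (c k) * (poly (l k) (x n j) / D (Suc n) j))"
        unfolding pu[of "x _ j"] by (simp add: sum_divide_distrib)
      also have "\<dots> = (\<Sum>k<p. \<Sum>n. poly u (c k) * (poly (l k) (x n j) / D (Suc n) j))"
        by (rule suminf_sum) (rule summable_mult[OF summ[OF j]])
      also have "\<dots> = (\<Sum>k<p. poly u (c k) * (\<Sum>n. poly (l k) (x n j) / D (Suc n) j))"
        using suminf_mult[OF summ[OF j]] by simp
      finally have "limit_speed f u (c j)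
          = (\<Sum>k<p. poly u (c k) * poly (l k) (c j)) + (\<Sum>k<p. poly u (c k) * (\<Sum>n. poly (l k) (x n j) / D (Suc n) j))"
        unfolding limit_speed_def using pu[of "c j"] by (simp add: x_def D_def v_def)
      then show ?thesis
        unfolding M_def limit_speed_def distrib_right sum.distrib
        by (simp only: mult.commute x_def D_def v_def)
    qed
    then show ?thesis using zero[OF j] by simp
  qed
  moreover have "\<exists>k<p. poly u (c k) \<noteq> 0"
  proof (rule ccontr)
    assume "\<not> (\<exists>k<p. poly u (c k) \<noteq> 0)"
    then have "(\<Sum>k<p. smult (poly u (c k)) (l k)) = 0" by (intro sum.neutral) auto
    then have "u = 0" by (rule trans[OF ulin])
    then show False using u(1) by simp
  qed
  ultimately obtain \<beta> where \<beta>: "\<exists>j<p. \<beta> j \<noteq> 0" "\<And>k. k < p \<Longrightarrow> (\<Sum>j<p. M j k * \<beta> j) = 0"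
    using right_kernel_imp_left_kernel[of p "\<lambda>k. poly u (c k)" M] by blast
  have D0: "D n j \<noteq> 0" if "j < p" for n j
    using weakly_expanding_iter_deriv_nonzero[OF we[OF that]] by (simp add: D_def v_def)
  have lx: "poly (l k) (x n j) / D (Suc n) j = - (1 / ?f2 k) * (1 / D n j * (1 / (c k - x n j)))"
    if k: "k < p" and j: "j < p" for k j n
  proof -
    have nz: "poly (pderiv f) (x n j) \<noteq> 0"
      using D0[OF j, of "Suc n"] by (simp add: D_def iter_deriv_Suc x_def)
    have e: "poly (pderiv f) (x n j) = (x n j - c k) * poly (g k) (x n j)"
      using arg_cong[OF g[OF k], of "\<lambda>q. poly q (x n j)"] by (simp add: algebra_simps)
    have nz': "poly (g k) (x n j) \<noteq> 0" "x n j - c k \<noteq> 0" using nz e by auto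
    have "D (Suc n) j = (x n j - c k) * poly (g k) (x n j) * D n j"
      by (simp add: D_def iter_deriv_Suc x_def[symmetric] e)
    then have "poly (l k) (x n j) / D (Suc n) j = 1 / ?f2 k * (1 / D n j * (1 / (x n j - c k)))"
      using nz' by (simp add: l_def)
    also have "1 / (x n j - c k) = - (1 / (c k - x n j))"
      by (metis minus_diff_eq minus_divide_right)
    finally show ?thesis by simp
  qed
  obtain C where "C \<ge> 1"
    and gr: "\<And>A. \<exists>R\<ge>1. \<forall>z. norm z \<ge> R \<longrightarrow> A * norm z \<le> norm (poly f z) \<and>
        norm (poly (pderiv f) z) * norm z \<le> C * norm (poly f z)"
    using monic_poly_growth[OF d monic] by blast
  obtain R where R: "R \<ge> 1" "\<And>z. norm z \<ge> R \<Longrightarrow> 2 * norm z \<le> norm (poly f z)"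
    using gr[of 2] by blast
  interpret escaping_poly f R by unfold_locales (use d R in auto)
  interpret invariant_measure f R p c \<beta>
  proof
    show "bij_betw c {..<p} {z. poly (pderiv f) z = 0}" by (rule bij)
    show "poly f (c j) \<in> filled" if j: "j < p" for j
    proof -
      obtain B where "\<And>n. norm ((poly f ^^ n) (poly f (c j))) \<le> B"
        using weakly_expanding_bounded_orbit[OF d monic we[OF j]] by blast
      then show ?thesis by (rule bounded_orbit_in_filled)
    qed
    show "iter_deriv f n (poly f (c j)) \<noteq> 0" if "j < p" for n j
      by (rule weakly_expanding_iter_deriv_nonzero[OF we[OF that]])
    show "summable (\<lambda>n. 1 / norm (iter_deriv f n (poly f (c j))))" if "j < p" for j
      by (rule weakly_expanding_summable[OF we[OF that]])
    fix k assume k: "k < p"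
    have s: "summable (\<lambda>n. 1 / D n j * (1 / (c k - x n j)))" if j: "j < p" for j
    proof -
      have "summable (\<lambda>n. - ?f2 k * (poly (l k) (x n j) / D (Suc n) j))"
        by (rule summable_mult[OF summ[OF j]])
      then show ?thesis using simple[OF k] by (simp add: lx[OF k j])
    qed
    have Mjk: "M j k * \<beta> j = (if j = k then \<beta> k else 0) - (1 / ?f2 k) * (\<Sum>n. \<beta> j / D n j * (1 / (c k - x n j)))"
      if j: "j < p" for j
    proof -
      have "M j k = (if j = k then 1 else 0) + (\<Sum>n. - (1 / ?f2 k) * (1 / D n j * (1 / (c k - x n j))))"
        unfolding M_def limit_speed_def lkj[OF k j] lx[OF k j, symmetric] by (simp add: x_def D_def v_def)
      also have "(\<Sum>n. - (1 / ?f2 k) * (1 / D n j * (1 / (c k - x n j))))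
          = - (1 / ?f2 k) * (\<Sum>n. 1 / D n j * (1 / (c k - x n j)))"
        by (rule suminf_mult[OF s[OF j]])
      finally have e: "M j k = (if j = k then 1 else 0) + - (1 / ?f2 k) * (\<Sum>n. 1 / D n j * (1 / (c k - x n j)))" .
      define S where "S = (\<Sum>n. 1 / D n j * (1 / (c k - x n j)))"
      have "M j k * \<beta> j = (if j = k then \<beta> k else 0) - (1 / ?f2 k) * (\<beta> j * S)"
        unfolding e S_def[symmetric] by (simp add: algebra_simps)
      then have "M j k * \<beta> j = (if j = k then \<beta> k else 0) - (1 / ?f2 k) * (\<beta> j * (\<Sum>n. 1 / D n j * (1 / (c k - x n j))))"
        unfolding S_def .
      also have "\<beta> j * (\<Sum>n. 1 / D n j * (1 / (c k - x n j))) = (\<Sum>n. \<beta> j * (1 / D n j * (1 / (c k - x n j))))"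
        by (rule suminf_mult[OF s[OF j], symmetric])
      finally show ?thesis by simp
    qed
    have "0 = (\<Sum>j<p. M j k * \<beta> j)" using \<beta>(2)[OF k] by simp
    also have "\<dots> = (\<Sum>j<p. (if j = k then \<beta> k else 0) - (1 / ?f2 k) * (\<Sum>n. \<beta> j / D n j * (1 / (c k - x n j))))"
      using Mjk by (intro sum.cong) auto
    also have "\<dots> = \<beta> k - (1 / ?f2 k) * (\<Sum>j<p. \<Sum>n. \<beta> j / D n j * (1 / (c k - x n j)))"
      using k by (simp add: sum_subtractf sum_distrib_left)
    also have "(\<Sum>j<p. \<Sum>n. \<beta> j / D n j * (1 / (c k - x n j))) = (\<Sum>n. \<Sum>j<p. \<beta> j / D n j * (1 / (c k - x n j)))"
    proof (rule suminf_sum[symmetric])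
      fix j assume "j \<in> {..<p}"
      then have "summable (\<lambda>n. \<beta> j * (1 / D n j * (1 / (c k - x n j))))" by (intro summable_mult s) simp
      then show "summable (\<lambda>n. \<beta> j / D n j * (1 / (c k - x n j)))" by simp
    qed
    finally have e: "0 = \<beta> k - (1 / ?f2 k) * (\<Sum>n. \<Sum>j<p. \<beta> j / D n j * (1 / (c k - x n j)))" .
    have "b * q = S" if "0 = b - (1 / q) * S" "q \<noteq> 0" for b q S :: complex
      using that by (simp add: field_simps)
    from this[OF e simple[OF k]]
    have "\<beta> k * ?f2 k = (\<Sum>n. \<Sum>j<p. \<beta> j / D n j * (1 / (c k - x n j)))" .
    then show "\<beta> k * poly (pderiv (pderiv f)) (c k) =
      (\<Sum>n. \<Sum>j<p. \<beta> j / iter_deriv f n (poly f (c j)) * (1 / (c k - (poly f ^^ n) (poly f (c j)))))"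
      unfolding x_def D_def v_def .
  qed (use simple in auto)
  show False using \<beta>(1) weights_vanish by blast
qed

section \<open>Strict derivatives and local inversion\<close>

definition near :: "nat \<Rightarrow> (nat \<Rightarrow> 'a::real_normed_vector) \<Rightarrow> real \<Rightarrow> (nat \<Rightarrow> 'a) \<Rightarrow> bool" where
  "near n x0 \<delta> x \<longleftrightarrow> (\<forall>i<n. norm (x i - x0 i) < \<delta>)"

definition sum_dist :: "nat \<Rightarrow> (nat \<Rightarrow> 'a::real_normed_vector) \<Rightarrow> (nat \<Rightarrow> 'a) \<Rightarrow> real" where
  "sum_dist n x y = (\<Sum>i<n. norm (x i - y i))"

text \<open>The number of variables depends on the polynomial, so functions on \<open>{..<n}\<close> replace a Euclidean type here.\<close>

definition has_strict_deriv ::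
    "((nat \<Rightarrow> 'a::real_normed_field) \<Rightarrow> 'a) \<Rightarrow> (nat \<Rightarrow> 'a) \<Rightarrow> nat \<Rightarrow> (nat \<Rightarrow> 'a) \<Rightarrow> bool" where
  "has_strict_deriv \<phi> A n x0 \<longleftrightarrow> (\<forall>\<eta>>0. \<exists>\<delta>>0. \<forall>x y. near n x0 \<delta> x \<and> near n x0 \<delta> y \<longrightarrow>
      norm (\<phi> x - \<phi> y - (\<Sum>i<n. A i * (x i - y i))) \<le> \<eta> * sum_dist n x y)"

lemma has_strict_derivE:
  assumes "has_strict_deriv \<phi> A n x0" "\<eta> > 0"
  obtains \<delta> where "\<delta> > 0" "\<And>x y. near n x0 \<delta> x \<Longrightarrow> near n x0 \<delta> y \<Longrightarrow>
      norm (\<phi> x - \<phi> y - (\<Sum>i<n. A i * (x i - y i))) \<le> \<eta> * sum_dist n x y"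
  using assms unfolding has_strict_deriv_def by blast

lemma sum_dist_nonneg: "0 \<le> sum_dist n x y"
  unfolding sum_dist_def by (intro sum_nonneg) auto

lemma near_mono: "near n x0 \<delta> x \<Longrightarrow> \<delta> \<le> \<delta>' \<Longrightarrow> near n x0 \<delta>' x"
  unfolding near_def by force

lemma near_self: "\<delta> > 0 \<Longrightarrow> near n x0 \<delta> x0"
  by (simp add: near_def)

lemma sum_dist_commute: "sum_dist n x y = sum_dist n y x"
  by (simp add: sum_dist_def norm_minus_commute)

lemma sum_dist_triangle: "sum_dist n x z \<le> sum_dist n x y + sum_dist n y z"
  unfolding sum_dist_def sum.distrib[symmetric]
  by (intro sum_mono) (metis dist_norm dist_triangle)

lemma norm_le_sum_dist: "i < n \<Longrightarrow> norm (x i - y i) \<le> sum_dist n x y"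
  unfolding sum_dist_def by (rule member_le_sum) auto

lemma near_sum_dist: "near n x0 \<delta> x \<Longrightarrow> sum_dist n x x0 \<le> n * \<delta>"
  unfolding sum_dist_def near_def using sum_bounded_above[of "{..<n}" "\<lambda>i. norm (x i - x0 i)" \<delta>]
  by (auto intro: less_imp_le)

lemma norm_linear_le:
  fixes A :: "nat \<Rightarrow> 'a::real_normed_field"
  shows "norm (\<Sum>i<n. A i * (x i - y i)) \<le> (\<Sum>i<n. norm (A i)) * sum_dist n x y"
proof -
  have "norm (\<Sum>i<n. A i * (x i - y i)) \<le> (\<Sum>i<n. norm (A i) * norm (x i - y i))"
    by (rule order_trans[OF norm_sum]) (simp add: norm_mult)
  also have "\<dots> \<le> (\<Sum>i<n. norm (A i) * sum_dist n x y)"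
    using norm_le_sum_dist[of _ n x y] by (intro sum_mono mult_left_mono) auto
  finally show ?thesis by (simp add: sum_distrib_right)
qed

lemma has_strict_deriv_lipschitz:
  assumes "has_strict_deriv \<phi> A n x0"
  obtains \<delta> C where "\<delta> > 0" "C > 0"
    "\<And>x y. near n x0 \<delta> x \<Longrightarrow> near n x0 \<delta> y \<Longrightarrow> norm (\<phi> x - \<phi> y) \<le> C * sum_dist n x y"
proof -
  obtain \<delta> where \<delta>: "\<delta> > 0" "\<And>x y. near n x0 \<delta> x \<Longrightarrow> near n x0 \<delta> y \<Longrightarrow>
      norm (\<phi> x - \<phi> y - (\<Sum>i<n. A i * (x i - y i))) \<le> 1 * sum_dist n x y"
    using has_strict_derivE[OF assms, of 1] by auto
  define C where "C = (\<Sum>i<n. norm (A i)) + 1"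
  show ?thesis
  proof (rule that[of \<delta> C])
    show "C > 0" unfolding C_def by (simp add: sum_nonneg add_nonneg_pos)
    fix x y assume xy: "near n x0 \<delta> x" "near n x0 \<delta> y"
    have "norm (\<phi> x - \<phi> y) \<le> norm (\<phi> x - \<phi> y - (\<Sum>i<n. A i * (x i - y i))) + norm (\<Sum>i<n. A i * (x i - y i))"
      using norm_triangle_ineq[of "\<phi> x - \<phi> y - (\<Sum>i<n. A i * (x i - y i))" "\<Sum>i<n. A i * (x i - y i)"] by simp
    also have "\<dots> \<le> 1 * sum_dist n x y + (\<Sum>i<n. norm (A i)) * sum_dist n x y"
      by (intro add_mono \<delta>(2) xy norm_linear_le)
    finally show "norm (\<phi> x - \<phi> y) \<le> C * sum_dist n x y" by (simp add: C_def algebra_simps)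
  qed (rule \<delta>(1))
qed

lemma has_strict_deriv_continuous:
  assumes "has_strict_deriv \<phi> A n x0" "\<eta> > 0"
  obtains \<delta> where "\<delta> > 0" "\<And>x. near n x0 \<delta> x \<Longrightarrow> norm (\<phi> x - \<phi> x0) < \<eta>"
proof -
  obtain \<delta> C where \<delta>: "\<delta> > 0" "C > 0"
    "\<And>x y. near n x0 \<delta> x \<Longrightarrow> near n x0 \<delta> y \<Longrightarrow> norm (\<phi> x - \<phi> y) \<le> C * sum_dist n x y"
    using has_strict_deriv_lipschitz[OF assms(1)] by metis
  define \<delta>' where "\<delta>' = min \<delta> (\<eta> / (2 * C * (real n + 1)))"
  have \<delta>': "\<delta>' > 0" "\<delta>' \<le> \<delta>" "\<delta>' \<le> \<eta> / (2 * C * (real n + 1))"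
    using \<delta>(1,2) assms(2) by (auto simp: \<delta>'_def)
  show ?thesis
  proof (rule that[OF \<delta>'(1)])
    fix x assume x: "near n x0 \<delta>' x"
    have "norm (\<phi> x - \<phi> x0) \<le> C * sum_dist n x x0"
      by (rule \<delta>(3)[OF near_mono[OF x \<delta>'(2)] near_self[OF \<delta>(1)]])
    also have "\<dots> \<le> C * (n * \<delta>')" using near_sum_dist[OF x] \<delta>(2) by (intro mult_left_mono) auto
    also have "\<dots> \<le> C * ((real n + 1) * (\<eta> / (2 * C * (real n + 1))))"
      using \<delta>' \<delta>(2) by (intro mult_left_mono mult_mono) auto
    also have "\<dots> = \<eta> / 2"
    proof -
      have "C \<noteq> 0" "real n + 1 \<noteq> 0" using \<delta>(2) by auto
      then show ?thesis by simp
    qed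
    also have "\<dots> < \<eta>" using assms(2) by simp
    finally show "norm (\<phi> x - \<phi> x0) < \<eta>" .
  qed
qed

lemma has_strict_deriv_const: "has_strict_deriv (\<lambda>_. k) (\<lambda>_. 0) n x0"
  unfolding has_strict_deriv_def by (auto intro!: exI[of _ 1] simp: sum_dist_nonneg)

lemma has_strict_deriv_coord:
  assumes "j < n"
  shows "has_strict_deriv (\<lambda>x. x j) (\<lambda>i. if i = j then 1 else 0) n x0"
proof -
  have "(\<Sum>i<n. (if i = j then 1 else 0) * (x i - y i)) = x j - y j" for x y :: "nat \<Rightarrow> 'a"
    using assms by (simp add: if_distrib[of "\<lambda>z. z * _"] cong: if_cong)
  then show ?thesis
    unfolding has_strict_deriv_def by (auto intro!: exI[of _ 1] simp: sum_dist_nonneg)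
qed

lemma has_strict_deriv_add:
  assumes "has_strict_deriv \<phi> A n x0" "has_strict_deriv \<psi> B n x0"
  shows "has_strict_deriv (\<lambda>x. \<phi> x + \<psi> x) (\<lambda>i. A i + B i) n x0"
  unfolding has_strict_deriv_def
proof (intro allI impI)
  fix \<eta> :: real assume \<eta>: "\<eta> > 0"
  obtain \<delta>1 where 1: "\<delta>1 > 0" "\<And>x y. near n x0 \<delta>1 x \<Longrightarrow> near n x0 \<delta>1 y \<Longrightarrow>
      norm (\<phi> x - \<phi> y - (\<Sum>i<n. A i * (x i - y i))) \<le> \<eta>/2 * sum_dist n x y"
    using has_strict_derivE[OF assms(1), of "\<eta>/2"] \<eta> by auto
  obtain \<delta>2 where 2: "\<delta>2 > 0" "\<And>x y. near n x0 \<delta>2 x \<Longrightarrow> near n x0 \<delta>2 y \<Longrightarrow>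
      norm (\<psi> x - \<psi> y - (\<Sum>i<n. B i * (x i - y i))) \<le> \<eta>/2 * sum_dist n x y"
    using has_strict_derivE[OF assms(2), of "\<eta>/2"] \<eta> by auto
  show "\<exists>\<delta>>0. \<forall>x y. near n x0 \<delta> x \<and> near n x0 \<delta> y \<longrightarrow>
      norm (\<phi> x + \<psi> x - (\<phi> y + \<psi> y) - (\<Sum>i<n. (A i + B i) * (x i - y i))) \<le> \<eta> * sum_dist n x y"
  proof (intro exI[of _ "min \<delta>1 \<delta>2"] conjI allI impI)
    fix x y assume xy: "near n x0 (min \<delta>1 \<delta>2) x \<and> near n x0 (min \<delta>1 \<delta>2) y"
    have "norm (\<phi> x + \<psi> x - (\<phi> y + \<psi> y) - (\<Sum>i<n. (A i + B i) * (x i - y i)))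
        = norm ((\<phi> x - \<phi> y - (\<Sum>i<n. A i * (x i - y i))) + (\<psi> x - \<psi> y - (\<Sum>i<n. B i * (x i - y i))))"
      unfolding distrib_right sum.distrib by (simp add: algebra_simps)
    also have "\<dots> \<le> \<eta>/2 * sum_dist n x y + \<eta>/2 * sum_dist n x y"
      using xy by (intro order_trans[OF norm_triangle_ineq] add_mono 1 2) (auto intro: near_mono)
    finally show "norm (\<phi> x + \<psi> x - (\<phi> y + \<psi> y) - (\<Sum>i<n. (A i + B i) * (x i - y i))) \<le> \<eta> * sum_dist n x y"
      by simp
  qed (use 1 2 in simp)
qed

lemma has_strict_deriv_mult:
  assumes "has_strict_deriv \<phi> A n x0" "has_strict_deriv \<psi> B n x0"
  shows "has_strict_deriv (\<lambda>x. \<phi> x * \<psi> x) (\<lambda>i. \<phi> x0 * B i + A i * \<psi> x0) n x0"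
  unfolding has_strict_deriv_def
proof (intro allI impI)
  fix \<eta> :: real assume \<eta>: "\<eta> > 0"
  define SA where "SA = (\<Sum>i<n. norm (A i))"
  define SB where "SB = (\<Sum>i<n. norm (B i))"
  define C where "C = norm (\<phi> x0) + norm (\<psi> x0) + SA + SB + 2"
  have S0: "SA \<ge> 0" "SB \<ge> 0" by (auto simp: SA_def SB_def intro: sum_nonneg)
  have C: "C > 0" "C \<ge> norm (\<phi> x0) + 1" "C \<ge> norm (\<psi> x0) + 1" "C \<ge> SA" "C \<ge> SB"
    using S0 norm_ge_zero[of "\<phi> x0"] norm_ge_zero[of "\<psi> x0"] unfolding C_def by linarith+
  \<comment> \<open>The error of the product splits into four terms, each at most
    \<open>\<zeta> * C\<close> times the distance of the two points.\<close>
  define \<zeta> where "\<zeta> = min 1 (\<eta> / (4 * C))"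
  have \<zeta>: "\<zeta> > 0" "\<zeta> \<le> 1" "\<zeta> * C \<le> \<eta>/4"
    using \<eta> C(1) mult_right_mono[of \<zeta> "\<eta> / (4 * C)" C] by (auto simp: \<zeta>_def field_simps)
  obtain \<delta>1 where 1: "\<delta>1 > 0" "\<And>x y. near n x0 \<delta>1 x \<Longrightarrow> near n x0 \<delta>1 y \<Longrightarrow>
      norm (\<phi> x - \<phi> y - (\<Sum>i<n. A i * (x i - y i))) \<le> \<zeta> * sum_dist n x y"
    using has_strict_derivE[OF assms(1) \<zeta>(1)] by blast
  obtain \<delta>2 where 2: "\<delta>2 > 0" "\<And>x y. near n x0 \<delta>2 x \<Longrightarrow> near n x0 \<delta>2 y \<Longrightarrow>
      norm (\<psi> x - \<psi> y - (\<Sum>i<n. B i * (x i - y i))) \<le> \<zeta> * sum_dist n x y"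
    using has_strict_derivE[OF assms(2) \<zeta>(1)] by blast
  obtain \<delta>3 where 3: "\<delta>3 > 0" "\<And>x. near n x0 \<delta>3 x \<Longrightarrow> norm (\<phi> x - \<phi> x0) < \<zeta>"
    using has_strict_deriv_continuous[OF assms(1) \<zeta>(1)] by blast
  obtain \<delta>4 where 4: "\<delta>4 > 0" "\<And>x. near n x0 \<delta>4 x \<Longrightarrow> norm (\<psi> x - \<psi> x0) < \<zeta>"
    using has_strict_deriv_continuous[OF assms(2) \<zeta>(1)] by blast
  define \<delta> where "\<delta> = min (min \<delta>1 \<delta>2) (min \<delta>3 \<delta>4)"
  show "\<exists>\<delta>>0. \<forall>x y. near n x0 \<delta> x \<and> near n x0 \<delta> y \<longrightarrow>
      norm (\<phi> x * \<psi> x - \<phi> y * \<psi> y - (\<Sum>i<n. (\<phi> x0 * B i + A i * \<psi> x0) * (x i - y i))) \<le> \<eta> * sum_dist n x y"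
  proof (intro exI[of _ \<delta>] conjI allI impI)
    show "\<delta> > 0" using 1 2 3 4 by (simp add: \<delta>_def)
    fix x y assume xy: "near n x0 \<delta> x \<and> near n x0 \<delta> y"
    define N where "N = sum_dist n x y"
    define a where "a = (\<Sum>i<n. A i * (x i - y i))"
    define b where "b = (\<Sum>i<n. B i * (x i - y i))"
    have N0: "N \<ge> 0" unfolding N_def by (rule sum_dist_nonneg)
    have na: "norm a \<le> C * N" "norm b \<le> C * N"
      using norm_linear_le[of A x y n] norm_linear_le[of B x y n] C(4,5) N0
        mult_right_mono[of SA C N] mult_right_mono[of SB C N]
      unfolding a_def b_def N_def SA_def SB_def by linarith+
    have e1: "norm (\<phi> x - \<phi> y - a) \<le> \<zeta> * N" unfolding a_def N_def
      by (rule 1(2)) (use xy in \<open>auto intro: near_mono simp: \<delta>_def\<close>)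
    have e2: "norm (\<psi> x - \<psi> y - b) \<le> \<zeta> * N" unfolding b_def N_def
      by (rule 2(2)) (use xy in \<open>auto intro: near_mono simp: \<delta>_def\<close>)
    have e3: "norm (\<phi> x - \<phi> x0) \<le> \<zeta>"
      by (intro less_imp_le 3(2)) (use xy in \<open>auto intro: near_mono simp: \<delta>_def\<close>)
    have e4: "norm (\<psi> y - \<psi> x0) \<le> \<zeta>"
      by (intro less_imp_le 4(2)) (use xy in \<open>auto intro: near_mono simp: \<delta>_def\<close>)
    have p: "norm (\<phi> x) \<le> C" using norm_triangle_sub[of "\<phi> x" "\<phi> x0"] e3 \<zeta>(2) C(2) by linarith
    have q: "norm (\<psi> y) \<le> C" using norm_triangle_sub[of "\<psi> y" "\<psi> x0"] e4 \<zeta>(2) C(3) by linarith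
    have "(\<Sum>i<n. (\<phi> x0 * B i + A i * \<psi> x0) * (x i - y i)) = \<phi> x0 * b + a * \<psi> x0"
      unfolding a_def b_def sum_distrib_left sum_distrib_right sum.distrib[symmetric]
      by (intro sum.cong) (auto simp: algebra_simps)
    then have "\<phi> x * \<psi> x - \<phi> y * \<psi> y - (\<Sum>i<n. (\<phi> x0 * B i + A i * \<psi> x0) * (x i - y i))
        = \<phi> x * (\<psi> x - \<psi> y - b) + (\<phi> x - \<phi> x0) * b + (\<phi> x - \<phi> y - a) * \<psi> y + a * (\<psi> y - \<psi> x0)"
      by (simp add: algebra_simps)
    also have "norm \<dots> \<le> norm (\<phi> x * (\<psi> x - \<psi> y - b)) + norm ((\<phi> x - \<phi> x0) * b)
        + norm ((\<phi> x - \<phi> y - a) * \<psi> y) + norm (a * (\<psi> y - \<psi> x0))"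
      by (intro order_trans[OF norm_triangle_ineq] add_mono order_refl)
    also have "\<dots> \<le> C * (\<zeta> * N) + \<zeta> * (C * N) + (\<zeta> * N) * C + (C * N) * \<zeta>"
      unfolding norm_mult using p q e1 e2 e3 e4 na C(1) \<zeta>(1) N0 by (intro add_mono mult_mono) auto
    also have "\<dots> = 4 * (\<zeta> * C) * N" by (simp add: algebra_simps)
    also have "\<dots> \<le> \<eta> * N" using \<zeta>(3) N0 by (intro mult_right_mono) auto
    finally show "norm (\<phi> x * \<psi> x - \<phi> y * \<psi> y - (\<Sum>i<n. (\<phi> x0 * B i + A i * \<psi> x0) * (x i - y i))) \<le> \<eta> * sum_dist n x y"
      unfolding N_def .
  qed
qed

definition strictly_differentiable ::
    "((nat \<Rightarrow> 'a::real_normed_field) \<Rightarrow> 'a) \<Rightarrow> nat \<Rightarrow> (nat \<Rightarrow> 'a) \<Rightarrow> bool" where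
  "strictly_differentiable \<phi> n x0 \<longleftrightarrow> (\<exists>A. has_strict_deriv \<phi> A n x0)"

lemma strictly_differentiable_const: "strictly_differentiable (\<lambda>_. k) n x0"
  unfolding strictly_differentiable_def using has_strict_deriv_const by blast

lemma strictly_differentiable_coord: "j < n \<Longrightarrow> strictly_differentiable (\<lambda>x. x j) n x0"
  unfolding strictly_differentiable_def using has_strict_deriv_coord by blast

lemma strictly_differentiable_add:
  "strictly_differentiable \<phi> n x0 \<Longrightarrow> strictly_differentiable \<psi> n x0 \<Longrightarrow>
    strictly_differentiable (\<lambda>x. \<phi> x + \<psi> x) n x0"
  unfolding strictly_differentiable_def using has_strict_deriv_add by blast

lemma strictly_differentiable_mult:
  "strictly_differentiable \<phi> n x0 \<Longrightarrow> strictly_differentiable \<psi> n x0 \<Longrightarrow>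
    strictly_differentiable (\<lambda>x. \<phi> x * \<psi> x) n x0"
  unfolding strictly_differentiable_def using has_strict_deriv_mult by blast

lemma strictly_differentiable_sum:
  assumes "\<And>i. i \<in> I \<Longrightarrow> strictly_differentiable (\<phi> i) n x0"
  shows "strictly_differentiable (\<lambda>x. \<Sum>i\<in>I. \<phi> i x) n x0"
  using assms
proof (induction I rule: infinite_finite_induct)
  case (insert i I)
  then show ?case using strictly_differentiable_add[of "\<phi> i" n x0 "\<lambda>x. \<Sum>i\<in>I. \<phi> i x"] by simp
qed (simp_all add: strictly_differentiable_const)

lemma strictly_differentiable_power:
  assumes "strictly_differentiable \<phi> n x0"
  shows "strictly_differentiable (\<lambda>x. \<phi> x ^ k) n x0"
proof (induction k)
  case (Suc k)
  then show ?case using strictly_differentiable_mult[OF assms Suc] by simp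
qed (simp add: strictly_differentiable_const)

text \<open>Divided by s - s0, the error of the linear approximation is at most a small multiple of
  the sum of the difference quotients of the curve, and this sum stays bounded.\<close>

lemma has_strict_deriv_curve:
  fixes x :: "'a::real_normed_field \<Rightarrow> nat \<Rightarrow> 'a"
  assumes \<phi>: "has_strict_deriv \<phi> A n x0" and x0: "x s0 = x0"
    and x: "\<And>i. i < n \<Longrightarrow> ((\<lambda>s. x s i) has_field_derivative x' i) (at s0)"
  shows "((\<lambda>s. \<phi> (x s)) has_field_derivative (\<Sum>i<n. A i * x' i)) (at s0)"
proof -
  define q where "q s i = (x s i - x0 i) / (s - s0)" for s i
  have q: "((\<lambda>s. q s i) \<longlongrightarrow> x' i) (at s0)" if "i < n" for i
    using x[OF that] x0 unfolding has_field_derivative_iff q_def by simp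
  have qs: "((\<lambda>s. \<Sum>i<n. norm (q s i)) \<longlongrightarrow> (\<Sum>i<n. norm (x' i))) (at s0)"
    using q by (intro tendsto_sum tendsto_norm) auto
  define C where "C = (\<Sum>i<n. norm (x' i)) + 1"
  have C0: "C > 0" unfolding C_def by (simp add: sum_nonneg add_nonneg_pos)
  have evC: "\<forall>\<^sub>F s in at s0. (\<Sum>i<n. norm (q s i)) < C"
    using order_tendstoD(2)[OF qs, of C] by (simp add: C_def)
  have evnear: "\<forall>\<^sub>F s in at s0. near n x0 \<delta> (x s)" if "\<delta> > 0" for \<delta>
  proof -
    have "\<forall>\<^sub>F s in at s0. norm (x s i - x0 i) < \<delta>" if i: "i < n" for i
    proof -
      have "isCont (\<lambda>s. x s i) s0" using x[OF i] by (rule DERIV_isCont)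
      then have "((\<lambda>s. x s i) \<longlongrightarrow> x0 i) (at s0)" using x0 by (simp add: isCont_def)
      from tendstoD[OF this \<open>\<delta> > 0\<close>] show ?thesis by (simp add: dist_norm)
    qed
    then have "\<forall>\<^sub>F s in at s0. \<forall>i\<in>{..<n}. norm (x s i - x0 i) < \<delta>"
      by (intro eventually_ball_finite) auto
    then show ?thesis unfolding near_def by (rule eventually_mono) auto
  qed
  have "((\<lambda>s. (\<phi> (x s) - \<phi> x0) / (s - s0) - (\<Sum>i<n. A i * q s i)) \<longlongrightarrow> 0) (at s0)"
  proof (rule tendstoI)
    fix e :: real assume e: "e > 0"
    obtain \<delta> where \<delta>: "\<delta> > 0" "\<And>x y. near n x0 \<delta> x \<Longrightarrow> near n x0 \<delta> y \<Longrightarrow>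
        norm (\<phi> x - \<phi> y - (\<Sum>i<n. A i * (x i - y i))) \<le> e / (2 * C) * sum_dist n x y"
      using has_strict_derivE[OF \<phi>, of "e / (2 * C)"] e C0 by auto
    show "\<forall>\<^sub>F s in at s0. dist ((\<phi> (x s) - \<phi> x0) / (s - s0) - (\<Sum>i<n. A i * q s i)) 0 < e"
      using evC evnear[OF \<delta>(1)] eventually_neq_at_within[of s0 s0 UNIV]
    proof eventually_elim
      case (elim s)
      then have s: "s - s0 \<noteq> 0" by auto
      have "(\<phi> (x s) - \<phi> x0) / (s - s0) - (\<Sum>i<n. A i * q s i)
          = (\<phi> (x s) - \<phi> x0 - (\<Sum>i<n. A i * (x s i - x0 i))) / (s - s0)"
        unfolding q_def diff_divide_distrib[of _ "\<Sum>i<n. _ i"] sum_divide_distrib by simp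
      also have "norm \<dots> \<le> (e / (2 * C) * sum_dist n (x s) x0) / norm (s - s0)"
        unfolding norm_divide using \<delta>(2)[OF elim(2) near_self[OF \<delta>(1)]] by (intro divide_right_mono) auto
      also have "\<dots> = e / (2 * C) * (\<Sum>i<n. norm (q s i))"
        unfolding sum_dist_def q_def norm_divide sum_divide_distrib[symmetric] by simp
      also have "\<dots> \<le> e / (2 * C) * C" using elim(1) e C0 by (intro mult_left_mono) auto
      also have "\<dots> < e" using e C0 by simp
      finally show ?case by simp
    qed
  qed
  moreover have "((\<lambda>s. \<Sum>i<n. A i * q s i) \<longlongrightarrow> (\<Sum>i<n. A i * x' i)) (at s0)"
    using q by (intro tendsto_sum tendsto_mult_left) auto
  ultimately have "((\<lambda>s. (\<phi> (x s) - \<phi> x0) / (s - s0) - (\<Sum>i<n. A i * q s i) + (\<Sum>i<n. A i * q s i))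
      \<longlongrightarrow> 0 + (\<Sum>i<n. A i * x' i)) (at s0)"
    by (rule tendsto_add)
  then show ?thesis unfolding has_field_derivative_iff using x0 by simp
qed

section \<open>Local inversion\<close>

lemma inverse_matrix:
  fixes A :: "nat \<Rightarrow> nat \<Rightarrow> 'a::field"
  assumes inj: "\<And>\<xi>. (\<And>i. i < n \<Longrightarrow> (\<Sum>j<n. A i j * \<xi> j) = 0) \<Longrightarrow> (\<forall>j<n. \<xi> j = 0)"
  obtains B where
    "\<And>i k. i < n \<Longrightarrow> k < n \<Longrightarrow> (\<Sum>j<n. B i j * A j k) = (if i = k then 1 else 0)"
    "\<And>i k. i < n \<Longrightarrow> k < n \<Longrightarrow> (\<Sum>j<n. A i j * B j k) = (if i = k then 1 else 0)"
proof -
  let ?M = "Matrix.mat n n (\<lambda>(i, j). A i j)"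
  have M: "?M \<in> carrier_mat n n" by simp
  let ?d = "Determinant.det ?M"
  have "?d \<noteq> 0"
  proof
    assume "?d = 0"
    then obtain \<xi> where "\<exists>i<n. \<xi> i \<noteq> 0" "\<forall>j<n. (\<Sum>i<n. A j i * \<xi> i) = 0"
      unfolding det_mat_eq_0_iff by blast
    then show False using inj[of \<xi>] by blast
  qed
  note adj = adj_mat[OF M]
  define B where "B i j = adj_mat ?M $$ (i, j) / ?d" for i j
  have "(\<Sum>j<n. B i j * A j k) = (if i = k then 1 else 0)" if "i < n" "k < n" for i k
  proof -
    have e1: "(adj_mat ?M * ?M) $$ (i, k) = (\<Sum>j<n. adj_mat ?M $$ (i, j) * A j k)"
      using adj(1) that by (simp add: scalar_prod_def lessThan_atLeast0)
    have e2: "(adj_mat ?M * ?M) $$ (i, k) = (if i = k then ?d else 0)"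
      unfolding adj(3) using that by simp
    from trans[OF e1[symmetric] e2] have "(\<Sum>j<n. adj_mat ?M $$ (i, j) * A j k) / ?d = (if i = k then 1 else 0)"
      using \<open>?d \<noteq> 0\<close> by simp
    then show ?thesis by (simp add: B_def sum_divide_distrib)
  qed
  moreover have "(\<Sum>j<n. A i j * B j k) = (if i = k then 1 else 0)" if "i < n" "k < n" for i k
  proof -
    have e1: "(?M * adj_mat ?M) $$ (i, k) = (\<Sum>j<n. A i j * adj_mat ?M $$ (j, k))"
      using adj(1) that by (simp add: scalar_prod_def lessThan_atLeast0)
    have e2: "(?M * adj_mat ?M) $$ (i, k) = (if i = k then ?d else 0)"
      unfolding adj(2) using that by simp
    from trans[OF e1[symmetric] e2] have "(\<Sum>j<n. A i j * adj_mat ?M $$ (j, k)) / ?d = (if i = k then 1 else 0)"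
      using \<open>?d \<noteq> 0\<close> by simp
    then show ?thesis by (simp add: B_def sum_divide_distrib)
  qed
  ultimately show ?thesis using that by blast
qed

locale local_inverse =
  fixes \<Phi> :: "(nat \<Rightarrow> 'a::{real_normed_field,banach}) \<Rightarrow> nat \<Rightarrow> 'a"
    and A B :: "nat \<Rightarrow> nat \<Rightarrow> 'a" and n :: nat and x0 :: "nat \<Rightarrow> 'a"
  assumes strict: "\<And>i. i < n \<Longrightarrow> has_strict_deriv (\<lambda>x. \<Phi> x i) (A i) n x0"
    and BA: "\<And>i k. i < n \<Longrightarrow> k < n \<Longrightarrow> (\<Sum>j<n. B i j * A j k) = (if i = k then 1 else 0)"
    and AB: "\<And>i k. i < n \<Longrightarrow> k < n \<Longrightarrow> (\<Sum>j<n. A i j * B j k) = (if i = k then 1 else 0)"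
begin

definition C :: real where "C = (\<Sum>i<n. \<Sum>j<n. norm (B i j)) + 1"

lemma C_pos: "C > 0"
  unfolding C_def by (simp add: sum_nonneg add_nonneg_pos)

definition app :: "(nat \<Rightarrow> 'a) \<Rightarrow> nat \<Rightarrow> 'a" where "app y i = (\<Sum>j<n. B i j * y j)"

definition lin :: "(nat \<Rightarrow> 'a) \<Rightarrow> nat \<Rightarrow> 'a" where "lin y i = (\<Sum>j<n. A i j * y j)"

lemma app_lin: "i < n \<Longrightarrow> app (lin y) i = y i"
proof -
  assume i: "i < n"
  have "app (lin y) i = (\<Sum>j<n. \<Sum>k<n. B i j * (A j k * y k))"
    by (simp add: app_def lin_def sum_distrib_left)
  also have "\<dots> = (\<Sum>k<n. \<Sum>j<n. B i j * (A j k * y k))" by (rule sum.swap)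
  also have "\<dots> = (\<Sum>k<n. (\<Sum>j<n. B i j * A j k) * y k)" by (simp add: sum_distrib_right mult.assoc)
  also have "\<dots> = (\<Sum>k<n. (if i = k then 1 else 0) * y k)" using BA[OF i] by (intro sum.cong) auto
  also have "\<dots> = y i" using i by (simp add: if_distrib[of "\<lambda>z. z * _"] cong: if_cong)
  finally show ?thesis .
qed

lemma lin_app: "i < n \<Longrightarrow> lin (app y) i = y i"
proof -
  assume i: "i < n"
  have "lin (app y) i = (\<Sum>j<n. \<Sum>k<n. A i j * (B j k * y k))"
    by (simp add: app_def lin_def sum_distrib_left)
  also have "\<dots> = (\<Sum>k<n. \<Sum>j<n. A i j * (B j k * y k))" by (rule sum.swap)
  also have "\<dots> = (\<Sum>k<n. (\<Sum>j<n. A i j * B j k) * y k)" by (simp add: sum_distrib_right mult.assoc)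
  also have "\<dots> = (\<Sum>k<n. (if i = k then 1 else 0) * y k)" using AB[OF i] by (intro sum.cong) auto
  also have "\<dots> = y i" using i by (simp add: if_distrib[of "\<lambda>z. z * _"] cong: if_cong)
  finally show ?thesis .
qed

lemma app_bound: "(\<Sum>i<n. norm (app y i)) \<le> C * (\<Sum>i<n. norm (y i))"
proof -
  have "norm (app y i) \<le> (\<Sum>j<n. norm (B i j)) * (\<Sum>i<n. norm (y i))" for i
  proof -
    have "norm (app y i) \<le> (\<Sum>j<n. norm (B i j) * norm (y j))"
      unfolding app_def by (rule order_trans[OF norm_sum]) (simp add: norm_mult)
    also have "\<dots> \<le> (\<Sum>j<n. norm (B i j) * (\<Sum>i<n. norm (y i)))"
      by (intro sum_mono mult_left_mono member_le_sum) auto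
    finally show ?thesis by (simp add: sum_distrib_right)
  qed
  then have "(\<Sum>i<n. norm (app y i)) \<le> (\<Sum>i<n. (\<Sum>j<n. norm (B i j)) * (\<Sum>i<n. norm (y i)))"
    by (intro sum_mono) auto
  also have "\<dots> = (\<Sum>i<n. \<Sum>j<n. norm (B i j)) * (\<Sum>i<n. norm (y i))" by (simp add: sum_distrib_right)
  also have "\<dots> \<le> C * (\<Sum>i<n. norm (y i))"
    unfolding C_def by (intro mult_right_mono sum_nonneg) auto
  finally show ?thesis .
qed

text \<open>Here the two-point form of the strict derivative pays off: near \<open>x0\<close> the
  map x - B \<Phi>(x) is Lipschitz with a constant as small as desired, which is what a contraction
  argument needs.\<close>

lemma remainder_small:
  assumes "\<eta> > 0"
  obtains \<delta> where "\<delta> > 0" "\<And>x y. near n x0 \<delta> x \<Longrightarrow> near n x0 \<delta> y \<Longrightarrow>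
    (\<Sum>i<n. norm (x i - y i - app (\<lambda>j. \<Phi> x j - \<Phi> y j) i)) \<le> \<eta> * sum_dist n x y"
proof -
  define \<zeta> where "\<zeta> = \<eta> / (C * (real n + 1))"
  have \<zeta>: "\<zeta> > 0" using assms C_pos by (simp add: \<zeta>_def)
  have "\<exists>\<delta>>0. \<forall>x y. near n x0 \<delta> x \<and> near n x0 \<delta> y \<longrightarrow>
      norm (\<Phi> x i - \<Phi> y i - (\<Sum>j<n. A i j * (x j - y j))) \<le> \<zeta> * sum_dist n x y" if "i < n" for i
    using strict[OF that] \<zeta> unfolding has_strict_deriv_def by blast
  then obtain \<delta>' where \<delta>': "\<And>i. i < n \<Longrightarrow> \<delta>' i > 0"
    "\<And>i x y. i < n \<Longrightarrow> near n x0 (\<delta>' i) x \<Longrightarrow> near n x0 (\<delta>' i) y \<Longrightarrow>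
      norm (\<Phi> x i - \<Phi> y i - (\<Sum>j<n. A i j * (x j - y j))) \<le> \<zeta> * sum_dist n x y"
    by metis
  define \<delta> where "\<delta> = Min (insert 1 (\<delta>' ` {..<n}))"
  have \<delta>: "\<delta> > 0" "\<And>i. i < n \<Longrightarrow> \<delta> \<le> \<delta>' i"
    using \<delta>'(1) by (auto simp: \<delta>_def)
  show ?thesis
  proof (rule that[OF \<delta>(1)])
    fix x y assume xy: "near n x0 \<delta> x" "near n x0 \<delta> y"
    define e where "e i = \<Phi> x i - \<Phi> y i - lin (\<lambda>j. x j - y j) i" for i
    have "x i - y i - app (\<lambda>j. \<Phi> x j - \<Phi> y j) i = - app e i" if "i < n" for i
    proof -
      have "app e i = app (\<lambda>j. \<Phi> x j - \<Phi> y j) i - app (lin (\<lambda>j. x j - y j)) i"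
        unfolding app_def e_def by (simp add: right_diff_distrib sum_subtractf)
      then show ?thesis using app_lin[OF that, of "\<lambda>j. x j - y j"] by simp
    qed
    then have "(\<Sum>i<n. norm (x i - y i - app (\<lambda>j. \<Phi> x j - \<Phi> y j) i)) = (\<Sum>i<n. norm (app e i))"
      by (intro sum.cong) auto
    also have "\<dots> \<le> C * (\<Sum>i<n. norm (e i))" by (rule app_bound)
    also have "\<dots> \<le> C * (\<Sum>i<n. \<zeta> * sum_dist n x y)"
      using C_pos xy \<delta>(2) unfolding e_def lin_def
      by (intro mult_left_mono sum_mono \<delta>'(2)) (auto intro: near_mono)
    also have "\<dots> = (C * real n * \<zeta>) * sum_dist n x y" by simp
    also have "\<dots> \<le> \<eta> * sum_dist n x y"
    proof (intro mult_right_mono sum_dist_nonneg)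
      have "C * real n * \<zeta> \<le> C * (real n + 1) * \<zeta>" using C_pos \<zeta> by (intro mult_right_mono mult_left_mono) auto
      also have "\<dots> = \<eta>"
      proof -
        have "C \<noteq> 0" "real n + 1 \<noteq> 0" using C_pos by auto
        then show ?thesis by (simp add: \<zeta>_def)
      qed
      finally show "C * real n * \<zeta> \<le> \<eta>" .
    qed
    finally show "(\<Sum>i<n. norm (x i - y i - app (\<lambda>j. \<Phi> x j - \<Phi> y j) i)) \<le> \<eta> * sum_dist n x y" .
  qed
qed

text \<open>Newton iteration x - B(\<Phi>(x) - y) with the inverse frozen at \<open>x0\<close>; it
  halves distances near \<open>x0\<close>. The fixed point is built by hand because
  \<open>sum_dist\<close> is only a pseudometric on index functions: entries from \<open>n\<close>
  on do not count.\<close>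

lemma local_homeomorphism:
  obtains \<delta> where "\<delta> > 0"
    "\<And>x y. near n x0 \<delta> x \<Longrightarrow> near n x0 \<delta> y \<Longrightarrow>
      sum_dist n x y \<le> 2 * C * (\<Sum>i<n. norm (\<Phi> x i - \<Phi> y i))"
    "\<And>\<rho> y. 0 < \<rho> \<Longrightarrow> \<rho> \<le> \<delta> \<Longrightarrow> 2 * C * (\<Sum>i<n. norm (\<Phi> x0 i - y i)) < \<rho> \<Longrightarrow>
      \<exists>x. near n x0 \<rho> x \<and> (\<forall>i<n. \<Phi> x i = y i)"
proof -
  obtain \<delta> where \<delta>: "\<delta> > 0" "\<And>x y. near n x0 \<delta> x \<Longrightarrow> near n x0 \<delta> y \<Longrightarrow>
    (\<Sum>i<n. norm (x i - y i - app (\<lambda>j. \<Phi> x j - \<Phi> y j) i)) \<le> 1/2 * sum_dist n x y"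
    using remainder_small[of "1/2"] by auto
  show ?thesis
  proof (rule that[OF \<delta>(1)])
    fix x y assume xy: "near n x0 \<delta> x" "near n x0 \<delta> y"
    let ?u = "app (\<lambda>j. \<Phi> x j - \<Phi> y j)"
    have "sum_dist n x y \<le> (\<Sum>i<n. norm (x i - y i - ?u i) + norm (?u i))"
      unfolding sum_dist_def by (intro sum_mono) (metis diff_add_cancel norm_triangle_ineq)
    also have "\<dots> \<le> 1/2 * sum_dist n x y + C * (\<Sum>i<n. norm (\<Phi> x i - \<Phi> y i))"
      unfolding sum.distrib by (intro add_mono \<delta>(2) xy app_bound)
    finally show "sum_dist n x y \<le> 2 * C * (\<Sum>i<n. norm (\<Phi> x i - \<Phi> y i))" by simp
  next
    fix \<rho> :: real and y :: "nat \<Rightarrow> 'a"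
    assume \<rho>: "0 < \<rho>" "\<rho> \<le> \<delta>" and small: "2 * C * (\<Sum>i<n. norm (\<Phi> x0 i - y i)) < \<rho>"
    define T where "T x i = x i - app (\<lambda>j. \<Phi> x j - y j) i" for x i
    define s where "s = C * (\<Sum>i<n. norm (\<Phi> x0 i - y i))"
    have s: "0 \<le> s" "2 * s < \<rho>" using C_pos small by (auto simp: s_def sum_nonneg)
    have contr: "sum_dist n (T x) (T x') \<le> 1/2 * sum_dist n x x'" if "near n x0 \<delta> x" "near n x0 \<delta> x'" for x x'
    proof -
      have "T x i - T x' i = x i - x' i - app (\<lambda>j. \<Phi> x j - \<Phi> x' j) i" for i
        unfolding T_def app_def by (simp add: algebra_simps sum_subtractf)
      then show ?thesis using \<delta>(2)[OF that] by (simp add: sum_dist_def)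
    qed
    define X where "X k = (T ^^ k) x0" for k
    have XS: "X (Suc k) = T (X k)" for k by (simp add: X_def)
    have first: "sum_dist n (X 1) (X 0) \<le> s"
      unfolding sum_dist_def s_def using app_bound[of "\<lambda>j. \<Phi> x0 j - y j"] by (simp add: X_def T_def)
    \<comment> \<open>The first step has length at most s and each later one at most half of its
      predecessor, so the iteration stays within 2s < \<rho> of \<open>x0\<close>.\<close>
    have inv: "sum_dist n (X k) x0 \<le> 2 * s * (1 - (1/2) ^ k) \<and> sum_dist n (X (Suc k)) (X k) \<le> s * (1/2) ^ k" for k
    proof (induction k)
      case 0
      show ?case using first by (simp add: X_def sum_dist_def)
    next
      case (Suc k)
      have b: "near n x0 \<delta> (X l)" if "sum_dist n (X l) x0 \<le> 2 * s * (1 - (1/2) ^ l)" for l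
        unfolding near_def
      proof (intro allI impI)
        fix i assume "i < n"
        then have "norm (X l i - x0 i) \<le> 2 * s * (1 - (1/2) ^ l)"
          using norm_le_sum_dist[of i n "X l" x0] that by linarith
        also have "\<dots> \<le> 2 * s * 1" using s(1) by (intro mult_left_mono) auto
        also have "\<dots> < \<delta>" using s(2) \<rho> by simp
        finally show "norm (X l i - x0 i) < \<delta>" .
      qed
      have 1: "sum_dist n (X (Suc k)) x0 \<le> 2 * s * (1 - (1/2) ^ Suc k)"
      proof -
        have "sum_dist n (X (Suc k)) x0 \<le> sum_dist n (X (Suc k)) (X k) + sum_dist n (X k) x0"
          by (rule sum_dist_triangle)
        also have "\<dots> \<le> s * (1/2) ^ k + 2 * s * (1 - (1/2) ^ k)" using Suc by (intro add_mono) auto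
        also have "\<dots> = 2 * s * (1 - (1/2) ^ Suc k)" by (simp add: algebra_simps)
        finally show ?thesis .
      qed
      have "sum_dist n (X (Suc (Suc k))) (X (Suc k)) \<le> 1/2 * sum_dist n (X (Suc k)) (X k)"
        unfolding XS[of "Suc k"] XS[of k, symmetric]
        using contr[OF b[OF 1] b[of k]] Suc by (simp add: XS[symmetric])
      also have "\<dots> \<le> 1/2 * (s * (1/2) ^ k)" using Suc by simp
      finally show ?case using 1 by simp
    qed
    have "\<exists>l. (\<lambda>k. X k i) \<longlonglongrightarrow> l" if i: "i < n" for i
    proof -
      have le: "norm (X (Suc k) i - X k i) \<le> s * (1/2) ^ k" for k
        using norm_le_sum_dist[OF i, of "X (Suc k)" "X k"] inv[of k] by linarith
      have "summable (\<lambda>k. X (Suc k) i - X k i)"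
        by (rule summable_comparison_test'[where g="\<lambda>k. s * (1/2) ^ k"])
          (auto intro!: summable_mult summable_geometric le)
      from summable_LIMSEQ[OF this]
      have "(\<lambda>k. X k i - X 0 i) \<longlonglongrightarrow> (\<Sum>k. X (Suc k) i - X k i)"
        unfolding sum_lessThan_telescope[of "\<lambda>k. X k i"] .
      from tendsto_add[OF this tendsto_const[of "X 0 i"]] show ?thesis by auto
    qed
    then obtain l where l: "\<And>i. i < n \<Longrightarrow> (\<lambda>k. X k i) \<longlonglongrightarrow> l i" by metis
    have lim_dist: "(\<lambda>k. sum_dist n (X k) l) \<longlonglongrightarrow> 0"
    proof -
      have "(\<lambda>k. \<Sum>i<n. norm (X k i - l i)) \<longlonglongrightarrow> (\<Sum>i<n. norm (l i - l i))"
        using l by (intro tendsto_sum tendsto_norm tendsto_diff tendsto_const) auto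
      then show ?thesis by (simp add: sum_dist_def)
    qed
    have lnear: "near n x0 \<rho> l"
      unfolding near_def
    proof (intro allI impI)
      fix i assume i: "i < n"
      have "norm (X k i - x0 i) \<le> 2 * s" for k
      proof -
        have "norm (X k i - x0 i) \<le> 2 * s * (1 - (1/2) ^ k)"
          using norm_le_sum_dist[OF i, of "X k" x0] inv[of k] by linarith
        also have "\<dots> \<le> 2 * s * 1" using s(1) by (intro mult_left_mono) auto
        finally show ?thesis by simp
      qed
      moreover have "(\<lambda>k. norm (X k i - x0 i)) \<longlonglongrightarrow> norm (l i - x0 i)"
        using l[OF i] by (intro tendsto_norm tendsto_diff tendsto_const)
      ultimately have "norm (l i - x0 i) \<le> 2 * s" by (intro LIMSEQ_le_const2) auto
      then show "norm (l i - x0 i) < \<rho>" using s(2) by linarith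
    qed
    have Xnear: "near n x0 \<delta> (X k)" for k
      unfolding near_def
    proof (intro allI impI)
      fix i assume i: "i < n"
      have "norm (X k i - x0 i) \<le> 2 * s * (1 - (1/2) ^ k)"
        using norm_le_sum_dist[OF i, of "X k" x0] inv[of k] by linarith
      also have "\<dots> \<le> 2 * s * 1" using s(1) by (intro mult_left_mono) auto
      also have "\<dots> < \<delta>" using s(2) \<rho> by simp
      finally show "norm (X k i - x0 i) < \<delta>" .
    qed
    have "sum_dist n (T l) l \<le> 0"
    proof (rule LIMSEQ_le_const)
      show "(\<lambda>k. 1/2 * sum_dist n (X k) l + sum_dist n (X (Suc k)) l) \<longlonglongrightarrow> 0"
        using tendsto_add[OF tendsto_mult_left[OF lim_dist, of "1/2"] LIMSEQ_Suc[OF lim_dist]] by simp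
      have "sum_dist n (T l) l \<le> 1/2 * sum_dist n (X k) l + sum_dist n (X (Suc k)) l" for k
        using sum_dist_triangle[of n "T l" l "T (X k)"] contr[OF near_mono[OF lnear \<rho>(2)] Xnear[of k]]
        by (simp add: XS sum_dist_commute[of n l])
      then show "\<exists>N. \<forall>k\<ge>N. sum_dist n (T l) l \<le> 1/2 * sum_dist n (X k) l + sum_dist n (X (Suc k)) l" by blast
    qed
    then have "norm (T l i - l i) \<le> 0" if "i < n" for i
      using norm_le_sum_dist[OF that, of "T l" l] by linarith
    then have fix': "app (\<lambda>j. \<Phi> l j - y j) i = 0" if "i < n" for i
      using that by (simp add: T_def)
    have "\<Phi> l i = y i" if i: "i < n" for i
    proof -
      have "\<Phi> l i - y i = lin (app (\<lambda>j. \<Phi> l j - y j)) i" by (rule lin_app[OF i, symmetric])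
      also have "\<dots> = 0" using fix' by (simp add: lin_def)
      finally show ?thesis by simp
    qed
    then show "\<exists>x. near n x0 \<rho> x \<and> (\<forall>i<n. \<Phi> x i = y i)" using lnear by blast
  qed
qed

text \<open>Along the curve \<Phi> moves in coordinate \<open>k\<close> only, so the velocity is
  column \<open>k\<close> of the inverse matrix; \<open>lip\<close> turns the remainder into o(s -
  s0).\<close>

lemma inverse_curve_derivative:
  fixes x :: "'a \<Rightarrow> nat \<Rightarrow> 'a"
  assumes k: "k < n" and j: "j < n" and s0: "s0 = \<Phi> x0 k" and x0: "x s0 = x0"
    and lip: "\<And>s. norm (s - s0) < r \<Longrightarrow> sum_dist n (x s) x0 \<le> c * norm (s - s0)" and r: "r > 0"
    and \<Phi>: "\<And>s i. norm (s - s0) < r \<Longrightarrow> i < n \<Longrightarrow> \<Phi> (x s) i = (if i = k then s else \<Phi> x0 i)"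
  shows "((\<lambda>s. x s j) has_field_derivative B j k) (at s0)"
proof -
  have "((\<lambda>s. (x s j - x0 j) / (s - s0) - B j k) \<longlongrightarrow> 0) (at s0)"
  proof (rule tendstoI)
    fix e :: real assume e: "e > 0"
    define c' where "c' = max c 1"
    have c': "c' > 0" "c \<le> c'" by (auto simp: c'_def)
    obtain \<delta> where \<delta>: "\<delta> > 0" "\<And>x y. near n x0 \<delta> x \<Longrightarrow> near n x0 \<delta> y \<Longrightarrow>
      (\<Sum>i<n. norm (x i - y i - app (\<lambda>j. \<Phi> x j - \<Phi> y j) i)) \<le> e / (2 * c') * sum_dist n x y"
      using remainder_small[of "e / (2 * c')"] e c' by auto
    have "\<forall>\<^sub>F s in at s0. norm (s - s0) < min r (\<delta> / c')"
      using r \<delta>(1) c' eventually_at[of "\<lambda>s. norm (s - s0) < min r (\<delta> / c')" s0 UNIV]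
      by (auto simp: dist_norm intro!: exI[of _ "min r (\<delta> / c')"])
    then show "\<forall>\<^sub>F s in at s0. dist ((x s j - x0 j) / (s - s0) - B j k) 0 < e"
      using eventually_neq_at_within[of s0 s0 UNIV]
    proof eventually_elim
      case (elim s)
      then have sr: "norm (s - s0) < r" and s\<delta>: "norm (s - s0) < \<delta> / c'" and ne: "s - s0 \<noteq> 0" by auto
      have d: "sum_dist n (x s) x0 \<le> c' * norm (s - s0)"
        using lip[OF sr] c' mult_right_mono[of c c' "norm (s - s0)"] by simp
      have "near n x0 \<delta> (x s)"
        unfolding near_def
      proof (intro allI impI)
        fix i assume "i < n"
        then have "norm (x s i - x0 i) \<le> c' * norm (s - s0)"
          using norm_le_sum_dist[of i n "x s" x0] d by linarith
        also have "\<dots> < \<delta>" using s\<delta> c' by (simp add: field_simps)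
        finally show "norm (x s i - x0 i) < \<delta>" .
      qed
      from \<delta>(2)[OF this near_self[OF \<delta>(1)]]
      have le: "(\<Sum>i<n. norm (x s i - x0 i - app (\<lambda>j. \<Phi> (x s) j - \<Phi> x0 j) i)) \<le> e / (2 * c') * sum_dist n (x s) x0" .
      have "app (\<lambda>j. \<Phi> (x s) j - \<Phi> x0 j) j = (\<Sum>i<n. B j i * (if i = k then s - s0 else 0))"
        unfolding app_def using \<Phi>[OF sr] s0 by (intro sum.cong) auto
      also have "\<dots> = B j k * (s - s0)" using k by (simp add: if_distrib[of "\<lambda>z. _ * z"] cong: if_cong)
      finally have ap: "app (\<lambda>j. \<Phi> (x s) j - \<Phi> x0 j) j = B j k * (s - s0)" .
      have "norm (x s j - x0 j - B j k * (s - s0))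
          \<le> (\<Sum>i<n. norm (x s i - x0 i - app (\<lambda>j. \<Phi> (x s) j - \<Phi> x0 j) i))"
        unfolding ap[symmetric]
        by (rule member_le_sum[where f="\<lambda>i. norm (x s i - x0 i - app (\<lambda>j. \<Phi> (x s) j - \<Phi> x0 j) i)"]) (use j in auto)
      also have "\<dots> \<le> e / (2 * c') * (c' * norm (s - s0))"
        using le d e c' by (meson divide_pos_pos mult_left_mono less_imp_le mult_pos_pos order_trans zero_less_numeral)
      also have "\<dots> = e / 2 * norm (s - s0)" using c' by simp
      finally have "norm (x s j - x0 j - B j k * (s - s0)) \<le> e / 2 * norm (s - s0)" .
      then have "norm (x s j - x0 j - B j k * (s - s0)) / norm (s - s0) \<le> e / 2"
        using ne by (simp add: divide_le_eq)
      moreover have "(x s j - x0 j) / (s - s0) - B j k = (x s j - x0 j - B j k * (s - s0)) / (s - s0)"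
        using ne by (simp add: diff_divide_distrib)
      ultimately have "norm ((x s j - x0 j) / (s - s0) - B j k) \<le> e / 2" by (simp add: norm_divide)
      then show ?case using e by simp
    qed
  qed
  then have "((\<lambda>s. (x s j - x0 j) / (s - s0)) \<longlongrightarrow> B j k) (at s0)" by (rule LIM_zero_cancel)
  then show ?thesis unfolding has_field_derivative_iff using x0 by simp
qed

end

section \<open>Polynomials with prescribed critical points\<close>

lemma dvd_pderiv_power:
  fixes q :: "'a::field_char_0 poly"
  assumes "[:-a, 1:] ^ Suc k dvd q"
  shows "[:-a, 1:] ^ k dvd pderiv q"
proof -
  obtain r where r: "q = [:-a, 1:] ^ Suc k * r" using assms by (auto simp: dvd_def)
  have "pderiv q = [:-a, 1:] ^ Suc k * pderiv r + r * smult (of_nat (Suc k)) ([:-a, 1:] ^ k * pderiv [:-a, 1:])"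
    unfolding r pderiv_mult pderiv_power_Suc by (simp add: mult.commute del: mult_pCons_left mult_pCons_right)
  moreover have "[:-a, 1:] ^ k dvd [:-a, 1:] ^ Suc k * pderiv r"
    by (metis dvd_mult2 power_Suc dvd_triv_right)
  moreover have "[:-a, 1:] ^ k dvd r * smult (of_nat (Suc k)) ([:-a, 1:] ^ k * pderiv [:-a, 1:])"
    by (intro dvd_mult dvd_smult dvd_mult2 dvd_refl)
  ultimately show ?thesis by (simp add: dvd_add)
qed

lemma poly_pderiv_iterate_eq_0:
  fixes q :: "'a::field_char_0 poly"
  assumes "q \<noteq> 0" "l < order a q"
  shows "poly ((pderiv ^^ l) q) a = 0"
proof -
  have *: "[:-a, 1:] ^ (order a q - l) dvd (pderiv ^^ l) q" if "l \<le> order a q" for l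
    using that
  proof (induction l)
    case 0
    then show ?case by (simp add: order_1)
  next
    case (Suc l)
    then have "order a q - l = Suc (order a q - Suc l)" by simp
    then have "[:-a, 1:] ^ Suc (order a q - Suc l) dvd (pderiv ^^ l) q" using Suc by simp
    from dvd_pderiv_power[OF this] show ?case by simp
  qed
  have "[:-a, 1:] dvd [:-a, 1:] ^ (order a q - l)" using assms(2) by (intro dvd_power) auto
  from dvd_trans[OF this *[of l]] assms(2) show ?thesis by (simp add: poly_eq_0_iff_dvd)
qed

lemma poly_pderiv_iterate_order:
  fixes q :: "'a::field_char_0 poly"
  assumes "q \<noteq> 0"
  shows "poly ((pderiv ^^ order a q) q) a \<noteq> 0"
  using assms
proof (induction "order a q" arbitrary: q)
  case 0
  then have "poly q a \<noteq> 0" using order_root[of q a] by simp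
  then show ?case using 0(1) by simp
next
  case (Suc k)
  then have root: "poly q a = 0" using order_root[of q a] by simp
  have ord: "order a q = Suc (order a (pderiv q))" by (rule order_pderiv[OF Suc.prems root])
  have "pderiv q \<noteq> 0"
  proof
    assume "pderiv q = 0"
    then have "degree q = 0" by (simp add: pderiv_eq_0_iff)
    then obtain k where "q = [:k:]" by (rule degree_eq_zeroE)
    then show False using root Suc.prems by simp
  qed
  then have "poly ((pderiv ^^ order a (pderiv q)) (pderiv q)) a \<noteq> 0" using Suc.hyps(1)[of "pderiv q"] Suc.hyps(2) ord by simp
  moreover have "(pderiv ^^ order a q) q = (pderiv ^^ order a (pderiv q)) (pderiv q)"
    unfolding ord by (simp only: funpow_Suc_right o_apply)
  ultimately show ?case by simp
qed

lemma order_geI: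
  fixes q :: "'a::field_char_0 poly"
  assumes "q \<noteq> 0" "\<And>l. l < k \<Longrightarrow> poly ((pderiv ^^ l) q) a = 0"
  shows "k \<le> order a q"
  using poly_pderiv_iterate_order[OF assms(1), of a] assms(2) by (metis not_le)

lemma prod_linear_powers_dvd:
  fixes h :: "'a::field_char_0 poly"
  assumes "finite I" "inj_on x I" "h \<noteq> 0" "\<And>i. i \<in> I \<Longrightarrow> m i \<le> order (x i) h"
  shows "(\<Prod>i\<in>I. [:- x i, 1:] ^ m i) dvd h"
  using assms
proof (induction I rule: finite_induct)
  case (insert j I)
  then have "(\<Prod>i\<in>I. [:- x i, 1:] ^ m i) dvd h" by (auto simp: inj_on_def)
  then obtain q where q: "h = (\<Prod>i\<in>I. [:- x i, 1:] ^ m i) * q" by (auto simp: dvd_def)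
  let ?P = "\<Prod>i\<in>I. [:- x i, 1:] ^ m i"
  have q0: "q \<noteq> 0" "?P \<noteq> 0" using q insert.prems(2) by auto
  have "poly ?P (x j) \<noteq> 0"
    using insert.hyps insert.prems(1) by (auto simp: poly_prod poly_power inj_on_def)
  then have "order (x j) ?P = 0" by (rule order_0I)
  then have "order (x j) h = order (x j) q" using q insert.prems(2) order_mult[of ?P q "x j"] by simp
  then have "m j \<le> order (x j) q" using insert.prems(3)[of j] by simp
  then have "[:- x j, 1:] ^ m j dvd q" by (simp add: order_divides)
  then show ?case unfolding q using insert.hyps by (simp add: mult_dvd_mono mult.commute)
qed simp

text \<open>\<open>split\<close> expresses that the derivative has all its roots in the field. It is
  automatic over the complex numbers; over the reals it says that all critical points are real. With
  it both fields share the whole local theory.\<close>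

locale critical_data =
  fixes f :: "'a::{real_normed_field,banach} poly" and p :: nat and c :: "nat \<Rightarrow> 'a"
  assumes deg: "2 \<le> degree f" and monic: "lead_coeff f = 1"
    and centered: "coeff f (degree f - 1) = 0"
    and bij: "bij_betw c {..<p} (critical_points f)"
    and split: "(\<Sum>i<p. multiplicity_crit f (c i)) = degree f - 1"
begin

definition d :: nat where "d = degree f"
definition m :: "nat \<Rightarrow> nat" where "m i = multiplicity_crit f (c i)"
definition crit_prod :: "(nat \<Rightarrow> 'a) \<Rightarrow> 'a poly" where "crit_prod x = (\<Prod>i<p. [:- x i, 1:] ^ m i)"

text \<open>The polynomial with critical points \<open>x 0, \<dots>, x (p - 1)\<close> of the prescribed multiplicities and
  constant term \<open>x p\<close>.\<close>

definition G :: "(nat \<Rightarrow> 'a) \<Rightarrow> 'a poly" where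
  "G x = monom (x p) 0 + (\<Sum>k<d. monom (of_nat d * coeff (crit_prod x) k / of_nat (Suc k)) (Suc k))"

definition base :: "nat \<Rightarrow> 'a" where "base i = (if i < p then c i else coeff f 0)"

lemma d2: "2 \<le> d" using deg by (simp add: d_def)

lemma pderiv_f_nonzero: "pderiv f \<noteq> 0" using deg by (simp add: pderiv_eq_0_iff)

lemma inj_c: "inj_on c {..<p}" using bij by (simp add: bij_betw_def)

lemma crit_c: "i < p \<Longrightarrow> poly (pderiv f) (c i) = 0"
  using bij by (auto simp: bij_betw_def critical_points_def)

lemma m_pos: "i < p \<Longrightarrow> 0 < m i"
  using crit_c[of i] order_root[of "pderiv f" "c i"] pderiv_f_nonzero by (simp add: m_def multiplicity_crit_def)

lemma sum_m: "(\<Sum>i<p. m i) = d - 1" using split by (simp add: m_def d_def)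

lemma degree_crit_prod: "degree (crit_prod x) = d - 1"
proof -
  have "degree (crit_prod x) = (\<Sum>i<p. degree ([:- x i, 1:] ^ m i))"
    unfolding crit_prod_def by (rule degree_prod_sum_eq) auto
  then show ?thesis by (simp add: degree_power_eq sum_m)
qed

lemma crit_prod_nonzero: "crit_prod x \<noteq> 0"
  unfolding crit_prod_def by auto

lemma lead_coeff_crit_prod: "coeff (crit_prod x) (d - 1) = 1"
proof -
  have "lead_coeff (crit_prod x) = 1"
    unfolding crit_prod_def by (simp add: lead_coeff_prod lead_coeff_power)
  then show ?thesis by (simp add: degree_crit_prod)
qed

lemma coeff_G_0: "coeff (G x) 0 = x p"
  by (simp add: G_def coeff_sum)

lemma coeff_G_Suc: "coeff (G x) (Suc k) = of_nat d * coeff (crit_prod x) k / of_nat (Suc k)"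
proof -
  have "coeff (G x) (Suc k) = (\<Sum>i<d. if i = k then of_nat d * coeff (crit_prod x) i / of_nat (Suc i) else 0)"
    by (simp add: G_def coeff_sum)
  also have "\<dots> = (if k < d then of_nat d * coeff (crit_prod x) k / of_nat (Suc k) else 0)" by simp
  also have "\<dots> = of_nat d * coeff (crit_prod x) k / of_nat (Suc k)"
    using degree_crit_prod[of x] by (auto simp: coeff_eq_0)
  finally show ?thesis .
qed

lemma pderiv_G: "pderiv (G x) = smult (of_nat d) (crit_prod x)"
  by (rule poly_eqI) (simp add: coeff_pderiv coeff_G_Suc del: of_nat_Suc)

lemma coeff_G_d: "coeff (G x) d = 1"
proof -
  have "d = Suc (d - 1)" using d2 by simp
  then have "coeff (G x) d = of_nat d * coeff (crit_prod x) (d - 1) / of_nat (Suc (d - 1))"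
    by (metis coeff_G_Suc)
  then show ?thesis using lead_coeff_crit_prod d2 by simp
qed

lemma coeff_G_above: "i > d \<Longrightarrow> coeff (G x) i = 0"
  using coeff_G_Suc[of x "i - 1"] degree_crit_prod[of x] d2 by (auto simp: coeff_eq_0)

lemma degree_G: "degree (G x) = d"
proof (rule antisym)
  show "degree (G x) \<le> d" by (rule degree_le) (simp add: coeff_G_above)
  show "d \<le> degree (G x)" by (rule le_degree) (simp add: coeff_G_d)
qed

lemma coeff_G_centered: "coeff (G x) (d - 1) = of_nat d * coeff (crit_prod x) (d - 2) / of_nat (d - 1)"
proof -
  have "d - 1 = Suc (d - 2)" using d2 by simp
  then show ?thesis using coeff_G_Suc[of x "d - 2"] by simp
qed

lemma G_monic_centered: "coeff (crit_prod x) (d - 2) = 0 \<Longrightarrow> G x \<in> monic_centered d"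
  by (simp add: monic_centered_def degree_G coeff_G_d coeff_G_centered del: One_nat_def)

lemma crit_prod_cong: "(\<And>i. i < p \<Longrightarrow> x i = y i) \<Longrightarrow> crit_prod x = crit_prod y"
  unfolding crit_prod_def by (intro prod.cong) auto

lemma G_cong: "(\<And>i. i \<le> p \<Longrightarrow> x i = y i) \<Longrightarrow> G x = G y"
  unfolding G_def using crit_prod_cong[of x y] by simp

lemma critical_points_G: "critical_points (G x) = x ` {..<p}"
  using m_pos d2 unfolding critical_points_def pderiv_G
  by (auto simp: crit_prod_def poly_prod poly_power)

lemma multiplicity_G:
  assumes x: "inj_on x {..<p}" and i: "i < p"
  shows "multiplicity_crit (G x) (x i) = m i"
proof -
  let ?Q = "\<Prod>j\<in>{..<p} - {i}. [:- x j, 1:] ^ m j"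
  have e: "crit_prod x = [:- x i, 1:] ^ m i * ?Q"
    unfolding crit_prod_def using i by (intro prod.remove) auto
  have "poly ?Q (x i) \<noteq> 0" using x i by (auto simp: poly_prod poly_power inj_on_def)
  then have "order (x i) ?Q = 0" by (rule order_0I)
  moreover have "order (x i) (crit_prod x) = order (x i) ([:- x i, 1:] ^ m i) + order (x i) ?Q"
    unfolding e by (rule order_mult) (use crit_prod_nonzero[of x] e in simp)
  ultimately have "order (x i) (crit_prod x) = m i" by (simp add: order_power_n_n)
  then show ?thesis using d2 by (simp add: multiplicity_crit_def pderiv_G order_smult)
qed

text \<open>The multiplicities make \<open>crit_prod x\<close> divide g', and both have degree d -
  1. So g' is determined by the critical points and its leading coefficient, and \<open>g\<close> by
  its constant term in addition.\<close>

lemma eq_G: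
  assumes g: "degree g = d" "coeff g d = 1" and x: "inj_on x {..<p}"
    and mult: "\<And>i. i < p \<Longrightarrow> multiplicity_crit g (x i) = m i" and xp: "x p = coeff g 0"
  shows "g = G x"
proof -
  have pg0: "pderiv g \<noteq> 0" using g d2 by (simp add: pderiv_eq_0_iff)
  have "crit_prod x dvd pderiv g"
    unfolding crit_prod_def using mult pg0 x
    by (intro prod_linear_powers_dvd) (auto simp: multiplicity_crit_def)
  then obtain q where q: "pderiv g = crit_prod x * q" by (auto simp: dvd_def)
  have q0: "q \<noteq> 0" using q pg0 by auto
  have "degree (pderiv g) = d - 1 + degree q"
    unfolding q using degree_mult_eq[OF crit_prod_nonzero q0] degree_crit_prod by simp
  then have "degree q = 0" using g by (simp add: degree_pderiv)
  then obtain k where k: "q = [:k:]" by (rule degree_eq_zeroE)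
  have "coeff (pderiv g) (d - 1) = of_nat d" using g d2 by (simp add: coeff_pderiv)
  moreover have "coeff (pderiv g) (d - 1) = k" by (simp add: q k lead_coeff_crit_prod del: One_nat_def)
  ultimately have pd: "pderiv g = pderiv (G x)" by (simp add: q k pderiv_G)
  show ?thesis
  proof (rule poly_eqI)
    fix i
    show "coeff g i = coeff (G x) i"
    proof (cases i)
      case 0 then show ?thesis using xp by (simp add: coeff_G_0)
    next
      case (Suc j)
      have "of_nat (Suc j) * coeff g (Suc j) = of_nat (Suc j) * coeff (G x) (Suc j)"
        using arg_cong[OF pd, of "\<lambda>q. coeff q j"] by (simp only: coeff_pderiv)
      then show ?thesis unfolding Suc by (simp only: mult_cancel_left of_nat_eq_0_iff) simp
    qed
  qed
qed

lemma f_eq_G: "f = G base"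
proof (rule eq_G)
  show "inj_on base {..<p}" using inj_c by (auto simp: inj_on_def base_def)
qed (auto simp: d_def monic base_def m_def)

lemma crit_prod_base_centered: "coeff (crit_prod base) (d - 2) = 0"
proof -
  have "coeff (G base) (d - 1) = 0" using centered f_eq_G by (simp add: d_def del: One_nat_def)
  then show ?thesis unfolding coeff_G_centered using d2 by (auto simp del: of_nat_diff)
qed

lemma strictly_differentiable_coeff_mult:
  assumes "\<And>k. strictly_differentiable (\<lambda>x. coeff (P x) k) n x0" "\<And>k. strictly_differentiable (\<lambda>x. coeff (Q x) k) n x0"
  shows "strictly_differentiable (\<lambda>x. coeff (P x * Q x) k) n x0"
  unfolding coeff_mult by (intro strictly_differentiable_sum strictly_differentiable_mult assms)

lemma strictly_differentiable_coeff_crit_prod: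
  "strictly_differentiable (\<lambda>x. coeff (crit_prod x) k) (Suc p) x0"
proof -
  have lin: "strictly_differentiable (\<lambda>x. coeff [:- x i, 1:] k) (Suc p) x0" if "i < p" for i k
  proof (cases k)
    case 0
    have "strictly_differentiable (\<lambda>x. (-1) * x i) (Suc p) x0"
      using that by (intro strictly_differentiable_mult strictly_differentiable_const strictly_differentiable_coord) auto
    then show ?thesis using 0 by simp
  next
    case (Suc j)
    then show ?thesis by (simp add: strictly_differentiable_const)
  qed
  have pow: "strictly_differentiable (\<lambda>x. coeff ([:- x i, 1:] ^ l) k) (Suc p) x0" if "i < p" for i l k
  proof (induction l arbitrary: k)
    case (Suc l)
    show ?case unfolding power_Suc by (rule strictly_differentiable_coeff_mult[OF lin[OF that] Suc])
  qed (simp add: strictly_differentiable_const)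
  have "strictly_differentiable (\<lambda>x. coeff (\<Prod>i<q. [:- x i, 1:] ^ m i) k) (Suc p) x0" if "q \<le> p" for q k
    using that
  proof (induction q arbitrary: k)
    case (Suc q)
    have "strictly_differentiable (\<lambda>x. coeff ((\<Prod>i<q. [:- x i, 1:] ^ m i) * [:- x q, 1:] ^ m q) k) (Suc p) x0"
      using Suc by (intro strictly_differentiable_coeff_mult pow) auto
    then show ?case by (simp only: prod.lessThan_Suc)
  qed (simp add: strictly_differentiable_const)
  then show ?thesis by (simp add: crit_prod_def)
qed

lemma strictly_differentiable_coeff_G:
  "strictly_differentiable (\<lambda>x. coeff (G x) k) (Suc p) x0"
proof (cases k)
  case 0
  then show ?thesis by (simp add: coeff_G_0 strictly_differentiable_coord)
next
  case (Suc j)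
  have "strictly_differentiable (\<lambda>x. (of_nat d / of_nat (Suc j)) * coeff (crit_prod x) j) (Suc p) x0"
    by (rule strictly_differentiable_mult[OF strictly_differentiable_const strictly_differentiable_coeff_crit_prod])
  then show ?thesis by (simp add: Suc coeff_G_Suc)
qed

text \<open>The last component is, up to a non-zero factor, the coefficient of degree d - 1 of
  \<open>G x\<close>. The p critical values and this centring equation form a square system in p + 1
  unknowns, and the stratum corresponds to the zeros of the last component.\<close>

definition \<Phi> :: "(nat \<Rightarrow> 'a) \<Rightarrow> nat \<Rightarrow> 'a" where
  "\<Phi> x i = (if i < p then poly (G x) (x i) else coeff (crit_prod x) (d - 2))"

lemma strictly_differentiable_\<Phi>:
  assumes "i < Suc p"
  shows "strictly_differentiable (\<lambda>x. \<Phi> x i) (Suc p) x0"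
proof (cases "i < p")
  case True
  have "poly (G x) (x i) = (\<Sum>k\<le>d. coeff (G x) k * x i ^ k)" for x
    by (simp add: poly_altdef degree_G)
  moreover have "strictly_differentiable (\<lambda>x. \<Sum>k\<le>d. coeff (G x) k * x i ^ k) (Suc p) x0"
    by (intro strictly_differentiable_sum strictly_differentiable_mult strictly_differentiable_power
        strictly_differentiable_coord[OF assms] strictly_differentiable_coeff_G)
  ultimately show ?thesis using True by (simp add: \<Phi>_def)
next
  case False
  then show ?thesis by (simp add: \<Phi>_def strictly_differentiable_coeff_crit_prod)
qed

end

section \<open>Derivatives along curves of polynomials\<close>

lemma poly_eq_sum_coeff:
  fixes q :: "'a::comm_semiring_1 poly"
  shows "degree q \<le> D \<Longrightarrow> poly q z = (\<Sum>k\<le>D. coeff q k * z ^ k)"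
  unfolding poly_altdef by (intro sum.mono_neutral_left) (auto simp: coeff_eq_0)

lemma has_field_derivative_transform_eventually:
  assumes "(g has_field_derivative D) (at t0)" "\<forall>\<^sub>F t in at t0. g t = h t" "g t0 = h t0"
  shows "(h has_field_derivative D) (at t0)"
proof -
  have "\<forall>\<^sub>F t in at t0. (g t - g t0) / (t - t0) = (h t - h t0) / (t - t0)"
    using assms(2) by eventually_elim (simp add: assms(3))
  from tendsto_cong[OF this] assms(1) show ?thesis
    unfolding has_field_derivative_iff by simp
qed

text \<open>A common degree bound writes all polynomials of the curve as sums of the same finite
  length, to which the product rule applies term by term.\<close>

lemma DERIV_poly_curve:
  fixes g :: "'a::real_normed_field \<Rightarrow> 'a poly"
  assumes g: "\<And>i. ((\<lambda>t. coeff (g t) i) has_field_derivative coeff u i) (at t0)"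
    and deg: "\<forall>\<^sub>F t in at t0. degree (g t) \<le> D" "degree (g t0) \<le> D" "degree u \<le> D"
    and y: "(y has_field_derivative y') (at t0)"
  shows "((\<lambda>t. poly (g t) (y t)) has_field_derivative poly u (y t0) + poly (pderiv (g t0)) (y t0) * y') (at t0)"
proof -
  have "((\<lambda>t. \<Sum>k\<le>D. coeff (g t) k * y t ^ k) has_field_derivative
      (\<Sum>k\<le>D. coeff u k * y t0 ^ k + (of_nat k * (y' * y t0 ^ (k - Suc 0))) * coeff (g t0) k)) (at t0)"
    by (rule DERIV_sum) (rule DERIV_mult[OF g DERIV_power[OF y]])
  moreover have "(\<Sum>k\<le>D. coeff u k * y t0 ^ k + (of_nat k * (y' * y t0 ^ (k - Suc 0))) * coeff (g t0) k)
      = poly u (y t0) + poly (pderiv (g t0)) (y t0) * y'"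
  proof -
    have e: "poly (pderiv (g t0)) (y t0) = (\<Sum>k\<le>D. of_nat k * coeff (g t0) k * y t0 ^ (k - 1))"
    proof -
      have "((\<lambda>z. \<Sum>k\<le>D. coeff (g t0) k * z ^ k) has_field_derivative
          (\<Sum>k\<le>D. coeff (g t0) k * (of_nat k * (1 * y t0 ^ (k - Suc 0))))) (at (y t0))"
        by (intro DERIV_sum DERIV_cmult DERIV_power DERIV_ident)
      moreover have "poly (g t0) = (\<lambda>z. \<Sum>k\<le>D. coeff (g t0) k * z ^ k)"
        using poly_eq_sum_coeff[OF deg(2)] by auto
      ultimately have "(poly (g t0) has_field_derivative (\<Sum>k\<le>D. coeff (g t0) k * (of_nat k * (1 * y t0 ^ (k - Suc 0))))) (at (y t0))"
        by simp
      from DERIV_unique[OF poly_DERIV this] show ?thesis by (simp add: mult.assoc mult.left_commute)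
    qed
    show ?thesis
      unfolding e sum.distrib poly_eq_sum_coeff[OF deg(3)] sum_distrib_right
      by (intro arg_cong2[of _ _ _ _ "(+)"] sum.cong refl) (simp_all add: mult_ac)
  qed
  ultimately have "((\<lambda>t. \<Sum>k\<le>D. coeff (g t) k * y t ^ k) has_field_derivative
      poly u (y t0) + poly (pderiv (g t0)) (y t0) * y') (at t0)" by simp
  then show ?thesis
  proof (rule has_field_derivative_transform_eventually)
    show "\<forall>\<^sub>F t in at t0. (\<Sum>k\<le>D. coeff (g t) k * y t ^ k) = poly (g t) (y t)"
      using deg(1) by eventually_elim (simp add: poly_eq_sum_coeff)
  qed (simp add: poly_eq_sum_coeff[OF deg(2)])
qed

text \<open>With \<open>Q t\<close> the divided difference of \<open>q t\<close> between \<open>X t\<close> and \<open>X t\<^sub>0\<close>, the equation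
  \<open>q t (X t) = 0\<close> reads \<open>Q t (X t - X t\<^sub>0) = - q t (X t\<^sub>0)\<close>.\<close>

lemma simple_root_curve_differentiable:
  fixes q :: "'a::real_normed_field \<Rightarrow> 'a poly"
  assumes q: "\<And>i. (\<lambda>t. coeff (q t) i) field_differentiable (at t0)"
    and deg: "\<forall>\<^sub>F t in at t0. degree (q t) \<le> D" "degree (q t0) \<le> D"
    and root: "\<forall>\<^sub>F t in at t0. poly (q t) (X t) = 0" "poly (q t0) (X t0) = 0"
    and cont: "(X \<longlongrightarrow> X t0) (at t0)"
    and simple: "poly (pderiv (q t0)) (X t0) \<noteq> 0"
  shows "X field_differentiable (at t0)"
proof -
  define Q where "Q t = (\<Sum>k\<le>D. coeff (q t) k * (\<Sum>l<k. X t0 ^ (k - Suc l) * X t ^ l))" for t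
  define P where "P t = (\<Sum>k\<le>D. coeff (q t) k * X t0 ^ k)" for t
  have clim: "((\<lambda>t. coeff (q t) i) \<longlongrightarrow> coeff (q t0) i) (at t0)" for i
    using field_differentiable_imp_continuous_at[OF q] by (simp add: continuous_at)
  have "(Q \<longlongrightarrow> (\<Sum>k\<le>D. coeff (q t0) k * (\<Sum>l<k. X t0 ^ (k - Suc l) * X t0 ^ l))) (at t0)"
    unfolding Q_def by (intro tendsto_intros clim cont)
  moreover have "(\<Sum>k\<le>D. coeff (q t0) k * (\<Sum>l<k. X t0 ^ (k - Suc l) * X t0 ^ l)) = poly (pderiv (q t0)) (X t0)"
  proof -
    have "(\<Sum>l<k. X t0 ^ (k - Suc l) * X t0 ^ l) = of_nat k * X t0 ^ (k - 1)" for k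
    proof -
      have "(\<Sum>l<k. X t0 ^ (k - Suc l) * X t0 ^ l) = (\<Sum>l<k. X t0 ^ (k - 1))"
        by (intro sum.cong) (auto simp: power_add[symmetric])
      then show ?thesis by simp
    qed
    then have "(\<Sum>k\<le>D. coeff (q t0) k * (\<Sum>l<k. X t0 ^ (k - Suc l) * X t0 ^ l))
        = (\<Sum>k\<le>D. coeff (q t0) k * (of_nat k * (1 * X t0 ^ (k - Suc 0))))" by simp
    moreover have "((\<lambda>z. \<Sum>k\<le>D. coeff (q t0) k * z ^ k) has_field_derivative
          (\<Sum>k\<le>D. coeff (q t0) k * (of_nat k * (1 * X t0 ^ (k - Suc 0))))) (at (X t0))"
      by (intro DERIV_sum DERIV_cmult DERIV_power DERIV_ident)
    moreover have "poly (q t0) = (\<lambda>z. \<Sum>k\<le>D. coeff (q t0) k * z ^ k)"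
      using poly_eq_sum_coeff[OF deg(2)] by auto
    ultimately show ?thesis using DERIV_unique[OF poly_DERIV[of "q t0" "X t0"]] by simp
  qed
  ultimately have Qlim: "(Q \<longlongrightarrow> poly (pderiv (q t0)) (X t0)) (at t0)" by simp
  have Q0: "\<forall>\<^sub>F t in at t0. Q t \<noteq> 0" by (rule tendsto_imp_eventually_ne[OF Qlim simple])
  obtain c' where c': "\<And>i. ((\<lambda>t. coeff (q t) i) has_field_derivative c' i) (at t0)"
    using q unfolding field_differentiable_def by metis
  have "(P has_field_derivative (\<Sum>k\<le>D. c' k * X t0 ^ k)) (at t0)"
    unfolding P_def by (intro DERIV_sum DERIV_cmult_right c')
  then have Plim: "((\<lambda>t. (P t - P t0) / (t - t0)) \<longlongrightarrow> (\<Sum>k\<le>D. c' k * X t0 ^ k)) (at t0)"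
    by (simp add: has_field_derivative_iff)
  have P0: "P t0 = 0" using root(2) poly_eq_sum_coeff[OF deg(2)] by (simp add: P_def)
  have "((\<lambda>t. - ((P t - P t0) / (t - t0)) / Q t) \<longlongrightarrow> - (\<Sum>k\<le>D. c' k * X t0 ^ k) / poly (pderiv (q t0)) (X t0)) (at t0)"
    by (intro tendsto_intros Plim Qlim simple)
  moreover have "\<forall>\<^sub>F t in at t0. - ((P t - P t0) / (t - t0)) / Q t = (X t - X t0) / (t - t0)"
    using Q0 root(1) deg(1)
  proof eventually_elim
    case (elim t)
    have "0 = (\<Sum>k\<le>D. coeff (q t) k * X t ^ k)" using elim poly_eq_sum_coeff[of "q t" D "X t"] by simp
    also have "\<dots> - P t = (X t - X t0) * Q t"
      unfolding P_def Q_def sum_subtractf[symmetric] sum_distrib_left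
    proof (rule sum.cong[OF refl])
      fix k
      have "X t ^ k - X t0 ^ k = (X t - X t0) * (\<Sum>l<k. X t0 ^ (k - Suc l) * X t ^ l)"
        by (simp add: power_diff_sumr2 mult.commute[of "X t ^ _"])
      then show "coeff (q t) k * X t ^ k - coeff (q t) k * X t0 ^ k
          = (\<Sum>l<k. (X t - X t0) * (coeff (q t) k * (X t0 ^ (k - Suc l) * X t ^ l)))"
        by (simp add: right_diff_distrib[symmetric] sum_distrib_left mult_ac)
    qed
    finally have "- P t = (X t - X t0) * Q t" by simp
    then have "X t - X t0 = - P t / Q t" using elim(1) by (simp add: field_simps)
    then show ?case using P0 by simp
  qed
  ultimately have "((\<lambda>t. (X t - X t0) / (t - t0)) \<longlongrightarrow> - (\<Sum>k\<le>D. c' k * X t0 ^ k) / poly (pderiv (q t0)) (X t0)) (at t0)"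
    by (rule Lim_transform_eventually)
  then show ?thesis unfolding field_differentiable_def has_field_derivative_iff by blast
qed

lemma degree_pderiv_iterate: "degree ((pderiv ^^ k) (q::'a::field_char_0 poly)) \<le> degree q"
proof (induction k)
  case (Suc k) then show ?case using degree_pderiv[of "(pderiv ^^ k) q"] by simp
qed simp

lemma coeff_pderiv_iterate_DERIV:
  fixes g :: "'a::real_normed_field \<Rightarrow> 'a poly"
  assumes "\<And>i. ((\<lambda>t. coeff (g t) i) has_field_derivative coeff u i) (at t0)"
  shows "((\<lambda>t. coeff ((pderiv ^^ k) (g t)) i) has_field_derivative coeff ((pderiv ^^ k) u) i) (at t0)"
proof (induction k arbitrary: i)
  case (Suc k)
  have "((\<lambda>t. of_nat (Suc i) * coeff ((pderiv ^^ k) (g t)) (Suc i)) has_field_derivative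
      of_nat (Suc i) * coeff ((pderiv ^^ k) u) (Suc i)) (at t0)"
    by (rule DERIV_cmult[OF Suc])
  then show ?case by (simp add: coeff_pderiv del: of_nat_Suc)
qed (use assms in simp)

lemma poly_pderiv_iterate_perturbation:
  fixes f :: "'a::real_normed_field poly"
  assumes "\<eta> > 0"
  shows "\<exists>\<delta>>0. \<forall>g z. degree g \<le> D \<longrightarrow> (\<forall>i. norm (coeff g i - coeff f i) < \<delta>) \<longrightarrow> norm (z - a) < \<delta> \<longrightarrow>
    norm (poly ((pderiv ^^ k) g) z - poly ((pderiv ^^ k) f) a) < \<eta>"
  using assms
proof (induction k arbitrary: f)
  case 0
  define D' where "D' = max D (degree f)"
  define S where "S = (\<Sum>i\<le>D'. (norm a + 1) ^ i) + 1"
  have S: "S > 0" unfolding S_def by (intro add_nonneg_pos sum_nonneg) auto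
  have "isCont (poly f) a" by simp
  then obtain \<delta>1 where \<delta>1: "\<delta>1 > 0" "\<And>z. norm (z - a) < \<delta>1 \<Longrightarrow> norm (poly f z - poly f a) < \<eta>/2"
    using 0 unfolding continuous_at_eps_delta dist_norm by (meson half_gt_zero)
  define \<delta> where "\<delta> = min (min 1 \<delta>1) (\<eta> / (2 * S))"
  have \<delta>: "\<delta> > 0" "\<delta> \<le> 1" "\<delta> \<le> \<delta>1" "\<delta> \<le> \<eta> / (2 * S)" using \<delta>1(1) 0 S by (auto simp: \<delta>_def)
  show ?case
  proof (intro exI[of _ \<delta>] conjI allI impI)
    fix g :: "'a poly" and z :: 'a
    assume g: "degree g \<le> D" "\<forall>i. norm (coeff g i - coeff f i) < \<delta>" and z: "norm (z - a) < \<delta>"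
    have nz: "norm z \<le> norm a + 1" using norm_triangle_sub[of z a] z \<delta>(2) by linarith
    have "poly g z - poly f z = (\<Sum>i\<le>D'. (coeff g i - coeff f i) * z ^ i)"
      using poly_eq_sum_coeff[of g D' z] poly_eq_sum_coeff[of f D' z] g(1)
      by (simp add: D'_def sum_subtractf left_diff_distrib)
    also have "norm \<dots> \<le> (\<Sum>i\<le>D'. \<delta> * (norm a + 1) ^ i)"
    proof (rule order_trans[OF norm_sum], rule sum_mono)
      fix i
      show "norm ((coeff g i - coeff f i) * z ^ i) \<le> \<delta> * (norm a + 1) ^ i"
        unfolding norm_mult norm_power using g(2) nz \<delta>(1)
        by (intro mult_mono power_mono) (auto intro: less_imp_le)
    qed
    also have "\<dots> = \<delta> * (S - 1)" by (simp add: S_def sum_distrib_left)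
    also have "\<dots> < \<delta> * S" using \<delta>(1) by simp
    also have "\<dots> \<le> \<eta> / (2 * S) * S" using \<delta>(4) S by (intro mult_right_mono) auto
    also have "\<dots> = \<eta> / 2" using S by simp
    finally have 1: "norm (poly g z - poly f z) < \<eta> / 2" .
    have 2: "norm (poly f z - poly f a) < \<eta> / 2" using \<delta>1(2) z \<delta>(3) by auto
    show "norm (poly ((pderiv ^^ 0) g) z - poly ((pderiv ^^ 0) f) a) < \<eta>"
      using norm_diff_triangle_less[OF 1 2] by simp
  qed (rule \<delta>(1))
next
  case (Suc k)
  obtain \<delta>' where \<delta>': "\<delta>' > 0" "\<And>g z. degree g \<le> D \<Longrightarrow> (\<forall>i. norm (coeff g i - coeff (pderiv f) i) < \<delta>') \<Longrightarrow>
      norm (z - a) < \<delta>' \<Longrightarrow> norm (poly ((pderiv ^^ k) g) z - poly ((pderiv ^^ k) (pderiv f)) a) < \<eta>"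
    using Suc.IH[OF Suc.prems, of "pderiv f"] by blast
  \<comment> \<open>Differentiation multiplies the differences of the relevant coefficients by at
    most this factor.\<close>
  define E where "E = real (Suc (max D (degree f)))"
  have E: "E \<ge> 1" by (simp add: E_def)
  define \<delta> where "\<delta> = \<delta>' / E"
  have \<delta>: "\<delta> > 0" "\<delta> \<le> \<delta>'" using \<delta>'(1) E by (auto simp: \<delta>_def field_simps)
  show ?case
  proof (intro exI[of _ \<delta>] conjI allI impI)
    fix g :: "'a poly" and z :: 'a
    assume g: "degree g \<le> D" "\<forall>i. norm (coeff g i - coeff f i) < \<delta>" and z: "norm (z - a) < \<delta>"
    have "norm (poly ((pderiv ^^ k) (pderiv g)) z - poly ((pderiv ^^ k) (pderiv f)) a) < \<eta>"
    proof (rule \<delta>'(2))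
      show "degree (pderiv g) \<le> D" using g(1) by (simp add: degree_pderiv)
      show "norm (z - a) < \<delta>'" using z \<delta>(2) by linarith
      show "\<forall>i. norm (coeff (pderiv g) i - coeff (pderiv f) i) < \<delta>'"
      proof
        fix i
        show "norm (coeff (pderiv g) i - coeff (pderiv f) i) < \<delta>'"
        proof (cases "Suc i \<le> max D (degree f)")
          case True
          have "coeff (pderiv g) i - coeff (pderiv f) i = of_nat (Suc i) * (coeff g (Suc i) - coeff f (Suc i))"
            by (simp add: coeff_pderiv right_diff_distrib del: of_nat_Suc)
          then have "norm (coeff (pderiv g) i - coeff (pderiv f) i) = real (Suc i) * norm (coeff g (Suc i) - coeff f (Suc i))"
            by (simp only: norm_mult norm_of_nat)
          also have "\<dots> < real (Suc i) * \<delta>" using g(2) by (intro mult_strict_left_mono) auto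
          also have "\<dots> \<le> E * \<delta>" using True \<delta>(1) by (intro mult_right_mono) (auto simp: E_def)
          also have "\<dots> = \<delta>'" using E by (simp add: \<delta>_def)
          finally show ?thesis .
        next
          case False
          then have "coeff g (Suc i) = 0" "coeff f (Suc i) = 0" using g(1) by (auto intro!: coeff_eq_0)
          then show ?thesis using \<delta>'(1) by (simp add: coeff_pderiv)
        qed
      qed
    qed
    then show "norm (poly ((pderiv ^^ Suc k) g) z - poly ((pderiv ^^ Suc k) f) a) < \<eta>"
      by (simp only: funpow_Suc_right o_apply)
  qed (rule \<delta>(1))
qed

section \<open>Critical points and tangent vectors of the stratum\<close>

context critical_data
begin

text \<open>The first derivative of f, of order at least one, that does not vanish at c_i; it is
  non-zero because f' has a zero of exact order m_i there.\<close>

definition curv :: "nat \<Rightarrow> 'a" where "curv i = poly ((pderiv ^^ Suc (m i)) f) (c i)"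

lemma curv_nonzero: "curv i \<noteq> 0"
proof -
  have "(pderiv ^^ Suc (m i)) f = (pderiv ^^ m i) (pderiv f)" by (simp only: funpow_Suc_right o_apply)
  then show ?thesis
    using poly_pderiv_iterate_order[OF pderiv_f_nonzero, of "c i"] by (simp add: curv_def m_def multiplicity_crit_def)
qed

text \<open>The separation by 2\<epsilon> makes the labelling of nearby critical points unambiguous.
  The last condition keeps the derivative of order m_i + 1 close to a non-zero constant, so that the
  derivative of order m_i is injective near c_i for all nearby polynomials.\<close>

definition good :: "real \<Rightarrow> bool" where
  "good \<epsilon> \<longleftrightarrow> \<epsilon> > 0 \<and> (\<forall>i<p. \<forall>j<p. i \<noteq> j \<longrightarrow> 2 * \<epsilon> \<le> dist (c i) (c j)) \<and>
    (\<forall>i<p. \<forall>g z. degree g \<le> d \<longrightarrow> (\<forall>l. norm (coeff g l - coeff f l) < \<epsilon>) \<longrightarrow> norm (z - c i) < \<epsilon> \<longrightarrow>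
      norm (poly ((pderiv ^^ Suc (m i)) g) z - curv i) < norm (curv i) / 2)"

lemma eventually_good: "\<forall>\<^sub>F \<epsilon> in at_right 0. good \<epsilon>"
proof -
  have pos: "\<forall>\<^sub>F \<epsilon> in at_right (0::real). \<epsilon> > 0" by (simp add: eventually_at_right_less)
  have lt: "\<forall>\<^sub>F \<epsilon> in at_right (0::real). \<epsilon> < \<delta>" if "\<delta> > 0" for \<delta>
    using that eventually_at_right_field by blast
  have "\<forall>\<^sub>F \<epsilon> in at_right 0. \<forall>i\<in>{..<p}. \<forall>j\<in>{..<p}. i \<noteq> j \<longrightarrow> 2 * \<epsilon> \<le> dist (c i) (c j)"
  proof (intro eventually_ball_finite finite_lessThan ballI)
    fix i j assume ij: "i \<in> {..<p}" "j \<in> {..<p}"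
    show "\<forall>\<^sub>F \<epsilon> in at_right 0. i \<noteq> j \<longrightarrow> 2 * \<epsilon> \<le> dist (c i) (c j)"
    proof (cases "i = j")
      case False
      then have "dist (c i) (c j) / 2 > 0" using inj_c ij by (auto simp: inj_on_def)
      from lt[OF this] show ?thesis by eventually_elim auto
    qed simp
  qed
  moreover have "\<forall>\<^sub>F \<epsilon> in at_right 0. \<forall>i\<in>{..<p}. \<forall>g z. degree g \<le> d \<longrightarrow> (\<forall>l. norm (coeff g l - coeff f l) < \<epsilon>) \<longrightarrow>
      norm (z - c i) < \<epsilon> \<longrightarrow> norm (poly ((pderiv ^^ Suc (m i)) g) z - curv i) < norm (curv i) / 2"
  proof (intro eventually_ball_finite finite_lessThan ballI)
    fix i assume "i \<in> {..<p}"
    obtain \<delta> where \<delta>: "\<delta> > 0" "\<And>g z. degree g \<le> d \<Longrightarrow> (\<forall>l. norm (coeff g l - coeff f l) < \<delta>) \<Longrightarrow> norm (z - c i) < \<delta> \<Longrightarrow>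
        norm (poly ((pderiv ^^ Suc (m i)) g) z - curv i) < norm (curv i) / 2"
      using poly_pderiv_iterate_perturbation[of "norm (curv i) / 2" d f "c i" "Suc (m i)"] curv_nonzero[of i]
      unfolding curv_def by (metis half_gt_zero zero_less_norm_iff)
    from lt[OF \<delta>(1)] show "\<forall>\<^sub>F \<epsilon> in at_right 0. \<forall>g z. degree g \<le> d \<longrightarrow> (\<forall>l. norm (coeff g l - coeff f l) < \<epsilon>) \<longrightarrow>
        norm (z - c i) < \<epsilon> \<longrightarrow> norm (poly ((pderiv ^^ Suc (m i)) g) z - curv i) < norm (curv i) / 2"
    proof eventually_elim
      case (elim \<epsilon>)
      then show ?case using \<delta>(2) less_trans[OF _ elim] by blast
    qed
  qed
  ultimately show ?thesis using pos by eventually_elim (auto simp: good_def)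
qed

lemma good_curv:
  assumes "good \<epsilon>" "i < p" "degree g \<le> d" "\<And>l. norm (coeff g l - coeff f l) < \<epsilon>" "norm (z - c i) < \<epsilon>"
  shows "norm (poly ((pderiv ^^ Suc (m i)) g) z - curv i) < norm (curv i) / 2"
proof -
  have "\<forall>g z. degree g \<le> d \<longrightarrow> (\<forall>l. norm (coeff g l - coeff f l) < \<epsilon>) \<longrightarrow> norm (z - c i) < \<epsilon> \<longrightarrow>
      norm (poly ((pderiv ^^ Suc (m i)) g) z - curv i) < norm (curv i) / 2"
    using assms(1,2) unfolding good_def by blast
  from this[rule_format, OF assms(3,4,5)] show ?thesis .
qed

lemma stratum_degree:
  assumes "g \<in> stratum \<epsilon> f p c"
  shows "degree g = d" "coeff g d = 1" "coeff g (d - 1) = 0" "\<And>l. norm (coeff g l - coeff f l) < \<epsilon>"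
  using assms by (auto simp: stratum_def monic_centered_def d_def)

text \<open>Any critical point close to c_i is one of the labelled points c'_j, hence close to c_j
  as well, and the separation forces j = i. So the definite description in \<open>crit_near\<close>
  has a unique solution.\<close>

lemma crit_near_unique:
  assumes good: "good \<epsilon>" and g: "g \<in> stratum \<epsilon> f p c" and i: "i < p"
    and z: "z \<in> critical_points g" "dist z (c i) < \<epsilon>"
  shows "crit_near \<epsilon> c g i = z"
proof -
  obtain c' where c': "bij_betw c' {..<p} (critical_points g)" "\<And>i. i < p \<Longrightarrow> dist (c' i) (c i) < \<epsilon>"
    using g by (auto simp: stratum_def)
  have "w = c' i" if w: "w \<in> critical_points g" "dist w (c i) < \<epsilon>" for w
  proof -
    obtain j where j: "j < p" "w = c' j" using w(1) c'(1) by (auto simp: bij_betw_def)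
    have "dist (c i) (c j) < 2 * \<epsilon>"
      using dist_triangle2[of "c i" "c j" w] w(2) c'(2)[OF j(1)] j(2) by (simp add: dist_commute)
    then have "\<not> 2 * \<epsilon> \<le> dist (c i) (c j)" by simp
    then have "i = j" using good i j(1) unfolding good_def by blast
    then show ?thesis using j by simp
  qed
  note uniq = this
  have eqz: "w = z" if "w \<in> critical_points g" "dist w (c i) < \<epsilon>" for w
    using uniq[OF that] uniq[OF z] by simp
  show ?thesis unfolding crit_near_def
  proof (rule the_equality)
    show "z \<in> critical_points g \<and> dist z (c i) < \<epsilon>" using z by blast
    show "\<And>w. w \<in> critical_points g \<and> dist w (c i) < \<epsilon> \<Longrightarrow> w = z" using eqz by blast
  qed
qed

lemma crit_near_stratum:
  assumes good: "good \<epsilon>" and g: "g \<in> stratum \<epsilon> f p c"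
  shows "bij_betw (crit_near \<epsilon> c g) {..<p} (critical_points g)"
    and "\<And>i. i < p \<Longrightarrow> dist (crit_near \<epsilon> c g i) (c i) < \<epsilon>"
    and "\<And>i. i < p \<Longrightarrow> multiplicity_crit g (crit_near \<epsilon> c g i) = m i"
proof -
  obtain c' where c': "bij_betw c' {..<p} (critical_points g)" "\<And>i. i < p \<Longrightarrow> dist (c' i) (c i) < \<epsilon>"
      "\<And>i. i < p \<Longrightarrow> multiplicity_crit g (c' i) = m i"
    using g unfolding stratum_def m_def by blast
  have eq: "crit_near \<epsilon> c g i = c' i" if "i < p" for i
  proof (rule crit_near_unique[OF good g that])
    show "c' i \<in> critical_points g" using c'(1) that by (auto simp: bij_betw_def)
    show "dist (c' i) (c i) < \<epsilon>" by (rule c'(2)[OF that])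
  qed
  show "bij_betw (crit_near \<epsilon> c g) {..<p} (critical_points g)"
    using c'(1) bij_betw_cong[of "{..<p}" "crit_near \<epsilon> c g" c'] eq by simp
  show "\<And>i. i < p \<Longrightarrow> dist (crit_near \<epsilon> c g i) (c i) < \<epsilon>" using eq c'(2) by simp
  show "\<And>i. i < p \<Longrightarrow> multiplicity_crit g (crit_near \<epsilon> c g i) = m i" using eq c'(3) by simp
qed

lemma f_in_stratum: "\<epsilon> > 0 \<Longrightarrow> f \<in> stratum \<epsilon> f p c"
  using bij centered by (auto simp: stratum_def monic_centered_def monic intro!: exI[of _ c])

lemma crit_near_f: "good \<epsilon> \<Longrightarrow> i < p \<Longrightarrow> crit_near \<epsilon> c f i = c i"
  using bij f_in_stratum by (intro crit_near_unique) (auto simp: good_def bij_betw_def)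

lemma stratum_pderiv_root:
  assumes good: "good \<epsilon>" and g: "g \<in> stratum \<epsilon> f p c" and i: "i < p" and l: "1 \<le> l" "l \<le> m i"
  shows "poly ((pderiv ^^ l) g) (crit_near \<epsilon> c g i) = 0"
proof -
  obtain l' where l': "l = Suc l'" using l(1) by (cases l) auto
  have "pderiv g \<noteq> 0" using stratum_degree(1)[OF g] d2 by (simp add: pderiv_eq_0_iff)
  then have "poly ((pderiv ^^ l') (pderiv g)) (crit_near \<epsilon> c g i) = 0"
    using crit_near_stratum(3)[OF good g i] l l'
    by (intro poly_pderiv_iterate_eq_0) (auto simp: multiplicity_crit_def)
  then show ?thesis by (simp only: l' funpow_Suc_right o_apply)
qed

text \<open>After subtraction of the linear map with slope \<open>curv i\<close>, the derivative of
  order m_i has Lipschitz constant at most half of |curv i|; so it cannot bring points closer than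
  by the factor left over.\<close>

lemma pderiv_expanding:
  assumes good: "good \<epsilon>" and g: "g \<in> stratum \<epsilon> f p c" and i: "i < p"
    and zw: "dist z (c i) < \<epsilon>" "dist w (c i) < \<epsilon>"
  shows "norm (curv i) / 2 * norm (z - w) \<le> norm (poly ((pderiv ^^ m i) g) z - poly ((pderiv ^^ m i) g) w)"
proof -
  define q where "q = (pderiv ^^ m i) g"
  have "norm ((poly q z - curv i * z) - (poly q w - curv i * w)) \<le> norm (curv i) / 2 * norm (z - w)"
  proof (rule field_differentiable_bound[where S="ball (c i) \<epsilon>" and f="\<lambda>z. poly q z - curv i * z"
        and f'="\<lambda>z. poly (pderiv q) z - curv i"])
    show "((\<lambda>z. poly q z - curv i * z) has_field_derivative poly (pderiv q) z - curv i) (at z within ball (c i) \<epsilon>)" for z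
      by (rule has_field_derivative_at_within) (rule DERIV_diff[OF poly_DERIV DERIV_cmult_Id])
    show "norm (poly (pderiv q) z - curv i) \<le> norm (curv i) / 2" if "z \<in> ball (c i) \<epsilon>" for z
    proof -
      have "norm (z - c i) < \<epsilon>" using that by (simp add: dist_norm norm_minus_commute)
      from good_curv[OF good i _ stratum_degree(4)[OF g] this] show ?thesis
        using stratum_degree(1)[OF g] by (simp add: q_def)
    qed
  qed (use zw in \<open>auto simp: dist_commute\<close>)
  moreover have "norm (curv i * (z - w)) \<le> norm ((poly q z - curv i * z) - (poly q w - curv i * w)) + norm (poly q z - poly q w)"
  proof -
    have "curv i * (z - w) = (poly q z - poly q w) - ((poly q z - curv i * z) - (poly q w - curv i * w))"
      by (simp add: algebra_simps)
    then show ?thesis using norm_triangle_ineq4[of "poly q z - poly q w" "(poly q z - curv i * z) - (poly q w - curv i * w)"]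
      by (simp add: add.commute)
  qed
  ultimately show ?thesis by (simp add: q_def norm_mult)
qed

text \<open>In the stratum, \<open>c\<^sub>i(g)\<close> is a simple root of the \<open>m\<^sub>i\<close>-th derivative of \<open>g\<close>.\<close>

lemma crit_near_differentiable:
  assumes good: "good \<epsilon>" and ev: "\<forall>\<^sub>F t in nhds t0. g t \<in> stratum \<epsilon> f p c"
    and g: "\<And>i. (\<lambda>t. coeff (g t) i) field_differentiable (at t0)" and i: "i < p"
  shows "(\<lambda>t. crit_near \<epsilon> c (g t) i) field_differentiable (at t0)"
proof -
  have g0: "g t0 \<in> stratum \<epsilon> f p c" using ev by (rule eventually_nhds_x_imp_x)
  have ev': "\<forall>\<^sub>F t in at t0. g t \<in> stratum \<epsilon> f p c" using ev by (simp add: eventually_nhds_conv_at)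
  define q where "q t = (pderiv ^^ m i) (g t)" for t
  define X where "X t = crit_near \<epsilon> c (g t) i" for t
  have mi: "1 \<le> m i" using m_pos[OF i] by simp
  have qdiff: "(\<lambda>t. coeff ((pderiv ^^ l) (g t)) j) field_differentiable (at t0)" for l j
  proof (induction l arbitrary: j)
    case (Suc l)
    have "(\<lambda>t. of_nat (Suc j) * coeff ((pderiv ^^ l) (g t)) (Suc j)) field_differentiable (at t0)"
      by (rule field_differentiable_mult[OF field_differentiable_const Suc])
    then show ?case by (simp add: coeff_pderiv del: of_nat_Suc)
  qed (use g in simp)
  have degq: "degree (q t) \<le> d" if "g t \<in> stratum \<epsilon> f p c" for t
    using degree_pderiv_iterate[of "m i" "g t"] stratum_degree(1)[OF that] by (simp add: q_def)
  have root: "poly (q t) (X t) = 0" if "g t \<in> stratum \<epsilon> f p c" for t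
    using stratum_pderiv_root[OF good that i mi] by (simp add: q_def X_def)
  \<comment> \<open>Continuity comes from expansion: the distance of the roots is controlled by the
    value of q_t at the old root \<open>X t0\<close>, and this value \<open>k t\<close> tends to
    zero with the coefficients.\<close>
  have Xlim: "(X \<longlongrightarrow> X t0) (at t0)"
  proof -
    define k where "k t = (\<Sum>j\<le>d. (coeff (q t) j - coeff (q t0) j) * X t0 ^ j)" for t
    have clim: "((\<lambda>t. coeff (q t) j) \<longlongrightarrow> coeff (q t0) j) (at t0)" for j
      using field_differentiable_imp_continuous_at[OF qdiff] unfolding q_def by (simp add: continuous_at)
    have "(k \<longlongrightarrow> (\<Sum>j\<le>d. (coeff (q t0) j - coeff (q t0) j) * X t0 ^ j)) (at t0)"
      unfolding k_def by (intro tendsto_intros clim)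
    then have "(k \<longlongrightarrow> 0) (at t0)" by simp
    then have "((\<lambda>t. 2 / norm (curv i) * norm (k t)) \<longlongrightarrow> 2 / norm (curv i) * 0) (at t0)"
      by (intro tendsto_mult_left tendsto_norm_zero)
    then have klim: "((\<lambda>t. 2 / norm (curv i) * norm (k t)) \<longlongrightarrow> 0) (at t0)"
      unfolding mult_zero_right .
    have kle: "\<forall>\<^sub>F t in at t0. norm (X t - X t0) \<le> 2 / norm (curv i) * norm (k t)"
      using ev'
    proof eventually_elim
      case (elim t)
      have "k t = poly (q t) (X t0) - poly (q t0) (X t0)"
        unfolding k_def poly_eq_sum_coeff[OF degq[OF elim]] poly_eq_sum_coeff[OF degq[OF g0]]
        by (simp add: left_diff_distrib sum_subtractf)
      then have k: "norm (k t) = norm (poly (q t) (X t) - poly (q t) (X t0))"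
        using root[OF elim] root[OF g0] by simp
      have "norm (curv i) / 2 * norm (X t - X t0) \<le> norm (k t)"
        unfolding k q_def X_def
        by (rule pderiv_expanding[OF good elim i]) (use crit_near_stratum(2)[OF good _ i] elim g0 in auto)
      then show ?case using curv_nonzero[of i] by (simp add: field_simps)
    qed
    have "((\<lambda>t. X t - X t0) \<longlongrightarrow> 0) (at t0)"
      by (rule Lim_null_comparison[OF kle klim])
    then show ?thesis by (rule LIM_zero_cancel)
  qed
  have nz: "poly (pderiv (q t0)) (X t0) \<noteq> 0"
  proof
    assume z: "poly (pderiv (q t0)) (X t0) = 0"
    have "norm (X t0 - c i) < \<epsilon>" using crit_near_stratum(2)[OF good g0 i] by (simp add: X_def dist_norm)
    from good_curv[OF good i _ stratum_degree(4)[OF g0] this] show False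
      using z stratum_degree(1)[OF g0] by (simp add: q_def)
  qed
  have "X field_differentiable (at t0)"
  proof (rule simple_root_curve_differentiable[where q=q and D=d, OF _ _ degq[OF g0] _ root[OF g0] Xlim nz])
    show "(\<lambda>t. coeff (q t) j) field_differentiable (at t0)" for j unfolding q_def by (rule qdiff)
    show "\<forall>\<^sub>F t in at t0. degree (q t) \<le> d" using ev' by eventually_elim (rule degq)
    show "\<forall>\<^sub>F t in at t0. poly (q t) (X t) = 0" using ev' by eventually_elim (rule root)
  qed
  then show ?thesis unfolding X_def[abs_def] .
qed

text \<open>The tangent space of the stratum at f. Order l = 0 is left free, since the values at c_i
  are the coordinates; order l = m_i is absent because that equation only determines the velocity of
  the critical point.\<close>

definition tangent :: "'a poly \<Rightarrow> bool" where
  "tangent u \<longleftrightarrow> degree u \<le> d - 2 \<and> (\<forall>i<p. \<forall>l. 1 \<le> l \<and> l < m i \<longrightarrow> poly ((pderiv ^^ l) u) (c i) = 0)"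

lemma poly_vanishing_on_critical_divisor:
  assumes u: "degree u \<le> d - 2" "\<And>i l. i < p \<Longrightarrow> l < m i \<Longrightarrow> poly ((pderiv ^^ l) u) (c i) = 0"
  shows "u = 0"
proof (rule ccontr)
  assume u0: "u \<noteq> 0"
  have "crit_prod c dvd u"
    unfolding crit_prod_def using inj_c u0 u(2) by (intro prod_linear_powers_dvd order_geI) auto
  from dvd_imp_degree_le[OF this u0] degree_crit_prod[of c] u(1) d2 show False by simp
qed

lemma tangent_eqI:
  assumes "tangent u" "tangent u'" "\<And>i. i < p \<Longrightarrow> poly u (c i) = poly u' (c i)"
  shows "u = u'"
proof -
  have pdiff: "(pderiv ^^ l) (u - u') = (pderiv ^^ l) u - (pderiv ^^ l) u'" for l
    by (induction l) (auto simp: pderiv_diff)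
  have "u - u' = 0"
  proof (rule poly_vanishing_on_critical_divisor)
    show "degree (u - u') \<le> d - 2" using assms(1,2) degree_diff_le by (auto simp: tangent_def)
    fix i l assume i: "i < p" and l: "l < m i"
    show "poly ((pderiv ^^ l) (u - u')) (c i) = 0"
      using assms i l by (cases "l = 0") (auto simp: pdiff tangent_def)
  qed
  then show ?thesis by simp
qed

text \<open>Differentiating g_t^(l)(c_i(t)) = 0 gives u^(l)(c_i) plus a multiple of f^(l+1)(c_i),
  which vanishes for l < m_i. For l = 0 the motion of the critical point drops out because f'(c_i) =
  0, so the critical value moves with velocity u(c_i). The two top coefficients are constant on the
  stratum.\<close>

lemma curve_velocity:
  assumes good: "good \<epsilon>" and ev: "\<forall>\<^sub>F t in nhds t0. g t \<in> stratum \<epsilon> f p c" and g0: "g t0 = f"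
    and g: "\<And>i. ((\<lambda>t. coeff (g t) i) has_field_derivative coeff u i) (at t0)"
  shows "tangent u"
    and "\<And>i. i < p \<Longrightarrow> ((\<lambda>t. poly (g t) (crit_near \<epsilon> c (g t) i)) has_field_derivative poly u (c i)) (at t0)"
proof -
  have ev': "\<forall>\<^sub>F t in at t0. g t \<in> stratum \<epsilon> f p c" using ev by (simp add: eventually_nhds_conv_at)
  have const: "coeff u i = 0" if "\<And>h. h \<in> stratum \<epsilon> f p c \<Longrightarrow> coeff h i = k" for i k
  proof -
    have "((\<lambda>_. k) has_field_derivative coeff u i) (at t0)"
    proof (rule has_field_derivative_transform_eventually[OF g])
      show "\<forall>\<^sub>F t in at t0. coeff (g t) i = k" using ev' by eventually_elim (rule that)
      show "coeff (g t0) i = k" using eventually_nhds_x_imp_x[OF ev] by (rule that)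
    qed
    from DERIV_unique[OF this DERIV_const] show ?thesis .
  qed
  have du: "degree u \<le> d - 2"
  proof (rule degree_le, intro allI impI)
    fix i assume "d - 2 < i"
    then consider "i = d - 1" | "i = d" | "i > d" by linarith
    then show "coeff u i = 0"
    proof cases
      case 3
      then show ?thesis using stratum_degree(1) by (intro const[of i 0]) (auto intro: coeff_eq_0)
    qed (use const[of i 0] const[of i 1] stratum_degree in simp_all)
  qed
  have Xd: "(\<lambda>t. crit_near \<epsilon> c (g t) i) field_differentiable (at t0)" if "i < p" for i
    using crit_near_differentiable[OF good ev _ that] g unfolding field_differentiable_def by blast
  have X0: "crit_near \<epsilon> c (g t0) i = c i" if "i < p" for i using crit_near_f[OF good that] g0 by simp
  have der: "((\<lambda>t. poly ((pderiv ^^ l) (g t)) (crit_near \<epsilon> c (g t) i)) has_field_derivative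
      poly ((pderiv ^^ l) u) (c i) + poly ((pderiv ^^ Suc l) f) (c i) * X') (at t0)"
    if "((\<lambda>t. crit_near \<epsilon> c (g t) i) has_field_derivative X') (at t0)" "i < p" for l i X'
  proof -
    have dg: "degree ((pderiv ^^ l) (g t)) \<le> d" if "g t \<in> stratum \<epsilon> f p c" for t
      using degree_pderiv_iterate[of l "g t"] stratum_degree(1)[OF that] by simp
    have "((\<lambda>t. poly ((pderiv ^^ l) (g t)) (crit_near \<epsilon> c (g t) i)) has_field_derivative
      poly ((pderiv ^^ l) u) (crit_near \<epsilon> c (g t0) i) + poly (pderiv ((pderiv ^^ l) (g t0))) (crit_near \<epsilon> c (g t0) i) * X') (at t0)"
    proof (rule DERIV_poly_curve[where D=d, OF coeff_pderiv_iterate_DERIV[OF g] _ _ _ that(1)])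
      show "\<forall>\<^sub>F t in at t0. degree ((pderiv ^^ l) (g t)) \<le> d" using ev' by eventually_elim (rule dg)
      show "degree ((pderiv ^^ l) (g t0)) \<le> d" using eventually_nhds_x_imp_x[OF ev] by (rule dg)
      show "degree ((pderiv ^^ l) u) \<le> d" using degree_pderiv_iterate[of l u] du by simp
    qed
    then show ?thesis using X0[OF that(2)] g0 by simp
  qed
  show "((\<lambda>t. poly (g t) (crit_near \<epsilon> c (g t) i)) has_field_derivative poly u (c i)) (at t0)" if i: "i < p" for i
  proof -
    obtain X' where "((\<lambda>t. crit_near \<epsilon> c (g t) i) has_field_derivative X') (at t0)"
      using Xd[OF i] unfolding field_differentiable_def by blast
    from der[OF this i, of 0] show ?thesis using crit_c[OF i] by simp
  qed
  show "tangent u"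
    unfolding tangent_def
  proof (intro conjI allI impI du)
    fix i l assume i: "i < p" and l: "1 \<le> l \<and> l < m i"
    obtain X' where X': "((\<lambda>t. crit_near \<epsilon> c (g t) i) has_field_derivative X') (at t0)"
      using Xd[OF i] unfolding field_differentiable_def by blast
    have "poly ((pderiv ^^ Suc l) f) (c i) = 0"
      using stratum_pderiv_root[OF good f_in_stratum i, of "Suc l"] l crit_near_f[OF good i] good by (simp add: good_def)
    then have d1: "((\<lambda>t. poly ((pderiv ^^ l) (g t)) (crit_near \<epsilon> c (g t) i)) has_field_derivative
        poly ((pderiv ^^ l) u) (c i)) (at t0)"
      using der[OF X' i, of l] by (simp del: funpow.simps)
    have z: "poly ((pderiv ^^ l) (g t)) (crit_near \<epsilon> c (g t) i) = 0" if "g t \<in> stratum \<epsilon> f p c" for t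
      using stratum_pderiv_root[OF good that i] l by simp
    have "((\<lambda>_. 0) has_field_derivative poly ((pderiv ^^ l) u) (c i)) (at t0)"
    proof (rule has_field_derivative_transform_eventually[OF d1])
      show "\<forall>\<^sub>F t in at t0. poly ((pderiv ^^ l) (g t)) (crit_near \<epsilon> c (g t) i) = 0"
        using ev' by eventually_elim (rule z)
      show "poly ((pderiv ^^ l) (g t0)) (crit_near \<epsilon> c (g t0) i) = 0"
        using eventually_nhds_x_imp_x[OF ev] by (rule z)
    qed
    from DERIV_unique[OF this DERIV_const] show "poly ((pderiv ^^ l) u) (c i) = 0" .
  qed
qed

text \<open>The partial sums of \<open>limit_speed\<close>. Index \<open>q\<close> belongs to the
  iterate of order q + 1 at c_j, that is, to f^q at the critical value.\<close>

definition speed :: "'a poly \<Rightarrow> nat \<Rightarrow> nat \<Rightarrow> 'a" where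
  "speed u j q = poly u (c j) + (\<Sum>n<q. poly u ((poly f ^^ n) (poly f (c j))) / iter_deriv f (Suc n) (poly f (c j)))"

text \<open>If y_q denotes the moving orbit point, the derivative obeys y_{q+1}' = u(y_q) + f'(y_q)
  y_q'. Division by (f^{q+1})' at the critical value turns this recursion into a sum.\<close>

lemma orbit_derivative:
  assumes good: "good \<epsilon>" and ev: "\<forall>\<^sub>F t in nhds t0. g t \<in> stratum \<epsilon> f p c" and g0: "g t0 = f"
    and g: "\<And>i. ((\<lambda>t. coeff (g t) i) has_field_derivative coeff u i) (at t0)" and j: "j < p"
    and nz: "\<And>n. iter_deriv f n (poly f (c j)) \<noteq> 0"
  shows "((\<lambda>t. (poly (g t) ^^ Suc q) (crit_near \<epsilon> c (g t) j)) has_field_derivative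
    iter_deriv f q (poly f (c j)) * speed u j q) (at t0)"
proof (induction q)
  case 0
  show ?case using curve_velocity(2)[OF good ev g0 g j] by (simp add: speed_def)
next
  case (Suc q)
  have ev': "\<forall>\<^sub>F t in at t0. g t \<in> stratum \<epsilon> f p c" using ev by (simp add: eventually_nhds_conv_at)
  let ?v = "poly f (c j)" and ?y = "\<lambda>t. (poly (g t) ^^ Suc q) (crit_near \<epsilon> c (g t) j)"
  have y0: "?y t0 = (poly f ^^ q) ?v"
    unfolding g0 crit_near_f[OF good j] by (simp only: funpow_Suc_right o_apply)
  have "((\<lambda>t. poly (g t) (?y t)) has_field_derivative poly u (?y t0) + poly (pderiv (g t0)) (?y t0)
      * (iter_deriv f q ?v * speed u j q)) (at t0)"
  proof (rule DERIV_poly_curve[where D=d, OF g _ _ _ Suc])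
    show "\<forall>\<^sub>F t in at t0. degree (g t) \<le> d" using ev' by eventually_elim (simp add: stratum_degree(1))
    show "degree (g t0) \<le> d" using g0 by (simp add: d_def)
    have "degree u \<le> d - 2" using curve_velocity(1)[OF good ev g0 g] by (simp add: tangent_def)
    then show "degree u \<le> d" by linarith
  qed
  moreover have "poly u (?y t0) + poly (pderiv (g t0)) (?y t0) * (iter_deriv f q ?v * speed u j q)
      = iter_deriv f (Suc q) ?v * speed u j (Suc q)"
    unfolding y0 unfolding g0 using nz[of "Suc q"]
    by (simp add: speed_def distrib_left iter_deriv_Suc mult.assoc)
  ultimately show ?case by simp
qed

lemma speed_tendsto:
  assumes "weakly_expanding f (c j)"
  shows "speed u j \<longlonglongrightarrow> limit_speed f u (c j)"
proof -
  have "summable (\<lambda>n. poly u ((poly f ^^ n) (poly f (c j))) / iter_deriv f (Suc n) (poly f (c j)))"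
    by (rule summable_norm_cancel[OF summable_along_orbit[OF deg monic assms]])
  from tendsto_add[OF tendsto_const summable_LIMSEQ[OF this]] show ?thesis
    unfolding speed_def[abs_def] limit_speed_def .
qed

end

section \<open>Critical values as local coordinates\<close>

lemma poly_of_coeffs:
  fixes a :: "nat \<Rightarrow> 'a::comm_monoid_add"
  assumes "\<And>i. i > D \<Longrightarrow> a i = 0"
  obtains u where "\<And>i. coeff u i = a i" "degree u \<le> D"
proof (rule that[of "\<Sum>i\<le>D. monom (a i) i"])
  show c: "coeff (\<Sum>i\<le>D. monom (a i) i) i = a i" for i
    using assms[of i] by (auto simp: coeff_sum)
  show "degree (\<Sum>i\<le>D. monom (a i) i) \<le> D"
    by (rule degree_le) (simp add: c assms)
qed

context critical_data
begin

lemma G_pderiv_root: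
  assumes i: "i < p" and l: "1 \<le> l" "l \<le> m i"
  shows "poly ((pderiv ^^ l) (G x)) (x i) = 0"
proof -
  obtain l' where l': "l = Suc l'" using l(1) by (cases l) auto
  have pd0: "pderiv (G x) \<noteq> 0" using degree_G[of x] d2 by (simp add: pderiv_eq_0_iff)
  have "[:- x i, 1:] ^ m i dvd crit_prod x"
    unfolding crit_prod_def using i by (intro dvd_prodI) auto
  then have "[:- x i, 1:] ^ m i dvd pderiv (G x)" unfolding pderiv_G by (rule dvd_smult)
  then have "m i \<le> order (x i) (pderiv (G x))" using pd0 by (simp add: order_divides)
  then have "poly ((pderiv ^^ l') (pderiv (G x))) (x i) = 0"
    using l l' by (intro poly_pderiv_iterate_eq_0[OF pd0]) simp
  then show ?thesis by (simp only: l' funpow_Suc_right o_apply)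
qed

lemma G_curve_coeffs:
  fixes x :: "'a \<Rightarrow> nat \<Rightarrow> 'a"
  assumes x0: "x s0 = base" and x: "\<And>i. i < Suc p \<Longrightarrow> ((\<lambda>s. x s i) has_field_derivative x' i) (at s0)"
  obtains u where "\<And>i. ((\<lambda>s. coeff (G (x s)) i) has_field_derivative coeff u i) (at s0)" "degree u \<le> d"
proof -
  have "\<exists>A. has_strict_deriv (\<lambda>x. coeff (G x) i) A (Suc p) base" for i
    using strictly_differentiable_coeff_G by (simp add: strictly_differentiable_def)
  then obtain A where A: "\<And>i. has_strict_deriv (\<lambda>x. coeff (G x) i) (A i) (Suc p) base" by metis
  define a where "a i = (if i \<le> d then \<Sum>j<Suc p. A i j * x' j else 0)" for i
  obtain u where u: "\<And>i. coeff u i = a i" "degree u \<le> d"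
    using poly_of_coeffs[of d a] by (auto simp: a_def)
  have "((\<lambda>s. coeff (G (x s)) i) has_field_derivative coeff u i) (at s0)" for i
  proof (cases "i \<le> d")
    case True
    then show ?thesis using has_strict_deriv_curve[OF A x0 x, of i] by (simp add: u a_def del: sum.lessThan_Suc)
  next
    case False
    then show ?thesis by (simp add: u a_def coeff_G_above)
  qed
  then show ?thesis using that u(2) by blast
qed

text \<open>A vector in the kernel of the differential of \<open>\<Phi>\<close> gives a velocity \<open>u\<close> of degree at most
  \<open>d - 2\<close> vanishing on the critical divisor, of degree \<open>d - 1\<close>.\<close>

lemma \<Phi>_differential_injective:
  assumes A: "\<And>i. i < Suc p \<Longrightarrow> has_strict_deriv (\<lambda>x. \<Phi> x i) (A i) (Suc p) base"
    and zero: "\<And>i. i < Suc p \<Longrightarrow> (\<Sum>j<Suc p. A i j * \<xi> j) = 0"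
  shows "\<forall>j<Suc p. \<xi> j = 0"
proof -
  define x where "x s i = base i + s * \<xi> i" for s i
  have x0: "x 0 = base" by (simp add: x_def fun_eq_iff)
  have xd: "((\<lambda>s. x s i) has_field_derivative \<xi> i) (at 0)" for i
    unfolding x_def by (auto intro!: derivative_eq_intros)
  obtain u where u: "\<And>i. ((\<lambda>s. coeff (G (x s)) i) has_field_derivative coeff u i) (at 0)" and du: "degree u \<le> d"
    using G_curve_coeffs[OF x0 xd] by blast
  have xc: "x 0 i = c i" if "i < p" for i using that by (simp add: x0 base_def)
  have Gf: "G (x 0) = f" using f_eq_G by (simp add: x0)
  have der: "((\<lambda>s. poly ((pderiv ^^ l) (G (x s))) (x s i)) has_field_derivative
      poly ((pderiv ^^ l) u) (c i) + poly ((pderiv ^^ Suc l) f) (c i) * \<xi> i) (at 0)" if i: "i < p" for i l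
  proof -
    have "((\<lambda>s. poly ((pderiv ^^ l) (G (x s))) (x s i)) has_field_derivative
      poly ((pderiv ^^ l) u) (x 0 i) + poly (pderiv ((pderiv ^^ l) (G (x 0)))) (x 0 i) * \<xi> i) (at 0)"
    proof (rule DERIV_poly_curve[where D=d, OF coeff_pderiv_iterate_DERIV[OF u] _ _ _ xd])
      have "degree ((pderiv ^^ l) (G (x t))) \<le> d" for t
        using degree_pderiv_iterate[of l "G (x t)"] by (simp add: degree_G)
      then show "\<forall>\<^sub>F t in at 0. degree ((pderiv ^^ l) (G (x t))) \<le> d" "degree ((pderiv ^^ l) (G (x 0))) \<le> d" by auto
      show "degree ((pderiv ^^ l) u) \<le> d" using degree_pderiv_iterate[of l u] du by simp
    qed
    then show ?thesis using xc[OF i] Gf by simp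
  qed
  \<comment> \<open>The prescribed zeros persist along the line. Orders below m_i give conditions on
    \<open>u\<close> alone; order m_i ties \<open>\<xi> i\<close> to \<open>u\<close>.\<close>
  have crit0: "poly ((pderiv ^^ l) u) (c i) + poly ((pderiv ^^ Suc l) f) (c i) * \<xi> i = 0"
    if "i < p" "1 \<le> l" "l \<le> m i" for i l
  proof -
    have "(\<lambda>s. poly ((pderiv ^^ l) (G (x s))) (x s i)) = (\<lambda>_. 0)" using G_pderiv_root[OF that] by auto
    with der[OF that(1), of l]
    have "((\<lambda>_. 0) has_field_derivative poly ((pderiv ^^ l) u) (c i) + poly ((pderiv ^^ Suc l) f) (c i) * \<xi> i) (at 0)"
      by (simp only:)
    from DERIV_unique[OF this DERIV_const] show ?thesis .
  qed
  have f0: "poly ((pderiv ^^ l) f) (c i) = 0" if "i < p" "1 \<le> l" "l \<le> m i" for i l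
    using G_pderiv_root[OF that, of base] that(1) f_eq_G by (simp add: base_def)
  have val0: "poly u (c i) = 0" if i: "i < p" for i
  proof -
    have "((\<lambda>s. \<Phi> (x s) i) has_field_derivative (\<Sum>j<Suc p. A i j * \<xi> j)) (at 0)"
      by (rule has_strict_deriv_curve[OF A x0 xd]) (use i in simp)
    then have "((\<lambda>s. poly (G (x s)) (x s i)) has_field_derivative 0) (at 0)"
      using zero[of i] i by (simp add: \<Phi>_def del: sum.lessThan_Suc)
    from DERIV_unique[OF der[OF i, of 0, simplified] this] show ?thesis using crit_c[OF i] by simp
  qed
  \<comment> \<open>The coefficient of degree d - 1 vanishes by the last component of the kernel
    equation, and that of degree d because all \<open>G x\<close> are monic.\<close>
  have du2: "degree u \<le> d - 2"
  proof (rule degree_le, intro allI impI)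
    fix i assume "d - 2 < i"
    then consider "i = d - 1" | "i = d" | "i > d" by linarith
    then show "coeff u i = 0"
    proof cases
      case 1
      have "((\<lambda>s. \<Phi> (x s) p) has_field_derivative (\<Sum>j<Suc p. A p j * \<xi> j)) (at 0)"
        by (rule has_strict_deriv_curve[OF A x0 xd]) simp
      then have "((\<lambda>s. coeff (crit_prod (x s)) (d - 2)) has_field_derivative 0) (at 0)"
        using zero[of p] by (simp add: \<Phi>_def del: sum.lessThan_Suc)
      from DERIV_cmult[OF this, of "of_nat d / of_nat (d - 1)"]
      have "((\<lambda>s. coeff (G (x s)) i) has_field_derivative 0) (at 0)"
        unfolding 1 coeff_G_centered by simp
      from DERIV_unique[OF u this] show ?thesis .
    next
      case 2
      have "(\<lambda>s. coeff (G (x s)) i) = (\<lambda>_. 1)" using 2 coeff_G_d by auto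
      then show ?thesis using DERIV_unique[OF u[of i]] DERIV_const by metis
    next
      case 3
      then show ?thesis using du by (intro coeff_eq_0) simp
    qed
  qed
  have u0: "u = 0"
  proof (rule poly_vanishing_on_critical_divisor[OF du2])
    fix i l assume i: "i < p" and l: "l < m i"
    show "poly ((pderiv ^^ l) u) (c i) = 0"
    proof (cases "l = 0")
      case False
      then show ?thesis using crit0[OF i, of l] f0[OF i, of "Suc l"] l by (simp del: funpow.simps)
    qed (use val0[OF i] in simp)
  qed
  \<comment> \<open>With u = 0 the equation of order m_j reads \<open>curv j * \<xi> j = 0\<close>;
    the last entry of \<open>\<xi>\<close> is the constant term of \<open>u\<close>.\<close>
  show ?thesis
  proof (intro allI impI)
    fix j assume "j < Suc p"
    then consider "j < p" | "j = p" by linarith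
    then show "\<xi> j = 0"
    proof cases
      case 1
      have "(pderiv ^^ l) (0::'a poly) = 0" for l by (induction l) auto
      then have "curv j * \<xi> j = 0" using crit0[OF 1, of "m j"] m_pos[OF 1] u0 by (simp add: curv_def del: funpow.simps)
      then show ?thesis using curv_nonzero by simp
    next
      case 2
      have "((\<lambda>s. x s p) has_field_derivative coeff u 0) (at 0)" using u[of 0] by (simp add: coeff_G_0)
      from DERIV_unique[OF xd this] show ?thesis using 2 u0 by simp
    qed
  qed
qed

definition coords :: "real \<Rightarrow> 'a poly \<Rightarrow> nat \<Rightarrow> 'a" where
  "coords \<epsilon> g i = (if i < p then crit_near \<epsilon> c g i else coeff g 0)"

lemma coords_stratum:
  assumes good: "good \<epsilon>" and g: "g \<in> stratum \<epsilon> f p c"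
  shows "g = G (coords \<epsilon> g)" "near (Suc p) base \<epsilon> (coords \<epsilon> g)"
    and "\<And>i. i < p \<Longrightarrow> \<Phi> (coords \<epsilon> g) i = crit_values \<epsilon> p c g i" "\<Phi> (coords \<epsilon> g) p = 0"
proof -
  note cn = crit_near_stratum[OF good g] and sd = stratum_degree[OF g]
  show eq: "g = G (coords \<epsilon> g)"
  proof (rule eq_G[OF sd(1,2)])
    show "inj_on (coords \<epsilon> g) {..<p}" using cn(1) by (auto simp: coords_def inj_on_def bij_betw_def)
  qed (use cn(3) in \<open>auto simp: coords_def\<close>)
  show "near (Suc p) base \<epsilon> (coords \<epsilon> g)"
    unfolding near_def using cn(2) sd(4)[of 0] by (auto simp: coords_def base_def dist_norm)
  show "\<Phi> (coords \<epsilon> g) i = crit_values \<epsilon> p c g i" if "i < p" for i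
    using that eq by (simp add: \<Phi>_def crit_values_def coords_def[of \<epsilon> g i])
  have "coeff (G (coords \<epsilon> g)) (d - 1) = 0" using sd(3) eq by simp
  then have "of_nat d * coeff (crit_prod (coords \<epsilon> g)) (d - 2) / of_nat (d - 1) = (0::'a)"
    unfolding coeff_G_centered .
  then show "\<Phi> (coords \<epsilon> g) p = 0" using d2 by (auto simp: \<Phi>_def)
qed

lemma G_in_stratum:
  assumes good: "good \<epsilon>" and x: "near (Suc p) base \<epsilon> x" and cx: "coeff (crit_prod x) (d - 2) = 0"
    and cf: "\<And>i. i \<le> d \<Longrightarrow> norm (coeff (G x) i - coeff f i) < \<epsilon>"
  shows "G x \<in> stratum \<epsilon> f p c" "\<And>i. i < p \<Longrightarrow> crit_near \<epsilon> c (G x) i = x i"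
proof -
  have \<epsilon>: "\<epsilon> > 0" using good by (simp add: good_def)
  have dx: "dist (x i) (c i) < \<epsilon>" if "i < p" for i
    using x that unfolding near_def by (auto simp: base_def dist_norm dest: spec[of _ i])
  have inj: "inj_on x {..<p}"
  proof (rule inj_onI)
    fix i j assume ij: "i \<in> {..<p}" "j \<in> {..<p}" "x i = x j"
    have "dist (c i) (c j) < 2 * \<epsilon>"
      using dist_triangle2[of "c i" "c j" "x i"] dx[of i] dx[of j] ij by (simp add: dist_commute)
    then have "\<not> 2 * \<epsilon> \<le> dist (c i) (c j)" by simp
    then show "i = j" using good ij unfolding good_def by blast
  qed
  show st: "G x \<in> stratum \<epsilon> f p c"
    unfolding stratum_def
  proof (intro CollectI conjI exI[of _ x] allI impI)
    show "G x \<in> monic_centered (degree f)" using G_monic_centered[OF cx] by (simp add: d_def)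
    show "norm (coeff (G x) i - coeff f i) < \<epsilon>" for i
      using cf[of i] \<epsilon> by (cases "i \<le> d") (auto simp: coeff_G_above coeff_eq_0 d_def)
    show "bij_betw x {..<p} (critical_points (G x))" using inj by (simp add: bij_betw_def critical_points_G)
  qed (use dx multiplicity_G[OF inj] in \<open>auto simp: m_def\<close>)
  show "crit_near \<epsilon> c (G x) i = x i" if "i < p" for i
    using that dx by (intro crit_near_unique[OF good st]) (auto simp: critical_points_G)
qed

text \<open>The inverse function theorem for \<open>\<Phi>\<close> at \<open>base\<close>. A partial
  derivative sees the inverse chart only along a coordinate line through the critical values of f,
  so curves that move a single critical value, with coefficients differentiable at the base point,
  carry all that is used later.\<close>

lemma chart:
  "\<forall>\<^sub>F \<epsilon> in at_right 0. good \<epsilon> \<and> inj_on (crit_values \<epsilon> p c) (stratum \<epsilon> f p c) \<and>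
    (\<forall>k<p. \<exists>g u. g (poly f (c k)) = f \<and>
      (\<forall>\<^sub>F s in nhds (poly f (c k)). g s \<in> stratum \<epsilon> f p c \<and> crit_values \<epsilon> p c (g s) = (crit_values \<epsilon> p c f)(k := s)) \<and>
      (\<forall>i. ((\<lambda>s. coeff (g s) i) has_field_derivative coeff u i) (at (poly f (c k)))))"
proof -
  have "\<exists>A. has_strict_deriv (\<lambda>x. \<Phi> x i) A (Suc p) base" if "i < Suc p" for i
    using strictly_differentiable_\<Phi>[OF that] by (simp add: strictly_differentiable_def)
  then obtain A where A: "\<And>i. i < Suc p \<Longrightarrow> has_strict_deriv (\<lambda>x. \<Phi> x i) (A i) (Suc p) base" by metis
  obtain B where BA: "\<And>i k. i < Suc p \<Longrightarrow> k < Suc p \<Longrightarrow> (\<Sum>j<Suc p. B i j * A j k) = (if i = k then 1 else 0)"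
      and AB: "\<And>i k. i < Suc p \<Longrightarrow> k < Suc p \<Longrightarrow> (\<Sum>j<Suc p. A i j * B j k) = (if i = k then 1 else 0)"
    using inverse_matrix[of "Suc p" A, OF \<Phi>_differential_injective[OF A]] by blast
  interpret li: local_inverse \<Phi> A B "Suc p" base
    by unfold_locales (use A BA AB in auto)
  obtain \<delta> where \<delta>: "\<delta> > 0"
    "\<And>x y. near (Suc p) base \<delta> x \<Longrightarrow> near (Suc p) base \<delta> y \<Longrightarrow>
      sum_dist (Suc p) x y \<le> 2 * li.C * (\<Sum>i<Suc p. norm (\<Phi> x i - \<Phi> y i))"
    "\<And>\<rho> y. 0 < \<rho> \<Longrightarrow> \<rho> \<le> \<delta> \<Longrightarrow> 2 * li.C * (\<Sum>i<Suc p. norm (\<Phi> base i - y i)) < \<rho> \<Longrightarrow>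
      \<exists>x. near (Suc p) base \<rho> x \<and> (\<forall>i<Suc p. \<Phi> x i = y i)"
    using li.local_homeomorphism by blast
  have \<Phi>b: "\<Phi> base i = poly f (c i)" if "i < p" for i
    using that f_eq_G by (simp add: \<Phi>_def base_def)
  have \<Phi>bp: "\<Phi> base p = 0" using crit_prod_base_centered by (simp add: \<Phi>_def)
  have "\<forall>\<^sub>F \<epsilon> in at_right 0. \<epsilon> < \<delta>"
    using \<delta>(1) eventually_at_right_field by blast
  then show ?thesis using eventually_good
  proof eventually_elim
    case (elim \<epsilon>)
    then have good: "good \<epsilon>" and \<epsilon>\<delta>: "\<epsilon> \<le> \<delta>" and \<epsilon>: "\<epsilon> > 0" by (auto simp: good_def)
    have Vf: "crit_values \<epsilon> p c f i = poly f (c i)" if "i < p" for i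
      using that crit_near_f[OF good that] by (simp add: crit_values_def)
    have inj: "inj_on (crit_values \<epsilon> p c) (stratum \<epsilon> f p c)"
    proof (rule inj_onI)
      fix g h assume g: "g \<in> stratum \<epsilon> f p c" and h: "h \<in> stratum \<epsilon> f p c"
        and eq: "crit_values \<epsilon> p c g = crit_values \<epsilon> p c h"
      note cg = coords_stratum[OF good g] and ch = coords_stratum[OF good h]
      have "\<Phi> (coords \<epsilon> g) i = \<Phi> (coords \<epsilon> h) i" if "i < Suc p" for i
        using cg(3)[of i] ch(3)[of i] cg(4) ch(4) eq that by (cases "i < p") (auto simp: less_Suc_eq)
      then have "(\<Sum>i<Suc p. norm (\<Phi> (coords \<epsilon> g) i - \<Phi> (coords \<epsilon> h) i)) = 0"
        by (intro sum.neutral) auto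
      then have "sum_dist (Suc p) (coords \<epsilon> g) (coords \<epsilon> h) \<le> 0"
        using \<delta>(2)[OF near_mono[OF cg(2) \<epsilon>\<delta>] near_mono[OF ch(2) \<epsilon>\<delta>]] by simp
      then have "norm (coords \<epsilon> g i - coords \<epsilon> h i) \<le> 0" if "i < Suc p" for i
        using norm_le_sum_dist[OF that, of "coords \<epsilon> g" "coords \<epsilon> h"] by linarith
      then have "G (coords \<epsilon> g) = G (coords \<epsilon> h)" by (intro G_cong) auto
      then show "g = h" using cg(1) ch(1) by simp
    qed
    moreover have "\<exists>g u. g (poly f (c k)) = f \<and>
      (\<forall>\<^sub>F s in nhds (poly f (c k)). g s \<in> stratum \<epsilon> f p c \<and> crit_values \<epsilon> p c (g s) = (crit_values \<epsilon> p c f)(k := s)) \<and>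
      (\<forall>i. ((\<lambda>s. coeff (g s) i) has_field_derivative coeff u i) (at (poly f (c k))))" if k: "k < p" for k
    proof -
      define s0 where "s0 = poly f (c k)"
      have "\<exists>\<rho>>0. \<forall>x. near (Suc p) base \<rho> x \<longrightarrow> norm (coeff (G x) i - coeff f i) < \<epsilon>" for i
      proof -
        obtain A' where "has_strict_deriv (\<lambda>x. coeff (G x) i) A' (Suc p) base"
          using strictly_differentiable_coeff_G unfolding strictly_differentiable_def by blast
        from has_strict_deriv_continuous[OF this \<epsilon>] show ?thesis using f_eq_G by metis
      qed
      then obtain \<rho>' where \<rho>': "\<And>i. \<rho>' i > 0" "\<And>i x. near (Suc p) base (\<rho>' i) x \<Longrightarrow> norm (coeff (G x) i - coeff f i) < \<epsilon>"
        by metis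
      define \<rho> where "\<rho> = min \<epsilon> (Min (\<rho>' ` {..d}))"
      have \<rho>: "\<rho> > 0" "\<rho> \<le> \<epsilon>" "\<And>i. i \<le> d \<Longrightarrow> \<rho> \<le> \<rho>' i"
        using \<epsilon> \<rho>'(1) by (auto simp: \<rho>_def min_le_iff_disj)
      define r where "r = \<rho> / (2 * li.C)"
      have r: "r > 0" using \<rho> li.C_pos by (simp add: r_def)
      define Y where "Y s i = (if i = k then s else \<Phi> base i)" for s i
      have Ysum: "(\<Sum>i<Suc p. norm (\<Phi> base i - Y s i)) = norm (s - s0)" for s
      proof -
        have "(\<Sum>i<Suc p. norm (\<Phi> base i - Y s i)) = (\<Sum>i<Suc p. if i = k then norm (s0 - s) else 0)"
          by (intro sum.cong) (auto simp: Y_def s0_def \<Phi>b k)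
        also have "\<dots> = norm (s0 - s)" using k by (subst sum.delta) auto
        finally show ?thesis by (simp add: norm_minus_commute)
      qed
      have ex: "\<exists>x. near (Suc p) base \<rho> x \<and> (\<forall>i<Suc p. \<Phi> x i = Y s i) \<and> (s = s0 \<longrightarrow> x = base)" if "norm (s - s0) < r" for s
      proof (cases "s = s0")
        case True
        then show ?thesis using near_self[OF \<rho>(1)] by (intro exI[of _ base]) (auto simp: Y_def s0_def \<Phi>b k)
      next
        case False
        have "2 * li.C * norm (s - s0) < 2 * li.C * r" using that li.C_pos by (intro mult_strict_left_mono) auto
        also have "\<dots> = \<rho>" using li.C_pos by (simp add: r_def)
        finally have "2 * li.C * (\<Sum>i<Suc p. norm (\<Phi> base i - Y s i)) < \<rho>" unfolding Ysum .
        from \<delta>(3)[OF \<rho>(1) order_trans[OF \<rho>(2) \<epsilon>\<delta>] this] show ?thesis using False by blast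
      qed
      \<comment> \<open>Local uniqueness controls only the entries below \<open>Suc p\<close>,
        whereas the derivative lemma asks for equality of functions at \<open>s0\<close>; hence
        \<open>x s0 = base\<close> is imposed in the choice.\<close>
      define x where "x s = (SOME x. near (Suc p) base \<rho> x \<and> (\<forall>i<Suc p. \<Phi> x i = Y s i) \<and> (s = s0 \<longrightarrow> x = base))" for s
      have x: "near (Suc p) base \<rho> (x s)" "\<And>i. i < Suc p \<Longrightarrow> \<Phi> (x s) i = Y s i" "s = s0 \<Longrightarrow> x s = base"
        if "norm (s - s0) < r" for s
        using someI_ex[OF ex[OF that]] unfolding x_def[symmetric] by auto
      have x0: "x s0 = base" using x(3)[of s0] r by simp
      have xd: "((\<lambda>s. x s j) has_field_derivative B j k) (at s0)" if j: "j < Suc p" for j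
      proof (rule li.inverse_curve_derivative[where r=r and c="2 * li.C"])
        show "sum_dist (Suc p) (x s) base \<le> 2 * li.C * norm (s - s0)" if "norm (s - s0) < r" for s
        proof -
          have "sum_dist (Suc p) (x s) base \<le> 2 * li.C * (\<Sum>i<Suc p. norm (\<Phi> (x s) i - \<Phi> base i))"
            using x(1)[OF that] \<rho>(2) \<epsilon>\<delta> \<delta>(1) by (intro \<delta>(2)) (auto intro: near_mono near_self)
          also have "(\<Sum>i<Suc p. norm (\<Phi> (x s) i - \<Phi> base i)) = (\<Sum>i<Suc p. norm (\<Phi> base i - Y s i))"
            using x(2)[OF that] by (intro sum.cong) (auto simp: norm_minus_commute)
          finally show ?thesis unfolding Ysum .
        qed
        show "s0 = \<Phi> base k" using \<Phi>b[OF k] by (simp add: s0_def)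
        show "\<Phi> (x s) i = (if i = k then s else \<Phi> base i)" if "norm (s - s0) < r" "i < Suc p" for s i
          using x(2)[OF that] by (simp add: Y_def)
      qed (use x0 j k r in auto)
      obtain u where u: "\<And>i. ((\<lambda>s. coeff (G (x s)) i) has_field_derivative coeff u i) (at s0)"
        using G_curve_coeffs[OF x0 xd] by blast
      have "G (x s) \<in> stratum \<epsilon> f p c \<and> crit_values \<epsilon> p c (G (x s)) = (crit_values \<epsilon> p c f)(k := s)"
        if s: "norm (s - s0) < r" for s
      proof
        have nb: "near (Suc p) base \<epsilon> (x s)" by (rule near_mono[OF x(1)[OF s] \<rho>(2)])
        have cp: "coeff (crit_prod (x s)) (d - 2) = 0"
          using x(2)[OF s, of p] k \<Phi>bp by (simp add: \<Phi>_def Y_def)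
        have cf: "norm (coeff (G (x s)) i - coeff f i) < \<epsilon>" if "i \<le> d" for i
          by (rule \<rho>'(2)[OF near_mono[OF x(1)[OF s] \<rho>(3)[OF that]]])
        have st: "crit_near \<epsilon> c (G (x s)) i = x s i" if "i < p" for i
          by (rule G_in_stratum(2)[OF good nb cp cf that])
        show "G (x s) \<in> stratum \<epsilon> f p c" by (rule G_in_stratum(1)[OF good nb cp cf])
        have "crit_values \<epsilon> p c (G (x s)) i = Y s i" if "i < p" for i
          using x(2)[OF s, of i] st[OF that] that by (simp add: crit_values_def \<Phi>_def)
        then show "crit_values \<epsilon> p c (G (x s)) = (crit_values \<epsilon> p c f)(k := s)"
          using k Vf \<Phi>b by (auto simp: fun_eq_iff Y_def crit_values_def restrict_def)
      qed
      then have "\<forall>\<^sub>F s in nhds s0. G (x s) \<in> stratum \<epsilon> f p c \<and> crit_values \<epsilon> p c (G (x s)) = (crit_values \<epsilon> p c f)(k := s)"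
        using r unfolding eventually_nhds_metric dist_norm by blast
      then show ?thesis
        using u x0 f_eq_G unfolding s0_def by (intro exI[of _ "\<lambda>s. G (x s)"] exI[of _ u]) auto
    qed
    ultimately show ?case using good by blast
  qed
qed

end

section \<open>Normalised speeds\<close>

text \<open>Lagrange interpolation at 0, ..., N makes each coefficient a fixed linear combination of
  values, which carries pointwise estimates over to coefficients.\<close>

lemma coeff_interpolation:
  fixes N :: nat
  obtains \<Lambda> :: "nat \<Rightarrow> nat \<Rightarrow> 'a::field_char_0" where
    "\<And>(q :: 'a poly) i. degree q \<le> N \<Longrightarrow> coeff q i = (\<Sum>k\<le>N. \<Lambda> i k * poly q (of_nat k))"
proof -
  define z where "z k = (of_nat k :: 'a)" for k
  define l where "l k = (\<Prod>j\<in>{..N} - {k}. smult (1 / (z k - z j)) [:- z j, 1:])" for k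
  have zi: "inj z" by (auto simp: inj_def z_def)
  have lz: "poly (l k) (z j) = (if j = k then 1 else 0)" if "k \<le> N" "j \<le> N" for j k
  proof (cases "j = k")
    case True
    have "poly (l k) (z k) = (\<Prod>j\<in>{..N} - {k}. 1)"
      unfolding l_def poly_prod using zi by (intro prod.cong) (auto simp: inj_def diff_divide_distrib[symmetric])
    then show ?thesis using True by simp
  next
    case False
    then show ?thesis unfolding l_def poly_prod using that by (auto intro!: prod_zero bexI[of _ j])
  qed
  have dl: "degree (l k) \<le> N" if "k \<le> N" for k
  proof -
    have "degree (l k) \<le> (\<Sum>j\<in>{..N} - {k}. degree (smult (1 / (z k - z j)) [:- z j, 1:]))"
      unfolding l_def by (rule order_trans[OF degree_prod_sum_le]) (simp_all only: o_def finite_Diff finite_atMost order_refl)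
    also have "\<dots> \<le> (\<Sum>j\<in>{..N} - {k}. 1)"
      by (intro sum_mono order_trans[OF degree_smult_le]) simp
    finally show ?thesis using that by simp
  qed
  show ?thesis
  proof (rule that[of "\<lambda>i k. coeff (l k) i"])
    fix q :: "'a poly" and i assume q: "degree q \<le> N"
    have "q = (\<Sum>k\<le>N. smult (poly q (z k)) (l k))"
    proof (rule poly_eq_by_degree[of "z ` {..N}"])
      fix w assume "w \<in> z ` {..N}"
      then obtain j where j: "j \<le> N" "w = z j" by auto
      have "poly (\<Sum>k\<le>N. smult (poly q (z k)) (l k)) (z j) = (\<Sum>k\<le>N. poly q (z k) * (if j = k then 1 else 0))"
        unfolding poly_sum poly_smult using lz j(1) by (intro sum.cong) auto
      also have "\<dots> = poly q (z j)" using j(1) by (simp add: if_distrib[of "\<lambda>y. _ * y"] cong: if_cong)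
      finally show "poly q w = poly (\<Sum>k\<le>N. smult (poly q (z k)) (l k)) w" using j(2) by simp
    next
      have c: "card (z ` {..N}) = Suc N" using zi by (simp add: card_image inj_on_subset)
      show "degree q < card (z ` {..N})" using q c by simp
      have "degree (\<Sum>k\<le>N. smult (poly q (z k)) (l k)) \<le> N"
        using dl by (intro degree_sum_le) (auto intro: order_trans[OF degree_smult_le])
      then show "degree (\<Sum>k\<le>N. smult (poly q (z k)) (l k)) < card (z ` {..N})" using c by simp
    qed simp
    then have "coeff q i = coeff (\<Sum>k\<le>N. smult (poly q (z k)) (l k)) i" by (rule arg_cong)
    then show "coeff q i = (\<Sum>k\<le>N. coeff (l k) i * poly q (of_nat k))"
      by (simp add: coeff_sum z_def mult.commute)
  qed
qed

text \<open>The expansion of the family is assumed pointwise in z. Applied at finitely many nodes it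
  bounds each coefficient of the error by a multiple of t^2. The number of nodes takes the degree of
  \<open>u\<close> into account, since a priori \<open>u\<close> is an arbitrary polynomial.\<close>

lemma family_through_coeffs:
  fixes f u :: "'a::real_normed_field poly"
  assumes fam: "family_through S f u F" and S: "\<And>g. g \<in> S \<Longrightarrow> degree g \<le> D"
  shows "((\<lambda>t. coeff (F t) i) has_field_derivative coeff u i) (at 0)"
proof -
  have F0: "F 0 = f" and ev: "\<forall>\<^sub>F t in nhds 0. F t \<in> S"
    and O: "\<And>z. (\<lambda>t. poly (F t) z - (poly f z + t * poly u z)) \<in> O[at 0](\<lambda>t. t\<^sup>2)"
    using fam by (auto simp: family_through_def)
  have f: "degree f \<le> D" using eventually_nhds_x_imp_x[OF ev] S F0 by simp
  define N where "N = max D (degree u)"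
  obtain \<Lambda> :: "nat \<Rightarrow> nat \<Rightarrow> 'a" where \<Lambda>: "\<And>(q :: 'a poly) i. degree q \<le> N \<Longrightarrow> coeff q i = (\<Sum>k\<le>N. \<Lambda> i k * poly q (of_nat k))"
    using coeff_interpolation by blast
  define E where "E t = F t - (f + smult t u)" for t
  define e where "e t = (\<Sum>k\<le>N. \<Lambda> i k * (poly (F t) (of_nat k) - (poly f (of_nat k) + t * poly u (of_nat k))))" for t
  have "e \<in> O[at 0](\<lambda>t. t\<^sup>2)"
  proof -
    have "(\<lambda>t. \<Lambda> i k * (poly (F t) (of_nat k) - (poly f (of_nat k) + t * poly u (of_nat k)))) \<in> O[at 0](\<lambda>t. t\<^sup>2)" for k
      using O[of "of_nat k"] by (cases "\<Lambda> i k = 0") simp_all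
    then show ?thesis unfolding e_def[abs_def] by (rule big_sum_in_bigo)
  qed
  then obtain C where C: "C > 0" "\<forall>\<^sub>F t in at 0. norm (e t) \<le> C * norm (t\<^sup>2)"
    by (rule landau_o.bigE)
  have eE: "\<forall>\<^sub>F t in at 0. coeff (F t) i = coeff f i + t * coeff u i + e t"
  proof -
    have "\<forall>\<^sub>F t in at 0. F t \<in> S" using ev by (simp add: eventually_nhds_conv_at)
    then show ?thesis
    proof eventually_elim
      case (elim t)
      have "degree (E t) \<le> N"
        unfolding E_def N_def using S[OF elim] f
        by (intro degree_diff_le degree_add_le order_trans[OF degree_smult_le]) auto
      from \<Lambda>[OF this, of i] have "coeff (E t) i = e t" by (simp add: e_def E_def)
      then show ?case by (simp add: E_def algebra_simps)
    qed
  qed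
  have "((\<lambda>t::'a. C * norm t) \<longlongrightarrow> C * norm (0::'a)) (at 0)"
    by (rule tendsto_mult_left[OF tendsto_norm[OF tendsto_ident_at]])
  then have lim0: "((\<lambda>t::'a. C * norm t) \<longlongrightarrow> 0) (at 0)" by simp
  have "\<forall>\<^sub>F t in at 0. norm (e t / t) \<le> C * norm t"
    using C(2) eventually_neq_at_within[of 0 0 UNIV]
  proof eventually_elim
    case (elim t)
    have "norm (e t) / norm t \<le> C * norm (t\<^sup>2) / norm t" using elim(1) by (intro divide_right_mono) auto
    then show ?case using elim(2) by (simp add: norm_divide norm_mult power2_eq_square)
  qed
  from Lim_null_comparison[OF this lim0] have "((\<lambda>t. e t / t) \<longlongrightarrow> 0) (at 0)" .
  from tendsto_add[OF tendsto_const[of "coeff u i"] this]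
  have "((\<lambda>t. coeff u i + e t / t) \<longlongrightarrow> coeff u i) (at 0)" by simp
  moreover have "\<forall>\<^sub>F t in at 0. coeff u i + e t / t = (coeff (F t) i - coeff (F 0) i) / (t - 0)"
    using eE eventually_neq_at_within[of 0 0 UNIV] by eventually_elim (simp add: F0 field_simps)
  ultimately show ?thesis
    unfolding has_field_derivative_iff by (rule Lim_transform_eventually)
qed

section \<open>Coordinate vectors and limit speeds\<close>

context critical_data
begin

text \<open>The coordinate vector of the critical value v_k at f: the basis of the tangent space
  dual to the evaluations at the critical points. Its existence is read off from the chart.\<close>

definition dual :: "nat \<Rightarrow> 'a poly" where
  "dual k = (THE u. tangent u \<and> (\<forall>i<p. poly u (c i) = (if i = k then 1 else 0)))"

lemma dualI:
  assumes "tangent u" "\<And>i. i < p \<Longrightarrow> poly u (c i) = (if i = k then 1 else 0)"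
  shows "dual k = u"
  unfolding dual_def
proof (rule the_equality)
  show "tangent u \<and> (\<forall>i<p. poly u (c i) = (if i = k then 1 else 0))" using assms by simp
  show "\<And>v. tangent v \<and> (\<forall>i<p. poly v (c i) = (if i = k then 1 else 0)) \<Longrightarrow> v = u"
    using assms by (intro tangent_eqI) auto
qed

definition chart_at :: "real \<Rightarrow> bool" where
  "chart_at \<epsilon> \<longleftrightarrow> good \<epsilon> \<and> inj_on (crit_values \<epsilon> p c) (stratum \<epsilon> f p c) \<and>
    (\<forall>k<p. \<exists>g u. g (poly f (c k)) = f \<and>
      (\<forall>\<^sub>F s in nhds (poly f (c k)). g s \<in> stratum \<epsilon> f p c \<and> crit_values \<epsilon> p c (g s) = (crit_values \<epsilon> p c f)(k := s)) \<and>
      (\<forall>i. ((\<lambda>s. coeff (g s) i) has_field_derivative coeff u i) (at (poly f (c k)))))"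

lemma eventually_chart_at: "\<forall>\<^sub>F \<epsilon> in at_right 0. chart_at \<epsilon>"
  using chart unfolding chart_at_def .

text \<open>Along the coordinate curve only the critical value with index \<open>k\<close> moves,
  with unit speed. Since critical values move with velocity u(c_i), the velocity of the curve is the
  dual vector.\<close>

lemma chart_curve:
  assumes ch: "chart_at \<epsilon>" and k: "k < p"
  obtains g where "g (poly f (c k)) = f"
    "\<forall>\<^sub>F s in nhds (poly f (c k)). g s \<in> stratum \<epsilon> f p c \<and> crit_values \<epsilon> p c (g s) = (crit_values \<epsilon> p c f)(k := s)"
    "\<And>i. ((\<lambda>s. coeff (g s) i) has_field_derivative coeff (dual k) i) (at (poly f (c k)))"
    "tangent (dual k)" "\<And>i. i < p \<Longrightarrow> poly (dual k) (c i) = (if i = k then 1 else 0)"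
proof -
  have good: "good \<epsilon>" using ch by (simp add: chart_at_def)
  let ?s0 = "poly f (c k)"
  obtain g u where g: "g ?s0 = f"
    and ev: "\<forall>\<^sub>F s in nhds ?s0. g s \<in> stratum \<epsilon> f p c \<and> crit_values \<epsilon> p c (g s) = (crit_values \<epsilon> p c f)(k := s)"
    and d: "\<And>i. ((\<lambda>s. coeff (g s) i) has_field_derivative coeff u i) (at ?s0)"
    using ch k unfolding chart_at_def by blast
  have st: "\<forall>\<^sub>F s in nhds ?s0. g s \<in> stratum \<epsilon> f p c" using ev by eventually_elim simp
  note cv = curve_velocity[OF good st g d]
  have val: "poly u (c i) = (if i = k then 1 else 0)" if i: "i < p" for i
  proof -
    have eq: "poly (g s) (crit_near \<epsilon> c (g s) i) = (if i = k then s else crit_values \<epsilon> p c f i)"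
      if "crit_values \<epsilon> p c (g s) = (crit_values \<epsilon> p c f)(k := s)" for s
      using fun_cong[OF that, of i] i by (simp add: crit_values_def)
    have d1: "((\<lambda>s. if i = k then s else crit_values \<epsilon> p c f i) has_field_derivative poly u (c i)) (at ?s0)"
    proof (rule has_field_derivative_transform_eventually[OF cv(2)[OF i]])
      show "\<forall>\<^sub>F s in at ?s0. poly (g s) (crit_near \<epsilon> c (g s) i) = (if i = k then s else crit_values \<epsilon> p c f i)"
      proof -
        have "\<forall>\<^sub>F s in at ?s0. crit_values \<epsilon> p c (g s) = (crit_values \<epsilon> p c f)(k := s)"
          using ev by (auto simp: eventually_nhds_conv_at elim: eventually_mono)
        then show ?thesis by eventually_elim (rule eq)
      qed
      show "poly (g ?s0) (crit_near \<epsilon> c (g ?s0) i) = (if i = k then ?s0 else crit_values \<epsilon> p c f i)"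
        using eventually_nhds_x_imp_x[OF ev] by (intro eq) simp
    qed
    show ?thesis
    proof (cases "i = k")
      case True
      then show ?thesis using DERIV_unique[OF d1] DERIV_ident by auto
    next
      case False
      then show ?thesis using DERIV_unique[OF d1] DERIV_const by auto
    qed
  qed
  have "dual k = u" by (rule dualI[OF cv(1) val])
  then show ?thesis using that[of g] g ev d cv(1) val by simp
qed

text \<open>\<open>dual\<close> does not depend on the size of the neighbourhood, so any admissible
  \<epsilon> yields these facts.\<close>

lemma tangent_dual: "k < p \<Longrightarrow> tangent (dual k)"
  and poly_dual: "k < p \<Longrightarrow> i < p \<Longrightarrow> poly (dual k) (c i) = (if i = k then 1 else 0)"
proof -
  have "\<exists>\<epsilon>. chart_at \<epsilon>" by (rule eventually_happens'[OF trivial_limit_at_right_real eventually_chart_at])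
  then obtain \<epsilon> where ch: "chart_at \<epsilon>" by blast
  show "k < p \<Longrightarrow> tangent (dual k)" by (rule chart_curve[OF ch])
  show "k < p \<Longrightarrow> i < p \<Longrightarrow> poly (dual k) (c i) = (if i = k then 1 else 0)" by (rule chart_curve[OF ch])
qed

text \<open>Near the critical values of f, injectivity identifies the inverse chart on the
  coordinate line with the curve of \<open>chart_curve\<close>, and \<open>deriv\<close> sees only
  this germ. The iterate of order \<open>Suc q\<close> is normalised by the derivative of order q,
  which matches the indexing of \<open>speed\<close>.\<close>

lemma L_seq_eq_speed:
  assumes ch: "chart_at \<epsilon>" and j: "j < p" and k: "k < p" and we: "weakly_expanding f (c j)"
  shows "L_seq \<epsilon> f p c j k (Suc q) = speed (dual k) j q"
proof -
  have good: "good \<epsilon>" and inj: "inj_on (crit_values \<epsilon> p c) (stratum \<epsilon> f p c)"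
    using ch by (auto simp: chart_at_def)
  let ?s0 = "poly f (c k)" and ?V = "crit_values \<epsilon> p c" and ?S = "stratum \<epsilon> f p c"
  obtain g where g: "g ?s0 = f"
    and ev: "\<forall>\<^sub>F s in nhds ?s0. g s \<in> ?S \<and> ?V (g s) = (?V f)(k := s)"
    and d: "\<And>i. ((\<lambda>s. coeff (g s) i) has_field_derivative coeff (dual k) i) (at ?s0)"
    by (rule chart_curve[OF ch k], rule that)
  have st: "\<forall>\<^sub>F s in nhds ?s0. g s \<in> ?S" using ev by eventually_elim simp
  have nz: "iter_deriv f n (poly f (c j)) \<noteq> 0" for n by (rule weakly_expanding_iter_deriv_nonzero[OF we])
  have Vfk: "?V f k = ?s0" using k crit_near_f[OF good k] by (simp add: crit_values_def)
  define \<Psi> where "\<Psi> h = (poly h ^^ Suc q) (crit_near \<epsilon> c h j)" for h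
  have "\<forall>\<^sub>F s in nhds ?s0. \<Psi> (inv_into ?S ?V ((?V f)(k := s))) = \<Psi> (g s)"
    using ev
  proof eventually_elim
    case (elim s)
    then have "inv_into ?S ?V ((?V f)(k := s)) = g s"
      using inv_into_f_f[OF inj conjunct1[OF elim]] by simp
    then show ?case by simp
  qed
  then have "deriv (\<lambda>s. \<Psi> (inv_into ?S ?V ((?V f)(k := s)))) ?s0 = deriv (\<lambda>s. \<Psi> (g s)) ?s0"
    by (rule deriv_cong_ev) simp
  also have "\<dots> = iter_deriv f q (poly f (c j)) * speed (dual k) j q"
    unfolding \<Psi>_def by (rule DERIV_imp_deriv[OF orbit_derivative[OF good st g d j nz]])
  finally show ?thesis
    unfolding L_seq_def partial_crit_value_def Vfk \<Psi>_def[symmetric] using nz[of q] by (simp add: deriv_iterate)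
qed

lemma L_seq_tendsto:
  assumes "chart_at \<epsilon>" "j < p" "k < p" "weakly_expanding f (c j)"
  shows "L_seq \<epsilon> f p c j k \<longlonglongrightarrow> limit_speed f (dual k) (c j)"
proof -
  have "(\<lambda>q. L_seq \<epsilon> f p c j k (Suc q)) \<longlonglongrightarrow> limit_speed f (dual k) (c j)"
    unfolding L_seq_eq_speed[OF assms] by (rule speed_tendsto[OF assms(4)])
  \<comment> \<open>The entry m = 0, where m - 1 is truncated to 0, does not affect the
    limit.\<close>
  then show ?thesis by (rule LIMSEQ_imp_Suc)
qed

lemma L_eq:
  assumes "chart_at \<epsilon>" "j < p" "k < p" "weakly_expanding f (c j)"
  shows "L \<epsilon> f p c j k = limit_speed f (dual k) (c j)"
  unfolding L_def by (rule limI[OF L_seq_tendsto[OF assms]])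

lemma pderiv_iterate_sum_smult:
  "(pderiv ^^ l) (\<Sum>k\<in>I. smult (b k) (q k)) = (\<Sum>k\<in>I. smult (b k) ((pderiv ^^ l) (q k :: 'a poly)))"
proof (induction l)
  case (Suc l)
  have "pderiv (\<Sum>k\<in>I. smult (b k) (h k)) = (\<Sum>k\<in>I. smult (b k) (pderiv (h k :: 'a poly)))" for h
    by (induction I rule: infinite_finite_induct) (auto simp: pderiv_add pderiv_smult)
  then show ?case by (simp add: Suc)
qed simp

lemma tangent_decompose:
  assumes "tangent u"
  shows "u = (\<Sum>k<p. smult (poly u (c k)) (dual k))"
proof (rule tangent_eqI[OF assms])
  show "tangent (\<Sum>k<p. smult (poly u (c k)) (dual k))"
    unfolding tangent_def
  proof (intro conjI allI impI)
    show "degree (\<Sum>k<p. smult (poly u (c k)) (dual k)) \<le> d - 2"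
      using tangent_dual by (intro degree_sum_le) (auto simp: tangent_def intro: order_trans[OF degree_smult_le])
    fix i l assume "i < p" "1 \<le> l \<and> l < m i"
    then show "poly ((pderiv ^^ l) (\<Sum>k<p. smult (poly u (c k)) (dual k))) (c i) = 0"
      using tangent_dual unfolding pderiv_iterate_sum_smult poly_sum
      by (intro sum.neutral) (auto simp: tangent_def)
  qed
  fix i assume i: "i < p"
  have "poly (\<Sum>k<p. smult (poly u (c k)) (dual k)) (c i) = (\<Sum>k<p. poly u (c k) * (if i = k then 1 else 0))"
    unfolding poly_sum poly_smult using poly_dual i by (intro sum.cong) auto
  also have "\<dots> = poly u (c i)" using i by (simp add: if_distrib[of "\<lambda>y. _ * y"] cong: if_cong)
  finally show "poly u (c i) = poly (\<Sum>k<p. smult (poly u (c k)) (dual k)) (c i)" by simp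
qed

lemma limit_speed_decompose:
  assumes u: "tangent u" and we: "weakly_expanding f (c j)"
  shows "limit_speed f u (c j) = (\<Sum>k<p. poly u (c k) * limit_speed f (dual k) (c j))"
proof (rule LIMSEQ_unique[OF speed_tendsto[OF we]])
  have pu: "poly u z = (\<Sum>k<p. poly u (c k) * poly (dual k) z)" for z
  proof -
    have "poly u z = poly (\<Sum>k<p. smult (poly u (c k)) (dual k)) z" by (rule arg_cong[OF tangent_decompose[OF u]])
    then show ?thesis by (simp only: poly_sum poly_smult)
  qed
  have "speed u j q = (\<Sum>k<p. poly u (c k) * speed (dual k) j q)" for q
  proof -
    let ?x = "\<lambda>n. (poly f ^^ n) (poly f (c j))" and ?D = "\<lambda>n. iter_deriv f (Suc n) (poly f (c j))"
    have "(\<Sum>n<q. poly u (?x n) / ?D n) = (\<Sum>n<q. \<Sum>k<p. poly u (c k) * (poly (dual k) (?x n) / ?D n))"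
      unfolding pu[of "?x _"] sum_divide_distrib by simp
    also have "\<dots> = (\<Sum>k<p. \<Sum>n<q. poly u (c k) * (poly (dual k) (?x n) / ?D n))" by (rule sum.swap)
    finally show ?thesis
      unfolding speed_def distrib_left sum.distrib sum_distrib_left using pu[of "c j"] by simp
  qed
  then have "speed u j = (\<lambda>q. \<Sum>k<p. poly u (c k) * speed (dual k) j q)" by (rule ext)
  then show "speed u j \<longlonglongrightarrow> (\<Sum>k<p. poly u (c k) * limit_speed f (dual k) (c j))"
    by (simp only:) (rule tendsto_sum, rule tendsto_mult_left, rule speed_tendsto[OF we])
qed

lemma family_speed_tendsto:
  assumes good: "good \<epsilon>" and st: "\<forall>\<^sub>F t in nhds 0. F t \<in> stratum \<epsilon> f p c" and F0: "F 0 = f"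
    and d: "\<And>i. ((\<lambda>t. coeff (F t) i) has_field_derivative coeff u i) (at 0)"
    and j: "j < p" and we: "weakly_expanding f (c j)"
  shows "speed_seq \<epsilon> f c F j \<longlonglongrightarrow> limit_speed f u (c j)"
proof -
  have nz: "iter_deriv f n (poly f (c j)) \<noteq> 0" for n by (rule weakly_expanding_iter_deriv_nonzero[OF we])
  have "speed_seq \<epsilon> f c F j (Suc q) = speed u j q" for q
    unfolding speed_seq_def DERIV_imp_deriv[OF orbit_derivative[OF good st F0 d j nz]]
    using nz[of q] by (simp add: deriv_iterate)
  then have "(\<lambda>q. speed_seq \<epsilon> f c F j (Suc q)) \<longlonglongrightarrow> limit_speed f u (c j)"
    using speed_tendsto[OF we] by simp
  then show ?thesis by (rule LIMSEQ_imp_Suc)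
qed

text \<open>Each coefficient comes with its own neighbourhood of differentiability. Only those up to
  degree d are intersected; the others vanish identically on the stratum.\<close>

lemma family_crit_near_differentiable:
  assumes good: "good \<epsilon>" and st: "\<forall>\<^sub>F t in nhds 0. F t \<in> stratum \<epsilon> f p c"
    and d: "\<And>i. differentiable_near_0 (\<lambda>t. coeff (F t) i)" and j: "j < p"
  shows "differentiable_near_0 (\<lambda>t. crit_near \<epsilon> c (F t) j)"
proof -
  have "\<forall>\<^sub>F t in nhds 0. \<forall>i\<in>{..d}. (\<lambda>t. coeff (F t) i) field_differentiable at t"
    using d by (intro eventually_ball_finite) (auto simp: differentiable_near_0_def)
  moreover have "\<forall>\<^sub>F t in nhds 0. \<forall>\<^sub>F s in nhds t. F s \<in> stratum \<epsilon> f p c"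
    using st by (simp add: eventually_eventually)
  ultimately show ?thesis
    unfolding differentiable_near_0_def
  proof eventually_elim
    case (elim t)
    show ?case
    proof (rule crit_near_differentiable[OF good elim(2) _ j])
      fix i
      show "(\<lambda>t. coeff (F t) i) field_differentiable at t"
      proof (cases "i \<le> d")
        case True
        then show ?thesis using elim(1) by simp
      next
        case False
        have z: "coeff (F s) i = 0" if "F s \<in> stratum \<epsilon> f p c" for s
          using stratum_degree(1)[OF that] False by (simp add: coeff_eq_0)
        have "((\<lambda>s. coeff (F s) i) has_field_derivative 0) (at t)"
        proof (rule has_field_derivative_transform_eventually[OF DERIV_const])
          show "\<forall>\<^sub>F s in at t. 0 = coeff (F s) i"
            using elim(2) unfolding eventually_nhds_conv_at by (auto elim!: eventually_mono simp: z)
          show "0 = coeff (F t) i" using eventually_nhds_x_imp_x[OF elim(2)] by (simp add: z)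
        qed
        then show ?thesis unfolding field_differentiable_def by blast
      qed
    qed
  qed
qed

lemma Lambda_family_conclusion:
  assumes ch: "chart_at \<epsilon>" and we: "\<forall>j<r. weakly_expanding f (c j)" and rp: "r \<le> p"
    and \<kappa>: "strict_mono_on {..<r} \<kappa>" "\<kappa> ` {..<r} \<subseteq> {..<p}"
    and det: "Determinant.det (Matrix.mat r r (\<lambda>(j, i). L \<epsilon> f p c j (\<kappa> i))) \<noteq> 0"
    and fam: "family_through (Lambda \<epsilon> f p c (\<kappa> ` {..<r})) f u F"
  shows "((\<forall>i. differentiable_near_0 (\<lambda>t. coeff (F t) i)) \<longrightarrow>
      (\<forall>j<r. differentiable_near_0 (\<lambda>t. crit_near \<epsilon> c (F t) j))) \<and>
    (u \<noteq> 0 \<longrightarrow> (\<exists>j<r. \<exists>l. speed_seq \<epsilon> f c F j \<longlonglongrightarrow> l \<and> l \<noteq> 0))"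
proof -
  have good: "good \<epsilon>" using ch by (simp add: chart_at_def)
  let ?K = "\<kappa> ` {..<r}"
  have evL: "\<forall>\<^sub>F t in nhds 0. F t \<in> Lambda \<epsilon> f p c ?K" and F0: "F 0 = f"
    using fam by (auto simp: family_through_def)
  have st: "\<forall>\<^sub>F t in nhds 0. F t \<in> stratum \<epsilon> f p c" using evL by eventually_elim (simp add: Lambda_def)
  have dF: "((\<lambda>t. coeff (F t) i) has_field_derivative coeff u i) (at 0)" for i
    by (rule family_through_coeffs[OF fam, where D=d]) (auto simp: Lambda_def stratum_degree(1))
  note cv = curve_velocity[OF good st F0 dF]
  have u0: "poly u (c i) = 0" if i: "i < p" "i \<notin> ?K" for i
  proof -
    have eq: "poly (F t) (crit_near \<epsilon> c (F t) i) = crit_values \<epsilon> p c f i" if "F t \<in> Lambda \<epsilon> f p c ?K" for t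
    proof -
      have "crit_values \<epsilon> p c (F t) i = crit_values \<epsilon> p c f i" using that i by (simp add: Lambda_def)
      then show ?thesis using i(1) by (simp add: crit_values_def)
    qed
    have "((\<lambda>_. crit_values \<epsilon> p c f i) has_field_derivative poly u (c i)) (at 0)"
    proof (rule has_field_derivative_transform_eventually[OF cv(2)[OF i(1)]])
      show "\<forall>\<^sub>F t in at 0. poly (F t) (crit_near \<epsilon> c (F t) i) = crit_values \<epsilon> p c f i"
        using evL unfolding eventually_nhds_conv_at by (auto elim!: eventually_mono intro: eq)
      show "poly (F 0) (crit_near \<epsilon> c (F 0) i) = crit_values \<epsilon> p c f i"
        by (rule eq[OF eventually_nhds_x_imp_x[OF evL]])
    qed
    from DERIV_unique[OF this DERIV_const] show ?thesis .
  qed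
  have inj\<kappa>: "inj_on \<kappa> {..<r}" using \<kappa>(1) by (rule strict_mono_on_imp_inj_on)
  have lim: "limit_speed f u (c j) = (\<Sum>i<r. L \<epsilon> f p c j (\<kappa> i) * poly u (c (\<kappa> i)))" if j: "j < r" for j
  proof -
    have wj: "weakly_expanding f (c j)" and jp: "j < p" using we rp j by auto
    have "limit_speed f u (c j) = (\<Sum>k<p. poly u (c k) * limit_speed f (dual k) (c j))"
      by (rule limit_speed_decompose[OF cv(1) wj])
    also have "\<dots> = (\<Sum>k\<in>?K. poly u (c k) * limit_speed f (dual k) (c j))"
      using \<kappa>(2) u0 by (intro sum.mono_neutral_right) auto
    also have "\<dots> = (\<Sum>i<r. poly u (c (\<kappa> i)) * limit_speed f (dual (\<kappa> i)) (c j))"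
      by (simp add: sum.reindex[OF inj\<kappa>])
    also have "\<dots> = (\<Sum>i<r. L \<epsilon> f p c j (\<kappa> i) * poly u (c (\<kappa> i)))"
    proof (rule sum.cong[OF refl])
      fix i assume "i \<in> {..<r}"
      then have "\<kappa> i < p" using \<kappa>(2) by auto
      from L_eq[OF ch jp this wj]
      show "poly u (c (\<kappa> i)) * limit_speed f (dual (\<kappa> i)) (c j) = L \<epsilon> f p c j (\<kappa> i) * poly u (c (\<kappa> i))"
        by (simp add: mult.commute)
    qed
    finally show ?thesis .
  qed
  have nz: "\<exists>j<r. limit_speed f u (c j) \<noteq> 0" if "u \<noteq> 0"
  proof (rule ccontr)
    assume "\<not> (\<exists>j<r. limit_speed f u (c j) \<noteq> 0)"
    then have "\<forall>j<r. (\<Sum>i<r. L \<epsilon> f p c j (\<kappa> i) * poly u (c (\<kappa> i))) = 0" using lim by simp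
    note ker = this
    have zero: "poly u (c (\<kappa> i)) = 0" if i: "i < r" for i
    proof (rule ccontr)
      assume "poly u (c (\<kappa> i)) \<noteq> 0"
      then have "\<exists>i<r. poly u (c (\<kappa> i)) \<noteq> 0" using i by blast
      then have "\<exists>x. (\<exists>i<r. x i \<noteq> 0) \<and> (\<forall>j<r. (\<Sum>i<r. L \<epsilon> f p c j (\<kappa> i) * x i) = 0)"
        using ker by (intro exI[of _ "\<lambda>i. poly u (c (\<kappa> i))"] conjI)
      then show False using det unfolding det_mat_eq_0_iff by (rule notE[rotated])
    qed
    have "u = 0"
    proof (rule tangent_eqI[OF cv(1)])
      have "(pderiv ^^ l) (0::'a poly) = 0" for l by (induction l) auto
      then show "tangent 0" by (simp add: tangent_def)
      fix i assume i: "i < p"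
      show "poly u (c i) = poly 0 (c i)"
        using zero u0[OF i] by (cases "i \<in> ?K") auto
    qed
    then show False using that by simp
  qed
  show ?thesis
  proof (intro conjI impI allI)
    show "differentiable_near_0 (\<lambda>t. crit_near \<epsilon> c (F t) j)"
      if "\<forall>i. differentiable_near_0 (\<lambda>t. coeff (F t) i)" "j < r" for j
      using that rp by (intro family_crit_near_differentiable[OF good st]) auto
    assume "u \<noteq> 0"
    then obtain j where j: "j < r" "limit_speed f u (c j) \<noteq> 0" using nz by blast
    have "speed_seq \<epsilon> f c F j \<longlonglongrightarrow> limit_speed f u (c j)"
      using we rp j(1) by (intro family_speed_tendsto[OF good st F0 dF]) auto
    then have "\<exists>l. speed_seq \<epsilon> f c F j \<longlonglongrightarrow> l \<and> l \<noteq> 0"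
      using j(2) by (intro exI conjI)
    then show "\<exists>j<r. \<exists>l. speed_seq \<epsilon> f c F j \<longlonglongrightarrow> l \<and> l \<noteq> 0"
      using j(1) by (intro exI[of _ j] conjI)
  qed
qed

end

section \<open>Openness of the stratum for simple critical points\<close>

lemma simple_root_persists:
  fixes q :: "'a::{real_normed_field,banach} poly"
  assumes a: "a \<noteq> 0" and \<rho>: "0 \<le> \<rho>"
    and der: "\<And>z. z \<in> cball w \<rho> \<Longrightarrow> norm (poly (pderiv q) z - a) \<le> norm a / 2"
    and val: "norm (poly q w) \<le> norm a * \<rho> / 2"
  obtains z where "z \<in> cball w \<rho>" "poly q z = 0"
proof -
  \<comment> \<open>Newton's map with the slope frozen at \<open>a\<close>: it contracts by 1/2 and
    maps the ball into itself. The Banach fixed point theorem works over the reals as well as over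
    the complex numbers.\<close>
  define T where "T z = z - poly q z / a" for z
  have lip: "dist (T x) (T y) \<le> 1 / 2 * dist x y" if "x \<in> cball w \<rho>" "y \<in> cball w \<rho>" for x y
    unfolding dist_norm
  proof (rule field_differentiable_bound[where S="cball w \<rho>" and f'="\<lambda>z. 1 - poly (pderiv q) z / a"])
    show "(T has_field_derivative 1 - poly (pderiv q) z / a) (at z within cball w \<rho>)" for z
      unfolding T_def by (rule has_field_derivative_at_within) (rule DERIV_diff[OF DERIV_ident DERIV_cdivide[OF poly_DERIV]])
    show "norm (1 - poly (pderiv q) z / a) \<le> 1 / 2" if "z \<in> cball w \<rho>" for z
    proof -
      have "1 - poly (pderiv q) z / a = - (poly (pderiv q) z - a) / a" using a by (simp add: field_simps)
      then have "norm (1 - poly (pderiv q) z / a) = norm (poly (pderiv q) z - a) / norm a"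
        by (simp only: norm_divide norm_minus_cancel)
      also have "\<dots> \<le> norm a / 2 / norm a" using der[OF that] by (intro divide_right_mono) auto
      finally show ?thesis using a by simp
    qed
  qed (use that in auto)
  have Tw: "dist w (T w) \<le> \<rho> / 2"
    using val a by (simp add: T_def dist_norm norm_divide field_simps)
  have "T ` cball w \<rho> \<subseteq> cball w \<rho>"
  proof
    fix y assume "y \<in> T ` cball w \<rho>"
    then obtain x where x: "x \<in> cball w \<rho>" "y = T x" by blast
    have "dist w y \<le> dist w (T w) + dist (T w) (T x)" unfolding x(2) by (rule dist_triangle)
    also have "\<dots> \<le> \<rho> / 2 + 1 / 2 * dist w x" using Tw lip[of w x] x(1) \<rho> by (intro add_mono) auto
    finally show "y \<in> cball w \<rho>" using x(1) by simp
  qed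
  then have "\<exists>!z\<in>cball w \<rho>. T z = z"
    using \<rho> lip by (intro Banach_fix[where c="1/2"]) (auto simp: complete_eq_closed)
  then obtain z where "z \<in> cball w \<rho>" "T z = z" by blast
  then show ?thesis using a by (intro that[of z]) (auto simp: T_def)
qed

context critical_data
begin

text \<open>Each simple critical point persists near c_i. This already gives d - 1 distinct zeros of
  g', so there are no others and all are simple; hence families in the full space of monic centred
  polynomials stay in the stratum.\<close>

lemma simple_stratum_open:
  assumes good: "good \<epsilon>" and simple: "\<And>i. i < p \<Longrightarrow> m i = 1"
  obtains \<eta> where "\<eta> > 0"
    "\<And>g. g \<in> monic_centered d \<Longrightarrow> (\<And>l. norm (coeff g l - coeff f l) < \<eta>) \<Longrightarrow> g \<in> stratum \<epsilon> f p c"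
proof -
  have \<epsilon>: "\<epsilon> > 0" using good by (simp add: good_def)
  have "\<exists>\<delta>>0. \<forall>g. degree g \<le> d \<longrightarrow> (\<forall>l. norm (coeff g l - coeff f l) < \<delta>) \<longrightarrow>
      norm (poly (pderiv g) (c i)) < norm (curv i) * (\<epsilon> / 2) / 2" if i: "i < p" for i
  proof -
    \<comment> \<open>The threshold is the bound |a| \<rho> / 2 of
      \<open>simple_root_persists\<close> for a = curv i and \<rho> = \<epsilon>/2; the smaller
      radius keeps the closed ball inside the \<epsilon>-neighbourhood.\<close>
    have "norm (curv i) * (\<epsilon> / 2) / 2 > 0" using curv_nonzero \<epsilon> by simp
    from poly_pderiv_iterate_perturbation[OF this, of d f "c i" 1]
    obtain \<delta> where "\<delta> > 0" "\<And>g z. degree g \<le> d \<Longrightarrow> (\<forall>l. norm (coeff g l - coeff f l) < \<delta>) \<Longrightarrow> norm (z - c i) < \<delta> \<Longrightarrow>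
        norm (poly (pderiv g) z - poly (pderiv f) (c i)) < norm (curv i) * (\<epsilon> / 2) / 2"
      by auto
    from this(1) this(2)[of _ "c i"] show ?thesis using crit_c[OF i] by (intro exI[of _ \<delta>]) auto
  qed
  then obtain \<delta> where \<delta>: "\<And>i. i < p \<Longrightarrow> \<delta> i > 0" "\<And>i g. i < p \<Longrightarrow> degree g \<le> d \<Longrightarrow>
      (\<forall>l. norm (coeff g l - coeff f l) < \<delta> i) \<Longrightarrow> norm (poly (pderiv g) (c i)) < norm (curv i) * (\<epsilon> / 2) / 2"
    by metis
  define \<eta> where "\<eta> = Min (insert \<epsilon> (\<delta> ` {..<p}))"
  have \<eta>: "\<eta> > 0" "\<eta> \<le> \<epsilon>" "\<And>i. i < p \<Longrightarrow> \<eta> \<le> \<delta> i" using \<epsilon> \<delta>(1) by (auto simp: \<eta>_def)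
  have pd: "p = d - 1" using sum_m simple by simp
  show ?thesis
  proof (rule that[OF \<eta>(1)])
    fix g assume g: "g \<in> monic_centered d" and near: "\<And>l. norm (coeff g l - coeff f l) < \<eta>"
    have dg: "degree g = d" using g by (simp add: monic_centered_def)
    have near\<epsilon>: "norm (coeff g l - coeff f l) < \<epsilon>" for l using near[of l] \<eta>(2) by linarith
    have curvg: "norm (poly (pderiv (pderiv g)) z - curv i) < norm (curv i) / 2" if "i < p" "dist z (c i) < \<epsilon>" for i z
      using good_curv[OF good that(1) _ near\<epsilon>, of z] dg simple[OF that(1)] that(2) by (simp add: dist_norm)
    have "\<exists>z. dist z (c i) < \<epsilon> \<and> poly (pderiv g) z = 0" if i: "i < p" for i
    proof -
      have "norm (coeff g l - coeff f l) < \<delta> i" for l using near[of l] \<eta>(3)[OF i] by linarith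
      then have v: "norm (poly (pderiv g) (c i)) \<le> norm (curv i) * (\<epsilon> / 2) / 2" using \<delta>(2)[OF i, of g] dg by simp
      obtain z where "z \<in> cball (c i) (\<epsilon> / 2)" "poly (pderiv g) z = 0"
      proof (rule simple_root_persists[OF curv_nonzero[of i] _ _ v])
        show "norm (poly (pderiv (pderiv g)) z - curv i) \<le> norm (curv i) / 2" if "z \<in> cball (c i) (\<epsilon> / 2)" for z
          using curvg[OF i, of z] that \<epsilon> by (simp add: dist_commute)
      qed (use \<epsilon> in auto)
      then show ?thesis using \<epsilon> by (intro exI[of _ z]) (simp add: dist_commute)
    qed
    then obtain c' where c': "\<And>i. i < p \<Longrightarrow> dist (c' i) (c i) < \<epsilon>" "\<And>i. i < p \<Longrightarrow> poly (pderiv g) (c' i) = 0" by metis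
    have pg0: "pderiv g \<noteq> 0" using dg d2 by (simp add: pderiv_eq_0_iff)
    have inj: "inj_on c' {..<p}"
    proof (rule inj_onI)
      fix i j assume ij: "i \<in> {..<p}" "j \<in> {..<p}" "c' i = c' j"
      have "dist (c i) (c j) < 2 * \<epsilon>"
        using dist_triangle2[of "c i" "c j" "c' i"] c'(1)[of i] c'(1)[of j] ij by (simp add: dist_commute)
      then have "\<not> 2 * \<epsilon> \<le> dist (c i) (c j)" by simp
      then show "i = j" using good ij unfolding good_def by blast
    qed
    have "c' ` {..<p} = critical_points g"
    proof (rule card_seteq)
      show "finite (critical_points g)" using poly_roots_finite[OF pg0] by (simp add: critical_points_def)
      show "c' ` {..<p} \<subseteq> critical_points g" using c'(2) by (auto simp: critical_points_def)
      have "card (critical_points g) \<le> degree (pderiv g)"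
        unfolding critical_points_def by (rule card_poly_roots_bound[OF pg0])
      then show "card (critical_points g) \<le> card (c' ` {..<p})"
        using card_image[OF inj] pd dg by (simp add: degree_pderiv)
    qed
    then have "bij_betw c' {..<p} (critical_points g)" using inj by (simp add: bij_betw_def)
    moreover have "multiplicity_crit g (c' i) = m i" if i: "i < p" for i
    proof -
      have "order (c' i) (pderiv g) \<noteq> 0" using c'(2)[OF i] pg0 order_root by blast
      moreover have "\<not> 1 < order (c' i) (pderiv g)"
      proof
        assume "1 < order (c' i) (pderiv g)"
        from poly_pderiv_iterate_eq_0[OF pg0 this] have "poly (pderiv (pderiv g)) (c' i) = 0" by simp
        then show False using curvg[OF i c'(1)[OF i]] by simp
      qed
      ultimately show ?thesis using simple[OF i] by (simp add: multiplicity_crit_def)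
    qed
    ultimately show "g \<in> stratum \<epsilon> f p c"
      using g near\<epsilon> c'(1) unfolding stratum_def d_def m_def by blast
  qed
qed

text \<open>The analytic input enters only through \<open>nonzero\<close>, which makes the argument
  independent of the field: over the reals this hypothesis will be supplied by the complex
  case.\<close>

lemma simple_family_conclusion:
  assumes good: "good \<epsilon>" and simple: "\<And>i. i < p \<Longrightarrow> m i = 1" and we: "\<And>j. j < p \<Longrightarrow> weakly_expanding f (c j)"
    and nonzero: "\<And>u. u \<noteq> 0 \<Longrightarrow> degree u \<le> d - 2 \<Longrightarrow> \<exists>j<p. limit_speed f u (c j) \<noteq> 0"
    and fam: "family_through (monic_centered d) f u F"
  shows "((\<forall>i. differentiable_near_0 (\<lambda>t. coeff (F t) i)) \<longrightarrow>
      (\<forall>j<p. differentiable_near_0 (\<lambda>t. crit_near \<epsilon> c (F t) j))) \<and>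
    (u \<noteq> 0 \<longrightarrow> (\<exists>j<p. \<exists>l. speed_seq \<epsilon> f c F j \<longlonglongrightarrow> l \<and> l \<noteq> 0))"
proof -
  have evM: "\<forall>\<^sub>F t in nhds 0. F t \<in> monic_centered d" and F0: "F 0 = f"
    using fam by (auto simp: family_through_def)
  have dF: "((\<lambda>t. coeff (F t) i) has_field_derivative coeff u i) (at 0)" for i
    by (rule family_through_coeffs[OF fam, where D=d]) (auto simp: monic_centered_def)
  obtain \<eta> where \<eta>: "\<eta> > 0"
    "\<And>g. g \<in> monic_centered d \<Longrightarrow> (\<And>l. norm (coeff g l - coeff f l) < \<eta>) \<Longrightarrow> g \<in> stratum \<epsilon> f p c"
    using simple_stratum_open[OF good simple] by blast
  have "\<forall>\<^sub>F t in nhds 0. \<forall>l\<in>{..d}. norm (coeff (F t) l - coeff f l) < \<eta>"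
  proof (intro eventually_ball_finite ballI finite_atMost)
    fix l
    have "((\<lambda>t. coeff (F t) l) \<longlongrightarrow> coeff (F 0) l) (at 0)"
      using DERIV_isCont[OF dF[of l]] unfolding isCont_def .
    from tendstoD[OF this \<eta>(1)] show "\<forall>\<^sub>F t in nhds 0. norm (coeff (F t) l - coeff f l) < \<eta>"
      using \<eta>(1) by (simp add: eventually_nhds_conv_at F0 dist_norm)
  qed
  then have st: "\<forall>\<^sub>F t in nhds 0. F t \<in> stratum \<epsilon> f p c"
    using evM
  proof eventually_elim
    case (elim t)
    show ?case
    proof (rule \<eta>(2)[OF elim(2)])
      fix l
      show "norm (coeff (F t) l - coeff f l) < \<eta>"
      proof (cases "l \<le> d")
        case False
        then have "coeff (F t) l = 0" "coeff f l = 0"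
          using elim(2) by (auto intro!: coeff_eq_0 simp: monic_centered_def d_def)
        then show ?thesis using \<eta>(1) by simp
      qed (use elim(1) in simp)
    qed
  qed
  have "degree u \<le> d - 2" using curve_velocity(1)[OF good st F0 dF] by (simp add: tangent_def)
  then have nz: "u \<noteq> 0 \<Longrightarrow> \<exists>j<p. limit_speed f u (c j) \<noteq> 0" by (intro nonzero)
  show ?thesis
  proof (intro conjI impI allI)
    show "differentiable_near_0 (\<lambda>t. crit_near \<epsilon> c (F t) j)"
      if "\<forall>i. differentiable_near_0 (\<lambda>t. coeff (F t) i)" "j < p" for j
      using that by (intro family_crit_near_differentiable[OF good st]) auto
    assume "u \<noteq> 0"
    then obtain j where j: "j < p" "limit_speed f u (c j) \<noteq> 0" using nz by blast
    have "speed_seq \<epsilon> f c F j \<longlonglongrightarrow> limit_speed f u (c j)"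
      using we j(1) by (intro family_speed_tendsto[OF good st F0 dF]) auto
    then have "\<exists>l. speed_seq \<epsilon> f c F j \<longlonglongrightarrow> l \<and> l \<noteq> 0"
      using j(2) by (intro exI conjI)
    then show "\<exists>j<p. \<exists>l. speed_seq \<epsilon> f c F j \<longlonglongrightarrow> l \<and> l \<noteq> 0"
      using j(1) by (intro exI[of _ j] conjI)
  qed
qed

section \<open>Conclusions for all sufficiently small neighbourhoods\<close>

theorem eventually_Lambda_families:
  assumes we: "\<forall>j<r. weakly_expanding f (c j)" and rp: "r \<le> p"
  shows "\<forall>\<^sub>F \<epsilon> in at_right 0.
    (\<forall>j<r. \<forall>k<p. convergent (L_seq \<epsilon> f p c j k)) \<and>
    (\<forall>\<kappa> u F.
       strict_mono_on {..<r} \<kappa> \<and> \<kappa> ` {..<r} \<subseteq> {..<p} \<and>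
       Determinant.det (Matrix.mat r r (\<lambda>(j, i). L \<epsilon> f p c j (\<kappa> i))) \<noteq> 0 \<and>
       family_through (Lambda \<epsilon> f p c (\<kappa> ` {..<r})) f u F \<longrightarrow>
         ((\<forall>i. differentiable_near_0 (\<lambda>t. coeff (F t) i)) \<longrightarrow>
            (\<forall>j<r. differentiable_near_0 (\<lambda>t. crit_near \<epsilon> c (F t) j))) \<and>
         (u \<noteq> 0 \<longrightarrow> (\<exists>j<r. \<exists>l. speed_seq \<epsilon> f c F j \<longlonglongrightarrow> l \<and> l \<noteq> 0)))"
  using eventually_chart_at
proof eventually_elim
  case (elim \<epsilon>)
  have "convergent (L_seq \<epsilon> f p c j k)" if "j < r" "k < p" for j k
    using that we rp by (intro convergentI[OF L_seq_tendsto[OF elim]]) auto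
  then show ?case by (intro conjI[rotated] allI impI Lambda_family_conclusion[OF elim we rp]) auto
qed

theorem eventually_simple_families:
  assumes simple: "\<forall>i<p. multiplicity_crit f (c i) = 1 \<and> weakly_expanding f (c i)"
    and nonzero: "\<And>u. u \<noteq> 0 \<Longrightarrow> degree u \<le> d - 2 \<Longrightarrow> \<exists>j<p. limit_speed f u (c j) \<noteq> 0"
  shows "\<forall>\<^sub>F \<epsilon> in at_right 0.
    (\<forall>u F. family_through (monic_centered d) f u F \<longrightarrow>
         ((\<forall>i. differentiable_near_0 (\<lambda>t. coeff (F t) i)) \<longrightarrow>
            (\<forall>j<p. differentiable_near_0 (\<lambda>t. crit_near \<epsilon> c (F t) j))) \<and>
         (u \<noteq> 0 \<longrightarrow> (\<exists>j<p. \<exists>l. speed_seq \<epsilon> f c F j \<longlonglongrightarrow> l \<and> l \<noteq> 0)))"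
  using eventually_good
proof eventually_elim
  case (elim \<epsilon>)
  show ?case
    by (intro allI impI simple_family_conclusion[OF elim _ _ nonzero]) (use simple in \<open>auto simp: m_def\<close>)
qed

end

text \<open>Over the complex numbers the derivative splits into linear factors, so the
  multiplicities add up to d - 1.\<close>

lemma critical_data_complex:
  fixes f :: "complex poly"
  assumes "2 \<le> d" "f \<in> monic_centered d" and bij: "bij_betw c {..<p} (critical_points f)"
  shows "critical_data f p c"
proof
  have d: "degree f = d" "coeff f d = 1" "coeff f (d - 1) = 0"
    using assms(2) unfolding monic_centered_def by blast+
  show "2 \<le> degree f" "lead_coeff f = 1" "coeff f (degree f - 1) = 0" using d assms(1) by simp_all
  show "bij_betw c {..<p} (critical_points f)" by (rule bij)
  have pf0: "pderiv f \<noteq> 0" using d assms(1) by (simp add: pderiv_eq_0_iff)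
  have "degree (pderiv f) = degree (smult (lead_coeff (pderiv f)) (\<Prod>z\<in>critical_points f. [:-z, 1:] ^ order z (pderiv f)))"
    unfolding critical_points_def complex_poly_decompose ..
  also have "\<dots> = (\<Sum>z\<in>critical_points f. degree ([:-z, 1:] ^ order z (pderiv f)))"
    unfolding degree_smult_eq using pf0 by (subst degree_prod_sum_eq) auto
  also have "\<dots> = (\<Sum>z\<in>critical_points f. order z (pderiv f))" by (simp add: degree_power_eq)
  also have "\<dots> = (\<Sum>i<p. multiplicity_crit f (c i))"
    unfolding multiplicity_crit_def by (rule sum.reindex_bij_betw[OF bij, symmetric])
  finally show "(\<Sum>i<p. multiplicity_crit f (c i)) = degree f - 1" by (simp add: degree_pderiv)
qed

section \<open>Real polynomials\<close>

abbreviation cpoly :: "real poly \<Rightarrow> complex poly" where "cpoly \<equiv> map_poly complex_of_real"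

lemma coeff_cpoly: "coeff (cpoly q) i = complex_of_real (coeff q i)"
  by (simp add: coeff_map_poly)

lemma degree_cpoly: "degree (cpoly q) = degree q"
  by (rule degree_map_poly) simp

lemma cpoly_eq_0_iff: "cpoly q = 0 \<longleftrightarrow> q = 0"
  by (simp add: poly_eq_iff coeff_cpoly)

lemma poly_cpoly: "poly (cpoly q) (complex_of_real x) = complex_of_real (poly q x)"
  by (simp add: poly_altdef degree_cpoly coeff_cpoly)

lemma cnj_poly_cpoly: "cnj (poly (cpoly q) z) = poly (cpoly q) (cnj z)"
  by (simp add: poly_altdef coeff_cpoly)

lemma pderiv_cpoly: "pderiv (cpoly q) = cpoly (pderiv q)"
  by (rule poly_eqI) (simp add: coeff_pderiv coeff_cpoly)

lemma pderiv_iterate_cpoly: "(pderiv ^^ l) (cpoly q) = cpoly ((pderiv ^^ l) q)"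
  by (induction l) (simp_all add: pderiv_cpoly)

lemma iterate_cpoly: "(poly (cpoly q) ^^ n) (complex_of_real x) = complex_of_real ((poly q ^^ n) x)"
  by (induction n) (simp_all add: poly_cpoly)

lemma iter_deriv_cpoly: "iter_deriv (cpoly q) n (complex_of_real x) = complex_of_real (iter_deriv q n x)"
  by (induction n) (simp_all add: iter_deriv_Suc pderiv_cpoly iterate_cpoly poly_cpoly)

text \<open>The order of a zero is read off from the vanishing of iterated derivatives, which
  complexification preserves in both directions.\<close>

lemma order_cpoly:
  assumes "q \<noteq> 0"
  shows "order (complex_of_real x) (cpoly q) = order x q"
proof (rule antisym)
  have q0: "cpoly q \<noteq> 0" using assms by (simp add: cpoly_eq_0_iff)
  show "order (complex_of_real x) (cpoly q) \<le> order x q"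
  proof (rule order_geI[OF assms])
    fix l assume "l < order (complex_of_real x) (cpoly q)"
    from poly_pderiv_iterate_eq_0[OF q0 this] show "poly ((pderiv ^^ l) q) x = 0"
      by (simp add: pderiv_iterate_cpoly poly_cpoly)
  qed
  show "order x q \<le> order (complex_of_real x) (cpoly q)"
  proof (rule order_geI[OF q0])
    fix l assume "l < order x q"
    from poly_pderiv_iterate_eq_0[OF assms this] show "poly ((pderiv ^^ l) (cpoly q)) (complex_of_real x) = 0"
      by (simp add: pderiv_iterate_cpoly poly_cpoly)
  qed
qed

lemma critical_points_cpoly: "complex_of_real x \<in> critical_points (cpoly q) \<longleftrightarrow> x \<in> critical_points q"
  by (simp add: critical_points_def pderiv_cpoly poly_cpoly)

lemma multiplicity_crit_cpoly:
  "pderiv q \<noteq> 0 \<Longrightarrow> multiplicity_crit (cpoly q) (complex_of_real x) = multiplicity_crit q x"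
  by (simp add: multiplicity_crit_def pderiv_cpoly order_cpoly)

lemma weakly_expanding_cpoly: "weakly_expanding (cpoly q) (complex_of_real x) \<longleftrightarrow> weakly_expanding q x"
  by (simp add: weakly_expanding_def Let_def deriv_iterate poly_cpoly iterate_cpoly iter_deriv_cpoly)

lemma monic_centered_cpoly: "cpoly q \<in> monic_centered n \<longleftrightarrow> q \<in> monic_centered n"
  by (simp add: monic_centered_def degree_cpoly coeff_cpoly)

lemma coeff_mult_in_Reals:
  fixes a b :: "complex poly"
  assumes "\<And>i. coeff a i \<in> \<real>" "\<And>i. coeff b i \<in> \<real>"
  shows "coeff (a * b) i \<in> \<real>"
  unfolding coeff_mult using assms by (intro sum_in_Reals Reals_mult)

lemma coeff_prod_in_Reals:
  fixes a :: "'b \<Rightarrow> complex poly"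
  assumes "\<And>x i. x \<in> I \<Longrightarrow> coeff (a x) i \<in> \<real>"
  shows "coeff (\<Prod>x\<in>I. a x) i \<in> \<real>"
  using assms
proof (induction I arbitrary: i rule: infinite_finite_induct)
  case (insert x I)
  then show ?case by (simp add: coeff_mult_in_Reals)
qed simp_all

lemma coeff_power_in_Reals:
  fixes a :: "complex poly"
  assumes "\<And>i. coeff a i \<in> \<real>"
  shows "coeff (a ^ n) i \<in> \<real>"
  using coeff_prod_in_Reals[of "{..<n}" "\<lambda>_. a" i] assms by simp

text \<open>f equals \<open>G base\<close>, so its coefficients are polynomial expressions with
  rational coefficients in the critical points, together with the constant term.\<close>

lemma critical_data_coeffs_in_Reals:
  fixes f :: "complex poly"
  assumes "critical_data f p c" and c: "\<And>i. i < p \<Longrightarrow> c i \<in> \<real>" and f0: "poly f 0 \<in> \<real>"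
  shows "coeff f i \<in> \<real>"
proof -
  interpret critical_data f p c by fact
  have "coeff (crit_prod base) k \<in> \<real>" for k
    unfolding crit_prod_def
  proof (intro coeff_prod_in_Reals coeff_power_in_Reals)
    fix x i assume "x \<in> {..<p}"
    then show "coeff [:- base x, 1:] i \<in> \<real>"
      using c[of x] by (auto simp: base_def coeff_pCons split: nat.split)
  qed
  then have "coeff (G base) (Suc k) \<in> \<real>" for k
    unfolding coeff_G_Suc by (intro Reals_divide Reals_mult Reals_of_nat)
  then show ?thesis
    using f0 f_eq_G by (cases i) (auto simp: poly_0_coeff_0)
qed

lemma critical_data_real:
  assumes "critical_data (cpoly f\<^sub>R) p c" and c: "\<And>i. i < p \<Longrightarrow> c i = complex_of_real (c\<^sub>R i)"
  shows "critical_data f\<^sub>R p c\<^sub>R"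
proof
  interpret critical_data "cpoly f\<^sub>R" p c by fact
  show deg': "2 \<le> degree f\<^sub>R" "lead_coeff f\<^sub>R = 1" "coeff f\<^sub>R (degree f\<^sub>R - 1) = 0"
    using deg monic centered by (simp_all add: degree_cpoly coeff_cpoly)
  have inj: "inj_on c\<^sub>R {..<p}" using inj_c c by (auto simp: inj_on_def)
  have "x \<in> critical_points f\<^sub>R \<longleftrightarrow> x \<in> c\<^sub>R ` {..<p}" for x
  proof -
    have "x \<in> critical_points f\<^sub>R \<longleftrightarrow> complex_of_real x \<in> c ` {..<p}"
      using bij by (simp add: critical_points_cpoly[symmetric] bij_betw_def)
    also have "\<dots> \<longleftrightarrow> x \<in> c\<^sub>R ` {..<p}" using c by (auto simp: image_iff)
    finally show ?thesis .
  qed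
  then show "bij_betw c\<^sub>R {..<p} (critical_points f\<^sub>R)" using inj by (auto simp: bij_betw_def)
  have "pderiv f\<^sub>R \<noteq> 0" using deg' by (simp add: pderiv_eq_0_iff)
  then have "(\<Sum>i<p. multiplicity_crit f\<^sub>R (c\<^sub>R i)) = (\<Sum>i<p. multiplicity_crit (cpoly f\<^sub>R) (c i))"
    using c by (intro sum.cong) (auto simp: multiplicity_crit_cpoly)
  then show "(\<Sum>i<p. multiplicity_crit f\<^sub>R (c\<^sub>R i)) = degree f\<^sub>R - 1" using split by (simp add: degree_cpoly)
qed

locale real_critical_data =
  cx: critical_data "cpoly f\<^sub>R" p c + re: critical_data f\<^sub>R p c\<^sub>R
  for f\<^sub>R :: "real poly" and p :: nat and c :: "nat \<Rightarrow> complex" and c\<^sub>R :: "nat \<Rightarrow> real" +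
  assumes c_eq: "\<And>i. i < p \<Longrightarrow> c i = complex_of_real (c\<^sub>R i)"
begin

lemma d_eq: "cx.d = re.d" by (simp add: cx.d_def re.d_def degree_cpoly)

lemma m_eq: "i < p \<Longrightarrow> cx.m i = re.m i"
  by (simp add: cx.m_def re.m_def c_eq multiplicity_crit_cpoly re.pderiv_f_nonzero)

lemma tangent_cpoly: "re.tangent u \<Longrightarrow> cx.tangent (cpoly u)"
  by (simp add: cx.tangent_def re.tangent_def d_eq m_eq degree_cpoly pderiv_iterate_cpoly c_eq poly_cpoly)

text \<open>The complexification of a real tangent vector is tangent, and tangent vectors are
  determined by their values at the critical points.\<close>

lemma dual_cpoly:
  assumes "k < p"
  shows "cx.dual k = cpoly (re.dual k)"
  using assms re.poly_dual by (intro cx.dualI tangent_cpoly re.tangent_dual) (auto simp: c_eq poly_cpoly)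

lemma limit_speed_cpoly:
  assumes j: "j < p" and we: "weakly_expanding f\<^sub>R (c\<^sub>R j)"
  shows "limit_speed (cpoly f\<^sub>R) (cpoly u) (c j) = complex_of_real (limit_speed f\<^sub>R u (c\<^sub>R j))"
proof (rule LIMSEQ_unique)
  have "weakly_expanding (cpoly f\<^sub>R) (c j)" using we j by (simp add: c_eq weakly_expanding_cpoly)
  then show "cx.speed (cpoly u) j \<longlonglongrightarrow> limit_speed (cpoly f\<^sub>R) (cpoly u) (c j)" by (rule cx.speed_tendsto)
  have "cx.speed (cpoly u) j = (\<lambda>q. complex_of_real (re.speed u j q))"
    using j by (simp add: fun_eq_iff cx.speed_def re.speed_def c_eq poly_cpoly iterate_cpoly iter_deriv_cpoly)
  then show "cx.speed (cpoly u) j \<longlonglongrightarrow> complex_of_real (limit_speed f\<^sub>R u (c\<^sub>R j))"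
    using tendsto_of_real[OF re.speed_tendsto[OF we, of u]] by simp
qed

lemma L_cpoly:
  assumes "cx.chart_at \<epsilon>" "re.chart_at \<epsilon>" "j < p" "k < p" and we: "weakly_expanding f\<^sub>R (c\<^sub>R j)"
  shows "L \<epsilon> (cpoly f\<^sub>R) p c j k = complex_of_real (L \<epsilon> f\<^sub>R p c\<^sub>R j k)"
proof -
  have "weakly_expanding (cpoly f\<^sub>R) (c j)" using assms by (simp add: c_eq weakly_expanding_cpoly)
  then show ?thesis
    using assms by (simp add: cx.L_eq re.L_eq dual_cpoly limit_speed_cpoly)
qed

lemma stratum_cpoly:
  assumes good: "cx.good \<epsilon>"
  shows "stratum \<epsilon> f\<^sub>R p c\<^sub>R = {g. cpoly g \<in> stratum \<epsilon> (cpoly f\<^sub>R) p c}"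
proof (rule Set.set_eqI, unfold mem_Collect_eq, rule iffI)
  fix g assume g: "g \<in> stratum \<epsilon> f\<^sub>R p c\<^sub>R"
  note sd = re.stratum_degree[OF g]
  obtain c' where c': "bij_betw c' {..<p} (critical_points g)" "\<And>i. i < p \<Longrightarrow> dist (c' i) (c\<^sub>R i) < \<epsilon>"
      "\<And>i. i < p \<Longrightarrow> multiplicity_crit g (c' i) = re.m i"
    using g unfolding stratum_def re.m_def by blast
  define x where "x i = complex_of_real (if i < p then c' i else coeff g 0)" for i
  have pg0: "pderiv g \<noteq> 0" using sd(1) re.d2 by (simp add: pderiv_eq_0_iff)
  have inj: "inj_on x {..<p}" using c'(1) by (auto simp: x_def inj_on_def bij_betw_def)
  have mult: "multiplicity_crit (cpoly g) (x i) = cx.m i" if "i < p" for i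
    using that c'(3) pg0 by (simp add: x_def multiplicity_crit_cpoly m_eq)
  \<comment> \<open>The real critical points of \<open>g\<close> already carry the total
    multiplicity d - 1, so the complexification has no non-real critical points.\<close>
  have "cpoly g = cx.G x"
    using sd inj mult by (intro cx.eq_G) (auto simp: degree_cpoly coeff_cpoly d_eq x_def)
  then have "bij_betw x {..<p} (critical_points (cpoly g))"
    using inj by (simp add: bij_betw_def cx.critical_points_G)
  moreover have "dist (x i) (c i) < \<epsilon>" if "i < p" for i
    using that c'(2)[OF that] by (simp add: x_def c_eq dist_of_real)
  moreover have "norm (coeff (cpoly g) i - coeff (cpoly f\<^sub>R) i) < \<epsilon>" for i
    using sd(4)[of i] by (simp add: coeff_cpoly flip: of_real_diff)
  moreover have "cpoly g \<in> monic_centered (degree (cpoly f\<^sub>R))"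
    using g by (simp add: stratum_def monic_centered_cpoly degree_cpoly)
  ultimately show "cpoly g \<in> stratum \<epsilon> (cpoly f\<^sub>R) p c"
    using mult unfolding stratum_def cx.m_def by blast
next
  fix g assume g: "cpoly g \<in> stratum \<epsilon> (cpoly f\<^sub>R) p c"
  note sd = cx.stratum_degree[OF g] and cn = cx.crit_near_stratum[OF good g]
  let ?x = "crit_near \<epsilon> c (cpoly g)"
  have pg0: "pderiv g \<noteq> 0" using sd(1) cx.d2 by (simp add: pderiv_eq_0_iff degree_cpoly)
  \<comment> \<open>The critical point of \<open>g\<close> near a real one is unique, hence equal to its conjugate.\<close>
  have real: "?x i = complex_of_real (Re (?x i))" if i: "i < p" for i
  proof -
    have "?x i \<in> critical_points (cpoly g)" using cn(1) i by (auto simp: bij_betw_def)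
    then have "cnj (?x i) \<in> critical_points (cpoly g)"
      by (simp add: critical_points_def pderiv_cpoly cnj_poly_cpoly[symmetric])
    moreover have "dist (cnj (?x i)) (c i) < \<epsilon>"
    proof -
      have "cnj (?x i) - c i = cnj (?x i - c i)" using c_eq[OF i] by simp
      then have "dist (cnj (?x i)) (c i) = dist (?x i) (c i)"
        unfolding dist_norm by (simp only: complex_mod_cnj)
      then show ?thesis using cn(2)[OF i] by simp
    qed
    ultimately have "?x i = cnj (?x i)" by (rule cx.crit_near_unique[OF good g i])
    then show ?thesis by (simp add: complex_eq_iff)
  qed
  define c' where "c' i = Re (?x i)" for i
  have x: "?x i = complex_of_real (c' i)" if "i < p" for i using real[OF that] by (simp add: c'_def)
  have "inj_on c' {..<p}" using cn(1) x by (auto simp: inj_on_def bij_betw_def)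
  moreover have "y \<in> critical_points g \<longleftrightarrow> y \<in> c' ` {..<p}" for y
  proof -
    have "y \<in> critical_points g \<longleftrightarrow> complex_of_real y \<in> ?x ` {..<p}"
      using cn(1) by (simp add: critical_points_cpoly[symmetric] bij_betw_def)
    also have "\<dots> \<longleftrightarrow> y \<in> c' ` {..<p}" using x by (auto simp: image_iff)
    finally show ?thesis .
  qed
  ultimately have "bij_betw c' {..<p} (critical_points g)" by (auto simp: bij_betw_def)
  moreover have "dist (c' i) (c\<^sub>R i) < \<epsilon>" if "i < p" for i
    using cn(2)[OF that] by (simp add: x[OF that] c_eq[OF that] dist_of_real)
  moreover have "multiplicity_crit g (c' i) = re.m i" if "i < p" for i
    using cn(3)[OF that] pg0 by (simp add: x[OF that] m_eq[OF that] multiplicity_crit_cpoly)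
  moreover have "norm (coeff g i - coeff f\<^sub>R i) < \<epsilon>" for i
    using sd(4)[of i] by (simp add: coeff_cpoly flip: of_real_diff)
  moreover have "g \<in> monic_centered (degree f\<^sub>R)"
    using g by (simp add: stratum_def monic_centered_cpoly degree_cpoly)
  ultimately show "g \<in> stratum \<epsilon> f\<^sub>R p c\<^sub>R"
    unfolding stratum_def re.m_def by blast
qed

end

lemma complex_simple_limit_speed_nonzero:
  fixes f u :: "complex poly"
  assumes "critical_data f p c" and simple: "\<forall>i<p. multiplicity_crit f (c i) = 1 \<and> weakly_expanding f (c i)"
    and u: "u \<noteq> 0" "degree u \<le> degree f - 2"
  shows "\<exists>j<p. limit_speed f u (c j) \<noteq> 0"
proof -
  interpret critical_data f p c by fact
  show ?thesis
  proof (rule limit_speed_nonzero[OF deg monic _ _ _ u])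
    show "bij_betw c {..<p} {z. poly (pderiv f) z = 0}" using bij by (simp add: critical_points_def)
    show "poly (pderiv (pderiv f)) (c j) \<noteq> 0" if "j < p" for j
      using curv_nonzero[of j] simple that by (simp add: curv_def m_def)
  qed (use simple in auto)
qed

theorem mainTheorem3:
  fixes f :: "complex poly" and c :: "nat \<Rightarrow> complex" and d p r :: nat
  assumes "2 \<le> d" and "f \<in> monic_centered d"
    and "bij_betw c {..<p} (critical_points f)"
    and "1 \<le> r" and "r \<le> p" and "\<forall>j<r. weakly_expanding f (c j)"
  shows
    "(\<forall>\<^sub>F \<epsilon> in at_right 0.
        (\<forall>j<r. \<forall>k<p. convergent (L_seq \<epsilon> f p c j k)) \<and>
        (\<forall>\<kappa> u F.
           strict_mono_on {..<r} \<kappa> \<and> \<kappa> ` {..<r} \<subseteq> {..<p} \<and>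
           Determinant.det (Matrix.mat r r (\<lambda>(j, i). L \<epsilon> f p c j (\<kappa> i))) \<noteq> 0 \<and>
           family_through (Lambda \<epsilon> f p c (\<kappa> ` {..<r})) f u F \<longrightarrow>
             ((\<forall>i. differentiable_near_0 (\<lambda>t. Polynomial.coeff (F t) i)) \<longrightarrow>
                (\<forall>j<r. differentiable_near_0 (\<lambda>t. crit_near \<epsilon> c (F t) j))) \<and>
             (u \<noteq> 0 \<longrightarrow> (\<exists>j<r. \<exists>l. speed_seq \<epsilon> f c F j \<longlonglongrightarrow> l \<and> l \<noteq> 0)))) \<and>
     ((\<forall>i<p. multiplicity_crit f (c i) = 1 \<and> weakly_expanding f (c i)) \<longrightarrow>
      (\<forall>\<^sub>F \<epsilon> in at_right 0.
        (\<forall>u F. family_through (monic_centered d) f u F \<longrightarrow>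
             ((\<forall>i. differentiable_near_0 (\<lambda>t. Polynomial.coeff (F t) i)) \<longrightarrow>
                (\<forall>j<p. differentiable_near_0 (\<lambda>t. crit_near \<epsilon> c (F t) j))) \<and>
             (u \<noteq> 0 \<longrightarrow> (\<exists>j<p. \<exists>l. speed_seq \<epsilon> f c F j \<longlonglongrightarrow> l \<and> l \<noteq> 0))))) \<and>
     (poly f 0 \<in> \<real> \<and> (\<forall>i<p. c i \<in> \<real>) \<longrightarrow>
      (\<exists>(f\<^sub>R :: real poly) (c\<^sub>R :: nat \<Rightarrow> real).
        f = map_poly complex_of_real f\<^sub>R \<and> (\<forall>i<p. c i = complex_of_real (c\<^sub>R i)) \<and>
        (\<forall>\<^sub>F \<epsilon> in at_right 0.
          stratum \<epsilon> f\<^sub>R p c\<^sub>R = {g. map_poly complex_of_real g \<in> stratum \<epsilon> f p c} \<and>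
          (\<forall>j<r. \<forall>k<p. L \<epsilon> f p c j k = complex_of_real (L \<epsilon> f\<^sub>R p c\<^sub>R j k)) \<and>
          (\<forall>j<r. \<forall>k<p. convergent (L_seq \<epsilon> f\<^sub>R p c\<^sub>R j k)) \<and>
          (\<forall>\<kappa> u F.
             strict_mono_on {..<r} \<kappa> \<and> \<kappa> ` {..<r} \<subseteq> {..<p} \<and>
             Determinant.det (Matrix.mat r r (\<lambda>(j, i). L \<epsilon> f\<^sub>R p c\<^sub>R j (\<kappa> i))) \<noteq> 0 \<and>
             family_through (Lambda \<epsilon> f\<^sub>R p c\<^sub>R (\<kappa> ` {..<r})) f\<^sub>R u F \<longrightarrow>
               ((\<forall>i. differentiable_near_0 (\<lambda>t. Polynomial.coeff (F t) i)) \<longrightarrow>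
                  (\<forall>j<r. differentiable_near_0 (\<lambda>t. crit_near \<epsilon> c\<^sub>R (F t) j))) \<and>
               (u \<noteq> 0 \<longrightarrow> (\<exists>j<r. \<exists>l. speed_seq \<epsilon> f\<^sub>R c\<^sub>R F j \<longlonglongrightarrow> l \<and> l \<noteq> 0)))) \<and>
        ((\<forall>i<p. multiplicity_crit f (c i) = 1 \<and> weakly_expanding f (c i)) \<longrightarrow>
         (\<forall>\<^sub>F \<epsilon> in at_right 0.
          (\<forall>u F. family_through (monic_centered d) f\<^sub>R u F \<longrightarrow>
               ((\<forall>i. differentiable_near_0 (\<lambda>t. Polynomial.coeff (F t) i)) \<longrightarrow>
                  (\<forall>j<p. differentiable_near_0 (\<lambda>t. crit_near \<epsilon> c\<^sub>R (F t) j))) \<and>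
               (u \<noteq> 0 \<longrightarrow> (\<exists>j<p. \<exists>l. speed_seq \<epsilon> f\<^sub>R c\<^sub>R F j \<longlonglongrightarrow> l \<and> l \<noteq> 0)))))))"
proof (intro conjI impI)
  have d: "degree f = d" using assms(2) by (simp add: monic_centered_def)
  have cd: "critical_data f p c" by (rule critical_data_complex[OF assms(1-3)])
  interpret critical_data f p c by fact
  have dd: "local.d = d" using d by (simp add: d_def)
  show "\<forall>\<^sub>F \<epsilon> in at_right 0.
        (\<forall>j<r. \<forall>k<p. convergent (L_seq \<epsilon> f p c j k)) \<and>
        (\<forall>\<kappa> u F.
           strict_mono_on {..<r} \<kappa> \<and> \<kappa> ` {..<r} \<subseteq> {..<p} \<and>
           Determinant.det (Matrix.mat r r (\<lambda>(j, i). L \<epsilon> f p c j (\<kappa> i))) \<noteq> 0 \<and>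
           family_through (Lambda \<epsilon> f p c (\<kappa> ` {..<r})) f u F \<longrightarrow>
             ((\<forall>i. differentiable_near_0 (\<lambda>t. Polynomial.coeff (F t) i)) \<longrightarrow>
                (\<forall>j<r. differentiable_near_0 (\<lambda>t. crit_near \<epsilon> c (F t) j))) \<and>
             (u \<noteq> 0 \<longrightarrow> (\<exists>j<r. \<exists>l. speed_seq \<epsilon> f c F j \<longlonglongrightarrow> l \<and> l \<noteq> 0)))"
    by (rule eventually_Lambda_families[OF assms(6,5)])
  show "\<forall>\<^sub>F \<epsilon> in at_right 0.
        (\<forall>u F. family_through (monic_centered d) f u F \<longrightarrow>
             ((\<forall>i. differentiable_near_0 (\<lambda>t. Polynomial.coeff (F t) i)) \<longrightarrow>
                (\<forall>j<p. differentiable_near_0 (\<lambda>t. crit_near \<epsilon> c (F t) j))) \<and>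
             (u \<noteq> 0 \<longrightarrow> (\<exists>j<p. \<exists>l. speed_seq \<epsilon> f c F j \<longlonglongrightarrow> l \<and> l \<noteq> 0)))"
    if simple: "\<forall>i<p. multiplicity_crit f (c i) = 1 \<and> weakly_expanding f (c i)"
    using eventually_simple_families[OF simple] complex_simple_limit_speed_nonzero[OF cd simple] unfolding dd d by blast
  assume real: "poly f 0 \<in> \<real> \<and> (\<forall>i<p. c i \<in> \<real>)"
  define f\<^sub>R where "f\<^sub>R = map_poly Re f"
  define c\<^sub>R where "c\<^sub>R i = Re (c i)" for i
  have f_eq: "f = cpoly f\<^sub>R"
  proof (rule poly_eqI)
    fix i
    have "coeff f i \<in> \<real>" using real by (intro critical_data_coeffs_in_Reals[OF cd]) auto
    then show "coeff f i = coeff (cpoly f\<^sub>R) i" by (simp add: coeff_cpoly f\<^sub>R_def coeff_map_poly)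
  qed
  have c_eq: "c i = complex_of_real (c\<^sub>R i)" if "i < p" for i using real that by (simp add: c\<^sub>R_def)
  interpret rc: real_critical_data f\<^sub>R p c c\<^sub>R
    by (intro real_critical_data.intro real_critical_data_axioms.intro critical_data_real[of _ _ c])
      (use cd f_eq c_eq in auto)
  have we: "weakly_expanding f (c j) \<longleftrightarrow> weakly_expanding f\<^sub>R (c\<^sub>R j)" if "j < p" for j
    using that by (simp add: f_eq c_eq weakly_expanding_cpoly)
  have weR: "\<forall>j<r. weakly_expanding f\<^sub>R (c\<^sub>R j)" using assms(5,6) we by auto
  show "\<exists>(f\<^sub>R :: real poly) (c\<^sub>R :: nat \<Rightarrow> real).
        f = map_poly complex_of_real f\<^sub>R \<and> (\<forall>i<p. c i = complex_of_real (c\<^sub>R i)) \<and>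
        (\<forall>\<^sub>F \<epsilon> in at_right 0.
          stratum \<epsilon> f\<^sub>R p c\<^sub>R = {g. map_poly complex_of_real g \<in> stratum \<epsilon> f p c} \<and>
          (\<forall>j<r. \<forall>k<p. L \<epsilon> f p c j k = complex_of_real (L \<epsilon> f\<^sub>R p c\<^sub>R j k)) \<and>
          (\<forall>j<r. \<forall>k<p. convergent (L_seq \<epsilon> f\<^sub>R p c\<^sub>R j k)) \<and>
          (\<forall>\<kappa> u F.
             strict_mono_on {..<r} \<kappa> \<and> \<kappa> ` {..<r} \<subseteq> {..<p} \<and>
             Determinant.det (Matrix.mat r r (\<lambda>(j, i). L \<epsilon> f\<^sub>R p c\<^sub>R j (\<kappa> i))) \<noteq> 0 \<and>
             family_through (Lambda \<epsilon> f\<^sub>R p c\<^sub>R (\<kappa> ` {..<r})) f\<^sub>R u F \<longrightarrow>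
               ((\<forall>i. differentiable_near_0 (\<lambda>t. Polynomial.coeff (F t) i)) \<longrightarrow>
                  (\<forall>j<r. differentiable_near_0 (\<lambda>t. crit_near \<epsilon> c\<^sub>R (F t) j))) \<and>
               (u \<noteq> 0 \<longrightarrow> (\<exists>j<r. \<exists>l. speed_seq \<epsilon> f\<^sub>R c\<^sub>R F j \<longlonglongrightarrow> l \<and> l \<noteq> 0)))) \<and>
        ((\<forall>i<p. multiplicity_crit f (c i) = 1 \<and> weakly_expanding f (c i)) \<longrightarrow>
         (\<forall>\<^sub>F \<epsilon> in at_right 0.
          (\<forall>u F. family_through (monic_centered d) f\<^sub>R u F \<longrightarrow>
               ((\<forall>i. differentiable_near_0 (\<lambda>t. Polynomial.coeff (F t) i)) \<longrightarrow>
                  (\<forall>j<p. differentiable_near_0 (\<lambda>t. crit_near \<epsilon> c\<^sub>R (F t) j))) \<and>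
               (u \<noteq> 0 \<longrightarrow> (\<exists>j<p. \<exists>l. speed_seq \<epsilon> f\<^sub>R c\<^sub>R F j \<longlonglongrightarrow> l \<and> l \<noteq> 0)))))"
  proof (intro exI[of _ f\<^sub>R] exI[of _ c\<^sub>R] conjI impI)
    show "f = cpoly f\<^sub>R" by (rule f_eq)
    show "\<forall>i<p. c i = complex_of_real (c\<^sub>R i)" using c_eq by blast
    have "\<forall>\<^sub>F \<epsilon> in at_right 0. stratum \<epsilon> f\<^sub>R p c\<^sub>R = {g. cpoly g \<in> stratum \<epsilon> f p c} \<and>
        (\<forall>j<r. \<forall>k<p. L \<epsilon> f p c j k = complex_of_real (L \<epsilon> f\<^sub>R p c\<^sub>R j k))"
      using rc.cx.eventually_chart_at rc.re.eventually_chart_at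
    proof eventually_elim
      case (elim \<epsilon>)
      show ?case
      proof (intro conjI allI impI)
        show "stratum \<epsilon> f\<^sub>R p c\<^sub>R = {g. cpoly g \<in> stratum \<epsilon> f p c}"
          unfolding f_eq using elim(1) by (intro rc.stratum_cpoly) (simp add: rc.cx.chart_at_def)
        show "L \<epsilon> f p c j k = complex_of_real (L \<epsilon> f\<^sub>R p c\<^sub>R j k)" if "j < r" "k < p" for j k
          unfolding f_eq using that weR assms(5) by (intro rc.L_cpoly elim) auto
      qed
    qed
    then show "\<forall>\<^sub>F \<epsilon> in at_right 0.
          stratum \<epsilon> f\<^sub>R p c\<^sub>R = {g. map_poly complex_of_real g \<in> stratum \<epsilon> f p c} \<and>
          (\<forall>j<r. \<forall>k<p. L \<epsilon> f p c j k = complex_of_real (L \<epsilon> f\<^sub>R p c\<^sub>R j k)) \<and>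
          (\<forall>j<r. \<forall>k<p. convergent (L_seq \<epsilon> f\<^sub>R p c\<^sub>R j k)) \<and>
          (\<forall>\<kappa> u F.
             strict_mono_on {..<r} \<kappa> \<and> \<kappa> ` {..<r} \<subseteq> {..<p} \<and>
             Determinant.det (Matrix.mat r r (\<lambda>(j, i). L \<epsilon> f\<^sub>R p c\<^sub>R j (\<kappa> i))) \<noteq> 0 \<and>
             family_through (Lambda \<epsilon> f\<^sub>R p c\<^sub>R (\<kappa> ` {..<r})) f\<^sub>R u F \<longrightarrow>
               ((\<forall>i. differentiable_near_0 (\<lambda>t. Polynomial.coeff (F t) i)) \<longrightarrow>
                  (\<forall>j<r. differentiable_near_0 (\<lambda>t. crit_near \<epsilon> c\<^sub>R (F t) j))) \<and>
               (u \<noteq> 0 \<longrightarrow> (\<exists>j<r. \<exists>l. speed_seq \<epsilon> f\<^sub>R c\<^sub>R F j \<longlonglongrightarrow> l \<and> l \<noteq> 0)))"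
      using rc.re.eventually_Lambda_families[OF weR assms(5)]
      by eventually_elim (rule conjI[OF conjunct1 conjI[OF conjunct2]])
    assume simple: "\<forall>i<p. multiplicity_crit f (c i) = 1 \<and> weakly_expanding f (c i)"
    have simpleR: "\<forall>i<p. multiplicity_crit f\<^sub>R (c\<^sub>R i) = 1 \<and> weakly_expanding f\<^sub>R (c\<^sub>R i)"
      using simple we by (simp add: f_eq c_eq multiplicity_crit_cpoly rc.re.pderiv_f_nonzero)
    have ddR: "rc.re.d = d" using d by (simp add: rc.re.d_def f_eq degree_cpoly)
    \<comment> \<open>The peak-function argument is available only over the complex numbers; the
      real non-vanishing is its restriction to complexified tangent vectors, whose limit speeds are
      real.\<close>
    have "\<exists>j<p. limit_speed f\<^sub>R u (c\<^sub>R j) \<noteq> 0" if u: "u \<noteq> 0" "degree u \<le> d - 2" for u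
    proof -
      have "\<exists>j<p. limit_speed f (cpoly u) (c j) \<noteq> 0"
        using u d by (intro complex_simple_limit_speed_nonzero[OF cd simple]) (auto simp: cpoly_eq_0_iff degree_cpoly)
      then show ?thesis using simpleR by (auto simp: f_eq rc.limit_speed_cpoly)
    qed
    then show "\<forall>\<^sub>F \<epsilon> in at_right 0.
          (\<forall>u F. family_through (monic_centered d) f\<^sub>R u F \<longrightarrow>
               ((\<forall>i. differentiable_near_0 (\<lambda>t. Polynomial.coeff (F t) i)) \<longrightarrow>
                  (\<forall>j<p. differentiable_near_0 (\<lambda>t. crit_near \<epsilon> c\<^sub>R (F t) j))) \<and>
               (u \<noteq> 0 \<longrightarrow> (\<exists>j<p. \<exists>l. speed_seq \<epsilon> f\<^sub>R c\<^sub>R F j \<longlonglongrightarrow> l \<and> l \<noteq> 0)))"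
      by (rule rc.re.eventually_simple_families[OF simpleR, unfolded ddR])
  qed
qed

end
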